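(* Let $\mathbf{X}=(\mathbf{X}_1,\dots,\mathbf{X}_k)$ be a $q$-dimensional random vector with continuous univariate marginals having a Gaussian copula with correlation matrix $\mathbf{R}\in\mathbb{S}^q_{>}$, let $\widehat{\mathbf{R}}_n$ be the matrix of normal scores rank correlation coefficients based on a sample $\mathbf{X}^{(1)},\dots,\mathbf{X}^{(n)}$ from $\mathbf{X}$, and let $\widehat{\mathcal{D}}^{\mathcal{N}}_{\Phi,n}=\mathcal{D}^{\mathcal{N}}_{\Phi}(\widehat{\mathbf{R}}_n)$ be the plug-in estimator of $\mathcal{D}^{\mathcal{N}}_\Phi(\mathbf{R})$. If the mapping $\mathbf{\Sigma}\mapsto(\mathcal{D}^{\mathcal{N}}_\Phi\circ\varphi)(\mathbf{\Sigma})$ from $(\mathbb{S}^q,\|\cdot\|_{\mathrm{F}})$ to $(\mathbb{R},|\cdot|)$ is Fréchet differentiable on $\mathbb{S}^q_{>}$, then the estimator $\widehat{\mathcal{D}}^{\mathcal{N}}_{\Phi,n}$ is asymptotically normal. Moreover, if (Fréchet) differentiation with respect to the matrix argument and integration can be interchanged in the integral defining $\mathcal{D}^{\mathcal{N}}_\Phi$, then $$\sqrt{n}\left(\widehat{\mathcal{D}}^{\mathcal{N}}_{\Phi,n}-\mathcal{D}^{\mathcal{N}}_\Phi(\mathbf{R})\right)\xrightarrow{d}\mathcal{N}(0,\zeta_\Phi^2),\qquad n\to\infty,$$ with $$\zeta_\Phi^2=2\,\mathrm{Tr}\Big(\big(\mathbf{R}(\mathbf{M}_\Phi-\mathbf{D}_{\mathbf{M}_\Phi\mathbf{R}})\big)^2\Big),$$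 where $\mathbf{D}_{\mathbf{M}_\Phi\mathbf{R}}$ is the diagonal matrix consisting of the diagonal of $\mathbf{M}_\Phi\mathbf{R}$, and $$\mathbf{M}_\Phi=\tfrac12\Big(\mathbf{F}_1-\mathcal{D}^{\mathcal{N}}_\Phi(\mathbf{R})\mathbf{R}_0^{-1}-\mathbb{E}_{\mathcal{N}(\mathbf{0},\mathbf{R})}[\alpha'(\mathbf{X})](\mathbf{R}^{-1}-\mathbf{R}_0^{-1})+\mathbf{R}^{-1}\mathbb{E}_{\mathcal{N}(\mathbf{0},\mathbf{R})}[\alpha'(\mathbf{X})\mathbf{X}\mathbf{X}^{\mathrm{T}}]\mathbf{R}^{-1}-\mathbf{F}_2\Big),$$ with $\alpha(\mathbf{x})=\Phi(k(\mathbf{x}))$, $\alpha'(\mathbf{x})=\Phi'(k(\mathbf{x}))$, $$k(\mathbf{x})=\frac{\prod_{i=1}^k|\mathbf{R}_{ii}|^{1/2}}{|\mathbf{R}|^{1/2}}\exp\left(-\tfrac12\mathbf{x}^{\mathrm{T}}(\mathbf{R}^{-1}-\mathbf{R}_0^{-1})\mathbf{x}\right),$$ $$\mathbf{F}_1=\mathbf{R}_0^{-1}\,\mathrm{diag}\left(\mathbb{E}_{\mathcal{N}(\mathbf{0},\mathbf{R}_0)}[\alpha(\mathbf{X})\mathbf{X}_1\mathbf{X}_1^{\mathrm{T}}],\dots,\mathbb{E}_{\mathcal{N}(\mathbf{0},\mathbf{R}_0)}[\alpha(\mathbf{X})\mathbf{X}_k\mathbf{X}_k^{\mathrm{T}}]\right)\mathbf{R}_0^{-1},$$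 $$\mathbf{F}_2=\mathbf{R}_0^{-1}\,\mathrm{diag}\left(\mathbb{E}_{\mathcal{N}(\mathbf{0},\mathbf{R})}[\alpha'(\mathbf{X})\mathbf{X}_1\mathbf{X}_1^{\mathrm{T}}],\dots,\mathbb{E}_{\mathcal{N}(\mathbf{0},\mathbf{R})}[\alpha'(\mathbf{X})\mathbf{X}_k\mathbf{X}_k^{\mathrm{T}}]\right)\mathbf{R}_0^{-1}.$$ In particular, for $\Phi(t)=t\log(t)$, $$\mathbf{M}_{t\log(t)}=-\tfrac12\left(\mathbf{R}^{-1}-\mathbf{R}_0^{-1}\right),$$ and for $\Phi(t)=(\sqrt t-1)^2$, $$\mathbf{M}_{(\sqrt t-1)^2}=\frac{2^{q/2}\exp\left(-\frac12\mathcal{D}^{\mathcal{N}}_{t\log(t)}(\mathbf{R})\right)}{|\mathbb{I}_q+\mathbf{R}_0^{-1}\mathbf{R}|^{1/2}}\left[-\tfrac12\left(\mathbf{R}^{-1}-\mathbf{R}_0^{-1}\right)+(\mathbb{I}_q+\mathbf{R}_0^{-1}\mathbf{R})^{-1}\mathbf{R}_0^{-1}-\boldsymbol{\gamma}\right],$$ where $\boldsymbol{\gamma}=\mathrm{diag}(\mathbf{R}_{11}^{-1}\mathbf{J}_{11}\mathbf{R}_{11}^{-1},\dots,\mathbf{R}_{kk}^{-1}\mathbf{J}_{kk}\mathbf{R}_{kk}^{-1})$ and $\mathbf{J}_{ij}\in\mathbb{R}^{d_i\times d_j}$, $i,j=1,\dots,k$, are the blocks of $\mathbf{R}(\mathb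b{I}_q+\mathbf{R}_0^{-1}\mathbf{R})^{-1}$.
   Context: Setting: $\mathbf{X}=(\mathbf{X}_1,\dots,\mathbf{X}_k)$ with $\mathbf{X}_i=(X_{i1},\dots,X_{id_i})$ and $q=d_1+\cdots+d_k$; $F_{ij}$ is the continuous cdf of $X_{ij}$; $\phi^{-1}$ is the standard normal quantile function. Gaussian copula with correlation matrix $\mathbf{R}$ means that the vector of scores $(\phi^{-1}\circ F_{ij})(X_{ij})$ is $\mathcal{N}(\mathbf{0},\mathbf{R})$. The function $\Phi:(0,\infty)\to\mathbb{R}$ is continuous and convex with $\Phi(1)=0$. Matrices: $\mathbb{S}^q$ is the set of all $q\times q$ covariance matrices and $\mathbb{S}^q_{>}\subset\mathbb{S}^q$ the positive definite ones; $\|\mathbf{\Sigma}\|_{\mathrm{F}}^2=\mathrm{Tr}(\mathbf{\Sigma}^{\mathrm{T}}\mathbf{\Sigma})$; $|\cdot|$ applied to a matrix is the determinant; $\mathbb{I}_q$ is the $q\times q$ identity matrix; $\mathrm{diag}(\mathbf{A}_1,\dots,\mathbf{A}_k)$ is the block diagonal matrix with blocks $\mathbf{A}_i$. A matrix $\mathbf{\Sigma}\in\mathbb{S}^q$ is partitioned in blocks $\mathbf{\Sigma}_{ij}\in\mathbb{R}^{d_i\times d_j}$, and $\mathbf{\Sigma}_0=\mathrm{diag}(\mathbf{\Sigma}_{11},\dots,\mathbf{\Sigma}_{kk})$ (similarly $\mathbf{R}_{ij}$, $\mathbf{R}_0$). With $\mathbf{D}_{\mathbf{\Sigma}}$ the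 diagonal matrix containing the diagonal of $\mathbf{\Sigma}$, $\varphi(\mathbf{\Sigma})=\mathbf{D}_{\mathbf{\Sigma}}^{-1/2}\mathbf{\Sigma}\mathbf{D}_{\mathbf{\Sigma}}^{-1/2}$. Gaussian $\Phi$-dependence: $$\mathcal{D}^{\mathcal{N}}_\Phi(\mathbf{\Sigma})=\int_{\mathbb{R}^q}\frac{\exp(-\frac12\mathbf{x}^{\mathrm{T}}\mathbf{\Sigma}_0^{-1}\mathbf{x})}{(2\pi)^{q/2}\prod_{i=1}^k|\mathbf{\Sigma}_{ii}|^{1/2}}\,\Phi\left(\frac{\prod_{i=1}^k|\mathbf{\Sigma}_{ii}|^{1/2}}{|\mathbf{\Sigma}|^{1/2}}\exp\left(-\tfrac12\mathbf{x}^{\mathrm{T}}(\mathbf{\Sigma}^{-1}-\mathbf{\Sigma}_0^{-1})\mathbf{x}\right)\right)d\mathbf{x};$$ $\mathcal{D}^{\mathcal{N}}_{t\log(t)}$ and $\mathcal{D}^{\mathcal{N}}_{(\sqrt t-1)^2}$ denote the cases $\Phi(t)=t\log t$ and $\Phi(t)=(\sqrt t-1)^2$; in particular $\mathcal{D}^{\mathcal{N}}_{t\log(t)}(\mathbf{\Sigma})=-\frac12\log\big(|\mathbf{\Sigma}|/\prod_{i=1}^k|\mathbf{\Sigma}_{ii}|\big)$. Estimator: $\mathbf{X}^{(1)},\dots,\mathbf{X}^{(n)}$ is an i.i.d. sample from $\mathbf{X}$ with components $X_{ij}^{(\ell)}$; $\widehat F_{ij}(x)=\frac1n\sum_{\ell=1}^n\mathbf{1}\{X_{ij}^{(\ell)}\le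 x\}$; $\widehat Z_{ij}^{(\ell)}=\phi^{-1}\big(\frac{n}{n+1}\widehat F_{ij}(X_{ij}^{(\ell)})\big)$; and $\widehat{\mathbf{R}}_n$ is the $q\times q$ matrix with blocks $\widehat{\mathbf{R}}_{im}\in\mathbb{R}^{d_i\times d_m}$ having entries $$(\widehat{\mathbf{R}}_{im})_{jt}=\frac{\frac1n\sum_{\ell=1}^n\widehat Z_{ij}^{(\ell)}\widehat Z_{mt}^{(\ell)}}{\frac1n\sum_{\ell=1}^n\big(\phi^{-1}(\frac{\ell}{n+1})\big)^2}.$$ Conventions: $\mathbb{E}_{\mathcal{N}(\mathbf{0},\mathbf{A})}$ is expectation when $\mathbf{X}=(\mathbf{X}_1,\dots,\mathbf{X}_k)$ (as a column vector) has the $\mathcal{N}(\mathbf{0},\mathbf{A})$ distribution. "Asymptotically normal" means that $\sqrt n\big(\widehat{\mathcal{D}}^{\mathcal{N}}_{\Phi,n}-\mathcal{D}^{\mathcal{N}}_\Phi(\mathbf{R})\big)$ converges in distribution to a centered normal law; $\mathcal{N}(0,0)$ is understood as the point mass at $0$. Interchanging differentiation and integration means that the Fréchet derivative of $\mathcal{D}^{\mathcal{N}}_\Phi$ at $\mathbf{R}$ in direction $\mathbf{H}$ equals the integral over $\mathbb{R}^q$ of the Fréchet derivative in direction $\mathbf{H}$ of the integrand above. *)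

theory Defs
  imports "HOL-Probability.Probability"
begin

text \<open>
  The coordinates of a \<open>q\<close>-dimensional vector are indexed by a finite type \<open>'q\<close>.  Its division into
  \<open>k\<close> subvectors is a surjective map \<open>b :: 'q \<Rightarrow> 'k\<close> onto a finite type of block labels; the \<open>i\<close>-th
  block consists of the coordinates \<open>a\<close> with \<open>b a = i\<close>, so \<open>d\<^sub>i = card {a. b a = i} \<ge> 1\<close>.  The norm
  of \<open>real ^ 'q ^ 'q\<close> is the Frobenius norm.
\<close>

definition cov_mats :: "(real ^ 'q ^ 'q) set" where
  "cov_mats = {A. transpose A = A \<and> (\<forall>x. 0 \<le> x \<bullet> (A *v x))}"

definition pd_mats :: "(real ^ 'q ^ 'q) set" where
  "pd_mats = {A \<in> cov_mats. \<forall>x. x \<noteq> 0 \<longrightarrow> 0 < x \<bullet> (A *v x)}"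

definition diag_part :: "real ^ 'q ^ 'q \<Rightarrow> real ^ 'q ^ 'q" where
  "diag_part A = (\<chi> a c. if a = c then A $ a $ c else 0)"

text \<open>
  The matrix with the same diagonal blocks and zero off-diagonal blocks; \<open>\<Sigma>\<^sub>0 = block_diag b \<Sigma>\<close>.
\<close>

definition block_diag :: "('q \<Rightarrow> 'k) \<Rightarrow> real ^ 'q ^ 'q \<Rightarrow> real ^ 'q ^ 'q" where
  "block_diag b A = (\<chi> a c. if b a = b c then A $ a $ c else 0)"

text \<open>
  The determinant of the \<open>i\<close>-th diagonal block, by the Leibniz formula that defines \<^const>\<open>det\<close>, over
  the indices of the block.
\<close>

definition block_det :: "('q::finite \<Rightarrow> 'k) \<Rightarrow> 'k \<Rightarrow> real ^ 'q ^ 'q \<Rightarrow> real" where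
  "block_det b i A =
     (\<Sum>p | p permutes {a. b a = i}. of_int (sign p) * (\<Prod>a\<in>{a. b a = i}. A $ a $ p a))"

definition inv_sqrt_diag :: "real ^ 'q ^ 'q \<Rightarrow> real ^ 'q ^ 'q" where
  "inv_sqrt_diag A = (\<chi> a c. if a = c then 1 / sqrt (A $ a $ a) else 0)"

definition cov_to_corr :: "real ^ 'q::finite ^ 'q \<Rightarrow> real ^ 'q ^ 'q" where
  "cov_to_corr A = inv_sqrt_diag A ** A ** inv_sqrt_diag A"

text \<open>Used for positive definite \<open>A\<close> only.\<close>

definition mvn :: "real ^ 'q::finite ^ 'q \<Rightarrow> (real ^ 'q) measure" where
  "mvn A = density lborel (\<lambda>x. ennreal (exp (- (x \<bullet> (matrix_inv A *v x)) / 2)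
     / ((2 * pi) powr (real CARD('q) / 2) * sqrt (det A))))"

text \<open>The centered normal law on the line with variance \<open>v \<ge> 0\<close>, degenerate for \<open>v = 0\<close>.\<close>

definition normal_law :: "real \<Rightarrow> real measure" where
  "normal_law v =
     (if v = 0 then return borel 0 else density lborel (\<lambda>x. ennreal (normal_density 0 (sqrt v) x)))"

definition std_normal_quantile :: "real \<Rightarrow> real" where
  "std_normal_quantile u = Inf {x. u \<le> cdf std_normal_distribution x}"

definition gaussian_copula :: "'s measure \<Rightarrow> ('s \<Rightarrow> real ^ 'q::finite) \<Rightarrow> real ^ 'q ^ 'q \<Rightarrow> bool" where
  "gaussian_copula M X R \<longleftrightarrow>
     distr M borel (\<lambda>\<omega>. \<chi> a. std_normal_quantile (cdf (distr M borel (\<lambda>\<omega>. X \<omega> $ a)) (X \<omega> $ a))) = mvn R"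

text \<open>The density ratio of \<open>N(0, \<Sigma>)\<close> and \<open>N(0, \<Sigma>\<^sub>0)\<close>; for \<open>\<Sigma> = R\<close> this is \<open>k(x)\<close>.\<close>

definition density_ratio :: "('q::finite \<Rightarrow> 'k::finite) \<Rightarrow> real ^ 'q ^ 'q \<Rightarrow> real ^ 'q \<Rightarrow> real" where
  "density_ratio b S x = (\<Prod>i\<in>UNIV. sqrt (block_det b i S)) / sqrt (det S)
     * exp (- (x \<bullet> ((matrix_inv S - matrix_inv (block_diag b S)) *v x)) / 2)"

definition dep_integrand ::
    "('q::finite \<Rightarrow> 'k::finite) \<Rightarrow> (real \<Rightarrow> real) \<Rightarrow> real ^ 'q ^ 'q \<Rightarrow> real ^ 'q \<Rightarrow> real" where
  "dep_integrand b \<Phi> S x = exp (- (x \<bullet> (matrix_inv (block_diag b S) *v x)) / 2)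
     / ((2 * pi) powr (real CARD('q) / 2) * (\<Prod>i\<in>UNIV. sqrt (block_det b i S)))
     * \<Phi> (density_ratio b S x)"

definition gauss_dep ::
    "('q::finite \<Rightarrow> 'k::finite) \<Rightarrow> (real \<Rightarrow> real) \<Rightarrow> real ^ 'q ^ 'q \<Rightarrow> real" where
  "gauss_dep b \<Phi> S = (\<integral>x. dep_integrand b \<Phi> S x \<partial>lborel)"

text \<open>
  The Bochner integral is \<open>0\<close> by convention where it does not exist.  For convex \<open>\<Phi>\<close> the integral
  always exists in \<open>(-\<infinity>, \<infinity>]\<close>, and it is a real number exactly if the integrand is integrable.  That
  \<open>gauss_dep b \<Phi>\<close> is a real-valued map on the positive definite matrices is therefore made
  explicit in the first conjunct below.
\<close>

definition dep_frechet_differentiable ::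
    "('q::finite \<Rightarrow> 'k::finite) \<Rightarrow> (real \<Rightarrow> real) \<Rightarrow> bool" where
  "dep_frechet_differentiable b \<Phi> \<longleftrightarrow>
     (\<forall>S\<in>pd_mats. integrable lborel (dep_integrand b \<Phi> S)) \<and>
     (\<forall>S\<in>pd_mats. (gauss_dep b \<Phi> \<circ> cov_to_corr) differentiable (at S within cov_mats))"

text \<open>
  Interchange of differentiation and integration at \<open>R\<close>.  A Frechet derivative within
  \<^const>\<open>cov_mats\<close> is determined only on symmetric directions \<open>H\<close>.  In particular the integrand is
  differentiable at \<open>R\<close> for almost every \<open>x\<close>.
\<close>

definition diff_integral_interchange ::
    "('q::finite \<Rightarrow> 'k::finite) \<Rightarrow> (real \<Rightarrow> real) \<Rightarrow> real ^ 'q ^ 'q \<Rightarrow> bool" where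
  "diff_integral_interchange b \<Phi> R \<longleftrightarrow> (\<exists>D' g.
     (gauss_dep b \<Phi> has_derivative D') (at R within cov_mats) \<and>
     (AE x in lborel. ((\<lambda>S. dep_integrand b \<Phi> S x) has_derivative g x) (at R within cov_mats)) \<and>
     (\<forall>H. transpose H = H \<longrightarrow> has_bochner_integral lborel (\<lambda>x. g x H) (D' H)))"

text \<open>The observations \<open>Xs l\<close> are numbered from \<open>l = 1\<close>.\<close>

definition emp_cdf :: "(nat \<Rightarrow> 's \<Rightarrow> real ^ 'q) \<Rightarrow> nat \<Rightarrow> 's \<Rightarrow> 'q \<Rightarrow> real \<Rightarrow> real" where
  "emp_cdf Xs n \<omega> a x = (\<Sum>l=1..n. if Xs l \<omega> $ a \<le> x then 1 else 0) / real n"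

definition normal_score :: "(nat \<Rightarrow> 's \<Rightarrow> real ^ 'q) \<Rightarrow> nat \<Rightarrow> 's \<Rightarrow> nat \<Rightarrow> 'q \<Rightarrow> real" where
  "normal_score Xs n \<omega> l a =
     std_normal_quantile (real n / (real n + 1) * emp_cdf Xs n \<omega> a (Xs l \<omega> $ a))"

definition rank_corr :: "(nat \<Rightarrow> 's \<Rightarrow> real ^ 'q) \<Rightarrow> nat \<Rightarrow> 's \<Rightarrow> real ^ 'q ^ 'q" where
  "rank_corr Xs n \<omega> = (\<chi> a c.
     ((\<Sum>l=1..n. normal_score Xs n \<omega> l a * normal_score Xs n \<omega> l c) / real n)
     / ((\<Sum>l=1..n. (std_normal_quantile (real l / (real n + 1)))\<^sup>2) / real n))"

text \<open>The matrix \<open>E[f(X) X X\<^sup>T]\<close> for \<open>X\<close> with law \<open>N\<close>.\<close>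

definition weighted_second_moment ::
    "(real ^ 'q) measure \<Rightarrow> (real ^ 'q \<Rightarrow> real) \<Rightarrow> real ^ 'q ^ 'q" where
  "weighted_second_moment N f = (\<chi> a c. \<integral>x. f x * (x $ a * x $ c) \<partial>N)"

text \<open>
  \<open>\<alpha>'\<close> is defined through \<^const>\<open>deriv\<close>, although \<open>\<Phi>\<close> need not be differentiable everywhere: a
  convex \<open>\<Phi>\<close> has at most countably many kinks, and \<open>k(x)\<close> avoids them for almost all \<open>x\<close>
  unless \<open>R = R\<^sub>0\<close>, where \<open>k = 1\<close> throughout.
\<close>

definition M_mat ::
    "('q::finite \<Rightarrow> 'k::finite) \<Rightarrow> (real \<Rightarrow> real) \<Rightarrow> real ^ 'q ^ 'q \<Rightarrow> real ^ 'q ^ 'q" where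
  "M_mat b \<Phi> R =
    (let R0 = block_diag b R;
         iR = matrix_inv R;
         iR0 = matrix_inv R0;
         \<alpha> = (\<lambda>x. \<Phi> (density_ratio b R x));
         \<alpha>' = (\<lambda>x. deriv \<Phi> (density_ratio b R x));
         F1 = iR0 ** block_diag b (weighted_second_moment (mvn R0) \<alpha>) ** iR0;
         F2 = iR0 ** block_diag b (weighted_second_moment (mvn R) \<alpha>') ** iR0
     in (1 / 2) *\<^sub>R
        (F1 - gauss_dep b \<Phi> R *\<^sub>R iR0
         - (\<integral>x. \<alpha>' x \<partial>mvn R) *\<^sub>R (iR - iR0)
         + iR ** weighted_second_moment (mvn R) \<alpha>' ** iR
         - F2))"

definition zeta_sq ::
    "('q::finite \<Rightarrow> 'k::finite) \<Rightarrow> (real \<Rightarrow> real) \<Rightarrow> real ^ 'q ^ 'q \<Rightarrow> real" where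
  "zeta_sq b \<Phi> R =
    (let B = R ** (M_mat b \<Phi> R - diag_part (M_mat b \<Phi> R ** R)) in 2 * trace (B ** B))"

text \<open>
  \<open>diag(R\<^sub>1\<^sub>1\<^sup>-\<^sup>1 J\<^sub>1\<^sub>1 R\<^sub>1\<^sub>1\<^sup>-\<^sup>1, \<dots>)\<close>, where \<open>J = R (I + R\<^sub>0\<^sup>-\<^sup>1 R)\<^sup>-\<^sup>1\<close>, as a product of block diagonal
  matrices; \<open>R\<^sub>0\<^sup>-\<^sup>1\<close> is block diagonal with blocks \<open>R\<^sub>i\<^sub>i\<^sup>-\<^sup>1\<close>.
\<close>

definition gamma_mat :: "('q::finite \<Rightarrow> 'k) \<Rightarrow> real ^ 'q ^ 'q \<Rightarrow> real ^ 'q ^ 'q" where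
  "gamma_mat b R =
    (let iR0 = matrix_inv (block_diag b R)
     in iR0 ** block_diag b (R ** matrix_inv (mat 1 + iR0 ** R)) ** iR0)"

end

theory Submission
  imports Defs "HOL-Real_Asymp.Real_Asymp"
begin

text \<open>
  The estimator depends on the sample through ranks only, and ranks do not change when the observations
  are replaced by their latent scores \<open>Z\<^sub>l\<close>, which are independent with law \<open>N(0, R)\<close> and almost surely
  have no ties (\<open>AE_regular\<close>).  So \<open>X\<close> may be thought of as Gaussian with known margins, and the question is
  what is lost by using normal scores of ranks in place of the \<open>Z\<^sub>l\<close>.

  Nothing is lost at the scale \<open>n\<^sup>-\<^sup>1\<^sup>/\<^sup>2\<close>.  Given the value \<open>y\<close> of an observation, its rank is one plus a binomial
  count with success probability \<open>G(y)\<close>, the standard normal distribution function.  Since the quantile function is Lipschitz in the logit of its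
  argument, this gives a mean square error \<open>o(n\<^sup>-\<^sup>1\<^sup>/\<^sup>2)\<close> of each score (\<open>normal_score_mean_square\<close>).  Without
  ties the denominator of the rank correlation is the mean square of the scores of either coordinate, so
  that \<open>R\<^sub>n - R\<close> is, up to a factor tending to \<open>1\<close>, the mean of
  \<open>\<psi>(u, v) = u v - r (u\<^sup>2 + v\<^sup>2) / 2\<close> over the pairs of scores.  The partial derivatives of \<open>\<psi>\<close> are the
  regression residuals \<open>v - r u\<close> and \<open>u - r v\<close>.  Hence the first order effect of the score errors consists of
  two sums of uncorrelated terms, and the second order effect is bounded by the mean square errors
  (\<open>score_product_error\<close>).  The delta method then reduces a differentiable functional of \<open>R\<^sub>n\<close> to a
  normalised sum of independent variables \<open>L(\<psi>(Z\<^sub>l))\<close>, to which the central limit theorem applies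
  (\<open>delta_method\<close>).  For the first claim the functional is \<open>D \<circ> \<phi>\<close>, as \<open>\<phi>\<close> fixes matrices with unit
  diagonal.

  For the second claim the derivative of \<open>D\<close> at \<open>R\<close> is \<open>H \<mapsto> Tr(M H)\<close> (\<open>interchange_derivative\<close>).  The
  pointwise derivative of the integrand follows from the logarithmic derivative of the normal density,
  provided that \<open>\<Phi>\<close> is differentiable at the density ratio \<open>k(x)\<close>; this is forced by the assumed
  differentiability of the integrand, since a change of one correlation between different blocks moves
  \<open>k(x)\<close> with nonzero speed for almost every \<open>x\<close> (\<open>AE_differentiable_at_ratio\<close>).  With a single block \<open>D\<close> vanishes identically.  Splitting the integral of
  the derivative into the expectations that constitute \<open>M\<close> requires that each of them exist.  They do
  because \<open>D\<close> is finite also at matrices slightly farther from \<open>R\<^sub>0\<close> than \<open>R\<close>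
  (\<open>integrable_quadratic_weight\<close>).  Finally \<open>Tr(M \<psi>(z))\<close> is a quadratic form in \<open>z\<close> whose variance, by
  Isserlis' formula, is \<open>\<zeta>\<^sup>2\<close> (\<open>influence_moments\<close>, \<open>zeta_sq_eq\<close>).

  In the two examples all expectations are moments of normal laws: for \<open>t log t\<close> because \<open>log k\<close> is a
  constant minus a quadratic form, for \<open>(\<surd>t - 1)\<^sup>2\<close> because the geometric mean of two centered normal
  densities is proportional to a normal density.
\<close>

section \<open>Simultaneous diagonalisation of two quadratic forms\<close>

lemma pd_matsD:
  assumes "P \<in> pd_mats"
  shows "transpose P = P" "x \<noteq> 0 \<Longrightarrow> 0 < x \<bullet> (P *v x)" "0 \<le> x \<bullet> (P *v x)"
  using assms by (auto simp: pd_mats_def cov_mats_def)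

lemma sym_inner_commute:
  fixes P :: "real ^ 'q ^ 'q"
  assumes "transpose P = P"
  shows "x \<bullet> (P *v y) = y \<bullet> (P *v x)"
proof -
  have "x \<bullet> (P *v y) = (transpose P *v x) \<bullet> y"
    by (simp add: dot_lmul_matrix transpose_matrix_vector)
  then show ?thesis by (simp add: assms inner_commute)
qed

lemma pd_form_lower_bound:
  fixes P :: "real ^ 'q ^ 'q"
  assumes "P \<in> pd_mats"
  obtains m where "0 < m" "\<And>x. m * (norm x)\<^sup>2 \<le> x \<bullet> (P *v x)"
proof -
  have "compact (sphere (0::real^'q) 1)" "sphere (0::real^'q) 1 \<noteq> {}"
    by auto
  moreover have "continuous_on (sphere (0::real^'q) 1) (\<lambda>x. x \<bullet> (P *v x))"
    by (intro continuous_intros)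
  ultimately obtain u where u: "norm u = 1" "\<And>x. norm x = 1 \<Longrightarrow> u \<bullet> (P *v u) \<le> x \<bullet> (P *v x)"
    using continuous_attains_inf[of "sphere (0::real^'q) 1" "\<lambda>x. x \<bullet> (P *v x)"] by auto
  show ?thesis
  proof (rule that[of "u \<bullet> (P *v u)"])
    show "0 < u \<bullet> (P *v u)"
      using u(1) by (intro pd_matsD(2)[OF assms]) auto
    fix x
    show "u \<bullet> (P *v u) * (norm x)\<^sup>2 \<le> x \<bullet> (P *v x)"
    proof (cases "x = 0")
      case False
      have "u \<bullet> (P *v u) \<le> (x /\<^sub>R norm x) \<bullet> (P *v (x /\<^sub>R norm x))"
        by (rule u(2)) (use False in auto)
      also have "\<dots> = (x \<bullet> (P *v x)) / (norm x)\<^sup>2"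
        by (simp add: matrix_vector_mult_scaleR power2_eq_square field_simps)
      finally show ?thesis
        using False by (simp add: field_simps)
    qed auto
  qed
qed

text \<open>
  Courant's argument: on the \<open>P\<close>-orthogonal complement of the vectors found so far, a maximiser of the
  Rayleigh quotient of \<open>B\<close> is a further generalised eigenvector.
\<close>

lemma generalized_eigenvector_step:
  fixes P B :: "real ^ 'q ^ 'q"
  assumes P: "P \<in> pd_mats" and B: "transpose B = B" and fin: "finite S"
    and eig: "\<And>s. s \<in> S \<Longrightarrow> \<exists>d. B *v s = d *\<^sub>R (P *v s)"
    and on: "\<And>s t. s \<in> S \<Longrightarrow> t \<in> S \<Longrightarrow> s \<bullet> (P *v t) = (if s = t then 1 else 0)"
    and card: "card S < CARD('q)"
  obtains x d where "B *v x = d *\<^sub>R (P *v x)" "x \<bullet> (P *v x) = 1" "\<And>s. s \<in> S \<Longrightarrow> s \<bullet> (P *v x) = 0"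
proof -
  have symP: "x \<bullet> (P *v y) = y \<bullet> (P *v x)" and symB: "x \<bullet> (B *v y) = y \<bullet> (B *v x)" for x y
    using sym_inner_commute pd_matsD(1)[OF P] B by blast+
  have dimS: "dim ((*v) P ` S) < DIM(real^'q)"
    using card card_image_le[OF fin, of "(*v) P"] dim_le_card'[of "(*v) P ` S"] fin by simp
  have "span ((*v) P ` S) \<noteq> UNIV"
    using dimS by (metis dim_UNIV dim_span less_irrefl)
  then obtain z where "z \<noteq> 0" and z: "\<And>y. y \<in> (*v) P ` S \<Longrightarrow> orthogonal z y"
    by (metis orthogonal_to_subspace_exists[OF dimS] span_base)
  define V where "V = {x. \<forall>s\<in>S. x \<bullet> (P *v s) = 0}"
  have zV: "z \<in> V"
    using z by (auto simp: V_def orthogonal_def)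
  have cV: "c *\<^sub>R x + y \<in> V" if "x \<in> V" "y \<in> V" for c x y
    using that by (auto simp: V_def inner_add_left)
  have closedV: "closed V"
  proof -
    have "V = (\<Inter>s\<in>S. {x. x \<bullet> (P *v s) = 0})" by (auto simp: V_def)
    moreover have "closed {x. x \<bullet> (P *v s) = 0}" for s
      by (intro closed_Collect_eq continuous_intros)
    ultimately show ?thesis by auto
  qed
  define K where "K = V \<inter> {x. x \<bullet> (P *v x) = 1}"
  obtain m where m: "0 < m" "\<And>x. m * (norm x)\<^sup>2 \<le> x \<bullet> (P *v x)"
    using pd_form_lower_bound[OF P] by blast
  have "bounded K"
  proof (rule boundedI)
    fix x assume "x \<in> K"
    then have "m * (norm x)\<^sup>2 \<le> 1" using m(2)[of x] by (simp add: K_def)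
    then have "(norm x)\<^sup>2 \<le> 1 / m" using m(1) by (simp add: field_simps)
    then show "norm x \<le> sqrt (1 / m)" by (simp add: real_le_rsqrt)
  qed
  moreover have "closed K"
    unfolding K_def by (intro closed_Int closedV closed_Collect_eq continuous_intros)
  ultimately have "compact K" by (simp add: compact_eq_bounded_closed)
  have norml: "(1 / sqrt (x \<bullet> (P *v x))) *\<^sub>R x \<in> K" if "x \<in> V" "x \<noteq> 0" for x
  proof -
    have "0 < x \<bullet> (P *v x)" using pd_matsD(2)[OF P that(2)] .
    then have "(1 / sqrt (x \<bullet> (P *v x))) * (1 / sqrt (x \<bullet> (P *v x))) * (x \<bullet> (P *v x)) = 1"
      by simp
    then show ?thesis
      using cV[OF that(1), of 0 "1 / sqrt (x \<bullet> (P *v x))"] zV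
      by (simp add: K_def V_def matrix_vector_mult_scaleR that(1)[unfolded V_def, simplified])
  qed
  then have "K \<noteq> {}" using zV \<open>z \<noteq> 0\<close> by blast
  moreover have "continuous_on K (\<lambda>x. x \<bullet> (B *v x))" by (intro continuous_intros)
  ultimately obtain x where xK: "x \<in> K" and xmax: "\<And>y. y \<in> K \<Longrightarrow> y \<bullet> (B *v y) \<le> x \<bullet> (B *v x)"
    using continuous_attains_sup[OF \<open>compact K\<close>] by blast
  define d where "d = x \<bullet> (B *v x)"
  have xV: "x \<in> V" and x1: "x \<bullet> (P *v x) = 1" using xK by (auto simp: K_def)
  have le: "y \<bullet> (B *v y) \<le> d * (y \<bullet> (P *v y))" if "y \<in> V" for y
  proof (cases "y = 0")
    case False
    have p: "0 < y \<bullet> (P *v y)" using pd_matsD(2)[OF P False] .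
    have "(1 / sqrt (y \<bullet> (P *v y))) * (1 / sqrt (y \<bullet> (P *v y))) * (y \<bullet> (B *v y)) \<le> d"
      using xmax[OF norml[OF that False]] by (simp add: matrix_vector_mult_scaleR d_def)
    then show ?thesis using p by (simp add: field_simps)
  qed auto
  \<comment> \<open>First variation of the form \<open>d P - B\<close>, which is nonnegative on \<open>V\<close> and vanishes at \<open>x\<close>.\<close>
  have var: "y \<bullet> (B *v x - d *\<^sub>R (P *v x)) = 0" if "y \<in> V" for y
  proof (rule ccontr)
    define L where "L = y \<bullet> (B *v x - d *\<^sub>R (P *v x))"
    define Q where "Q = d * (y \<bullet> (P *v y)) - y \<bullet> (B *v y)"
    assume "y \<bullet> (B *v x - d *\<^sub>R (P *v x)) \<noteq> 0"
    then have "L \<noteq> 0" by (simp add: L_def)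
    have Q0: "0 \<le> Q" using le[OF that] by (simp add: Q_def)
    have ineq: "2 * t * L \<le> t\<^sup>2 * Q" for t
    proof -
      have "(t *\<^sub>R y + x) \<bullet> (B *v (t *\<^sub>R y + x)) \<le> d * ((t *\<^sub>R y + x) \<bullet> (P *v (t *\<^sub>R y + x)))"
        by (rule le[OF cV[OF that xV]])
      then show ?thesis
        using x1 symP[of x y] symB[of x y]
        by (simp add: L_def Q_def inner_diff_right matrix_vector_right_distrib matrix_vector_mult_scaleR
            inner_add_left inner_add_right algebra_simps power2_eq_square d_def[symmetric])
    qed
    define t where "t = L / (Q + 1)"
    have "2 * L\<^sup>2 / (Q + 1) \<le> L\<^sup>2 / (Q + 1)\<^sup>2 * Q"
      using ineq[of t] by (simp add: t_def power2_eq_square field_simps)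
    also have "\<dots> = (L\<^sup>2 / (Q + 1)) * (Q / (Q + 1))" by (simp add: power2_eq_square)
    also have "\<dots> \<le> (L\<^sup>2 / (Q + 1)) * 1"
      using Q0 by (intro mult_left_mono) auto
    finally have "L\<^sup>2 / (Q + 1) \<le> 0" by simp
    moreover have "0 < L\<^sup>2 / (Q + 1)" using \<open>L \<noteq> 0\<close> Q0 by simp
    ultimately show False by simp
  qed
  have all: "y \<bullet> (B *v x - d *\<^sub>R (P *v x)) = 0" for y
  proof -
    define y' where "y' = y - (\<Sum>s\<in>S. (y \<bullet> (P *v s)) *\<^sub>R s)"
    have "y' \<in> V"
      unfolding V_def
    proof safe
      fix t assume t: "t \<in> S"
      have "y' \<bullet> (P *v t) = y \<bullet> (P *v t) - (\<Sum>s\<in>S. (y \<bullet> (P *v s)) * (s \<bullet> (P *v t)))"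
        by (simp add: y'_def inner_diff_left inner_sum_left)
      also have "(\<Sum>s\<in>S. (y \<bullet> (P *v s)) * (s \<bullet> (P *v t))) = (\<Sum>s\<in>S. if s = t then y \<bullet> (P *v s) else 0)"
        by (intro sum.cong) (auto simp: on t)
      finally show "y' \<bullet> (P *v t) = 0" using t fin by simp
    qed
    moreover have "s \<bullet> (B *v x - d *\<^sub>R (P *v x)) = 0" if s: "s \<in> S" for s
    proof -
      obtain e where e: "B *v s = e *\<^sub>R (P *v s)" using eig[OF s] by blast
      have "s \<bullet> (P *v x) = 0" using xV s symP[of s x] by (auto simp: V_def)
      moreover have "s \<bullet> (B *v x) = 0" using symB[of s x] e xV s by (auto simp: V_def)
      ultimately show ?thesis by (simp add: inner_diff_right)
    qed
    ultimately have "y' \<bullet> (B *v x - d *\<^sub>R (P *v x)) + (\<Sum>s\<in>S. (y \<bullet> (P *v s)) * (s \<bullet> (B *v x - d *\<^sub>R (P *v x)))) = 0"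
      using var by simp
    moreover have "y = y' + (\<Sum>s\<in>S. (y \<bullet> (P *v s)) *\<^sub>R s)" by (simp add: y'_def)
    then have "y \<bullet> (B *v x - d *\<^sub>R (P *v x)) = (y' + (\<Sum>s\<in>S. (y \<bullet> (P *v s)) *\<^sub>R s)) \<bullet> (B *v x - d *\<^sub>R (P *v x))"
      by simp
    then have "y \<bullet> (B *v x - d *\<^sub>R (P *v x)) =
       y' \<bullet> (B *v x - d *\<^sub>R (P *v x)) + (\<Sum>s\<in>S. (y \<bullet> (P *v s)) * (s \<bullet> (B *v x - d *\<^sub>R (P *v x))))"
      by (simp add: inner_add_left inner_sum_left)
    ultimately show ?thesis by simp
  qed
  have "B *v x = d *\<^sub>R (P *v x)"
    using all[of "B *v x - d *\<^sub>R (P *v x)"] by simp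
  moreover have "s \<bullet> (P *v x) = 0" if "s \<in> S" for s
    using xV that symP[of s x] by (auto simp: V_def)
  ultimately show ?thesis using that x1 by blast
qed

text \<open>
  Any \<open>P\<close>-orthonormal family of generalised eigenvectors can be completed to a basis, one vector at a time.
  Taking \<open>B = 0\<close> turns this into the completion of an arbitrary \<open>P\<close>-orthonormal family.
\<close>

lemma generalized_eigenbasis_extend:
  fixes P B :: "real ^ 'q ^ 'q"
  assumes P: "P \<in> pd_mats" and B: "transpose B = B" and fin: "finite S"
    and eig: "\<And>s. s \<in> S \<Longrightarrow> \<exists>d. B *v s = d *\<^sub>R (P *v s)"
    and on: "\<And>s t. s \<in> S \<Longrightarrow> t \<in> S \<Longrightarrow> s \<bullet> (P *v t) = (if s = t then 1 else 0)"
  obtains w :: "'q \<Rightarrow> real ^ 'q" and d where "S \<subseteq> range w"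
    "\<And>i j. w i \<bullet> (P *v w j) = (if i = j then 1 else 0)" "\<And>i. B *v w i = d i *\<^sub>R (P *v w i)"
proof -
  have cardle: "card S \<le> CARD('q)"
    if fin: "finite S" and on: "\<And>s t. s \<in> S \<Longrightarrow> t \<in> S \<Longrightarrow> s \<bullet> (P *v t) = (if s = t then 1 else 0)" for S
  proof -
    have "independent S"
    proof (rule independent_if_scalars_zero[OF fin])
      fix f t assume 0: "(\<Sum>x\<in>S. f x *\<^sub>R x) = 0" and t: "t \<in> S"
      have "0 = (\<Sum>x\<in>S. f x *\<^sub>R x) \<bullet> (P *v t)" by (simp add: 0)
      also have "\<dots> = (\<Sum>x\<in>S. if x = t then f x else 0)"
        unfolding inner_sum_left by (intro sum.cong) (auto simp: on t)
      finally show "f t = 0" using t fin by simp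
    qed
    then show ?thesis using independent_bound by fastforce
  qed
  have "\<exists>T. finite T \<and> S \<subseteq> T \<and> card T = CARD('q) \<and> (\<forall>s\<in>T. \<exists>d. B *v s = d *\<^sub>R (P *v s)) \<and>
     (\<forall>s\<in>T. \<forall>t\<in>T. s \<bullet> (P *v t) = (if s = t then 1 else 0))"
    using fin eig on
  proof (induction "CARD('q) - card S" arbitrary: S)
    case 0
    then show ?case using cardle[of S] by (intro exI[of _ S]) auto
  next
    case (Suc n)
    have card: "card S < CARD('q)" using Suc(2) by simp
    obtain x d where x: "B *v x = d *\<^sub>R (P *v x)" "x \<bullet> (P *v x) = 1" "\<And>s. s \<in> S \<Longrightarrow> s \<bullet> (P *v x) = 0"
      using generalized_eigenvector_step[OF P B Suc(3-5) card] by metis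
    have xS: "x \<notin> S" using x by force
    have x': "x \<bullet> (P *v s) = 0" if "s \<in> S" for s
      using x(3)[OF that] sym_inner_commute[OF pd_matsD(1)[OF P]] by metis
    have "\<exists>T. finite T \<and> insert x S \<subseteq> T \<and> card T = CARD('q) \<and> (\<forall>s\<in>T. \<exists>d. B *v s = d *\<^sub>R (P *v s)) \<and>
     (\<forall>s\<in>T. \<forall>t\<in>T. s \<bullet> (P *v t) = (if s = t then 1 else 0))"
    proof (rule Suc(1))
      show "n = CARD('q) - card (insert x S)" using Suc(2,3) xS by simp
      show "finite (insert x S)" using Suc(3) by simp
      show "\<exists>d. B *v s = d *\<^sub>R (P *v s)" if "s \<in> insert x S" for s
        using that Suc(4) x by auto
      show "s \<bullet> (P *v t) = (if s = t then 1 else 0)" if "s \<in> insert x S" "t \<in> insert x S" for s t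
        using that Suc(5) x x' xS by auto
    qed
    then show ?case by blast
  qed
  then obtain T where T: "finite T" "S \<subseteq> T" "card T = CARD('q)" "\<forall>s\<in>T. \<exists>d. B *v s = d *\<^sub>R (P *v s)"
     "\<forall>s\<in>T. \<forall>t\<in>T. s \<bullet> (P *v t) = (if s = t then 1 else 0)" by blast
  obtain w :: "'q \<Rightarrow> real ^ 'q" where w: "bij_betw w UNIV T"
    using finite_same_card_bij[of "UNIV :: 'q set" T] T(1,3) by auto
  have wT: "w i \<in> T" for i using w by (auto simp: bij_betw_def)
  have "\<forall>i. \<exists>d. B *v w i = d *\<^sub>R (P *v w i)" using T(4) wT by blast
  from choice[OF this] obtain d where d: "\<And>i. B *v w i = d i *\<^sub>R (P *v w i)" by blast
  have 1: "S \<subseteq> range w" using bij_betw_imp_surj_on[OF w] T(2) by simp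
  have 2: "w i \<bullet> (P *v w j) = (if i = j then 1 else 0)" for i j
  proof -
    have "w i = w j \<longleftrightarrow> i = j"
      using bij_betw_imp_inj_on[OF w] by (simp add: inj_eq)
    then show ?thesis using T(5)[rule_format, OF wT[of i] wT[of j]] by simp
  qed
  from that[OF 1 2 d] show ?thesis .
qed

section \<open>Matrix inverses and block diagonal parts\<close>

lemma matrix_inv_eqI:
  fixes A B :: "real ^ 'q ^ 'q"
  assumes "A ** B = mat 1"
  shows "matrix_inv A = B"
proof -
  have "A ** B = mat 1 \<and> B ** A = mat 1"
    using assms matrix_left_right_inverse[of A B] by simp
  then have *: "A ** matrix_inv A = mat 1 \<and> matrix_inv A ** A = mat 1"
    unfolding matrix_inv_def by (rule someI)
  have "matrix_inv A = matrix_inv A ** (A ** B)" by (simp add: assms)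
  also have "\<dots> = B" using * by (simp add: matrix_mul_assoc)
  finally show ?thesis .
qed

lemma matrix_inv_mult:
  fixes A :: "real ^ 'q ^ 'q"
  assumes "invertible A"
  shows "A ** matrix_inv A = mat 1" "matrix_inv A ** A = mat 1"
proof -
  obtain B where B: "A ** B = mat 1" "B ** A = mat 1" using assms by (auto simp: invertible_def)
  with matrix_inv_eqI[OF B(1)] show "A ** matrix_inv A = mat 1" "matrix_inv A ** A = mat 1" by simp_all
qed

lemma matrix_distribs:
  fixes A B D :: "real ^ 'q::finite ^ 'q"
  shows "(A + B) ** D = A ** D + B ** D" "(A - B) ** D = A ** D - B ** D"
    "D ** (A + B) = D ** A + D ** B" "D ** (A - B) = D ** A - D ** B"
    "A ** (r *\<^sub>R B) = r *\<^sub>R (A ** B)" "(r *\<^sub>R A) ** B = r *\<^sub>R (A ** B)"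
  by (simp_all add: matrix_matrix_mult_def vec_eq_iff sum.distrib sum_subtractf distrib_left distrib_right left_diff_distrib right_diff_distrib sum_distrib_left mult_ac)

text \<open>
  Keeping only the blocks in \<open>T\<close> and putting the identity elsewhere makes the block diagonal part of \<open>A\<close> a
  product of commuting factors with one block each, so that its determinant splits over the blocks.
\<close>

definition block_or_one :: "('q::finite \<Rightarrow> 'k) \<Rightarrow> 'k set \<Rightarrow> real ^ 'q ^ 'q \<Rightarrow> real ^ 'q ^ 'q" where
  "block_or_one b T A = (\<chi> a c. if b a = b c \<and> b a \<in> T then A $ a $ c else if a = c then 1 else 0)"

text \<open>
  Only permutations that move nothing outside the block contribute to the Leibniz sum.
\<close>

lemma det_block_or_one_single: "det (block_or_one b {i} A) = block_det b i A"
proof -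
  let ?S = "{a. b a = i}"
  let ?B = "block_or_one b {i} A"
  have "det ?B = (\<Sum>p | p permutes ?S. of_int (sign p) * (\<Prod>a\<in>UNIV. ?B $ a $ p a))"
    unfolding det_def
  proof (rule sum.mono_neutral_right)
    show "finite {p. p permutes (UNIV :: 'a set)}" by (simp add: finite_permutations)
    show "{p. p permutes ?S} \<subseteq> {p. p permutes UNIV}" using permutes_subset by blast
    show "\<forall>p\<in>{p. p permutes UNIV} - {p. p permutes ?S}. of_int (sign p) * (\<Prod>a\<in>UNIV. ?B $ a $ p a) = 0"
    proof
      fix p assume p: "p \<in> {p. p permutes UNIV} - {p. p permutes ?S}"
      have "\<exists>a. a \<notin> ?S \<and> p a \<noteq> a"
      proof (rule ccontr)
        assume "\<not> (\<exists>a. a \<notin> ?S \<and> p a \<noteq> a)"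
        then have "p permutes ?S" using p by (auto simp: permutes_def)
        then show False using p by simp
      qed
      then obtain a where "a \<notin> ?S" "p a \<noteq> a" by blast
      then have "?B $ a $ p a = 0" by (simp add: block_or_one_def)
      then have "(\<Prod>a\<in>UNIV. ?B $ a $ p a) = 0" by (intro prod_zero) auto
      then show "of_int (sign p) * (\<Prod>a\<in>UNIV. ?B $ a $ p a) = 0" by simp
    qed
  qed
  also have "\<dots> = block_det b i A"
    unfolding block_det_def
  proof (rule sum.cong[OF refl])
    fix p assume "p \<in> {p. p permutes ?S}"
    then have p: "p permutes ?S" by simp
    have out: "p a = a" if "a \<notin> ?S" for a using permutes_not_in[OF p that] .
    have ins: "p a \<in> ?S" if "a \<in> ?S" for a using permutes_in_image[OF p, of a] that by blast
    have "(\<Prod>a\<in>UNIV. ?B $ a $ p a) = (\<Prod>a\<in>?S. ?B $ a $ p a)"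
      by (rule prod.mono_neutral_right) (auto simp: block_or_one_def out)
    also have "\<dots> = (\<Prod>a\<in>?S. A $ a $ p a)"
      by (rule prod.cong[OF refl]) (use ins in \<open>auto simp: block_or_one_def\<close>)
    finally show "of_int (sign p) * (\<Prod>a\<in>UNIV. ?B $ a $ p a) = of_int (sign p) * (\<Prod>a\<in>?S. A $ a $ p a)"
      by simp
  qed
  finally show ?thesis .
qed

lemma block_or_one_insert:
  assumes "i \<notin> T"
  shows "block_or_one b (insert i T) A = block_or_one b {i} A ** block_or_one b T A"
proof -
  have "(\<Sum>k\<in>UNIV. block_or_one b {i} A $ a $ k * block_or_one b T A $ k $ c) = block_or_one b (insert i T) A $ a $ c" for a c
  proof (cases "b a = i")
    case True
    have "(\<Sum>k\<in>UNIV. block_or_one b {i} A $ a $ k * block_or_one b T A $ k $ c)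
      = (\<Sum>k\<in>UNIV. if k = c then block_or_one b {i} A $ a $ c else 0)"
      by (rule sum.cong[OF refl]) (use assms True in \<open>auto simp: block_or_one_def\<close>)
    also have "\<dots> = block_or_one b {i} A $ a $ c" by simp
    finally show ?thesis using True by (simp add: block_or_one_def)
  next
    case False
    have "(\<Sum>k\<in>UNIV. block_or_one b {i} A $ a $ k * block_or_one b T A $ k $ c)
      = (\<Sum>k\<in>UNIV. if k = a then block_or_one b T A $ a $ c else 0)"
      by (rule sum.cong[OF refl]) (use False in \<open>auto simp: block_or_one_def\<close>)
    also have "\<dots> = block_or_one b T A $ a $ c" by simp
    finally show ?thesis using False by (simp add: block_or_one_def)
  qed
  then show ?thesis by (simp add: vec_eq_iff matrix_matrix_mult_def)
qed

lemma det_block_diag: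
  fixes b :: "'q::finite \<Rightarrow> 'k::finite"
  shows "det (block_diag b A) = (\<Prod>i\<in>UNIV. block_det b i A)"
proof -
  have *: "det (block_or_one b T A) = (\<Prod>i\<in>T. block_det b i A)" if "finite T" for T :: "'k set"
    using that
  proof (induction T rule: finite_induct)
    case empty
    have "block_or_one b {} A = mat 1" by (simp add: block_or_one_def mat_def vec_eq_iff)
    then show ?case by simp
  next
    case (insert i T)
    then show ?case
      unfolding block_or_one_insert[OF insert.hyps(2)] by (simp add: det_mul det_block_or_one_single)
  qed
  have "block_or_one b UNIV A = block_diag b A"
    by (simp add: block_or_one_def block_diag_def vec_eq_iff)
  then show ?thesis using *[of UNIV] by simp
qed

lemma prod_sqrt_block_det:
  fixes b :: "'q::finite \<Rightarrow> 'k::finite"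
  shows "(\<Prod>i\<in>UNIV. sqrt (block_det b i A)) = sqrt (det (block_diag b A))"
proof -
  have "sqrt (\<Prod>i\<in>T. f i) = (\<Prod>i\<in>T. sqrt (f i))" if "finite T" for f and T :: "'k set"
    using that by induction (simp_all add: real_sqrt_mult)
  then show ?thesis by (simp add: det_block_diag)
qed

lemma block_diag_idem [simp]: "block_diag b (block_diag b A) = block_diag b A"
  by (simp add: block_diag_def vec_eq_iff)

lemma block_diag_add: "block_diag b (A + B) = block_diag b A + block_diag b B"
  and block_diag_diff: "block_diag b (A - B) = block_diag b A - block_diag b B"
  and block_diag_scaleR: "block_diag b (c *\<^sub>R A) = c *\<^sub>R block_diag b A"
  and transpose_block_diag: "transpose (block_diag b A) = block_diag b (transpose A)"
  and block_diag_mat1 [simp]: "block_diag b (mat 1) = mat 1"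
  by (auto simp: block_diag_def vec_eq_iff transpose_def mat_def)

lemma block_diag_mult_left:
  assumes "block_diag b A = A"
  shows "block_diag b (A ** B) = A ** block_diag b B"
proof -
  have z: "A $ a $ k = 0" if "b a \<noteq> b k" for a k
  proof -
    have "block_diag b A $ a $ k = 0" using that by (simp add: block_diag_def)
    then show ?thesis by (simp only: assms)
  qed
  have "(if b a = b c then \<Sum>k\<in>UNIV. A $ a $ k * B $ k $ c else 0) =
    (\<Sum>k\<in>UNIV. A $ a $ k * (if b k = b c then B $ k $ c else 0))" for a c
  proof (cases "b a = b c")
    case True
    have "(\<Sum>k\<in>UNIV. A $ a $ k * B $ k $ c) = (\<Sum>k\<in>UNIV. A $ a $ k * (if b k = b c then B $ k $ c else 0))"
      by (rule sum.cong[OF refl]) (use True z in auto)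
    then show ?thesis using True by simp
  next
    case False
    have "(\<Sum>k\<in>UNIV. A $ a $ k * (if b k = b c then B $ k $ c else 0)) = 0"
      by (rule sum.neutral) (use False z in auto)
    then show ?thesis using False by simp
  qed
  moreover have "block_diag b (A ** B) $ a $ c = (if b a = b c then \<Sum>k\<in>UNIV. A $ a $ k * B $ k $ c else 0)" for a c
    by (simp add: block_diag_def matrix_matrix_mult_def)
  moreover have "(A ** block_diag b B) $ a $ c = (\<Sum>k\<in>UNIV. A $ a $ k * (if b k = b c then B $ k $ c else 0))" for a c
    by (simp add: block_diag_def matrix_matrix_mult_def)
  ultimately show ?thesis unfolding vec_eq_iff by presburger
qed

lemma block_diag_mult_right:
  assumes "block_diag b A = A"
  shows "block_diag b (B ** A) = block_diag b B ** A"
proof -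
  have "block_diag b (transpose A ** transpose B) = transpose A ** block_diag b (transpose B)"
    by (rule block_diag_mult_left) (metis assms transpose_block_diag)
  then have "transpose (block_diag b (B ** A)) = transpose (block_diag b B ** A)"
    by (simp add: transpose_block_diag matrix_transpose_mul)
  then show ?thesis by (metis transpose_transpose)
qed

lemma block_diag_matrix_inv:
  fixes A :: "real ^ 'q::finite ^ 'q"
  assumes "block_diag b A = A" "invertible A"
  shows "block_diag b (matrix_inv A) = matrix_inv A"
proof -
  have "A ** block_diag b (matrix_inv A) = block_diag b (A ** matrix_inv A)"
    using block_diag_mult_left[OF assms(1)] by simp
  also have "\<dots> = mat 1" using matrix_inv_mult[OF assms(2)] by simp
  finally show ?thesis using matrix_inv_eqI by metis
qed

text \<open>
  The trace pairing sees only those entries of \<open>B\<close> that meet a nonzero entry of \<open>A\<close>.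
\<close>

lemma trace_mult_block_diag:
  fixes A B :: "real ^ 'q::finite ^ 'q"
  assumes "block_diag b A = A"
  shows "trace (A ** B) = trace (A ** block_diag b B)"
proof -
  have "trace (A ** B) = trace (block_diag b (A ** B))"
    by (simp add: trace_def block_diag_def)
  then show ?thesis by (simp add: block_diag_mult_left[OF assms])
qed

lemma block_diag_pd:
  fixes b :: "'q::finite \<Rightarrow> 'k::finite" and A :: "real ^ 'q ^ 'q"
  assumes "A \<in> pd_mats"
  shows "block_diag b A \<in> pd_mats"
proof -
  define r where "r x i = (\<chi> a. if b a = i then x $ a else 0)" for x :: "real ^ 'q" and i
  have form: "x \<bullet> (block_diag b A *v x) = (\<Sum>i\<in>UNIV. r x i \<bullet> (A *v r x i))" for x
  proof -
    have "(\<Sum>i\<in>UNIV. r x i \<bullet> (A *v r x i)) =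
        (\<Sum>i\<in>UNIV. \<Sum>a\<in>UNIV. \<Sum>c\<in>UNIV. if b a = i \<and> b c = i then x $ a * (A $ a $ c * x $ c) else 0)"
      by (intro sum.cong refl) (auto simp: r_def inner_vec_def matrix_vector_mult_def sum_distrib_left intro!: sum.cong)
    also have "\<dots> = (\<Sum>a\<in>UNIV. \<Sum>c\<in>UNIV. \<Sum>i\<in>UNIV. if b a = i \<and> b c = i then x $ a * (A $ a $ c * x $ c) else 0)"
      by (subst sum.swap, rule sum.cong[OF refl], rule sum.swap)
    also have "\<dots> = (\<Sum>a\<in>UNIV. \<Sum>c\<in>UNIV. if b a = b c then x $ a * (A $ a $ c * x $ c) else 0)"
    proof (intro sum.cong refl)
      fix a c
      have "(\<Sum>i\<in>UNIV. if b a = i \<and> b c = i then x $ a * (A $ a $ c * x $ c) else 0)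
          = (\<Sum>i\<in>UNIV. if b a = i then (if b c = b a then x $ a * (A $ a $ c * x $ c) else 0) else 0)"
        by (intro sum.cong) auto
      then show "(\<Sum>i\<in>UNIV. if b a = i \<and> b c = i then x $ a * (A $ a $ c * x $ c) else 0)
          = (if b a = b c then x $ a * (A $ a $ c * x $ c) else 0)" by simp
    qed
    also have "\<dots> = x \<bullet> (block_diag b A *v x)"
      by (auto simp: block_diag_def inner_vec_def matrix_vector_mult_def sum_distrib_left intro!: sum.cong)
    finally show ?thesis by simp
  qed
  have nn: "0 \<le> y \<bullet> (A *v y)" for y using assms by (auto simp: pd_mats_def cov_mats_def)
  have sym: "transpose A = A" using assms by (auto simp: pd_mats_def cov_mats_def)
  have pos: "0 < x \<bullet> (block_diag b A *v x)" if "x \<noteq> 0" for x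
  proof -
    have "\<exists>a. x $ a \<noteq> 0" using that by (simp add: vec_eq_iff)
    then obtain a where "x $ a \<noteq> 0" by blast
    then have "r x (b a) $ a \<noteq> 0" by (simp add: r_def)
    then have "r x (b a) \<noteq> 0" by (metis zero_index)
    then have "0 < r x (b a) \<bullet> (A *v r x (b a))" using assms by (auto simp: pd_mats_def)
    then have "0 < (\<Sum>i\<in>UNIV. r x i \<bullet> (A *v r x i))" using nn by (intro sum_pos2[of _ "b a"]) auto
    then show ?thesis by (simp add: form)
  qed
  have "0 \<le> x \<bullet> (block_diag b A *v x)" for x
    by (simp add: form sum_nonneg nn)
  then show ?thesis using pos by (auto simp: pd_mats_def cov_mats_def transpose_block_diag sym)
qed

section \<open>Congruence to diagonal matrices\<close>

text \<open>Transposed matrices act from the left throughout.\<close>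

declare transpose_matrix_vector [simp del]

definition diag_mat :: "('q \<Rightarrow> real) \<Rightarrow> real ^ 'q ^ 'q" where
  "diag_mat d = (\<chi> i j. if i = j then d i else 0)"

lemma diag_mat_vec: "(diag_mat d *v x) $ i = d i * (x :: real ^ 'q::finite) $ i"
proof -
  have "(\<Sum>j\<in>UNIV. (if i = j then d i else 0) * x $ j) = (\<Sum>j\<in>UNIV. if j = i then d i * x $ i else 0)"
    by (intro sum.cong) auto
  then show ?thesis by (simp add: diag_mat_def matrix_vector_mult_def)
qed

lemma diag_mat_mult: "diag_mat d ** diag_mat e = (diag_mat (\<lambda>i. d i * e i) :: real ^ 'q::finite ^ 'q)"
proof -
  have "(diag_mat d ** diag_mat e) *v x = diag_mat (\<lambda>i. d i * e i) *v x" for x :: "real ^ 'q"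
    by (simp add: vec_eq_iff diag_mat_vec flip: matrix_vector_mul_assoc)
  then show ?thesis by (simp add: matrix_eq)
qed

lemma diag_mat_one: "diag_mat (\<lambda>_. 1) = mat 1"
  by (simp add: diag_mat_def mat_def)

lemma transpose_diag_mat: "transpose (diag_mat d) = diag_mat d"
  by (auto simp: diag_mat_def transpose_def vec_eq_iff)

lemma det_diag_mat: "det (diag_mat d :: real ^ 'q::finite ^ 'q) = (\<Prod>i\<in>UNIV. d i)"
  by (subst det_diagonal) (auto simp: diag_mat_def)

lemma inner_diag_mat: "y \<bullet> (diag_mat d *v y) = (\<Sum>i\<in>UNIV. d i * (y $ i)\<^sup>2)" for y :: "real ^ 'q::finite"
  by (simp add: inner_vec_def diag_mat_vec power2_eq_square mult_ac)

lemma inner_mult_transpose: "x \<bullet> (A *v y) = (transpose A *v x) \<bullet> y" for A :: "real ^ 'q::finite ^ 'q"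
  by (simp add: dot_lmul_matrix transpose_matrix_vector)

lemma inner_transpose: "x \<bullet> (transpose A *v y) = (A *v x) \<bullet> y" for A :: "real ^ 'q::finite ^ 'q"
  by (simp add: inner_mult_transpose)

lemma congruence_entry:
  fixes P :: "real ^ 'q::finite ^ 'q"
    and w :: "'q \<Rightarrow> real ^ 'q"
  shows "(transpose (\<chi> i j. w j $ i) ** P ** (\<chi> i j. w j $ i)) $ i $ j = w i \<bullet> (P *v w j)"
proof -
  have 1: "(\<chi> i j. w j $ i) *v axis j 1 = (w j :: real ^ 'q)" for j
    by (simp add: matrix_vector_mult_basis column_def vec_eq_iff)
  have "A $ i $ j = axis i 1 \<bullet> (A *v axis j 1)" for A :: "real ^ 'q ^ 'q"
    by (simp add: matrix_vector_mult_basis column_def inner_axis')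
  then have "(transpose (\<chi> i j. w j $ i) ** P ** (\<chi> i j. w j $ i)) $ i $ j =
     axis i 1 \<bullet> ((transpose (\<chi> i j. w j $ i) ** P ** (\<chi> i j. w j $ i)) *v axis j 1)"
    by simp
  also have "\<dots> = w i \<bullet> (P *v w j)"
    by (simp add: matrix_vector_mul_assoc[symmetric] inner_transpose 1)
  finally show ?thesis .
qed

text \<open>
  With a generalised eigenbasis as the columns of \<open>W\<close>, \<open>C\<close> is the transposed inverse of \<open>W\<close>.
\<close>

lemma simultaneous_diagonalization:
  fixes P B :: "real ^ 'q::finite ^ 'q"
  assumes "P \<in> pd_mats" "transpose B = B"
  obtains C :: "real ^ 'q ^ 'q" and d where "invertible C" "P = C ** transpose C" "B = C ** diag_mat d ** transpose C"
proof -
  obtain w :: "'q \<Rightarrow> real ^ 'q" and d where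
    w: "\<And>i j. w i \<bullet> (P *v w j) = (if i = j then 1 else 0)" "\<And>i. B *v w i = d i *\<^sub>R (P *v w i)"
    using generalized_eigenbasis_extend[OF assms finite.emptyI] by (metis empty_iff)
  define W where "W = (\<chi> i j. w j $ i)"
  have PW: "transpose W ** P ** W = mat 1"
    by (simp add: vec_eq_iff W_def congruence_entry w mat_def)
  have BW: "transpose W ** B ** W = diag_mat d"
    by (auto simp: vec_eq_iff W_def congruence_entry w diag_mat_def)
  define C where "C = P ** W"
  have TC: "transpose W ** C = mat 1" using PW by (simp add: C_def matrix_mul_assoc)
  then have CT: "C ** transpose W = mat 1" by (simp add: matrix_left_right_inverse)
  then have WC: "W ** transpose C = mat 1"
    by (metis matrix_transpose_mul transpose_mat transpose_transpose)
  have "invertible C" using TC CT by (auto simp: invertible_def)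
  moreover have "C ** (transpose W ** A ** W) ** transpose C = A" for A
  proof -
    have "C ** (transpose W ** A ** W) ** transpose C = (C ** transpose W) ** A ** (W ** transpose C)"
      by (simp add: matrix_mul_assoc)
    then show ?thesis by (simp add: CT WC)
  qed
  from this[of P] this[of B] have "P = C ** transpose C" "B = C ** diag_mat d ** transpose C"
    unfolding PW BW by simp_all
  ultimately show ?thesis using that by blast
qed

text \<open>
  All quantities in the normal density are explicit for matrices \<open>C D C\<^sup>T\<close> with a common \<open>C\<close>.
\<close>

lemma congruence_diag:
  fixes C :: "real ^ 'q::finite ^ 'q"
    and d :: "'q \<Rightarrow> real"
  assumes C: "invertible C"
  defines "S \<equiv> C ** diag_mat d ** transpose C"
  shows det_congruence_diag: "det S = (det C)\<^sup>2 * (\<Prod>i\<in>UNIV. d i)"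
    and matrix_inv_congruence_diag: "(\<And>i. d i \<noteq> 0) \<Longrightarrow>
      matrix_inv S = transpose (matrix_inv C) ** diag_mat (\<lambda>i. 1 / d i) ** matrix_inv C"
    and inv_form_congruence_diag: "(\<And>i. d i \<noteq> 0) \<Longrightarrow>
      (C *v y) \<bullet> (matrix_inv S *v (C *v y)) = (\<Sum>i\<in>UNIV. (y $ i)\<^sup>2 / d i)"
    and cov_congruence_diag: "(\<And>i. 0 \<le> d i) \<Longrightarrow> S \<in> cov_mats"
    and pd_congruence_diag: "S \<in> pd_mats \<longleftrightarrow> (\<forall>i. 0 < d i)"
proof -
  let ?K = "matrix_inv C"
  have CK: "C ** ?K = mat 1" and KC: "?K ** C = mat 1" using matrix_inv_mult[OF C] .
  have TKC: "transpose ?K ** transpose C = mat 1" and TCK: "transpose C ** transpose ?K = mat 1"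
    by (metis CK matrix_transpose_mul transpose_mat, metis KC matrix_transpose_mul transpose_mat)
  show "det S = (det C)\<^sup>2 * (\<Prod>i\<in>UNIV. d i)"
    by (simp add: S_def det_mul det_diag_mat power2_eq_square)
  show inv: "matrix_inv S = transpose ?K ** diag_mat (\<lambda>i. 1 / d i) ** ?K" if "\<And>i. d i \<noteq> 0"
  proof (rule matrix_inv_eqI)
    have "S ** (transpose ?K ** diag_mat (\<lambda>i. 1 / d i) ** ?K) =
      C ** diag_mat d ** (transpose C ** transpose ?K) ** diag_mat (\<lambda>i. 1 / d i) ** ?K"
      by (simp add: S_def matrix_mul_assoc)
    also have "\<dots> = C ** (diag_mat d ** diag_mat (\<lambda>i. 1 / d i)) ** ?K"
      by (simp add: TCK matrix_mul_assoc)
    also have "\<dots> = mat 1" by (simp add: diag_mat_mult that diag_mat_one CK)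
    finally show "S ** (transpose ?K ** diag_mat (\<lambda>i. 1 / d i) ** ?K) = mat 1" .
  qed
  show "(C *v y) \<bullet> (matrix_inv S *v (C *v y)) = (\<Sum>i\<in>UNIV. (y $ i)\<^sup>2 / d i)" if "\<And>i. d i \<noteq> 0"
  proof -
    have "?K *v (C *v y) = y" by (simp add: matrix_vector_mul_assoc KC)
    then have "(C *v y) \<bullet> (matrix_inv S *v (C *v y)) = y \<bullet> (diag_mat (\<lambda>i. 1 / d i) *v y)"
      by (simp add: inv[OF that] matrix_vector_mul_assoc[symmetric] inner_transpose)
    then show ?thesis by (simp add: inner_diag_mat)
  qed
  have form: "x \<bullet> (S *v x) = (\<Sum>i\<in>UNIV. d i * ((transpose C *v x) $ i)\<^sup>2)" for x
    by (simp add: S_def matrix_vector_mul_assoc[symmetric] inner_mult_transpose[of x C] inner_diag_mat)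
  have sym: "transpose S = S"
    by (simp add: S_def matrix_transpose_mul transpose_diag_mat matrix_mul_assoc)
  show cov: "S \<in> cov_mats" if "\<And>i. 0 \<le> d i"
    using that by (simp add: cov_mats_def sym form sum_nonneg)
  show "S \<in> pd_mats \<longleftrightarrow> (\<forall>i. 0 < d i)"
  proof
    assume pd: "S \<in> pd_mats"
    show "\<forall>i. 0 < d i"
    proof
      fix i
      have e: "transpose C *v (transpose ?K *v axis i 1) = axis i 1"
        by (simp add: matrix_vector_mul_assoc TCK)
      then have "transpose ?K *v axis i 1 \<noteq> 0" by (metis axis_eq_0_iff matrix_vector_mult_0_right zero_neq_one)
      from pd_matsD(2)[OF pd this] have "0 < (\<Sum>j\<in>UNIV. d j * ((axis i 1 :: real ^ 'q) $ j)\<^sup>2)"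
        by (simp only: form e)
      also have "\<dots> = (\<Sum>j\<in>UNIV. if j = i then d i else 0)"
        by (intro sum.cong) (auto simp: axis_def)
      finally show "0 < d i" by simp
    qed
  next
    assume d: "\<forall>i. 0 < d i"
    have "0 < x \<bullet> (S *v x)" if "x \<noteq> 0" for x
    proof -
      have "transpose ?K *v (transpose C *v x) = x" by (simp add: matrix_vector_mul_assoc TKC)
      then have "transpose C *v x \<noteq> 0" using that by (metis matrix_vector_mult_0_right)
      then have "\<exists>i. (transpose C *v x) $ i \<noteq> 0" by (simp add: vec_eq_iff)
      then obtain i where "(transpose C *v x) $ i \<noteq> 0" by blast
      then have "0 < (\<Sum>i\<in>UNIV. d i * ((transpose C *v x) $ i)\<^sup>2)"
        by (intro sum_pos2[of _ i]) (use d in \<open>auto simp: less_imp_le\<close>)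
      then show ?thesis by (simp add: form)
    qed
    then show "S \<in> pd_mats" using cov d by (simp add: pd_mats_def less_imp_le)
  qed
qed

lemma pd_factor:
  fixes P :: "real ^ 'q::finite ^ 'q"
  assumes "P \<in> pd_mats"
  obtains C :: "real ^ 'q ^ 'q" where "invertible C" "P = C ** transpose C"
  by (rule simultaneous_diagonalization[OF assms transpose_mat[of 1]]) (rule that)

lemma factor_pd:
  fixes C :: "real ^ 'q::finite ^ 'q"
  assumes C: "invertible C" and P: "P = C ** transpose C"
  shows "det P = (det C)\<^sup>2" "(C *v y) \<bullet> (matrix_inv P *v (C *v y)) = (norm y)\<^sup>2" "P \<in> pd_mats"
    "det P > 0" "invertible P"
proof -
  have P': "P = C ** diag_mat (\<lambda>_. 1) ** transpose C" using P by (simp add: diag_mat_one)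
  show d: "det P = (det C)\<^sup>2" using det_congruence_diag[OF C, of "\<lambda>_. 1"] by (simp add: P')
  show "(C *v y) \<bullet> (matrix_inv P *v (C *v y)) = (norm y)\<^sup>2"
    using inv_form_congruence_diag[OF C, of "\<lambda>_. 1"]
    by (simp add: P' norm_vec_def L2_set_def sum_nonneg)
  show "P \<in> pd_mats" using pd_congruence_diag[OF C, of "\<lambda>_. 1"] by (simp add: P')
  show "det P > 0" using d C by (simp add: invertible_det_nz)
  then show "invertible P" by (simp add: invertible_det_nz)
qed

lemma pd_matrix_inv:
  fixes P :: "real ^ 'q::finite ^ 'q"
  assumes "P \<in> pd_mats"
  shows "det P > 0" "invertible P" "matrix_inv P \<in> pd_mats" "transpose (matrix_inv P) = matrix_inv P"
proof -
  obtain C :: "real ^ 'q ^ 'q" where C: "invertible C" "P = C ** transpose C" by (rule pd_factor[OF assms])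
  show "det P > 0" and i: "invertible P" using factor_pd(4,5)[OF C] by auto
  show t: "transpose (matrix_inv P) = matrix_inv P"
  proof -
    have "P ** transpose (matrix_inv P) = transpose (matrix_inv P ** P)"
      by (simp add: matrix_transpose_mul pd_matsD(1)[OF assms])
    then have "P ** transpose (matrix_inv P) = mat 1"
      by (simp add: matrix_inv_mult[OF i] transpose_mat)
    then show ?thesis by (rule matrix_inv_eqI[symmetric])
  qed
  have "0 < x \<bullet> (matrix_inv P *v x)" if "x \<noteq> 0" for x
  proof -
    have x: "P *v (matrix_inv P *v x) = x" by (simp add: matrix_vector_mul_assoc matrix_inv_mult[OF i])
    then have "matrix_inv P *v x \<noteq> 0" using that by auto
    from pd_matsD(2)[OF assms this] show ?thesis by (simp add: x inner_commute)
  qed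
  then show "matrix_inv P \<in> pd_mats"
  proof -
    assume pos: "\<And>x. x \<noteq> 0 \<Longrightarrow> 0 < x \<bullet> (matrix_inv P *v x)"
    then have "0 \<le> x \<bullet> (matrix_inv P *v x)" for x
      by (cases "x = 0") (auto simp: less_imp_le)
    then show ?thesis using pos t by (simp add: pd_mats_def cov_mats_def)
  qed
qed

lemma transpose_matrix_inv_mult:
  fixes C :: "real ^ 'q::finite ^ 'q"
  assumes "invertible C"
  shows "matrix_inv C *v (C *v y) = y" "C *v (matrix_inv C *v y) = y"
  by (simp_all add: matrix_vector_mul_assoc matrix_inv_mult[OF assms])

section \<open>Lebesgue measure under linear maps\<close>

lemma lborel_vec_PiM:
  "(lborel :: (real ^ 'q::finite) measure) = distr (PiM UNIV (\<lambda>_. lborel)) borel (\<lambda>f. \<chi> i. f i)"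
proof (rule lborel_eqI)
  interpret product_sigma_finite "\<lambda>_::'q. lborel :: real measure" ..
  have [measurable]: "(\<lambda>f. \<chi> i. f i) \<in> (PiM UNIV (\<lambda>_::'q. lborel :: real measure)) \<rightarrow>\<^sub>M borel"
    by (rule borel_measurable_euclidean_space[THEN iffD2]) (auto simp: Basis_vec_def inner_axis)
  fix l u :: "real ^ 'q" assume lu: "\<And>b. b \<in> Basis \<Longrightarrow> l \<bullet> b \<le> u \<bullet> b"
  have le: "l $ i \<le> u $ i" for i using lu[of "axis i 1"] by (simp add: inner_axis)
  have "(\<lambda>f. \<chi> i. f i) -` box l u \<inter> space (PiM UNIV (\<lambda>_::'q. lborel :: real measure)) = Pi\<^sub>E UNIV (\<lambda>i. {l $ i <..< u $ i})"
    by (auto simp: mem_box_cart space_PiM PiE_def Pi_iff)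
  then have "emeasure (distr (PiM UNIV (\<lambda>_. lborel)) borel (\<lambda>f. \<chi> i. f i)) (box l u) = (\<Prod>i\<in>UNIV. ennreal (u $ i - l $ i))"
    using le by (subst emeasure_distr) (auto simp: emeasure_PiM)
  also have "\<dots> = ennreal (\<Prod>i\<in>UNIV. (u - l) $ i)"
    using le by (subst prod_ennreal) auto
  also have "(\<Prod>i\<in>UNIV. (u - l) $ i) = (\<Prod>b\<in>Basis. (u - l) \<bullet> b)"
  proof -
    have bs: "(Basis :: (real ^ 'q) set) = range (\<lambda>i. axis i 1)" by (auto simp: Basis_vec_def)
    show ?thesis
      by (simp add: bs prod.reindex inj_on_def axis_eq_axis inner_axis)
  qed
  finally show "emeasure (distr (PiM UNIV (\<lambda>_. lborel)) borel (\<lambda>f. \<chi> i. f i)) (box l u) = (\<Prod>b\<in>Basis. (u - l) \<bullet> b)" .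
qed simp

lemma measurable_vec_lambda [measurable (raw)]:
  assumes "\<And>i. (\<lambda>x. f x i) \<in> borel_measurable M"
  shows "(\<lambda>x. (\<chi> i. f x i) :: real ^ 'q::finite) \<in> borel_measurable M"
  using assms by (intro borel_measurable_euclidean_space[THEN iffD2]) (auto simp: Basis_vec_def inner_axis)

lemma borel_measurable_vec_nth [measurable (raw)]:
  assumes "f \<in> borel_measurable M"
  shows "(\<lambda>x. (f x :: real ^ 'q::finite) $ i) \<in> borel_measurable M"
proof -
  have "(\<lambda>x. x $ i) \<in> borel_measurable (borel :: (real ^ 'q) measure)"
    by (intro borel_measurable_continuous_onI continuous_intros)
  from measurable_compose[OF assms this] show ?thesis .
qed

lemma borel_measurable_matrix_vector [measurable (raw)]:
  assumes "f \<in> borel_measurable M"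
  shows "(\<lambda>x. (A :: real ^ 'q::finite ^ 'r::finite) *v f x) \<in> borel_measurable M"
proof -
  have "(*v) A \<in> borel_measurable borel"
    by (intro borel_measurable_continuous_onI continuous_intros)
  from measurable_compose[OF assms this] show ?thesis .
qed

lemma nn_integral_vec:
  fixes f :: "real ^ 'q::finite \<Rightarrow> ennreal"
  assumes [measurable]: "f \<in> borel_measurable borel"
  shows "(\<integral>\<^sup>+x. f x \<partial>lborel) = (\<integral>\<^sup>+x. f (\<chi> i. x i) \<partial>PiM UNIV (\<lambda>_. lborel))"
  by (subst lborel_vec_PiM, subst nn_integral_distr) measurable

text \<open>
  Fubini's theorem with one coordinate singled out, for arguments that vary that coordinate alone.
\<close>

lemma nn_integral_vec_coordinate:
  fixes f :: "real ^ 'q::finite \<Rightarrow> ennreal"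
  assumes [measurable]: "f \<in> borel_measurable borel"
  shows "(\<integral>\<^sup>+x. f x \<partial>lborel) =
    (\<integral>\<^sup>+x. (\<integral>\<^sup>+y. f (\<chi> i. if i = m then y else x i) \<partial>lborel) \<partial>PiM (UNIV - {m}) (\<lambda>_. lborel))"
proof -
  interpret product_sigma_finite "\<lambda>_::'q. lborel :: real measure" ..
  have "(\<integral>\<^sup>+x. f x \<partial>lborel) = (\<integral>\<^sup>+x. f (\<chi> i. x i) \<partial>PiM (insert m (UNIV - {m})) (\<lambda>_. lborel))"
    by (simp add: nn_integral_vec insert_absorb)
  also have "\<dots> = (\<integral>\<^sup>+x. (\<integral>\<^sup>+y. f (\<chi> i. (x(m := y)) i) \<partial>lborel) \<partial>PiM (UNIV - {m}) (\<lambda>_. lborel))"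
    by (rule product_nn_integral_insert) auto
  finally show ?thesis by (simp add: fun_upd_def)
qed

text \<open>
  Every linear map is a product of coordinate stretchings, transpositions and shears, for which the
  formula follows coordinatewise.
\<close>

lemma nn_integral_linear_map:
  fixes f :: "real ^ 'q::finite \<Rightarrow> real ^ 'q"
  assumes "linear f" "det (matrix f) \<noteq> 0" "g \<in> borel_measurable borel"
  shows "(\<integral>\<^sup>+x. g x \<partial>lborel) = ennreal \<bar>det (matrix f)\<bar> * (\<integral>\<^sup>+y. g (f y) \<partial>lborel)"
proof -
  have meas: "h \<in> borel_measurable borel" if "linear h" for h :: "real ^ 'q \<Rightarrow> real ^ 'q"
    using that by (intro borel_measurable_continuous_onI linear_continuous_on) (simp add: linear_conv_bounded_linear)
  have "det (matrix f) \<noteq> 0 \<longrightarrow> (\<forall>g\<in>borel_measurable borel.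
     (\<integral>\<^sup>+x. g x \<partial>lborel) = ennreal \<bar>det (matrix f)\<bar> * (\<integral>\<^sup>+y. g (f y) \<partial>lborel))" (is "?P f")
    using \<open>linear f\<close>
  proof (rule induct_linear_elementary)
    fix f g :: "real ^ 'q \<Rightarrow> real ^ 'q"
    assume lin: "linear f" "linear g" and P: "?P f" "?P g"
    have m: "matrix (f \<circ> g) = matrix f ** matrix g" using lin by (simp add: matrix_compose)
    show "?P (f \<circ> g)"
    proof (intro impI ballI)
      fix h :: "real ^ 'q \<Rightarrow> ennreal" assume nz: "det (matrix (f \<circ> g)) \<noteq> 0" and h: "h \<in> borel_measurable borel"
      have nz: "det (matrix f) \<noteq> 0" "det (matrix g) \<noteq> 0" using nz by (auto simp: m det_mul)
      have hf: "(\<lambda>y. h (f y)) \<in> borel_measurable borel"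
        using measurable_compose[OF meas[OF lin(1)] h] .
      have "(\<integral>\<^sup>+x. h x \<partial>lborel) = ennreal \<bar>det (matrix f)\<bar> * (\<integral>\<^sup>+y. h (f y) \<partial>lborel)"
        using P(1) nz h by blast
      also have "(\<integral>\<^sup>+y. h (f y) \<partial>lborel) = ennreal \<bar>det (matrix g)\<bar> * (\<integral>\<^sup>+y. h (f (g y)) \<partial>lborel)"
        using P(2) nz hf by blast
      finally show "(\<integral>\<^sup>+x. h x \<partial>lborel) = ennreal \<bar>det (matrix (f \<circ> g))\<bar> * (\<integral>\<^sup>+y. h ((f \<circ> g) y) \<partial>lborel)"
        by (simp add: m det_mul abs_mult ennreal_mult mult.assoc)
    qed
  next
    fix f :: "real ^ 'q \<Rightarrow> real ^ 'q" and i
    assume "linear f" and 0: "\<And>x. f x $ i = 0"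
    have "row i (matrix f) = 0" by (simp add: row_def matrix_def 0 vec_eq_iff)
    then show "?P f" by (simp add: det_zero_row)
  next
    fix c :: "'q \<Rightarrow> real"
    let ?h = "\<lambda>x. \<chi> i. c i * x $ i"
    have d: "det (matrix ?h) = (\<Prod>i\<in>UNIV. c i)"
      by (subst det_diagonal) (auto simp: matrix_def axis_def)
    show "?P ?h"
    proof (intro impI ballI)
      fix g :: "real ^ 'q \<Rightarrow> ennreal" assume nz: "det (matrix ?h) \<noteq> 0" and g[measurable]: "g \<in> borel_measurable borel"
      then have c: "c i \<noteq> 0" for i by (simp add: d)
      have c': "(\<Sum>b\<in>Basis. ((\<chi> i. c i) \<bullet> b) *\<^sub>R b) = (\<chi> i. c i)" by (rule euclidean_representation)
      have bs: "(Basis :: (real ^ 'q) set) = range (\<lambda>i. axis i 1)" by (auto simp: Basis_vec_def)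
      have "lborel = density (distr lborel borel (\<lambda>x. 0 + (\<Sum>j\<in>Basis. ((\<chi> i. c i) \<bullet> j * (x \<bullet> j)) *\<^sub>R j)))
         (\<lambda>_. ennreal (\<Prod>j\<in>Basis. \<bar>(\<chi> i. c i) \<bullet> j\<bar>))"
        by (rule lborel_affine_euclidean) (auto simp: bs inner_axis c)
      also have "(\<lambda>x. 0 + (\<Sum>j\<in>Basis. ((\<chi> i. c i) \<bullet> j * (x \<bullet> j)) *\<^sub>R j)) = ?h"
      proof
        fix x :: "real ^ 'q"
        have "(\<Sum>j\<in>Basis. ((\<chi> i. c i) \<bullet> j * (x \<bullet> j)) *\<^sub>R j) = (\<Sum>j\<in>Basis. (?h x \<bullet> j) *\<^sub>R j)"
          by (rule sum.cong) (auto simp: bs inner_axis)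
        then show "0 + (\<Sum>j\<in>Basis. ((\<chi> i. c i) \<bullet> j * (x \<bullet> j)) *\<^sub>R j) = ?h x"
          by (simp only: euclidean_representation add_0)
      qed
      also have "(\<Prod>j\<in>Basis. \<bar>(\<chi> i. c i) \<bullet> j\<bar>) = \<bar>det (matrix ?h)\<bar>"
        by (simp add: d bs prod.reindex inj_on_def axis_eq_axis inner_axis abs_prod)
      finally have l: "lborel = density (distr lborel borel ?h) (\<lambda>_. ennreal \<bar>det (matrix ?h)\<bar>)" .
      show "(\<integral>\<^sup>+x. g x \<partial>lborel) = ennreal \<bar>det (matrix ?h)\<bar> * (\<integral>\<^sup>+y. g (?h y) \<partial>lborel)"
        by (subst l) (simp add: nn_integral_density nn_integral_distr nn_integral_cmult)
    qed
  next
    fix m n :: 'q assume "m \<noteq> n"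
    let ?t = "Transposition.transpose m n"
    let ?h = "\<lambda>v::(real, 'q) vec. \<chi> i. v $ ?t i"
    have lin: "linear ?h"
      by (rule linearI) (simp_all add: plus_vec_def scaleR_vec_def)
    have "(\<chi> i j. if ?t i = j then 1 else 0) = (\<chi> i j. if j = ?t i then 1 else (0::real))"
      by (auto intro!: Cart_lambda_cong)
    then have "matrix ?h = transpose(\<chi> i j. mat 1 $ i $ ?t j)"
      by (auto simp: matrix_eq transpose_def axis_def mat_def matrix_def)
    then have 1: "\<bar>det (matrix ?h)\<bar> = 1"
      by (simp add: det_permute_columns permutes_swap_id sign_swap_id abs_mult)
    have bs: "(Basis :: (real ^ 'q) set) = range (\<lambda>i. axis i 1)" by (auto simp: Basis_vec_def)
    have l: "lborel = distr lborel borel ?h"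
    proof (rule lborel_eqI)
      fix l u :: "real ^ 'q" assume lu: "\<And>b. b \<in> Basis \<Longrightarrow> l \<bullet> b \<le> u \<bullet> b"
      have le: "l $ i \<le> u $ i" for i using lu[of "axis i 1"] by (simp add: inner_axis bs)
      have eq: "?h -` box l u = box (?h l) (?h u)"
        by (auto simp: mem_box_cart) (metis transpose_involutory)+
      have pr: "(\<Prod>b\<in>Basis. (u - l) \<bullet> b) = (\<Prod>i\<in>UNIV. (u $ i - l $ i))" for u l :: "real ^ 'q"
        by (simp add: bs prod.reindex inj_on_def axis_eq_axis inner_axis)
      have "emeasure (distr lborel borel ?h) (box l u) = emeasure lborel (box (?h l) (?h u))"
        using eq by (simp add: emeasure_distr)
      also have "\<dots> = (\<Prod>b\<in>Basis. (?h u - ?h l) \<bullet> b)"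
        by (subst emeasure_lborel_box) (auto simp: bs inner_axis le)
      also have "(\<Prod>b\<in>Basis. (?h u - ?h l) \<bullet> b) = (\<Prod>b\<in>Basis. (u - l) \<bullet> b)"
        unfolding pr using prod.permute[OF permutes_swap_id, of m UNIV n "\<lambda>i. u $ i - l $ i"] by (simp add: comp_def)
      finally show "emeasure (distr lborel borel ?h) (box l u) = (\<Prod>b\<in>Basis. (u - l) \<bullet> b)" .
    qed simp
    show "?P ?h"
    proof (intro impI ballI)
      fix g :: "real ^ 'q \<Rightarrow> ennreal" assume g[measurable]: "g \<in> borel_measurable borel"
      show "(\<integral>\<^sup>+x. g x \<partial>lborel) = ennreal \<bar>det (matrix ?h)\<bar> * (\<integral>\<^sup>+y. g (?h y) \<partial>lborel)"
        unfolding 1 by (subst l) (simp add: nn_integral_distr)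
    qed
  next
    fix m n :: 'q assume mn: "m \<noteq> n"
    let ?h = "\<lambda>v::(real, 'q) vec. \<chi> i. if i = m then v $ m + v $ n else v $ i"
    have "matrix ?h = (\<chi> k. if k = m then row m (mat 1) + 1 *s row n (mat 1) else row k (mat 1))"
      by (auto simp: matrix_def row_def mat_def axis_def vec_eq_iff)
    then have 1: "det (matrix ?h) = 1" using det_row_operation[OF mn, of "mat 1 :: real ^ 'q ^ 'q" 1] by simp
    show "?P ?h"
    proof (intro impI ballI)
      fix g :: "real ^ 'q \<Rightarrow> ennreal" assume g[measurable]: "g \<in> borel_measurable borel"
      have "(\<integral>\<^sup>+y. g (?h y) \<partial>lborel) = (\<integral>\<^sup>+x. (\<integral>\<^sup>+y. g (?h (\<chi> i. if i = m then y else x i)) \<partial>lborel) \<partial>PiM (UNIV - {m}) (\<lambda>_. lborel))"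
        by (rule nn_integral_vec_coordinate) measurable
      also have "\<dots> = (\<integral>\<^sup>+x. (\<integral>\<^sup>+y. g (\<chi> i. if i = m then y else x i) \<partial>lborel) \<partial>PiM (UNIV - {m}) (\<lambda>_. lborel))"
      proof (rule nn_integral_cong)
        fix x :: "'q \<Rightarrow> real"
        have "(\<integral>\<^sup>+y. g (\<chi> i. if i = m then y else x i) \<partial>lborel) =
            (\<integral>\<^sup>+y. g (\<chi> i. if i = m then x n + 1 * y else x i) \<partial>lborel)"
          by (subst nn_integral_real_affine[of _ 1 "x n"]) auto
        also have "\<dots> = (\<integral>\<^sup>+y. g (?h (\<chi> i. if i = m then y else x i)) \<partial>lborel)"
          using mn by (intro nn_integral_cong arg_cong[of _ _ g]) (auto simp: vec_eq_iff)
        finally show "(\<integral>\<^sup>+y. g (?h (\<chi> i. if i = m then y else x i)) \<partial>lborel) =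
            (\<integral>\<^sup>+y. g (\<chi> i. if i = m then y else x i) \<partial>lborel)" by simp
      qed
      also have "\<dots> = (\<integral>\<^sup>+x. g x \<partial>lborel)" by (rule nn_integral_vec_coordinate[symmetric]) measurable
      finally show "(\<integral>\<^sup>+x. g x \<partial>lborel) = ennreal \<bar>det (matrix ?h)\<bar> * (\<integral>\<^sup>+y. g (?h y) \<partial>lborel)"
        by (simp add: 1)
    qed
  qed
  then show ?thesis using assms by blast
qed

section \<open>Multivariate normal laws\<close>

abbreviation std_PiM :: "('q \<Rightarrow> real) measure" where
  "std_PiM \<equiv> PiM UNIV (\<lambda>_. std_normal_distribution)"

lemma prob_space_std_normal: "prob_space std_normal_distribution"
  using real_dist_normal_dist by (simp add: real_distribution_def)

lemma sets_std_PiM [measurable_cong]: "sets (std_PiM :: ('q \<Rightarrow> real) measure) = sets (PiM UNIV (\<lambda>_. borel))"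
  by (rule sets_PiM_cong) auto

lemma prob_space_std_PiM: "prob_space (std_PiM :: ('q \<Rightarrow> real) measure)"
  by (rule prob_space_PiM) (rule prob_space_std_normal)

lemma std_PiM_density:
  "(std_PiM :: ('q::finite \<Rightarrow> real) measure) =
    density (PiM UNIV (\<lambda>_. lborel)) (\<lambda>f. \<Prod>i\<in>UNIV. ennreal (std_normal_density (f i)))"
proof -
  interpret L: product_sigma_finite "\<lambda>_::'q. lborel :: real measure" ..
  interpret N: product_sigma_finite "\<lambda>_::'q. std_normal_distribution"
    unfolding product_sigma_finite_def
    using prob_space_std_normal by (auto intro: prob_space_imp_sigma_finite)
  let ?g = "\<lambda>f. \<Prod>i\<in>UNIV. ennreal (std_normal_density (f i))"
  have [measurable]: "?g \<in> borel_measurable (PiM UNIV (\<lambda>_::'q. lborel))" by measurable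
  show ?thesis
  proof (rule N.PiM_eqI[symmetric])
    show "sets (density (PiM UNIV (\<lambda>_::'q. lborel)) ?g) = sets (std_PiM :: ('q \<Rightarrow> real) measure)"
    proof -
      have "sets (PiM UNIV (\<lambda>_::'q. lborel :: real measure)) = sets (std_PiM :: ('q \<Rightarrow> real) measure)"
        by (rule sets_PiM_cong) auto
      then show ?thesis by simp
    qed
    fix A :: "'q \<Rightarrow> real set" assume "\<And>i. i \<in> UNIV \<Longrightarrow> A i \<in> sets std_normal_distribution"
    then have A[measurable]: "A i \<in> sets borel" for i by auto
    have S: "Pi\<^sub>E UNIV A \<in> sets (PiM UNIV (\<lambda>_::'q. lborel :: real measure))"
      by (rule sets_PiM_I_finite) auto
    have ind: "indicator (Pi\<^sub>E UNIV A) f = (\<Prod>i\<in>UNIV. indicator (A i) (f i) :: ennreal)" for f :: "'q \<Rightarrow> real"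
    proof (cases "\<forall>i. f i \<in> A i")
      case False
      then obtain i where "f i \<notin> A i" by blast
      then have "(\<Prod>i\<in>UNIV. indicator (A i) (f i) :: ennreal) = 0" by (intro prod_zero bexI[of _ i]) auto
      then show ?thesis using False by (auto simp: PiE_def Pi_iff)
    qed (auto simp: PiE_def Pi_iff)
    have "emeasure (density (PiM UNIV (\<lambda>_::'q. lborel)) ?g) (Pi\<^sub>E UNIV A) =
      (\<integral>\<^sup>+f. (\<Prod>i\<in>UNIV. ennreal (std_normal_density (f i)) * indicator (A i) (f i)) \<partial>PiM UNIV (\<lambda>_::'q. lborel))"
      using S by (subst emeasure_density) (auto simp: ind prod.distrib)
    also have "\<dots> = (\<Prod>i\<in>UNIV. \<integral>\<^sup>+x. ennreal (std_normal_density x) * indicator (A i) x \<partial>lborel)"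
      by (rule L.product_nn_integral_prod) auto
    also have "\<dots> = (\<Prod>i\<in>UNIV. emeasure std_normal_distribution (A i))"
      by (simp add: emeasure_density)
    finally show "emeasure (density (PiM UNIV (\<lambda>_::'q. lborel)) ?g) (Pi\<^sub>E UNIV A) = (\<Prod>i\<in>UNIV. emeasure std_normal_distribution (A i))" .
  qed simp
qed

definition gauss_pdf :: "real ^ 'q::finite ^ 'q \<Rightarrow> real ^ 'q \<Rightarrow> real" where
  "gauss_pdf A x = exp (- (x \<bullet> (matrix_inv A *v x)) / 2) / ((2 * pi) powr (real CARD('q) / 2) * sqrt (det A))"

lemma gauss_pdf_measurable [measurable]: "gauss_pdf A \<in> borel_measurable borel"
  unfolding gauss_pdf_def by measurable

lemma gauss_pdf_pos: "A \<in> pd_mats \<Longrightarrow> 0 < gauss_pdf A x"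
  by (simp add: gauss_pdf_def pd_matrix_inv)

lemma mvn_density: "mvn A = density lborel (\<lambda>x. ennreal (gauss_pdf A x))"
  by (simp add: mvn_def gauss_pdf_def)

lemma sets_mvn [simp, measurable_cong]: "sets (mvn A) = sets borel"
  and space_mvn [simp]: "space (mvn A) = UNIV"
  by (simp_all add: mvn_def)

text \<open>
  The substitution \<open>x = C y\<close> with \<open>R = C C\<^sup>T\<close> turns the normal density into a product.
\<close>

lemma gauss_pdf_factor:
  fixes C :: "real ^ 'q::finite ^ 'q"
  assumes C: "invertible C" and R: "R = C ** transpose C"
  shows "\<bar>det C\<bar> * gauss_pdf R (C *v y) = (\<Prod>i\<in>UNIV. std_normal_density (y $ i))"
proof -
  have d: "sqrt (det R) = \<bar>det C\<bar>" using factor_pd(1)[OF C R] by simp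
  have nz: "det C \<noteq> 0" using C by (simp add: invertible_det_nz)
  have "(\<Prod>i\<in>(UNIV::'q set). std_normal_density (y $ i)) = (1 / sqrt (2 * pi)) ^ CARD('q) * exp (\<Sum>i\<in>UNIV. - (y $ i)\<^sup>2 / 2)"
    by (simp add: std_normal_density_def prod.distrib exp_sum prod_dividef power_divide)
  also have "(\<Sum>i\<in>UNIV. - (y $ i)\<^sup>2 / 2) = - (norm y)\<^sup>2 / 2"
    by (simp add: norm_vec_def L2_set_def sum_nonneg sum_negf flip: sum_divide_distrib)
  also have "(1 / sqrt (2 * pi)) ^ CARD('q) = 1 / (2 * pi) powr (real CARD('q) / 2)"
  proof -
    have "sqrt (2 * pi) ^ CARD('q) = ((2 * pi) powr (1 / 2)) powr real CARD('q)"
      by (simp add: powr_realpow powr_half_sqrt)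
    then show ?thesis by (simp add: powr_powr power_divide)
  qed
  finally have "(\<Prod>i\<in>(UNIV::'q set). std_normal_density (y $ i)) = 1 / (2 * pi) powr (real CARD('q) / 2) * exp (- (norm y)\<^sup>2 / 2)" .
  then show ?thesis
    using nz by (simp add: gauss_pdf_def d factor_pd(2)[OF C R])
qed

lemma mvn_factor:
  fixes C :: "real ^ 'q::finite ^ 'q"
  assumes C: "invertible C" and R: "R = C ** transpose C"
  shows "mvn R = distr std_PiM borel (\<lambda>f. C *v (\<chi> i. f i))"
proof (rule measure_eqI)
  fix A assume "A \<in> sets (mvn R)"
  then have A[measurable]: "A \<in> sets borel" by simp
  have lin: "linear ((*v) C)" by (rule matrix_vector_mul_linear)
  have mC: "matrix ((*v) C) = C" by (rule matrix_of_matrix_vector_mul)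
  have "emeasure (mvn R) A = (\<integral>\<^sup>+x. ennreal (gauss_pdf R x) * indicator A x \<partial>lborel)"
    by (simp add: mvn_density emeasure_density)
  also have "\<dots> = ennreal \<bar>det C\<bar> * (\<integral>\<^sup>+y. ennreal (gauss_pdf R (C *v y)) * indicator A (C *v y) \<partial>lborel)"
    using nn_integral_linear_map[OF lin, of "\<lambda>x. ennreal (gauss_pdf R x) * indicator A x"] C
    by (simp add: mC invertible_det_nz)
  also have "\<dots> = (\<integral>\<^sup>+y. ennreal (\<bar>det C\<bar> * gauss_pdf R (C *v y)) * indicator A (C *v y) \<partial>lborel)"
    by (subst nn_integral_cmult[symmetric]) (auto simp: ennreal_mult' mult.assoc)
  also have "\<dots> = (\<integral>\<^sup>+y. (\<Prod>i\<in>UNIV. ennreal (std_normal_density (y $ i))) * indicator A (C *v y) \<partial>lborel)"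
    unfolding gauss_pdf_factor[OF C R] by (simp add: prod_ennreal)
  also have "\<dots> = (\<integral>\<^sup>+f. (\<Prod>i\<in>UNIV. ennreal (std_normal_density (f i))) * indicator A (C *v (\<chi> i. f i)) \<partial>PiM UNIV (\<lambda>_. lborel))"
    by (subst nn_integral_vec) auto
  also have "\<dots> = (\<integral>\<^sup>+f. indicator A (C *v (\<chi> i. f i)) \<partial>std_PiM)"
    unfolding std_PiM_density by (subst nn_integral_density) auto
  also have "\<dots> = emeasure (distr std_PiM borel (\<lambda>f. C *v (\<chi> i. f i))) A"
  proof -
    have [measurable]: "(\<lambda>f. C *v (\<chi> i. f i)) \<in> std_PiM \<rightarrow>\<^sub>M borel" by measurable
    have "(\<integral>\<^sup>+f. indicator A (C *v (\<chi> i. f i)) \<partial>std_PiM) = (\<integral>\<^sup>+x. indicator A x \<partial>distr std_PiM borel (\<lambda>f. C *v (\<chi> i. f i)))"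
      by (subst nn_integral_distr) auto
    then show ?thesis by simp
  qed
  finally show "emeasure (mvn R) A = emeasure (distr std_PiM borel (\<lambda>f. C *v (\<chi> i. f i))) A" .
qed simp

lemma prob_space_mvn:
  assumes "R \<in> pd_mats"
  shows "prob_space (mvn R)"
proof -
  obtain C :: "real ^ 'a ^ 'a" where C: "invertible C" "R = C ** transpose C" by (rule pd_factor[OF assms])
  interpret prob_space "std_PiM :: ('a \<Rightarrow> real) measure" by (rule prob_space_std_PiM)
  show ?thesis unfolding mvn_factor[OF C] by (rule prob_space_distr) measurable
qed

text \<open>
  Linear functionals that are orthonormal for the covariance form are independent standard normal
  variables; this carries marginal laws, residuals and moments back to products.
\<close>

lemma mvn_functionals:
  fixes R :: "real ^ 'q::finite ^ 'q" and w :: "'q \<Rightarrow> real ^ 'q"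
  assumes R: "R \<in> pd_mats" and w: "\<And>i j. w i \<bullet> (R *v w j) = (if i = j then 1 else 0)"
  shows "distr (mvn R) (PiM UNIV (\<lambda>_. borel)) (\<lambda>z i. w i \<bullet> z) = std_PiM"
proof -
  define W where "W = (\<chi> i j. w j $ i)"
  define C where "C = R ** W"
  have "transpose W ** R ** W = mat 1"
    by (simp add: vec_eq_iff W_def congruence_entry w mat_def)
  then have TC: "transpose W ** C = mat 1" by (simp add: C_def matrix_mul_assoc)
  then have CT: "C ** transpose W = mat 1" by (simp add: matrix_left_right_inverse)
  have "W ** transpose C = transpose (C ** transpose W)" by (simp add: matrix_transpose_mul)
  then have WC: "W ** transpose C = mat 1" by (simp add: CT transpose_mat)
  have "C ** transpose C = R ** (W ** transpose C)" by (simp add: C_def matrix_mul_assoc)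
  then have RC: "R = C ** transpose C" by (simp add: WC)
  have inv: "invertible C" using TC CT by (auto simp: invertible_def)
  have coord: "w i \<bullet> (C *v y) = y $ i" for i y
  proof -
    have "w i \<bullet> (C *v y) = (transpose W *v (C *v y)) $ i"
      by (simp add: W_def matrix_vector_mult_def transpose_def inner_vec_def)
    then show ?thesis by (simp add: matrix_vector_mul_assoc TC)
  qed
  have m[measurable]: "(\<lambda>z i. w i \<bullet> z) \<in> borel \<rightarrow>\<^sub>M PiM UNIV (\<lambda>_. borel)"
    by (rule measurable_PiM_single') auto
  have "distr (mvn R) (PiM UNIV (\<lambda>_. borel)) (\<lambda>z i. w i \<bullet> z) =
      distr std_PiM (PiM UNIV (\<lambda>_. borel)) ((\<lambda>z i. w i \<bullet> z) \<circ> (\<lambda>f. C *v (\<chi> i. f i)))"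
    unfolding mvn_factor[OF inv RC] by (rule distr_distr) measurable
  also have "(\<lambda>z i. w i \<bullet> z) \<circ> (\<lambda>f. C *v (\<chi> i. f i)) = (\<lambda>x. x)"
    by (auto simp: coord fun_eq_iff)
  also have "distr std_PiM (PiM UNIV (\<lambda>_. borel)) (\<lambda>x. x) = (std_PiM :: ('q \<Rightarrow> real) measure)"
    by (rule distr_id2) (simp add: sets_std_PiM)
  finally show ?thesis .
qed

lemma mvn_functional_extend:
  fixes R :: "real ^ 'q::finite ^ 'q"
  assumes R: "R \<in> pd_mats" and fin: "finite S"
    and on: "\<And>s t. s \<in> S \<Longrightarrow> t \<in> S \<Longrightarrow> s \<bullet> (R *v t) = (if s = t then 1 else 0)"
  obtains w :: "'q \<Rightarrow> real ^ 'q" where "S \<subseteq> range w"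
    "distr (mvn R) (PiM UNIV (\<lambda>_. borel)) (\<lambda>z i. w i \<bullet> z) = std_PiM"
proof -
  have t0: "transpose (0 :: real ^ 'q ^ 'q) = 0" by (simp add: transpose_def vec_eq_iff)
  have e: "\<exists>d. (0 :: real ^ 'q ^ 'q) *v s = d *\<^sub>R (R *v s)" for s
    by (rule exI[of _ 0]) simp
  obtain w :: "'q \<Rightarrow> real ^ 'q" and d :: "'q \<Rightarrow> real" where w: "S \<subseteq> range w"
    "\<And>i j. w i \<bullet> (R *v w j) = (if i = j then 1 else 0)" "\<And>i. (0 :: real ^ 'q ^ 'q) *v w i = d i *\<^sub>R (R *v w i)"
    by (rule generalized_eigenbasis_extend[OF R t0 fin e on], assumption+, rule that)
  show ?thesis by (rule that[OF w(1) mvn_functionals[OF R w(2)]])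
qed

lemma mvn_functional_std:
  fixes R :: "real ^ 'q::finite ^ 'q"
  assumes R: "R \<in> pd_mats" and u: "u \<bullet> (R *v u) = 1"
  shows "distr (mvn R) borel (\<lambda>z. u \<bullet> z) = std_normal_distribution"
proof -
  have on: "s \<bullet> (R *v t) = (if s = t then 1 else 0)" if "s \<in> {u}" "t \<in> {u}" for s t
    using that u by auto
  obtain w :: "'q \<Rightarrow> real ^ 'q" where w: "{u} \<subseteq> range w"
    "distr (mvn R) (PiM UNIV (\<lambda>_. borel)) (\<lambda>z i. w i \<bullet> z) = std_PiM"
    by (rule mvn_functional_extend[where S="{u}", OF R _ on]) auto
  obtain i where i: "u = w i" using w(1) by auto
  have m[measurable]: "(\<lambda>z i. w i \<bullet> z) \<in> borel \<rightarrow>\<^sub>M PiM UNIV (\<lambda>_. borel)"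
    by (rule measurable_PiM_single') auto
  have "distr (mvn R) borel (\<lambda>z. u \<bullet> z) = distr (mvn R) borel ((\<lambda>f. f i) \<circ> (\<lambda>z i. w i \<bullet> z))"
    by (simp add: comp_def i)
  also have "\<dots> = distr (distr (mvn R) (PiM UNIV (\<lambda>_. borel)) (\<lambda>z i. w i \<bullet> z)) borel (\<lambda>f. f i)"
    by (rule distr_distr[symmetric]) measurable
  also have "\<dots> = distr std_PiM std_normal_distribution (\<lambda>f. f i)"
    unfolding w(2) by (rule distr_cong) auto
  also have "\<dots> = std_normal_distribution"
    by (rule distr_PiM_component) (auto simp: prob_space_std_normal)
  finally show ?thesis .
qed

lemma mvn_functional_pair:
  fixes R :: "real ^ 'q::finite ^ 'q"
  assumes R: "R \<in> pd_mats" and uv: "u \<bullet> (R *v u) = 1" "v \<bullet> (R *v v) = 1" "u \<bullet> (R *v v) = 0"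
  shows "distr (mvn R) (borel \<Otimes>\<^sub>M borel) (\<lambda>z. (u \<bullet> z, v \<bullet> z)) = std_normal_distribution \<Otimes>\<^sub>M std_normal_distribution"
proof -
  interpret Np: prob_space std_normal_distribution by (rule prob_space_std_normal)
  interpret P: prob_space "std_PiM :: ('q \<Rightarrow> real) measure" by (rule prob_space_std_PiM)
  have vu: "v \<bullet> (R *v u) = 0" using uv(3) sym_inner_commute[OF pd_matsD(1)[OF R]] by metis
  have on: "s \<bullet> (R *v t) = (if s = t then 1 else 0)" if "s \<in> {u, v}" "t \<in> {u, v}" for s t
    using that uv vu by auto
  obtain w :: "'q \<Rightarrow> real ^ 'q" where w: "{u, v} \<subseteq> range w"
    "distr (mvn R) (PiM UNIV (\<lambda>_. borel)) (\<lambda>z i. w i \<bullet> z) = std_PiM"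
    by (rule mvn_functional_extend[where S="{u, v}", OF R _ on]) auto
  obtain i j where i: "u = w i" and j: "v = w j" using w(1) by auto
  have ij: "i \<noteq> j" using uv i j by auto
  have m[measurable]: "(\<lambda>z i. w i \<bullet> z) \<in> borel \<rightarrow>\<^sub>M PiM UNIV (\<lambda>_. borel)"
    by (rule measurable_PiM_single') auto
  have "distr (mvn R) (borel \<Otimes>\<^sub>M borel) (\<lambda>z. (u \<bullet> z, v \<bullet> z)) = distr (mvn R) (borel \<Otimes>\<^sub>M borel) ((\<lambda>f. (f i, f j)) \<circ> (\<lambda>z i. w i \<bullet> z))"
    by (simp add: comp_def i j)
  also have "\<dots> = distr (distr (mvn R) (PiM UNIV (\<lambda>_. borel)) (\<lambda>z i. w i \<bullet> z)) (borel \<Otimes>\<^sub>M borel) (\<lambda>f. (f i, f j))"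
    by (rule distr_distr[symmetric]) measurable
  finally have 1: "distr (mvn R) (borel \<Otimes>\<^sub>M borel) (\<lambda>z. (u \<bullet> z, v \<bullet> z)) = distr std_PiM (borel \<Otimes>\<^sub>M borel) (\<lambda>f. (f i, f j))"
    unfolding w(2) .
  have iv: "P.indep_vars (\<lambda>_. borel) (\<lambda>i f. f i) UNIV"
  proof (subst P.indep_vars_iff_distr_eq_PiM)
    show "distr std_PiM (PiM UNIV (\<lambda>_. borel)) (\<lambda>x. \<lambda>i\<in>UNIV. x i) = PiM UNIV (\<lambda>i. distr std_PiM borel (\<lambda>f::'q \<Rightarrow> real. f i))"
    proof -
      have "distr std_PiM borel (\<lambda>f::'q \<Rightarrow> real. f i) = std_normal_distribution" for i
      proof -
        have "distr std_PiM borel (\<lambda>f::'q \<Rightarrow> real. f i) = distr std_PiM std_normal_distribution (\<lambda>f. f i)"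
          by (rule distr_cong) auto
        also have "\<dots> = std_normal_distribution"
          by (rule distr_PiM_component) (auto simp: prob_space_std_normal)
        finally show ?thesis .
      qed
      moreover have "distr std_PiM (PiM UNIV (\<lambda>_. borel)) (\<lambda>x. \<lambda>i\<in>UNIV. x i) = (std_PiM :: ('q \<Rightarrow> real) measure)"
        by (simp add: restrict_UNIV) (rule distr_id2, simp add: sets_std_PiM)
      ultimately show ?thesis by simp
    qed
  qed auto
  have "P.indep_var borel (\<lambda>f. restrict f {i} i) borel (\<lambda>f. restrict f {j} j)"
    using P.indep_var_compose[OF P.indep_var_restrict[OF iv, of "{i}" "{j}"], of "\<lambda>f. f i" borel "\<lambda>f. f j" borel] ij
    by (simp add: comp_def)
  then have "P.indep_var borel (\<lambda>f. f i) borel (\<lambda>f. f j)"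
    by simp
  then have "distr std_PiM borel (\<lambda>f. f i) \<Otimes>\<^sub>M distr std_PiM borel (\<lambda>f. f j) = distr std_PiM (borel \<Otimes>\<^sub>M borel) (\<lambda>f. (f i, f j))"
    by (subst (asm) P.indep_var_distribution_eq) auto
  moreover have "distr std_PiM borel (\<lambda>f::'q \<Rightarrow> real. f i) = std_normal_distribution" for i
  proof -
    have "distr std_PiM borel (\<lambda>f::'q \<Rightarrow> real. f i) = distr std_PiM std_normal_distribution (\<lambda>f. f i)"
      by (rule distr_cong) auto
    also have "\<dots> = std_normal_distribution"
      by (rule distr_PiM_component) (auto simp: prob_space_std_normal)
    finally show ?thesis .
  qed
  ultimately show ?thesis using 1 by simp
qed

section \<open>Regression residuals and moments of normal laws\<close>

lemma matrix_axis_nth: "((R :: real ^ 'q::finite ^ 'q) *v axis c 1) $ a = R $ a $ c"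
  by (simp add: matrix_vector_mult_basis column_def)

lemma pd_sym_nth:
  assumes "R \<in> pd_mats"
  shows "R $ c $ a = R $ a $ c"
proof -
  have "transpose R $ c $ a = R $ a $ c" by (simp add: transpose_def)
  then show ?thesis by (simp add: pd_matsD(1)[OF assms])
qed

lemma inner_axis_nth: "axis a 1 \<bullet> (z :: real ^ 'q::finite) = z $ a"
  by (simp add: inner_axis')

lemma mvn_marginal:
  assumes "R \<in> pd_mats" "R $ a $ a = 1"
  shows "distr (mvn R) borel (\<lambda>z. z $ a) = std_normal_distribution"
  using mvn_functional_std[OF assms(1), of "axis a 1"] assms(2)
  by (simp add: inner_axis_nth matrix_axis_nth)

text \<open>
  Positive definiteness on the plane of two coordinates is the strict Cauchy-Schwarz inequality.
\<close>

lemma corr_sq_less_1: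
  fixes R :: "real ^ 'q::finite ^ 'q"
  assumes R: "R \<in> pd_mats" "R $ a $ a = 1" "R $ c $ c = 1" "a \<noteq> c"
  shows "(R $ a $ c)\<^sup>2 < 1"
proof -
  let ?r = "R $ a $ c"
  have s: "R $ c $ a = ?r" by (rule pd_sym_nth[OF R(1)])
  have "(axis c 1 - ?r *\<^sub>R axis a 1) $ c = (1 :: real)" using R(4) by (simp add: axis_def)
  then have "axis c 1 - ?r *\<^sub>R axis a 1 \<noteq> (0 :: real ^ 'q)" by (metis zero_index zero_neq_one)
  from pd_matsD(2)[OF R(1) this] show ?thesis
    by (simp add: matrix_vector_mult_diff_distrib matrix_vector_mult_scaleR inner_diff_left inner_diff_right
        inner_axis_nth matrix_axis_nth s R power2_eq_square)
qed

lemma mvn_residual_pair: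
  fixes R :: "real ^ 'q::finite ^ 'q"
  assumes R: "R \<in> pd_mats" "R $ a $ a = 1" "R $ c $ c = 1" "a \<noteq> c"
  defines "r \<equiv> R $ a $ c"
  shows "distr (mvn R) (borel \<Otimes>\<^sub>M borel) (\<lambda>z. (z $ a, (z $ c - r * z $ a) / sqrt (1 - r\<^sup>2))) =
    std_normal_distribution \<Otimes>\<^sub>M std_normal_distribution"
proof -
  let ?s = "sqrt (1 - r\<^sup>2)"
  define t where "t = 1 / ?s"
  define v where "v = t *\<^sub>R (axis c 1 - r *\<^sub>R axis a 1 :: real ^ 'q)"
  have sym: "R $ c $ a = r" unfolding r_def by (rule pd_sym_nth[OF R(1)])
  have s: "0 < 1 - r\<^sup>2" using corr_sq_less_1[OF R] by (simp add: r_def)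
  have "axis a 1 \<bullet> (R *v v) = 0"
    by (simp add: v_def matrix_vector_mult_diff_distrib matrix_vector_mult_scaleR inner_diff_right inner_axis_nth matrix_axis_nth R(2) r_def)
  moreover have "v \<bullet> (R *v v) = 1"
  proof -
    have "v \<bullet> (R *v v) = t * t * (1 - r\<^sup>2)"
      by (simp add: v_def matrix_vector_mult_diff_distrib matrix_vector_mult_scaleR inner_diff_left inner_diff_right
          inner_axis_nth matrix_axis_nth sym R(2,3) r_def[symmetric] power2_eq_square algebra_simps)
    then show ?thesis using s by (simp add: t_def)
  qed
  moreover have "axis a 1 \<bullet> (R *v axis a 1) = 1" by (simp add: inner_axis_nth matrix_axis_nth R)
  ultimately have "distr (mvn R) (borel \<Otimes>\<^sub>M borel) (\<lambda>z. (axis a 1 \<bullet> z, v \<bullet> z)) =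
    std_normal_distribution \<Otimes>\<^sub>M std_normal_distribution"
    using mvn_functional_pair[OF R(1)] by blast
  moreover have "v \<bullet> z = (z $ c - r * z $ a) / ?s" for z
    by (simp add: v_def t_def inner_diff_left inner_axis_nth)
  ultimately show ?thesis by (simp add: inner_axis_nth)
qed

lemma std_normal_measure_UNIV [simp]: "measure std_normal_distribution UNIV = 1"
  using prob_space.prob_space[OF prob_space_std_normal] by simp

lemma std_normal_moment:
  "integrable std_normal_distribution (\<lambda>x. x ^ k)"
  "integral\<^sup>L std_normal_distribution (\<lambda>x. 1 :: real) = 1"
  "integral\<^sup>L std_normal_distribution (\<lambda>x. x) = 0"
  "integral\<^sup>L std_normal_distribution (\<lambda>x. x ^ 2) = 1"
  "integral\<^sup>L std_normal_distribution (\<lambda>x. x ^ 3) = 0"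
  "integral\<^sup>L std_normal_distribution (\<lambda>x. x ^ 4) = 3"
proof -
  interpret prob_space std_normal_distribution by (rule prob_space_std_normal)
  show "integrable std_normal_distribution (\<lambda>x. x ^ k)"
    using integrable_std_normal_moment[of k] by (subst integrable_density) (auto simp: normal_density_nonneg)
  show "integral\<^sup>L std_normal_distribution (\<lambda>x. 1 :: real) = 1" by simp
  show "integral\<^sup>L std_normal_distribution (\<lambda>x. x) = 0"
    using integral_std_normal_moment_odd[of 0] by (subst integral_density) (auto simp: normal_density_nonneg)
  show "integral\<^sup>L std_normal_distribution (\<lambda>x. x ^ 2) = 1"
    using integral_std_normal_moment_even[of 1] by (subst integral_density) (auto simp: normal_density_nonneg)
  show "integral\<^sup>L std_normal_distribution (\<lambda>x. x ^ 3) = 0"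
    using integral_std_normal_moment_odd[of 1] by (subst integral_density) (auto simp: normal_density_nonneg)
  show "integral\<^sup>L std_normal_distribution (\<lambda>x. x ^ 4) = 3"
    using integral_std_normal_moment_even[of 2] by (subst integral_density) (auto simp: normal_density_nonneg fact_numeral)
qed

lemma nn_integral_std_normal_sq: "(\<integral>\<^sup>+y. ennreal (y\<^sup>2) \<partial>std_normal_distribution) = 1"
  using std_normal_moment(1)[of 2] std_normal_moment(4) by (subst nn_integral_eq_integral) auto

text \<open>
  Under \<open>N(0, R)\<close> the regression residual of one coordinate on another is a centered normal variable
  that is independent of the regressor.
\<close>

lemma mvn_residual_sq:
  fixes R :: "real ^ 'q::finite ^ 'q" and F :: "real \<Rightarrow> ennreal"
  assumes R: "R \<in> pd_mats" "R $ a $ a = 1" "R $ c $ c = 1" "a \<noteq> c"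
    and F[measurable]: "F \<in> borel_measurable borel"
  shows "(\<integral>\<^sup>+z. ennreal ((z $ c - R $ a $ c * z $ a)\<^sup>2) * F (z $ a) \<partial>mvn R) =
    ennreal (1 - (R $ a $ c)\<^sup>2) * (\<integral>\<^sup>+z. F (z $ a) \<partial>mvn R)"
proof -
  interpret N: prob_space std_normal_distribution by (rule prob_space_std_normal)
  interpret P: pair_sigma_finite std_normal_distribution std_normal_distribution
    by (intro pair_sigma_finite.intro N.sigma_finite_measure_axioms)
  let ?s = "1 - (R $ a $ c)\<^sup>2"
  have s: "0 < ?s" using corr_sq_less_1[OF R] by simp
  have "(\<integral>\<^sup>+z. ennreal ((z $ c - R $ a $ c * z $ a)\<^sup>2) * F (z $ a) \<partial>mvn R) =
      (\<integral>\<^sup>+z. (\<lambda>(x, y). ennreal (?s * y\<^sup>2) * F x) (z $ a, (z $ c - R $ a $ c * z $ a) / sqrt ?s) \<partial>mvn R)"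
    using s by (intro nn_integral_cong) (simp add: power_divide)
  also have "\<dots> = (\<integral>\<^sup>+p. (\<lambda>(x, y). ennreal (?s * y\<^sup>2) * F x) p \<partial>(std_normal_distribution \<Otimes>\<^sub>M std_normal_distribution))"
    unfolding mvn_residual_pair[OF R, symmetric] by (subst nn_integral_distr) auto
  also have "\<dots> = (\<integral>\<^sup>+x. \<integral>\<^sup>+y. ennreal (?s * y\<^sup>2) * F x \<partial>std_normal_distribution \<partial>std_normal_distribution)"
    by (subst N.nn_integral_fst[symmetric]) auto
  also have "\<dots> = (\<integral>\<^sup>+x. ennreal ?s * F x \<partial>std_normal_distribution)"
    using s by (simp add: nn_integral_multc nn_integral_cmult ennreal_mult nn_integral_std_normal_sq)
  also have "\<dots> = ennreal ?s * (\<integral>\<^sup>+x. F x \<partial>std_normal_distribution)"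
    by (rule nn_integral_cmult) simp
  also have "(\<integral>\<^sup>+x. F x \<partial>std_normal_distribution) = (\<integral>\<^sup>+z. F (z $ a) \<partial>mvn R)"
    unfolding mvn_marginal[OF R(1,2), symmetric] by (subst nn_integral_distr) auto
  finally show ?thesis .
qed

lemma mvn_residual_zero:
  fixes R :: "real ^ 'q::finite ^ 'q" and F :: "real \<Rightarrow> real"
  assumes R: "R \<in> pd_mats" "R $ a $ a = 1" "R $ c $ c = 1" "a \<noteq> c"
    and F[measurable]: "F \<in> borel_measurable borel"
    and int: "integrable (mvn R) (\<lambda>z. (z $ c - R $ a $ c * z $ a) * F (z $ a))"
  shows "(\<integral>z. (z $ c - R $ a $ c * z $ a) * F (z $ a) \<partial>mvn R) = 0"
proof -
  interpret N: prob_space std_normal_distribution by (rule prob_space_std_normal)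
  interpret P: pair_sigma_finite std_normal_distribution std_normal_distribution
    by (intro pair_sigma_finite.intro N.sigma_finite_measure_axioms)
  let ?s = "1 - (R $ a $ c)\<^sup>2"
  let ?h = "\<lambda>(x, y). sqrt ?s * y * F x"
  have s: "0 < ?s" using corr_sq_less_1[OF R] by simp
  then have ne: "(R $ a $ c)\<^sup>2 \<noteq> 1" by simp
  have eq: "(z $ c - R $ a $ c * z $ a) * F (z $ a) = ?h (z $ a, (z $ c - R $ a $ c * z $ a) / sqrt ?s)" for z
    using s by simp
  have "integrable (std_normal_distribution \<Otimes>\<^sub>M std_normal_distribution) ?h"
    unfolding mvn_residual_pair[OF R, symmetric]
    by (subst integrable_distr_eq) (use int in \<open>auto simp: ne\<close>)
  then have "(\<integral>p. ?h p \<partial>(std_normal_distribution \<Otimes>\<^sub>M std_normal_distribution)) =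
      (\<integral>x. \<integral>y. ?h (x, y) \<partial>std_normal_distribution \<partial>std_normal_distribution)"
    by (subst P.integral_fst'[symmetric]) auto
  also have "\<dots> = 0" by (simp add: std_normal_moment)
  finally show ?thesis
    unfolding mvn_residual_pair[OF R, symmetric] eq by (subst (asm) integral_distr) auto
qed

lemma std_PiM_monomial:
  "has_bochner_integral (std_PiM :: ('q::finite \<Rightarrow> real) measure) (\<lambda>f. \<Prod>m\<in>UNIV. f m ^ e m)
     (\<Prod>m\<in>UNIV. integral\<^sup>L std_normal_distribution (\<lambda>x. x ^ e m))"
proof -
  interpret product_sigma_finite "\<lambda>_::'q. std_normal_distribution"
    unfolding product_sigma_finite_def
    using prob_space_std_normal by (auto intro: prob_space_imp_sigma_finite)
  show ?thesis
    unfolding has_bochner_integral_iff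
    using product_integrable_prod[of UNIV "\<lambda>m x. x ^ e m"] product_integral_prod[of UNIV "\<lambda>m x. x ^ e m"] std_normal_moment(1)
    by simp
qed

lemma prod_power_of_bool: "(\<Prod>m\<in>UNIV. f m ^ of_bool (m = i)) = f i" for f :: "'q::finite \<Rightarrow> real"
proof -
  have "(\<Prod>m\<in>UNIV. f m ^ of_bool (m = i)) = (\<Prod>m\<in>UNIV. if m = i then f m else 1)"
    by (intro prod.cong) auto
  then show ?thesis by simp
qed

lemma std_PiM_second:
  "has_bochner_integral (std_PiM :: ('q::finite \<Rightarrow> real) measure) (\<lambda>f. f i * f j) (if i = j then 1 else 0)"
proof -
  let ?e = "\<lambda>m. of_bool (m = i) + of_bool (m = j) :: nat"
  have "(\<Prod>m\<in>UNIV. integral\<^sup>L std_normal_distribution (\<lambda>x. x ^ ?e m)) = (if i = j then 1 else 0)"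
  proof (cases "i = j")
    case True
    then show ?thesis by (intro trans[OF prod.neutral]) (auto simp: std_normal_moment of_bool_def numeral_2_eq_2[symmetric] power2_eq_square[symmetric])
  next
    case False
    then have "(\<Prod>m\<in>UNIV. integral\<^sup>L std_normal_distribution (\<lambda>x. x ^ ?e m)) = 0"
      by (intro prod_zero bexI[of _ i]) (auto simp: std_normal_moment)
    then show ?thesis using False by simp
  qed
  with std_PiM_monomial[of ?e] show ?thesis by (simp only: power_add prod.distrib prod_power_of_bool)
qed

text \<open>
  A product of four coordinates has nonzero mean only if the indices pair up.
\<close>

lemma std_PiM_fourth:
  "has_bochner_integral (std_PiM :: ('q::finite \<Rightarrow> real) measure) (\<lambda>f. f i * f j * f k * f l)
    ((if i = j \<and> k = l then 1 else 0) + (if i = k \<and> j = l then 1 else 0) + (if i = l \<and> j = k then 1 else 0))"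
proof -
  let ?e = "\<lambda>m. of_bool (m = i) + of_bool (m = j) + of_bool (m = k) + of_bool (m = l) :: nat"
  define mo where "mo n = integral\<^sup>L std_normal_distribution (\<lambda>x. x ^ n)" for n
  have mo: "mo 0 = 1" "mo (Suc 0) = 0" "mo (Suc (Suc 0)) = 1" "mo (Suc (Suc (Suc 0))) = 0" "mo (Suc (Suc (Suc (Suc 0)))) = 3"
    using std_normal_moment(2-6) by (simp_all add: mo_def eval_nat_numeral)
  have odd: "(\<Prod>m\<in>UNIV. mo (?e m)) = 0" if "mo (?e p) = 0" for p
    using that by (intro prod_zero bexI[of _ p]) auto
  have "(\<Prod>m\<in>UNIV. mo (?e m)) =
    ((if i = j \<and> k = l then 1 else 0) + (if i = k \<and> j = l then 1 else 0) + (if i = l \<and> j = k then 1 else 0))"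
  proof (cases "i = j \<and> j = k \<and> k = l")
    case True
    then have "(\<Prod>m\<in>UNIV. mo (?e m)) = (\<Prod>m\<in>UNIV. if m = i then 3 else 1)"
      by (intro prod.cong) (auto simp: mo)
    then show ?thesis using True by simp
  next
    case ne: False
    show ?thesis
    proof (cases "(i = j \<and> k = l) \<or> (i = k \<and> j = l) \<or> (i = l \<and> j = k)")
      case True
      then have "(\<Prod>m\<in>UNIV. mo (?e m)) = 1"
        using ne by (intro prod.neutral) (auto simp: mo)
      moreover have "(if i = j \<and> k = l then 1 else 0) + (if i = k \<and> j = l then 1 else 0) + (if i = l \<and> j = k then 1 else 0) = (1 :: real)"
        using True
      proof (elim disjE conjE)
        assume "i = j" "k = l" then show ?thesis using ne by simp
      next
        assume "i = k" "j = l" then show ?thesis using ne by simp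
      next
        assume "i = l" "j = k" then show ?thesis using ne by simp
      qed
      ultimately show ?thesis by simp
    next
      case False
      have "\<exists>p. mo (?e p) = 0"
      proof (cases "i = j")
        case True
        then have "k \<noteq> l" using False by blast
        then show ?thesis
          by (intro exI[of _ "if k = i then l else k"]) (use True in \<open>auto simp: mo\<close>)
      next
        case ij: False
        show ?thesis
        proof (cases "k = i \<or> l = i")
          case True
          then show ?thesis by (intro exI[of _ j]) (use False ij in \<open>auto simp: mo\<close>)
        next
          case False
          then show ?thesis by (intro exI[of _ i]) (use ij in \<open>auto simp: mo\<close>)
        qed
      qed
      then have "(\<Prod>m\<in>UNIV. mo (?e m)) = 0" using odd by blast
      moreover have "\<not> (i = j \<and> k = l)" "\<not> (i = k \<and> j = l)" "\<not> (i = l \<and> j = k)" using False by blast+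
      ultimately show ?thesis by (simp only: if_False add_0)
    qed
  qed
  with std_PiM_monomial[of ?e] show ?thesis
    unfolding mo_def[symmetric] by (simp only: power_add prod.distrib prod_power_of_bool)
qed

lemma mvn_has_integral_via_factor:
  fixes C :: "real ^ 'q::finite ^ 'q" and g :: "real ^ 'q \<Rightarrow> real"
  assumes C: "invertible C" "R = C ** transpose C" and [measurable]: "g \<in> borel_measurable borel"
    and h: "has_bochner_integral std_PiM (\<lambda>f. g (C *v (\<chi> i. f i))) I"
  shows "has_bochner_integral (mvn R) g I"
  using h unfolding has_bochner_integral_iff mvn_factor[OF C]
  by (simp add: integrable_distr_eq integral_distr)

lemma mvn_second_moment:
  fixes R :: "real ^ 'q::finite ^ 'q"
  assumes R: "R \<in> pd_mats"
  shows "has_bochner_integral (mvn R) (\<lambda>z. z $ a * z $ c) (R $ a $ c)"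
proof -
  obtain C :: "real ^ 'q ^ 'q" where C: "invertible C" "R = C ** transpose C" by (rule pd_factor[OF R])
  have "has_bochner_integral std_PiM (\<lambda>f. \<Sum>i\<in>UNIV. \<Sum>j\<in>UNIV. (C $ a $ i * C $ c $ j) * (f i * f j))
     (\<Sum>i\<in>UNIV. \<Sum>j\<in>UNIV. (C $ a $ i * C $ c $ j) * (if i = j then 1 else 0))"
    by (intro has_bochner_integral_sum has_bochner_integral_mult_right std_PiM_second)
  also have "(\<Sum>i\<in>UNIV. \<Sum>j\<in>UNIV. (C $ a $ i * C $ c $ j) * (if i = j then 1 else 0)) = R $ a $ c"
    by (simp add: C(2) matrix_matrix_mult_def transpose_def if_distrib cong: if_cong)
  also have "(\<lambda>f. \<Sum>i\<in>UNIV. \<Sum>j\<in>UNIV. (C $ a $ i * C $ c $ j) * (f i * f j)) =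
    (\<lambda>f. (C *v (\<chi> i. f i)) $ a * (C *v (\<chi> i. f i)) $ c)"
    by (auto simp: matrix_vector_mult_def sum_product mult_ac intro!: ext sum.cong)
  finally show ?thesis by (intro mvn_has_integral_via_factor[OF C]) auto
qed

text \<open>
  Isserlis' formula, by writing \<open>z = C y\<close> with independent standard normal \<open>y\<close> and expanding.
\<close>

lemma mvn_fourth_moment:
  fixes R :: "real ^ 'q::finite ^ 'q"
  assumes R: "R \<in> pd_mats"
  shows "has_bochner_integral (mvn R) (\<lambda>z. z $ a * z $ c * z $ d * z $ e)
    (R $ a $ c * R $ d $ e + R $ a $ d * R $ c $ e + R $ a $ e * R $ c $ d)"
proof -
  obtain C :: "real ^ 'q ^ 'q" where C: "invertible C" "R = C ** transpose C" by (rule pd_factor[OF R])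
  have Rd: "R $ x $ y = (\<Sum>i\<in>UNIV. C $ x $ i * C $ y $ i)" for x y
    by (simp add: C(2) matrix_matrix_mult_def transpose_def)
  let ?c = "\<lambda>i j k l. C $ a $ i * C $ c $ j * C $ d $ k * C $ e $ l"
  let ?d = "\<lambda>i j k l. (if i = j \<and> k = l then 1 else 0) + (if i = k \<and> j = l then 1 else 0) + (if i = l \<and> j = k then 1 else (0::real))"
  have "has_bochner_integral std_PiM (\<lambda>f. \<Sum>i\<in>UNIV. \<Sum>j\<in>UNIV. \<Sum>k\<in>UNIV. \<Sum>l\<in>UNIV. ?c i j k l * (f i * f j * f k * f l))
     (\<Sum>i\<in>UNIV. \<Sum>j\<in>UNIV. \<Sum>k\<in>UNIV. \<Sum>l\<in>UNIV. ?c i j k l * ?d i j k l)"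
    by (intro has_bochner_integral_sum has_bochner_integral_mult_right std_PiM_fourth)
  also have "(\<Sum>i\<in>UNIV. \<Sum>j\<in>UNIV. \<Sum>k\<in>UNIV. \<Sum>l\<in>UNIV. ?c i j k l * ?d i j k l) =
      R $ a $ c * R $ d $ e + R $ a $ d * R $ c $ e + R $ a $ e * R $ c $ d"
  proof -
    have 1: "(\<Sum>l\<in>UNIV. if i = j \<and> k = l then ?c i j k l else 0) = (if i = j then ?c i j k k else 0)"
      "(\<Sum>l\<in>UNIV. if i = k \<and> j = l then ?c i j k l else 0) = (if i = k then ?c i j k j else 0)"
      "(\<Sum>l\<in>UNIV. if i = l \<and> j = k then ?c i j k l else 0) = (if j = k then ?c i j k i else 0)" for i j k
    proof -
      show "(\<Sum>l\<in>UNIV. if i = j \<and> k = l then ?c i j k l else 0) = (if i = j then ?c i j k k else 0)"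
        by (cases "i = j") simp_all
      show "(\<Sum>l\<in>UNIV. if i = k \<and> j = l then ?c i j k l else 0) = (if i = k then ?c i j k j else 0)"
        by (cases "i = k") simp_all
      show "(\<Sum>l\<in>UNIV. if i = l \<and> j = k then ?c i j k l else 0) = (if j = k then ?c i j k i else 0)"
        by (cases "j = k") simp_all
    qed
    have mi: "x * (if Q then 1 else 0) = (if Q then x else 0)" for x :: real and Q by simp
    have "(\<Sum>i\<in>UNIV. \<Sum>j\<in>UNIV. \<Sum>k\<in>UNIV. \<Sum>l\<in>UNIV. ?c i j k l * ?d i j k l) =
      (\<Sum>i\<in>UNIV. \<Sum>j\<in>UNIV. \<Sum>k\<in>UNIV. \<Sum>l\<in>UNIV. (if i = j \<and> k = l then ?c i j k l else 0) +
         (if i = k \<and> j = l then ?c i j k l else 0) + (if i = l \<and> j = k then ?c i j k l else 0))"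
      by (simp only: distrib_left mi)
    also have "\<dots> = (\<Sum>i\<in>UNIV. \<Sum>j\<in>UNIV. \<Sum>k\<in>UNIV. if i = j then ?c i j k k else 0) +
       (\<Sum>i\<in>UNIV. \<Sum>j\<in>UNIV. \<Sum>k\<in>UNIV. if i = k then ?c i j k j else 0) +
       (\<Sum>i\<in>UNIV. \<Sum>j\<in>UNIV. \<Sum>k\<in>UNIV. if j = k then ?c i j k i else 0)"
      by (simp only: sum.distrib 1)
    also have "(\<Sum>i\<in>UNIV. \<Sum>j\<in>UNIV. \<Sum>k\<in>UNIV. if i = j then ?c i j k k else 0) = (\<Sum>i\<in>UNIV. \<Sum>k\<in>UNIV. ?c i i k k)"
    proof (rule sum.cong[OF refl])
      fix i
      have "(\<Sum>j\<in>UNIV. \<Sum>k\<in>UNIV. if i = j then ?c i j k k else 0) = (\<Sum>j\<in>UNIV. if i = j then \<Sum>k\<in>UNIV. ?c i j k k else 0)"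
        by (intro sum.cong) auto
      then show "(\<Sum>j\<in>UNIV. \<Sum>k\<in>UNIV. if i = j then ?c i j k k else 0) = (\<Sum>k\<in>UNIV. ?c i i k k)" by simp
    qed
    also have "(\<Sum>i\<in>UNIV. \<Sum>j\<in>UNIV. \<Sum>k\<in>UNIV. if i = k then ?c i j k j else 0) = (\<Sum>i\<in>UNIV. \<Sum>j\<in>UNIV. ?c i j i j)"
      by simp
    also have "(\<Sum>i\<in>UNIV. \<Sum>j\<in>UNIV. \<Sum>k\<in>UNIV. if j = k then ?c i j k i else 0) = (\<Sum>i\<in>UNIV. \<Sum>j\<in>UNIV. ?c i j j i)"
      by simp
    finally show ?thesis
      unfolding Rd sum_product by (simp add: mult_ac)
  qed
  also have "(\<lambda>f. \<Sum>i\<in>UNIV. \<Sum>j\<in>UNIV. \<Sum>k\<in>UNIV. \<Sum>l\<in>UNIV. ?c i j k l * (f i * f j * f k * f l)) =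
    (\<lambda>f. (C *v (\<chi> i. f i)) $ a * (C *v (\<chi> i. f i)) $ c * (C *v (\<chi> i. f i)) $ d * (C *v (\<chi> i. f i)) $ e)"
  proof
    fix f :: "'q \<Rightarrow> real"
    let ?y = "\<lambda>x. \<Sum>i\<in>UNIV. C $ x $ i * f i"
    have four: "sum A UNIV * sum B UNIV * sum D UNIV * sum E UNIV =
        (\<Sum>i\<in>UNIV. \<Sum>j\<in>UNIV. \<Sum>k\<in>UNIV. \<Sum>l\<in>UNIV. A i * (B j * (D k * E l)))" for A B D E :: "'q \<Rightarrow> real"
      by (simp only: mult.assoc sum_distrib_left[symmetric] sum_distrib_right[symmetric])
    have "?y a * ?y c * ?y d * ?y e = (\<Sum>i\<in>UNIV. \<Sum>j\<in>UNIV. \<Sum>k\<in>UNIV. \<Sum>l\<in>UNIV.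
       (C $ a $ i * f i) * ((C $ c $ j * f j) * ((C $ d $ k * f k) * (C $ e $ l * f l))))"
      by (rule four)
    then show "(\<Sum>i\<in>UNIV. \<Sum>j\<in>UNIV. \<Sum>k\<in>UNIV. \<Sum>l\<in>UNIV. ?c i j k l * (f i * f j * f k * f l)) =
      (C *v (\<chi> i. f i)) $ a * (C *v (\<chi> i. f i)) $ c * (C *v (\<chi> i. f i)) $ d * (C *v (\<chi> i. f i)) $ e"
      by (simp add: matrix_vector_mult_def mult_ac)
  qed
  finally show ?thesis by (intro mvn_has_integral_via_factor[OF C]) auto
qed

section \<open>The integrand along a line of matrices\<close>

lemma density_ratio_eq:
  assumes "S \<in> pd_mats"
  shows "density_ratio b S x = gauss_pdf S x / gauss_pdf (block_diag b S) x"
proof -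
  have e: "exp (- (q - q0) / 2) = exp (- q / 2) / exp (- q0 / 2)" for q q0 :: real
    by (simp add: exp_diff[symmetric] diff_divide_distrib)
  show ?thesis
    unfolding density_ratio_def gauss_pdf_def prod_sqrt_block_det matrix_vector_mult_diff_rdistrib inner_diff_right e
    by simp
qed

lemma density_ratio_pos: "S \<in> pd_mats \<Longrightarrow> 0 < density_ratio b S x"
  by (simp add: density_ratio_eq gauss_pdf_pos block_diag_pd)

lemma dep_integrand_eq:
  "dep_integrand b \<Phi> S x = gauss_pdf (block_diag b S) x * \<Phi> (density_ratio b S x)"
  by (simp add: dep_integrand_def gauss_pdf_def prod_sqrt_block_det)

lemma gauss_pdf_ratio:
  assumes "S \<in> pd_mats"
  shows "gauss_pdf (block_diag b S) x * density_ratio b S x = gauss_pdf S x"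
  using gauss_pdf_pos[OF block_diag_pd[OF assms], of b x] by (simp add: density_ratio_eq[OF assms])

text \<open>
  A direction \<open>H\<close> can be diagonalised together with \<open>S\<close>, which makes the density of
  \<open>N(0, S + t H)\<close> an explicit function of \<open>t\<close> near \<open>0\<close>.
\<close>

lemma gauss_pdf_line:
  fixes S H :: "real ^ 'q::finite ^ 'q"
  assumes S: "S \<in> pd_mats" and H: "transpose H = H"
  defines "u \<equiv> \<lambda>x. matrix_inv S *v x"
  obtains \<delta> where "0 < \<delta>" "\<And>t. \<bar>t\<bar> < \<delta> \<Longrightarrow> S + t *\<^sub>R H \<in> pd_mats"
    "\<And>x. ((\<lambda>t. gauss_pdf (S + t *\<^sub>R H) x) has_real_derivative
        gauss_pdf S x * ((u x \<bullet> (H *v u x)) - trace (matrix_inv S ** H)) / 2) (at 0)"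
proof -
  obtain C :: "real ^ 'q ^ 'q" and d where C: "invertible C" "S = C ** transpose C" "H = C ** diag_mat d ** transpose C"
    by (rule simultaneous_diagonalization[OF S H])
  define m where "m = Max (range (\<lambda>i. \<bar>d i\<bar>)) + 1"
  have dm: "\<bar>d i\<bar> < m" for i
  proof -
    have "\<bar>d i\<bar> \<le> Max (range (\<lambda>i. \<bar>d i\<bar>))" by (rule Max_ge) auto
    then show ?thesis unfolding m_def by linarith
  qed
  have m: "0 < m" by (rule le_less_trans[OF abs_ge_zero dm[of undefined]])
  have pos: "0 < 1 + t * d i" if "\<bar>t\<bar> < 1 / m" for t i
  proof -
    have "\<bar>t * d i\<bar> \<le> \<bar>t\<bar> * m" unfolding abs_mult using dm[of i] by (intro mult_left_mono) auto
    also have "\<dots> < 1" using that m by (simp add: field_simps)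
    finally show ?thesis by linarith
  qed
  have SH: "S + t *\<^sub>R H = C ** diag_mat (\<lambda>i. 1 + t * d i) ** transpose C" for t
  proof -
    have "diag_mat (\<lambda>i. 1 + t * d i) = mat 1 + t *\<^sub>R diag_mat d"
      by (simp add: diag_mat_def mat_def vec_eq_iff)
    then have "C ** diag_mat (\<lambda>i. 1 + t * d i) ** transpose C = C ** (mat 1 + t *\<^sub>R diag_mat d) ** transpose C" by simp
    also have "\<dots> = C ** transpose C + t *\<^sub>R (C ** diag_mat d ** transpose C)"
      by (simp add: matrix_distribs)
    finally show ?thesis by (simp add: C(2,3))
  qed
  have pd: "S + t *\<^sub>R H \<in> pd_mats" if "\<bar>t\<bar> < 1 / m" for t
    unfolding SH pd_congruence_diag[OF C(1)] using pos[OF that] by blast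
  let ?c = "(2 * pi) powr (real CARD('q) / 2)"
  have der: "((\<lambda>t. gauss_pdf (S + t *\<^sub>R H) x) has_real_derivative
        gauss_pdf S x * ((u x \<bullet> (H *v u x)) - trace (matrix_inv S ** H)) / 2) (at 0)" for x
  proof -
    define y where "y = matrix_inv C *v x"
    have x: "x = C *v y" by (simp add: y_def transpose_matrix_inv_mult[OF C(1)])
    have detC: "det C \<noteq> 0" using C(1) by (simp add: invertible_det_nz)
    define f where "f t = exp (- (\<Sum>i\<in>UNIV. (y $ i)\<^sup>2 / (1 + t * d i) + ln (1 + t * d i)) / 2) / (?c * \<bar>det C\<bar>)" for t
    have split_exp: "exp (- a / 2) / (c * (\<bar>det C\<bar> * exp (l / 2))) = exp (- (a + l) / 2) / (c * \<bar>det C\<bar>)" for a l c :: real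
    proof -
      have "exp (- (a + l) / 2) = exp (- a / 2) / exp (l / 2)" by (simp add: exp_diff[symmetric] diff_divide_distrib)
      then show ?thesis by simp
    qed
    have eq: "gauss_pdf (S + t *\<^sub>R H) x = f t" if t: "\<bar>t\<bar> < 1 / m" for t
    proof -
      have nz: "1 + t * d i \<noteq> 0" for i using pos[OF t, of i] by simp
      have "sqrt (det (S + t *\<^sub>R H)) = \<bar>det C\<bar> * sqrt (\<Prod>i\<in>UNIV. 1 + t * d i)"
        unfolding SH det_congruence_diag[OF C(1)] by (simp add: real_sqrt_mult)
      also have "sqrt (\<Prod>i\<in>UNIV. 1 + t * d i) = exp ((\<Sum>i\<in>UNIV. ln (1 + t * d i)) / 2)"
      proof -
        have "(\<Prod>i\<in>UNIV. 1 + t * d i) = exp (\<Sum>i\<in>UNIV. ln (1 + t * d i))"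
          using pos[OF t] by (simp add: exp_sum)
        then show ?thesis by (simp add: powr_half_sqrt[symmetric] powr_def)
      qed
      finally have sd: "sqrt (det (S + t *\<^sub>R H)) = \<bar>det C\<bar> * exp ((\<Sum>i\<in>UNIV. ln (1 + t * d i)) / 2)" .
      have q: "x \<bullet> (matrix_inv (S + t *\<^sub>R H) *v x) = (\<Sum>i\<in>UNIV. (y $ i)\<^sup>2 / (1 + t * d i))"
        unfolding x SH by (rule inv_form_congruence_diag[OF C(1) nz])
      show ?thesis
        unfolding gauss_pdf_def sd q f_def sum.distrib by (rule split_exp)
    qed
    have fd: "(f has_real_derivative f 0 * ((\<Sum>i\<in>UNIV. d i * (y $ i)\<^sup>2) - (\<Sum>i\<in>UNIV. d i)) / 2) (at 0)"
    proof -
      have "((\<lambda>t. (y $ i)\<^sup>2 / (1 + t * d i) + ln (1 + t * d i)) has_real_derivative - (d i * (y $ i)\<^sup>2) + d i) (at 0)" for i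
        by (auto intro!: derivative_eq_intros)
      then have "((\<lambda>t. \<Sum>i\<in>UNIV. (y $ i)\<^sup>2 / (1 + t * d i) + ln (1 + t * d i)) has_real_derivative (\<Sum>i\<in>UNIV. - (d i * (y $ i)\<^sup>2) + d i)) (at 0)"
        by (intro DERIV_sum)
      from DERIV_cdivide[OF DERIV_fun_exp[OF DERIV_cdivide[OF DERIV_minus[OF this], of 2]], of "?c * \<bar>det C\<bar>"]
      show ?thesis
        unfolding f_def[abs_def] by (rule DERIV_cong) (simp add: sum_subtractf right_diff_distrib diff_divide_distrib mult_ac)
    qed
    have "((\<lambda>t. gauss_pdf (S + t *\<^sub>R H) x) has_real_derivative
      gauss_pdf S x * ((\<Sum>i\<in>UNIV. d i * (y $ i)\<^sup>2) - (\<Sum>i\<in>UNIV. d i)) / 2) (at 0)"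
    proof -
      have f0: "f 0 = gauss_pdf S x" using eq[of 0] m by simp
      show ?thesis
        using fd unfolding f0
      proof (rule has_field_derivative_transform_within[where d="1 / m"])
        fix t :: real assume "dist t 0 < 1 / m"
        then show "f t = gauss_pdf (S + t *\<^sub>R H) x" using eq[of t] by simp
      qed (use m in auto)
    qed
    moreover have "u x \<bullet> (H *v u x) = (\<Sum>i\<in>UNIV. d i * (y $ i)\<^sup>2)"
    proof -
      have i: "matrix_inv S = transpose (matrix_inv C) ** matrix_inv C"
        using matrix_inv_congruence_diag[OF C(1), of "\<lambda>_. 1"] by (simp add: diag_mat_one C(2))
      have ux: "transpose C *v u x = y"
      proof -
        have "transpose C ** transpose (matrix_inv C) = transpose (matrix_inv C ** C)" by (simp add: matrix_transpose_mul)
        then have "transpose C ** transpose (matrix_inv C) = mat 1" by (simp add: matrix_inv_mult[OF C(1)] transpose_mat)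
        then show ?thesis by (simp add: u_def i y_def matrix_vector_mul_assoc matrix_mul_assoc)
      qed
      have "u x \<bullet> (H *v u x) = u x \<bullet> (C *v (diag_mat d *v (transpose C *v u x)))"
        by (simp only: C(3) matrix_vector_mul_assoc matrix_mul_assoc)
      also have "\<dots> = y \<bullet> (diag_mat d *v y)" unfolding inner_mult_transpose[of "u x" C] ux ..
      finally show ?thesis by (simp add: inner_diag_mat)
    qed
    moreover have "trace (matrix_inv S ** H) = (\<Sum>i\<in>UNIV. d i)"
    proof -
      have i: "matrix_inv S = transpose (matrix_inv C) ** matrix_inv C"
        using matrix_inv_congruence_diag[OF C(1), of "\<lambda>_. 1"] by (simp add: diag_mat_one C(2))
      have "transpose C ** transpose (matrix_inv C) = transpose (matrix_inv C ** C)" by (simp add: matrix_transpose_mul)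
      then have t: "transpose C ** transpose (matrix_inv C) = mat 1" by (simp add: matrix_inv_mult[OF C(1)] transpose_mat)
      have "matrix_inv S ** H = transpose (matrix_inv C) ** ((matrix_inv C ** C) ** (diag_mat d ** transpose C))"
        by (simp add: i C(3) matrix_mul_assoc)
      also have "\<dots> = transpose (matrix_inv C) ** (diag_mat d ** transpose C)" by (simp add: matrix_inv_mult[OF C(1)])
      finally have "trace (matrix_inv S ** H) = trace (transpose (matrix_inv C) ** (diag_mat d ** transpose C))" by simp
      also have "\<dots> = trace ((diag_mat d ** transpose C) ** transpose (matrix_inv C))" by (rule trace_mul_sym)
      also have "(diag_mat d ** transpose C) ** transpose (matrix_inv C) = diag_mat d"
        by (simp add: matrix_mul_assoc[symmetric] t)
      finally show ?thesis by (simp add: trace_def diag_mat_def)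
    qed
    ultimately show ?thesis by simp
  qed
  show ?thesis by (rule that[of "1 / m"]) (use m pd der in auto)
qed

text \<open>
  A derivative within \<^const>\<open>cov_mats\<close> gives directional derivatives, because the line stays in the
  open cone of positive definite matrices for small \<open>t\<close>.
\<close>

lemma derivative_along_line:
  fixes F :: "real ^ 'q::finite ^ 'q \<Rightarrow> real"
  assumes S: "S \<in> pd_mats" and H: "transpose H = H" and F: "(F has_derivative F') (at S within cov_mats)"
  shows "((\<lambda>t. F (S + t *\<^sub>R H)) has_real_derivative F' H) (at 0)"
proof -
  obtain \<delta> where d: "0 < \<delta>" "\<And>t. \<bar>t\<bar> < \<delta> \<Longrightarrow> S + t *\<^sub>R H \<in> pd_mats"
    by (rule gauss_pdf_line[OF S H], rule that)
  interpret F': bounded_linear F' using F by (rule has_derivative_bounded_linear)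
  have l: "((\<lambda>t. S + t *\<^sub>R H) has_derivative (\<lambda>t. t *\<^sub>R H)) (at 0 within {-\<delta><..<\<delta>})"
    by (auto intro!: derivative_eq_intros)
  have "(\<lambda>t. S + t *\<^sub>R H) ` {-\<delta><..<\<delta>} \<subseteq> cov_mats"
    using d(2) by (auto simp: pd_mats_def)
  then have "(F has_derivative F') (at (S + 0 *\<^sub>R H) within (\<lambda>t. S + t *\<^sub>R H) ` {-\<delta><..<\<delta>})"
    using F by (simp add: has_derivative_subset)
  from has_derivative_in_compose[OF l this]
  have "((\<lambda>t. F (S + t *\<^sub>R H)) has_derivative (\<lambda>t. F' (t *\<^sub>R H))) (at 0 within {-\<delta><..<\<delta>})" .
  moreover have "at 0 within {-\<delta><..<\<delta>} = at (0::real)" using d(1) by (intro at_within_open) auto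
  moreover have "(\<lambda>t. F' (t *\<^sub>R H)) = (*) (F' H)" by (simp add: F'.scaleR fun_eq_iff)
  ultimately show ?thesis by (simp add: has_field_derivative_def)
qed

text \<open>
  If \<open>\<kappa>\<close> crosses \<open>\<kappa> 0\<close> with nonzero speed, differentiability of \<open>\<Phi> \<circ> \<kappa>\<close> is inherited by \<open>\<Phi>\<close>: every value
  close to \<open>\<kappa> 0\<close> is taken by \<open>\<kappa>\<close> at a proportionally close time.
\<close>

lemma DERIV_of_compose:
  fixes \<kappa> \<Phi> :: "real \<Rightarrow> real"
  assumes k: "(\<kappa> has_real_derivative d) (at 0)" and d: "d \<noteq> 0" and \<delta>: "0 < \<delta>"
    and cont: "\<And>t. \<bar>t\<bar> < \<delta> \<Longrightarrow> isCont \<kappa> t"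
    and p: "((\<lambda>t. \<Phi> (\<kappa> t)) has_real_derivative e) (at 0)"
  shows "(\<Phi> has_real_derivative e / d) (at (\<kappa> 0))"
proof -
  have key: "(\<Phi> has_real_derivative e / d) (at (\<kappa> 0))"
    if k: "(\<kappa> has_real_derivative d) (at 0)" and d: "0 < d"
      and cont: "\<And>t. \<bar>t\<bar> < \<delta> \<Longrightarrow> isCont \<kappa> t" and p: "((\<lambda>t. \<Phi> (\<kappa> t)) has_real_derivative e) (at 0)" for \<kappa> d e
    unfolding has_field_derivative_def has_derivative_at_alt
  proof (intro conjI allI impI)
    show "bounded_linear ((*) (e / d))" by (rule bounded_linear_mult_right)
    fix \<epsilon> :: real assume eps: "0 < \<epsilon>"
    define K where "K = (1 + \<bar>e / d\<bar>) * (2 / d)"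
    have K: "0 < K" using d by (simp add: K_def add_pos_nonneg)
    \<comment> \<open>errors of slope at most \<open>d / 2\<close> keep the speed of \<open>\<kappa>\<close> above \<open>d / 2\<close>\<close>
    define \<eta> where "\<eta> = min (d / 2) (\<epsilon> / K)"
    have eta: "0 < \<eta>" using d eps K by (simp add: \<eta>_def)
    obtain r1 where r1: "0 < r1" "\<And>t. \<bar>t\<bar> < r1 \<Longrightarrow> \<bar>\<kappa> t - \<kappa> 0 - d * t\<bar> \<le> \<eta> * \<bar>t\<bar>"
      using k eta unfolding has_field_derivative_def has_derivative_at_alt by auto
    obtain r2 where r2: "0 < r2" "\<And>t. \<bar>t\<bar> < r2 \<Longrightarrow> \<bar>\<Phi> (\<kappa> t) - \<Phi> (\<kappa> 0) - e * t\<bar> \<le> \<eta> * \<bar>t\<bar>"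
      using p eta unfolding has_field_derivative_def has_derivative_at_alt by auto
    define r where "r = min \<delta> (min r1 r2)"
    have r: "0 < r" "r \<le> \<delta>" "r \<le> r1" "r \<le> r2" using \<delta> r1 r2 by (auto simp: r_def)
    show "\<exists>\<rho>>0. \<forall>y. norm (y - \<kappa> 0) < \<rho> \<longrightarrow> norm (\<Phi> y - \<Phi> (\<kappa> 0) - e / d * (y - \<kappa> 0)) \<le> \<epsilon> * norm (y - \<kappa> 0)"
    proof (intro exI[of _ "d / 2 * r"] conjI allI impI)
      show "0 < d / 2 * r" using d r by simp
      fix y assume y: "norm (y - \<kappa> 0) < d / 2 * r"
      define h where "h = \<bar>y - \<kappa> 0\<bar> / (d / 2)"
      have h: "0 \<le> h" "h < r" "d / 2 * h = \<bar>y - \<kappa> 0\<bar>" using y d by (auto simp: h_def field_simps)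
      have etad: "\<eta> \<le> d / 2" unfolding \<eta>_def by (rule min.cobounded1)
      have "\<eta> * h \<le> d / 2 * h" using etad h(1) by (rule mult_right_mono)
      then have "\<bar>\<kappa> h - \<kappa> 0 - d * h\<bar> \<le> d / 2 * h" "\<bar>\<kappa> (- h) - \<kappa> 0 + d * h\<bar> \<le> d / 2 * h"
        using r1(2)[of h] r1(2)[of "- h"] h r by auto
      then have "\<kappa> (- h) \<le> y" "y \<le> \<kappa> h" using h(3) by (auto simp: abs_le_iff)
      moreover have "\<forall>t. - h \<le> t \<and> t \<le> h \<longrightarrow> isCont \<kappa> t" using cont h r by auto
      ultimately obtain t where t: "- h \<le> t" "t \<le> h" "\<kappa> t = y"
        using IVT[of \<kappa> "- h" y h] h(1) by auto
      have th: "\<bar>t\<bar> \<le> h" using t by auto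
      have "\<Phi> y - \<Phi> (\<kappa> 0) - e / d * (y - \<kappa> 0) = (\<Phi> (\<kappa> t) - \<Phi> (\<kappa> 0) - e * t) - e / d * (\<kappa> t - \<kappa> 0 - d * t)"
        using d by (simp add: t(3) right_diff_distrib)
      then have "\<bar>\<Phi> y - \<Phi> (\<kappa> 0) - e / d * (y - \<kappa> 0)\<bar> \<le> \<bar>\<Phi> (\<kappa> t) - \<Phi> (\<kappa> 0) - e * t\<bar> + \<bar>e / d\<bar> * \<bar>\<kappa> t - \<kappa> 0 - d * t\<bar>"
        by (simp only: abs_mult[symmetric]) (rule abs_triangle_ineq4)
      also have "\<dots> \<le> \<eta> * \<bar>t\<bar> + \<bar>e / d\<bar> * (\<eta> * \<bar>t\<bar>)"
        using r1(2)[of t] r2(2)[of t] th h r by (intro add_mono mult_left_mono) auto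
      also have "\<dots> = \<eta> * (1 + \<bar>e / d\<bar>) * \<bar>t\<bar>" by (simp add: algebra_simps)
      also have "\<dots> \<le> \<eta> * (1 + \<bar>e / d\<bar>) * h" using eta th by (intro mult_left_mono) auto
      also have "\<dots> = \<eta> * K * \<bar>y - \<kappa> 0\<bar>" using d by (simp add: h_def K_def)
      also have "\<dots> \<le> \<epsilon> * \<bar>y - \<kappa> 0\<bar>"
        using K by (intro mult_right_mono) (auto simp: \<eta>_def min_def field_simps)
      finally show "norm (\<Phi> y - \<Phi> (\<kappa> 0) - e / d * (y - \<kappa> 0)) \<le> \<epsilon> * norm (y - \<kappa> 0)" by simp
    qed
  qed
  show ?thesis
  proof (cases "0 < d")
    case True
    then show ?thesis using key[OF k True cont p] by blast
  next
    case False
    have k': "((\<lambda>t. \<kappa> (- t)) has_real_derivative - d) (at 0)"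
      using k DERIV_mirror[of \<kappa> d 0] by simp
    have p': "((\<lambda>t. \<Phi> (\<kappa> (- t))) has_real_derivative - e) (at 0)"
      using p DERIV_mirror[of "\<lambda>t. \<Phi> (\<kappa> t)" e 0] by simp
    have cont': "isCont (\<lambda>t. \<kappa> (- t)) t" if "\<bar>t\<bar> < \<delta>" for t
      using continuous_at_compose[of t uminus \<kappa>] cont[of "- t"] that by (simp add: comp_def)
    show ?thesis using key[OF k' _ cont' p'] False d by simp
  qed
qed

section \<open>Convex functions on the positive half-line\<close>

text \<open>
  A supporting line at \<open>1\<close> turns a convex function into a valley with bottom \<open>1\<close>.
\<close>

lemma convex_on_valley:
  fixes f :: "real \<Rightarrow> real"
  assumes f: "convex_on {0<..} f" and f1: "f 1 = 0"
  obtains s where "\<And>t. 0 < t \<Longrightarrow> 0 \<le> f t - s * (t - 1)"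
    "\<And>t u. 1 \<le> t \<Longrightarrow> t \<le> u \<Longrightarrow> f t - s * (t - 1) \<le> f u - s * (u - 1)"
    "\<And>t u. 0 < u \<Longrightarrow> u \<le> t \<Longrightarrow> t \<le> 1 \<Longrightarrow> f t - s * (t - 1) \<le> f u - s * (u - 1)"
proof -
  obtain s where s: "\<And>t. 0 < t \<Longrightarrow> s * (t - 1) \<le> f t"
  proof -
    have "1 \<in> interior {0::real<..}" by (simp add: interior_open)
    from convex_le_Inf_differential[OF f this] show ?thesis using that f1 by force
  qed
  define v where "v t = f t - s * (t - 1)" for t
  have v0: "0 \<le> v t" if "0 < t" for t using s[OF that] by (simp add: v_def)
  have v1: "v 1 = 0" by (simp add: v_def f1)
  have mix: "v t \<le> v u" if u: "0 < u" and a: "0 \<le> a" "a \<le> 1" and tu: "t - 1 = a * (u - 1)" for t u a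
  proof -
    have t: "t = (1 - a) * 1 + a * u" using tu by (simp add: algebra_simps)
    have "f t \<le> (1 - a) * f 1 + a * f u"
      using convex_onD[OF f a, of 1 u] u unfolding t by simp
    then have "v t \<le> a * v u" unfolding v_def t by (simp add: f1 algebra_simps)
    also have "\<dots> \<le> 1 * v u" using a v0[OF u] by (intro mult_right_mono) auto
    finally show ?thesis by simp
  qed
  show ?thesis
  proof (rule that[of s])
    show "0 \<le> f t - s * (t - 1)" if "0 < t" for t using v0[OF that] by (simp add: v_def)
    show "f t - s * (t - 1) \<le> f u - s * (u - 1)" if "1 \<le> t" "t \<le> u" for t u
    proof (cases "u = 1")
      case False
      then have "1 < u" using that by simp
      then have "v t \<le> v u"
        using that by (intro mix[of u "(t - 1) / (u - 1)"]) (auto simp: divide_le_eq) 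
      then show ?thesis by (simp add: v_def)
    qed (use that in auto)
    show "f t - s * (t - 1) \<le> f u - s * (u - 1)" if "0 < u" "u \<le> t" "t \<le> 1" for t u
    proof (cases "u = 1")
      case False
      then have "u < 1" using that by simp
      then have "v t \<le> v u"
        using that by (intro mix[of u "(t - 1) / (u - 1)"]) (auto simp: neg_divide_le_eq divide_nonpos_neg)
      then show ?thesis by (simp add: v_def)
    qed (use that in auto)
  qed
qed

text \<open>
  A contraction of the logarithmic scale moves large arguments down and small ones up, that is,
  towards the bottom of the valley, except in a bounded range.
\<close>

lemma valley_powr:
  fixes v :: "real \<Rightarrow> real" and B p :: real
  assumes v0: "\<And>t. 0 < t \<Longrightarrow> 0 \<le> v t"
    and up: "\<And>t u. 1 \<le> t \<Longrightarrow> t \<le> u \<Longrightarrow> v t \<le> v u"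
    and down: "\<And>t u. 0 < u \<Longrightarrow> u \<le> t \<Longrightarrow> t \<le> 1 \<Longrightarrow> v t \<le> v u"
    and B: "0 < B" and p: "0 < p" "p < 1"
  obtains C where "0 \<le> C" "\<And>t. 0 < t \<Longrightarrow> v (B * t powr p) \<le> v t + C"
proof -
  \<comment> \<open>the fixed point of \<open>t \<mapsto> B t\<^sup>p\<close>\<close>
  define T where "T = B powr (1 / (1 - p))"
  have T: "0 < T" using B by (simp add: T_def)
  have BT: "B * T powr p = T"
  proof -
    have "B * T powr p = B powr (1 + 1 / (1 - p) * p)"
      using B by (simp add: T_def powr_powr powr_add)
    also have "1 + 1 / (1 - p) * p = 1 / (1 - p)" using p by (simp add: field_simps)
    finally show ?thesis by (simp add: T_def)
  qed
  have hi: "B * t powr p \<le> t \<longleftrightarrow> T \<le> t" if t: "0 < t" for t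
  proof -
    have "t powr p * t powr (1 - p) = t" using t by (simp add: powr_add[symmetric])
    then have "B * t powr p \<le> t \<longleftrightarrow> B * t powr p \<le> t powr (1 - p) * t powr p" by (simp add: mult.commute)
    also have "\<dots> \<longleftrightarrow> B \<le> t powr (1 - p)" using t by simp
    also have "\<dots> \<longleftrightarrow> T powr (1 - p) \<le> t powr (1 - p)" using B p by (simp add: T_def powr_powr)
    also have "T powr (1 - p) \<le> t powr (1 - p) \<longleftrightarrow> T \<le> t"
      using T t p by (meson diff_gt_0_iff_gt less_imp_le not_le powr_less_mono2 powr_mono2)
    finally show ?thesis .
  qed
  show ?thesis
  proof (rule that[of "v T"])
    show "0 \<le> v T" using v0 T by blast
    fix t :: real assume t: "0 < t"
    define y where "y = B * t powr p"
    have y: "0 < y" using B t by (simp add: y_def)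
    have yT: "T \<le> y" if "T \<le> t"
    proof -
      have "B * T powr p \<le> B * t powr p" using that T B p by (intro mult_left_mono powr_mono2) auto
      then show ?thesis by (simp add: BT y_def)
    qed
    have Ty: "y \<le> T" if "t \<le> T"
    proof -
      have "B * t powr p \<le> B * T powr p" using that t B p by (intro mult_left_mono powr_mono2) auto
      then show ?thesis by (simp add: BT y_def)
    qed
    have nn: "0 \<le> v T" "0 \<le> v t" using v0 T t by auto
    have "v y \<le> v t \<or> v y \<le> v T"
    proof (cases "T \<le> t")
      case True
      then have yt: "y \<le> t" using hi[OF t] by (simp add: y_def)
      show ?thesis
      proof (cases "1 \<le> y")
        case True then show ?thesis using up[of y t] yt by blast
      next
        case False
        then show ?thesis using down[of T y] T yT[OF \<open>T \<le> t\<close>] by simp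
      qed
    next
      case False
      then have yt: "t \<le> y" using hi[OF t] by (simp add: y_def)
      show ?thesis
      proof (cases "1 \<le> y")
        case True then show ?thesis using up[of y T] Ty False by simp
      next
        case F: False then show ?thesis using down[of t y] yt t by simp
      qed
    qed
    then show "v (B * t powr p) \<le> v t + v T" using nn unfolding y_def by linarith
  qed
qed

text \<open>
  A tangent lies below the graph; comparing at \<open>3 t / 2\<close> and \<open>t / 2\<close> bounds the slope from both sides.
  The derivative is thus integrable as soon as dilated copies of the function are.
\<close>

lemma convex_deriv_bound:
  fixes f :: "real \<Rightarrow> real"
  assumes f: "convex_on {0<..} f" and t: "0 < t" and d: "(f has_real_derivative D) (at t)"
  shows "\<bar>t * D\<bar> \<le> 2 * (\<bar>f (3 / 2 * t)\<bar> + \<bar>f (1 / 2 * t)\<bar> + \<bar>f t\<bar>)"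
proof -
  have tan: "D * (y - t) \<le> f y - f t" if "0 < y" for y
    using convex_on_imp_above_tangent[OF f, of t y D] t d that by (auto simp: interior_open has_field_derivative_at_within)
  have 1: "D * t / 2 \<le> f (3 / 2 * t) - f t" using tan[of "3 / 2 * t"] t by (simp add: field_simps)
  have 2: "- (D * t / 2) \<le> f (1 / 2 * t) - f t" using tan[of "1 / 2 * t"] t by (simp add: field_simps)
  have lin: "x \<le> 2 * (p + q + r) \<and> - x \<le> 2 * (p + q + r)"
    if "x / 2 \<le> a - c" "- (x / 2) \<le> b - c" "a \<le> p" "b \<le> q" "- c \<le> r" "0 \<le> p" "0 \<le> q" for x a b c p q r :: real
    using that by simp
  have "\<bar>x\<bar> \<le> 2 * (\<bar>a\<bar> + \<bar>b\<bar> + \<bar>c\<bar>)" if "x / 2 \<le> a - c" "- (x / 2) \<le> b - c" for x a b c :: real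
    using lin[OF that abs_ge_self abs_ge_self abs_ge_minus_self abs_ge_zero abs_ge_zero] by (intro abs_leI) blast+
  from this[OF 1 2] show ?thesis by (simp add: mult.commute)
qed

text \<open>
  A symmetric second difference with step \<open>t / (m + 2)\<close>; the shift by \<open>2\<close> keeps \<open>t - t / (m + 2)\<close> positive.
\<close>

definition second_diff :: "(real \<Rightarrow> real) \<Rightarrow> nat \<Rightarrow> real \<Rightarrow> real" where
  "second_diff f m t = real (m + 2) * (f (t + t / real (m + 2)) + f (t - t / real (m + 2)) - 2 * f t)"

lemma inverse_nat_limit: "(\<lambda>m. t / real (m + 2)) \<longlonglongrightarrow> 0"
  by real_asymp

text \<open>
  One-sided difference quotients of a convex function are monotone in the step, hence enclose both
  one-sided derivatives; differentiability therefore reads as a countable condition, which makes the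
  set of kinks a Borel set.
\<close>

lemma convex_differentiable_iff:
  fixes f :: "real \<Rightarrow> real"
  assumes f: "convex_on {0<..} f" and t: "0 < t"
  shows "(\<exists>D. (f has_real_derivative D) (at t)) \<longleftrightarrow> (\<forall>n. \<exists>m. second_diff f m t < 1 / real (Suc n))"
proof
  assume "\<exists>D. (f has_real_derivative D) (at t)"
  then obtain D where D: "(f has_real_derivative D) (at t)" by blast
  have l: "filterlim (\<lambda>m. t / real (m + 2)) (at 0) sequentially"
    using t by (intro filterlim_atI inverse_nat_limit) auto
  have l': "filterlim (\<lambda>m. - (t / real (m + 2))) (at 0) sequentially"
    using t tendsto_minus[OF inverse_nat_limit[of t]] by (intro filterlim_atI) auto
  have q: "((\<lambda>h. (f (t + h) - f t) / h) \<longlongrightarrow> D) (at 0)" using D by (simp add: DERIV_def)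
  have "(\<lambda>m. t * ((f (t + t / real (m + 2)) - f t) / (t / real (m + 2)) -
      (f (t + - (t / real (m + 2))) - f t) / (- (t / real (m + 2))))) \<longlonglongrightarrow> t * (D - D)"
    by (intro tendsto_intros filterlim_compose[OF q l] filterlim_compose[OF q l'])
  moreover have "t * ((f (t + t / real (m + 2)) - f t) / (t / real (m + 2)) -
      (f (t + - (t / real (m + 2))) - f t) / (- (t / real (m + 2)))) = second_diff f m t" for m
  proof -
    have "t * ((A - c) / (t / r) - (B - c) / (- (t / r))) = r * (A + B - 2 * c)" if "0 < r" for A B c r :: real
      using t that by (simp add: field_simps)
    then show ?thesis by (simp add: second_diff_def)
  qed
  ultimately have "(\<lambda>m. second_diff f m t) \<longlonglongrightarrow> 0" by simp
  then have "eventually (\<lambda>m. second_diff f m t < 1 / real (Suc n)) sequentially" for n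
    by (rule order_tendstoD(2)) simp
  then show "\<forall>n. \<exists>m. second_diff f m t < 1 / real (Suc n)"
    by (meson eventually_sequentially le_refl)
next
  assume small: "\<forall>n. \<exists>m. second_diff f m t < 1 / real (Suc n)"
  define sp where "sp h = (f (t + h) - f t) / h" for h
  have mono: "sp h \<le> sp h'" if h: "h \<noteq> 0" "h' \<noteq> 0" "- t < h" "h < h'" for h h'
  proof -
    have sp_eq: "(f t - f (t + h)) / (t - (t + h)) = sp h" if "h \<noteq> 0" for h
      using that by (simp add: sp_def field_simps)
    consider "0 < h" | "h < 0" "h' < 0" | "h < 0" "0 < h'" using h by linarith
    then show ?thesis
    proof cases
      case 1
      then have "(f t - f (t + h)) / (t - (t + h)) \<le> (f t - f (t + h')) / (t - (t + h'))"
        using t h by (intro convex_on_slope_le(1)[OF f]) auto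
      then show ?thesis unfolding sp_eq[OF h(1)] sp_eq[OF h(2)] .
    next
      case 2
      then show ?thesis using convex_on_slope_le(2)[OF f, of "t + h" t "t + h'"] t h by (simp add: sp_def)
    next
      case 3
      have "(f (t + h) - f t) / (t + h - t) \<le> (f (t + h) - f (t + h')) / (t + h - (t + h'))"
        using t h 3 by (intro convex_on_slope_le(1)[OF f]) auto
      also have "\<dots> \<le> (f t - f (t + h')) / (t - (t + h'))"
        using t h 3 by (intro convex_on_slope_le(2)[OF f]) auto
      finally show ?thesis unfolding sp_eq[OF h(2)] by (simp add: sp_def)
    qed
  qed
  define D where "D = Sup (sp ` {- t<..<0})"
  have bdd: "bdd_above (sp ` {- t<..<0})"
    using mono[of _ 1] t by (intro bdd_aboveI[of _ "sp 1"]) auto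
  have ne: "sp ` {- t<..<0} \<noteq> {}" using t by (auto intro!: exI[of _ "- t / 2"])
  have Dl: "sp h \<le> D" if "- t < h" "h < 0" for h
    unfolding D_def using bdd that by (intro cSup_upper) auto
  have Du: "D \<le> sp h" if "0 < h" for h
    unfolding D_def using ne that mono t by (intro cSup_least) auto
  have "((\<lambda>h. (f (t + h) - f t) / h) \<longlongrightarrow> D) (at 0)"
  proof (rule tendstoI)
    fix e :: real assume e: "0 < e"
    obtain n where n: "1 / real (Suc n) < e * t" using t e by (metis mult_pos_pos reals_Archimedean inverse_eq_divide)
    obtain m where m: "second_diff f m t < 1 / real (Suc n)" using small by blast
    define h0 where "h0 = t / real (m + 2)"
    have h0: "0 < h0" "h0 < t" using t by (auto simp: h0_def divide_less_eq)
    have "second_diff f m t = t * (sp h0 - sp (- h0))"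
    proof -
      have "t * ((A - c) / (t / r) - (B - c) / (- (t / r))) = r * (A + B - 2 * c)" if "0 < r" for A B c r :: real
        using t that by (simp add: field_simps)
      then show ?thesis by (simp add: second_diff_def sp_def h0_def)
    qed
    then have "t * (sp h0 - sp (- h0)) < e * t" using m n by simp
    then have gap: "sp h0 - sp (- h0) < e" using t by (simp add: mult.commute)
    show "eventually (\<lambda>h. dist ((f (t + h) - f t) / h) D < e) (at 0)"
      unfolding eventually_at
    proof (intro exI[of _ h0] conjI ballI impI)
      show "0 < h0" by fact
      fix h :: real assume h: "h \<noteq> 0 \<and> dist h 0 < h0"
      have "sp (- h0) \<le> sp h" "sp h \<le> sp h0" using mono[of "- h0" h] mono[of h h0] h h0 by (auto simp: dist_real_def)
      moreover have "sp (- h0) \<le> D" "D \<le> sp h0" using Dl[of "- h0"] Du[of h0] h0 by auto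
      ultimately show "dist ((f (t + h) - f t) / h) D < e" using gap by (auto simp: sp_def dist_real_def)
    qed
  qed
  then show "\<exists>D. (f has_real_derivative D) (at t)" by (auto simp: DERIV_def)
qed

lemma borel_measurable_comp_positive:
  fixes f :: "real \<Rightarrow> real"
  assumes c: "continuous_on {0<..} f" and [measurable]: "k \<in> borel_measurable M" and k: "\<And>x. 0 < k x"
  shows "(\<lambda>x. f (k x)) \<in> borel_measurable M"
proof -
  have [measurable]: "(\<lambda>t. indicator {0<..} t *\<^sub>R f t) \<in> borel_measurable borel"
    by (rule borel_measurable_continuous_on_indicator[OF _ c]) simp
  have "(\<lambda>x. f (k x)) = (\<lambda>x. indicator {0<..} (k x) *\<^sub>R f (k x))" using k by auto
  also have "\<dots> \<in> borel_measurable M"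
    by (rule measurable_compose[of k M borel "\<lambda>t. indicator {0<..} t *\<^sub>R f t"]) measurable
  finally show ?thesis .
qed

text \<open>
  The derivative is a Borel function on \<open>(0, \<infinity>)\<close>: where there is a derivative it is a limit of
  difference quotients, and at a kink \<^const>\<open>deriv\<close> takes one fixed value.
\<close>

lemma borel_measurable_deriv_comp:
  fixes f :: "real \<Rightarrow> real"
  assumes f: "convex_on {0<..} f" and c: "continuous_on {0<..} f"
    and k[measurable]: "k \<in> borel_measurable M" and pos: "\<And>x. 0 < k x"
  shows "(\<lambda>x. deriv f (k x)) \<in> borel_measurable M"
proof -
  define c0 where "c0 = (SOME D :: real. False)"
  have p: "0 < t + t / real (m + 2)" "0 < t - t / real (m + 2)" if "0 < t" for t :: real and m
    using that by (auto simp: divide_less_eq add_pos_pos)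
  have m1[measurable]: "(\<lambda>x. f (k x + k x / real (m + 2))) \<in> borel_measurable M" for m
    using p pos by (intro borel_measurable_comp_positive[OF c]) auto
  have m2[measurable]: "(\<lambda>x. f (k x - k x / real (m + 2))) \<in> borel_measurable M" for m
    using p pos by (intro borel_measurable_comp_positive[OF c]) auto
  have m3[measurable]: "(\<lambda>x. f (k x)) \<in> borel_measurable M"
    by (rule borel_measurable_comp_positive[OF c k pos])
  have [measurable]: "(\<lambda>x. second_diff f m (k x)) \<in> borel_measurable M" for m
    unfolding second_diff_def by measurable
  define q where "q m t = (f (t + t / real (m + 2)) - f t) / (t / real (m + 2))" for m t
  have [measurable]: "(\<lambda>x. q m (k x)) \<in> borel_measurable M" for m
    unfolding q_def by measurable
  have "deriv f t = (if \<forall>n. \<exists>m. second_diff f m t < 1 / real (Suc n) then lim (\<lambda>m. q m t) else c0)" if t: "0 < t" for t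
  proof (cases "\<exists>D. (f has_real_derivative D) (at t)")
    case True
    then obtain D where D: "(f has_real_derivative D) (at t)" by blast
    have l: "filterlim (\<lambda>m. t / real (m + 2)) (at 0) sequentially"
      using t by (intro filterlim_atI inverse_nat_limit) auto
    have q: "((\<lambda>h. (f (t + h) - f t) / h) \<longlongrightarrow> D) (at 0)" using D by (simp add: DERIV_def)
    have "(\<lambda>m. q m t) \<longlonglongrightarrow> D" unfolding q_def by (rule filterlim_compose[OF q l])
    then have "lim (\<lambda>m. q m t) = D" by (rule limI)
    then show ?thesis unfolding convex_differentiable_iff[OF f t, symmetric] using True DERIV_imp_deriv[OF D] by simp
  next
    case False
    then have "deriv f t = c0" by (simp add: deriv_def c0_def)
    then show ?thesis unfolding convex_differentiable_iff[OF f t, symmetric] using False by simp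
  qed
  then have "(\<lambda>x. deriv f (k x)) = (\<lambda>x. if \<forall>n. \<exists>m. second_diff f m (k x) < 1 / real (Suc n) then lim (\<lambda>m. q m (k x)) else c0)"
    using pos by auto
  also have "\<dots> \<in> borel_measurable M" by measurable
  finally show ?thesis .
qed

section \<open>Integrability with quadratic weight\<close>

lemma integrable_gauss_pdf:
  assumes S: "S \<in> pd_mats"
  shows "integrable lborel (gauss_pdf S)" "integrable lborel (\<lambda>x. gauss_pdf S x * (x $ a * x $ c))"
proof -
  interpret prob_space "mvn S" by (rule prob_space_mvn[OF S])
  have "integrable (mvn S) (\<lambda>x. 1 :: real)" by simp
  then show "integrable lborel (gauss_pdf S)"
    unfolding mvn_density by (subst (asm) integrable_density) (auto simp: gauss_pdf_pos[OF S] less_imp_le)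
  have "integrable (mvn S) (\<lambda>x. x $ a * x $ c)"
    using mvn_second_moment[OF S] by (simp add: has_bochner_integral_iff)
  then show "integrable lborel (\<lambda>x. gauss_pdf S x * (x $ a * x $ c))"
    unfolding mvn_density by (subst (asm) integrable_density) (auto simp: gauss_pdf_pos[OF S] less_imp_le)
qed

lemma integrable_gauss_pdf_norm:
  fixes S :: "real ^ 'q::finite ^ 'q"
  assumes S: "S \<in> pd_mats"
  shows "integrable lborel (\<lambda>x. gauss_pdf S x * (1 + (norm x)\<^sup>2))"
proof -
  have "(\<lambda>x. gauss_pdf S x * (1 + (norm x)\<^sup>2)) = (\<lambda>x. gauss_pdf S x + (\<Sum>a\<in>UNIV. gauss_pdf S x * (x $ a * x $ a)))"
    by (simp add: distrib_left power2_norm_eq_inner inner_vec_def sum_distrib_left fun_eq_iff)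
  then show ?thesis
    by (simp only:) (intro Bochner_Integration.integrable_add Bochner_Integration.integrable_sum integrable_gauss_pdf[OF S])
qed

lemma density_ratio_measurable [measurable]:
  assumes "S \<in> pd_mats" shows "density_ratio b S \<in> borel_measurable borel"
proof -
  have "density_ratio b S = (\<lambda>x. gauss_pdf S x / gauss_pdf (block_diag b S) x)"
    using density_ratio_eq[OF assms] by blast
  then show ?thesis by simp
qed

lemma gauss_pdf_congruence:
  fixes C :: "real ^ 'q::finite ^ 'q"
  assumes C: "invertible C" and d: "\<And>i. 0 < d i"
  shows "gauss_pdf (C ** diag_mat d ** transpose C) (C *v y) =
    exp (- (\<Sum>i\<in>UNIV. (y $ i)\<^sup>2 / d i) / 2) / ((2 * pi) powr (real CARD('q) / 2) * sqrt (det (C ** diag_mat d ** transpose C)))"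
  unfolding gauss_pdf_def by (subst inv_form_congruence_diag[OF C]) (use d in \<open>auto simp: less_imp_neq[THEN not_sym]\<close>)

text \<open>
  In coordinates that make \<open>R\<^sub>0\<close> the identity and \<open>R\<close> the diagonal matrix with entries \<open>d\<close>, the density
  ratio is the exponential of a diagonal form with weights \<open>1 - 1 / d\<^sub>i\<close>.
\<close>

lemma density_ratio_congruence:
  fixes C :: "real ^ 'q::finite ^ 'q"
  assumes C: "invertible C" and d: "\<And>i. 0 < d i"
    and S: "S = C ** diag_mat d ** transpose C" and S0: "block_diag b S = C ** transpose C"
  obtains K where "0 < K" "\<And>y. density_ratio b S (C *v y) = K * exp ((\<Sum>i\<in>UNIV. (1 - 1 / d i) * (y $ i)\<^sup>2) / 2)"
proof -
  have S0': "block_diag b S = C ** diag_mat (\<lambda>_. 1) ** transpose C" by (simp add: S0 diag_mat_one)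
  have pd: "S \<in> pd_mats" unfolding S using pd_congruence_diag[OF C] d by blast
  have pd0: "block_diag b S \<in> pd_mats" by (rule block_diag_pd[OF pd])
  define K where "K = sqrt (det (block_diag b S)) / sqrt (det S)"
  have "0 < K" using pd_matrix_inv(1)[OF pd] pd_matrix_inv(1)[OF pd0] by (simp add: K_def)
  moreover have "density_ratio b S (C *v y) = K * exp ((\<Sum>i\<in>UNIV. (1 - 1 / d i) * (y $ i)\<^sup>2) / 2)" for y
  proof -
    let ?c = "(2 * pi) powr (real CARD('q) / 2)"
    have 1: "gauss_pdf S (C *v y) = exp (- (\<Sum>i\<in>UNIV. (y $ i)\<^sup>2 / d i) / 2) / (?c * sqrt (det S))"
      unfolding S by (rule gauss_pdf_congruence[OF C d])
    have 2: "gauss_pdf (block_diag b S) (C *v y) = exp (- (\<Sum>i\<in>UNIV. (y $ i)\<^sup>2 / 1) / 2) / (?c * sqrt (det (block_diag b S)))"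
      unfolding S0' by (rule gauss_pdf_congruence[OF C]) simp
    have e: "exp (- a / 2) / (c * s) / (exp (- e / 2) / (c * r)) = r / s * exp ((e - a) / 2)" if "c \<noteq> 0" for a c s e r :: real
    proof -
      have "exp ((e - a) / 2) = exp (- a / 2) / exp (- e / 2)" by (simp add: exp_diff[symmetric] diff_divide_distrib)
      then show ?thesis using that by simp
    qed
    have "density_ratio b S (C *v y) = K * exp (((\<Sum>i\<in>UNIV. (y $ i)\<^sup>2 / 1) - (\<Sum>i\<in>UNIV. (y $ i)\<^sup>2 / d i)) / 2)"
      unfolding density_ratio_eq[OF pd] 1 2 K_def by (rule e) simp
    also have "(\<Sum>i\<in>UNIV. (y $ i)\<^sup>2 / 1) - (\<Sum>i\<in>UNIV. (y $ i)\<^sup>2 / d i) = (\<Sum>i\<in>UNIV. (1 - 1 / d i) * (y $ i)\<^sup>2)"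
      by (simp add: sum_subtractf[symmetric] left_diff_distrib)
    finally show ?thesis .
  qed
  ultimately show ?thesis by (rule that)
qed

lemma norm_square_coordinates: "(norm y)\<^sup>2 = (\<Sum>i\<in>UNIV. (y $ i)\<^sup>2)" for y :: "real ^ 'q::finite"
  unfolding power2_norm_eq_inner inner_vec_def by (simp add: power2_eq_square)

lemma exp_times_quadratic_bound:
  fixes u \<eta> m :: real
  assumes "0 < \<eta>" "0 \<le> u" "0 \<le> m"
  shows "exp (- (\<eta> * u) / 2) * (1 + m * u) \<le> 1 + 2 * m / \<eta>"
proof -
  let ?e = "exp (- (\<eta> * u) / 2)"
  have "?e * (\<eta> * u / 2) \<le> 1"
  proof -
    have "\<eta> * u / 2 \<le> exp (\<eta> * u / 2)" using exp_ge_add_one_self[of "\<eta> * u / 2"] by linarith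
    then have "?e * (\<eta> * u / 2) \<le> ?e * exp (\<eta> * u / 2)" by (intro mult_left_mono) auto
    also have "\<dots> = 1" by (simp add: exp_add[symmetric])
    finally show ?thesis .
  qed
  then have "2 * m / \<eta> * (?e * (\<eta> * u / 2)) \<le> 2 * m / \<eta> * 1" using assms by (intro mult_left_mono) auto
  then have 1: "?e * (m * u) \<le> 2 * m / \<eta>" using assms by (simp add: mult_ac)
  have 2: "?e \<le> 1" using assms by simp
  show ?thesis using add_mono[OF 2 1] by (simp only: distrib_left mult_1_right)
qed

text \<open>
  Moving \<open>R\<close> away from \<open>R\<^sub>0\<close> along the segment leaves \<open>R\<^sub>0\<close> unchanged and makes the density ratio more
  extreme.  A coordinatewise dilation turns the ratio at \<open>R\<close> into a power less than one of that at the
  new matrix, and the Gaussian weight gains a factor that absorbs quadratic growth; hence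
  integrability at the new matrix gives integrability with quadratic weight at \<open>R\<close>.
\<close>

lemma integrable_quadratic_weight:
  fixes R :: "real ^ 'q::finite ^ 'q" and b :: "'q \<Rightarrow> 'k::finite"
  assumes int: "\<And>S. S \<in> pd_mats \<Longrightarrow> integrable lborel (dep_integrand b \<Phi> S)"
    and R: "R \<in> pd_mats" and cvx: "convex_on {0<..} \<Phi>" and cont: "continuous_on {0<..} \<Phi>" and \<Phi>1: "\<Phi> 1 = 0"
    and c: "0 < c"
  shows "integrable lborel (\<lambda>x. gauss_pdf (block_diag b R) x * (1 + (norm x)\<^sup>2) * \<Phi> (c * density_ratio b R x))"
proof -
  let ?R0 = "block_diag b R"
  have R0: "?R0 \<in> pd_mats" by (rule block_diag_pd[OF R])
  have Rs: "transpose R = R" using R by (rule pd_matsD(1))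
  obtain C :: "real ^ 'q ^ 'q" and d where C: "invertible C" "?R0 = C ** transpose C" "R = C ** diag_mat d ** transpose C"
    by (rule simultaneous_diagonalization[OF R0 Rs])
  have d: "0 < d i" for i using R pd_congruence_diag[OF C(1), of d] unfolding C(3)[symmetric] by blast
  \<comment> \<open>small enough for \<open>\<mu>\<close>, the eigenvalues of the matrix beyond \<open>R\<close>, to remain positive\<close>
  define \<epsilon> where "\<epsilon> = Min (range d) / 2"
  have dm: "2 * \<epsilon> \<le> d i" for i by (simp add: \<epsilon>_def)
  have eps: "0 < \<epsilon>"
  proof -
    have "Min (range d) \<in> range d" by (rule Min_in) auto
    then show ?thesis using d by (auto simp: \<epsilon>_def)
  qed
  define \<mu> where "\<mu> i = d i + \<epsilon> * (d i - 1)" for i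
  have mu: "0 < \<mu> i" for i
  proof -
    have "0 < \<epsilon> + \<epsilon> * d i" using eps d[of i] by (simp add: add_pos_pos)
    then show ?thesis using dm[of i] by (simp add: \<mu>_def right_diff_distrib)
  qed
  \<comment> \<open>the factor by which the weight \<open>1 - 1 / d\<^sub>i\<close> grows in the step from \<open>d\<close> to \<open>\<mu>\<close>\<close>
  define \<rho> where "\<rho> i = 1 + \<epsilon> / \<mu> i" for i
  \<comment> \<open>half of the smallest gain (on the logarithmic scale) contracts the ratio, the other half is spent on the Gaussian weight\<close>
  define \<eta> where "\<eta> = sqrt (Min (range \<rho>)) - 1"
  have rm: "Min (range \<rho>) \<le> \<rho> i" for i by simp
  have r1: "1 < Min (range \<rho>)"
  proof -
    have "Min (range \<rho>) \<in> range \<rho>" by (rule Min_in) auto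
    then obtain i where "Min (range \<rho>) = \<rho> i" by blast
    then show ?thesis using eps mu[of i] by (simp add: \<rho>_def)
  qed
  have eta: "0 < \<eta>" "(1 + \<eta>)\<^sup>2 = Min (range \<rho>)" 
  proof -
    have "0 < sqrt m - 1" "(1 + (sqrt m - 1))\<^sup>2 = m" if "1 < m" for m :: real using that by auto
    from this[OF r1] show "0 < \<eta>" "(1 + \<eta>)\<^sup>2 = Min (range \<rho>)" unfolding \<eta>_def .
  qed
  \<comment> \<open>the dilation after which the ratio at \<open>R\<close> is a power \<open>1 / (1 + \<eta>)\<close> of the ratio at the new matrix, up to a constant\<close>
  define \<theta> where "\<theta> i = sqrt (\<rho> i / (1 + \<eta>))" for i
  have th2: "(\<theta> i)\<^sup>2 = \<rho> i / (1 + \<eta>)" "1 + \<eta> \<le> (\<theta> i)\<^sup>2" "0 < \<theta> i" for i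
  proof -
    have "(1 + \<eta>) * (1 + \<eta>) \<le> \<rho> i" using rm[of i] eta(2) by (simp add: power2_eq_square)
    then have "1 + \<eta> \<le> \<rho> i / (1 + \<eta>)" using eta(1) by (simp add: pos_le_divide_eq)
    moreover from this have "0 < \<rho> i / (1 + \<eta>)" using eta(1) by linarith
    ultimately show "(\<theta> i)\<^sup>2 = \<rho> i / (1 + \<eta>)" "1 + \<eta> \<le> (\<theta> i)\<^sup>2" "0 < \<theta> i" by (auto simp: \<theta>_def)
  qed
  define S where "S = C ** diag_mat \<mu> ** transpose C"
  have S: "S = R + \<epsilon> *\<^sub>R (R - ?R0)"
  proof -
    have dg: "diag_mat \<mu> = diag_mat d + \<epsilon> *\<^sub>R (diag_mat d - mat 1)"
      by (simp add: diag_mat_def mat_def \<mu>_def vec_eq_iff)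
    have "S = C ** diag_mat d ** transpose C + \<epsilon> *\<^sub>R (C ** diag_mat d ** transpose C - C ** transpose C)"
      unfolding S_def dg by (simp add: matrix_distribs)
    then show ?thesis unfolding C(2) C(3)[symmetric] .
  qed
  have Spd: "S \<in> pd_mats" unfolding S_def using pd_congruence_diag[OF C(1)] mu by blast
  have S0: "block_diag b S = ?R0" by (simp add: S block_diag_add block_diag_diff block_diag_scaleR)
  obtain KR where KR: "0 < KR" "\<And>y. density_ratio b R (C *v y) = KR * exp ((\<Sum>i\<in>UNIV. (1 - 1 / d i) * (y $ i)\<^sup>2) / 2)"
    by (rule density_ratio_congruence[OF C(1) d C(3,2)], rule that)
  obtain KS where KS: "0 < KS" "\<And>y. density_ratio b S (C *v y) = KS * exp ((\<Sum>i\<in>UNIV. (1 - 1 / \<mu> i) * (y $ i)\<^sup>2) / 2)"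
    by (rule density_ratio_congruence[OF C(1) mu S_def S0[unfolded C(2)]], rule that)
  define A where "A = C ** diag_mat \<theta>"
  have Az: "A *v z = C *v (diag_mat \<theta> *v z)" for z by (simp add: A_def matrix_vector_mul_assoc)
  have detA: "det A \<noteq> 0"
    using C(1) th2(3) by (simp add: A_def det_mul det_diag_mat invertible_det_nz less_imp_neq[THEN not_sym])
  define p where "p = 1 / (1 + \<eta>)"
  have p: "0 < p" "p < 1" using eta(1) by (auto simp: p_def)
  have ratio: "c * density_ratio b R (A *v z) = (c * KR / KS powr p) * density_ratio b S (C *v z) powr p" for z
  proof -
    have w: "(1 - 1 / d i) * (\<theta> i)\<^sup>2 = p * (1 - 1 / \<mu> i)" for i
    proof -
      have "(1 - 1 / d i) * \<rho> i = 1 - 1 / \<mu> i"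
      proof -
        have "\<rho> i = (d i + \<epsilon> * d i) / \<mu> i" using mu[of i] by (simp add: \<rho>_def field_simps) (simp add: \<mu>_def field_simps)
        then have "(1 - 1 / d i) * \<rho> i = (1 - 1 / d i) * (d i * (1 + \<epsilon>)) / \<mu> i" by (simp add: algebra_simps)
        also have "(1 - 1 / d i) * (d i * (1 + \<epsilon>)) = \<mu> i - 1" using d[of i] by (simp add: \<mu>_def field_simps)
        finally show ?thesis using mu[of i] by (simp add: diff_divide_distrib)
      qed
      then show ?thesis unfolding th2(1) p_def by simp
    qed
    have sm: "(\<Sum>i\<in>UNIV. (1 - 1 / d i) * ((diag_mat \<theta> *v z) $ i)\<^sup>2) = p * (\<Sum>i\<in>UNIV. (1 - 1 / \<mu> i) * (z $ i)\<^sup>2)"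
      unfolding sum_distrib_left
    proof (rule sum.cong[OF refl])
      fix i
      have "(1 - 1 / d i) * ((diag_mat \<theta> *v z) $ i)\<^sup>2 = ((1 - 1 / d i) * (\<theta> i)\<^sup>2) * (z $ i)\<^sup>2"
        by (simp add: diag_mat_vec power_mult_distrib)
      then show "(1 - 1 / d i) * ((diag_mat \<theta> *v z) $ i)\<^sup>2 = p * ((1 - 1 / \<mu> i) * (z $ i)\<^sup>2)"
        unfolding w by simp
    qed
    have "density_ratio b S (C *v z) powr p = KS powr p * exp (p * (\<Sum>i\<in>UNIV. (1 - 1 / \<mu> i) * (z $ i)\<^sup>2) / 2)"
      unfolding KS(2) using KS(1) by (simp add: powr_mult exp_powr_real mult.commute)
    then show ?thesis using KS(1) by (simp add: Az KR(2) sm)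
  qed
  obtain s where s: "\<And>t. 0 < t \<Longrightarrow> 0 \<le> \<Phi> t - s * (t - 1)"
    "\<And>t u. 1 \<le> t \<Longrightarrow> t \<le> u \<Longrightarrow> \<Phi> t - s * (t - 1) \<le> \<Phi> u - s * (u - 1)"
    "\<And>t u. 0 < u \<Longrightarrow> u \<le> t \<Longrightarrow> t \<le> 1 \<Longrightarrow> \<Phi> t - s * (t - 1) \<le> \<Phi> u - s * (u - 1)"
    by (rule convex_on_valley[OF cvx \<Phi>1], rule that)
  define v where "v t = \<Phi> t - s * (t - 1)" for t
  have B: "0 < c * KR / KS powr p" using c KR(1) KS(1) by simp
  obtain Cv where Cv: "0 \<le> Cv" "\<And>t. 0 < t \<Longrightarrow> v ((c * KR / KS powr p) * t powr p) \<le> v t + Cv"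
  proof (rule valley_powr[of v, OF _ _ _ B p])
    show "0 \<le> v t" if "0 < t" for t using s(1)[OF that] by (simp add: v_def)
    show "v t \<le> v u" if "1 \<le> t" "t \<le> u" for t u using s(2)[OF that] by (simp add: v_def)
    show "v t \<le> v u" if "0 < u" "u \<le> t" "t \<le> 1" for t u using s(3)[OF that] by (simp add: v_def)
  qed (rule that)
  obtain m where m: "0 \<le> m" "\<And>z. norm (A *v z) \<le> norm z * m"
    using bounded_linear.nonneg_bounded[OF matrix_vector_mul_bounded_linear[of A]] by auto
  let ?f = "gauss_pdf ?R0"
  let ?k = "\<lambda>x. c * density_ratio b R x"
  have fp: "0 < ?f x" for x by (rule gauss_pdf_pos[OF R0])
  have kp: "0 < ?k x" for x by (rule mult_pos_pos[OF c density_ratio_pos[OF R]])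
  have weight: "?f (A *v z) * (1 + (norm (A *v z))\<^sup>2) \<le> (1 + 2 * m\<^sup>2 / \<eta>) * ?f (C *v z)" for z
  proof -
    have R0': "?R0 = C ** diag_mat (\<lambda>_. 1) ** transpose C" by (simp add: C(2) diag_mat_one)
    let ?n = "(2 * pi) powr (real CARD('q) / 2) * sqrt (det ?R0)"
    have np: "0 < ?n" using pd_matrix_inv(1)[OF R0] by simp
    have fy: "?f (C *v y) = exp (- (norm y)\<^sup>2 / 2) / ?n" for y
    proof -
      have "?f (C *v y) = exp (- (\<Sum>i\<in>UNIV. (y $ i)\<^sup>2 / 1) / 2) / ?n"
        unfolding R0' by (rule gauss_pdf_congruence[OF C(1)]) simp
      then show ?thesis by (simp add: norm_square_coordinates)
    qed
    have "(1 + \<eta>) * (norm z)\<^sup>2 \<le> (norm (diag_mat \<theta> *v z))\<^sup>2"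
    proof -
      have "(1 + \<eta>) * (norm z)\<^sup>2 = (\<Sum>i\<in>UNIV. (1 + \<eta>) * (z $ i)\<^sup>2)"
        by (simp add: norm_square_coordinates sum_distrib_left)
      also have "\<dots> \<le> (\<Sum>i\<in>UNIV. (\<theta> i)\<^sup>2 * (z $ i)\<^sup>2)" by (intro sum_mono mult_right_mono th2(2)) simp
      also have "\<dots> = (norm (diag_mat \<theta> *v z))\<^sup>2"
        by (simp add: norm_square_coordinates diag_mat_vec power_mult_distrib)
      finally show ?thesis .
    qed
    then have "exp (- (norm (diag_mat \<theta> *v z))\<^sup>2 / 2) \<le> exp (- (norm z)\<^sup>2 / 2) * exp (- (\<eta> * (norm z)\<^sup>2) / 2)"
      by (simp add: exp_add[symmetric] distrib_right)
    then have "?f (A *v z) \<le> ?f (C *v z) * exp (- (\<eta> * (norm z)\<^sup>2) / 2)"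
      unfolding Az fy using np by (simp add: divide_right_mono)
    moreover have "1 + (norm (A *v z))\<^sup>2 \<le> 1 + m\<^sup>2 * (norm z)\<^sup>2"
      using power_mono[OF m(2)[of z], of 2] by (simp add: power_mult_distrib mult.commute)
    ultimately have "?f (A *v z) * (1 + (norm (A *v z))\<^sup>2) \<le> (?f (C *v z) * exp (- (\<eta> * (norm z)\<^sup>2) / 2)) * (1 + m\<^sup>2 * (norm z)\<^sup>2)"
      using fp[of "C *v z"] by (intro mult_mono) auto
    also have "\<dots> = ?f (C *v z) * (exp (- (\<eta> * (norm z)\<^sup>2) / 2) * (1 + m\<^sup>2 * (norm z)\<^sup>2))" by simp
    also have "\<dots> \<le> ?f (C *v z) * (1 + 2 * m\<^sup>2 / \<eta>)"
      using fp[of "C *v z"] by (intro mult_left_mono exp_times_quadratic_bound eta(1)) auto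
    finally show ?thesis by (simp add: mult.commute)
  qed
  note [measurable] = density_ratio_measurable[OF R, of b] density_ratio_measurable[OF Spd, of b]
  have k_meas: "?k \<in> borel_measurable borel" by measurable
  have \<Phi>k[measurable]: "(\<lambda>x. \<Phi> (?k x)) \<in> borel_measurable borel"
    by (rule borel_measurable_comp_positive[OF cont k_meas kp])
  have vk[measurable]: "(\<lambda>x. v (?k x)) \<in> borel_measurable borel" unfolding v_def by measurable
  have \<Phi>S[measurable]: "(\<lambda>x. \<Phi> (density_ratio b S x)) \<in> borel_measurable borel"
    by (rule borel_measurable_comp_positive[OF cont density_ratio_measurable[OF Spd] density_ratio_pos[OF Spd]])
  have vS[measurable]: "(\<lambda>x. v (density_ratio b S x)) \<in> borel_measurable borel" unfolding v_def by measurable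
  have vS0: "0 \<le> v (density_ratio b S x)" for x using s(1)[OF density_ratio_pos[OF Spd]] by (simp add: v_def)
  have vk0: "0 \<le> v (?k x)" for x using s(1)[OF kp] by (simp add: v_def)
  have iS: "integrable lborel (\<lambda>x. ?f x * (v (density_ratio b S x) + Cv))"
  proof -
    have 1: "integrable lborel (\<lambda>x. ?f x * \<Phi> (density_ratio b S x))"
      using int[OF Spd] unfolding dep_integrand_eq[abs_def] S0 .
    have 2: "?f x * density_ratio b S x = gauss_pdf S x" for x using gauss_pdf_ratio[OF Spd, of b x] by (simp add: S0)
    have "(\<lambda>x. ?f x * (v (density_ratio b S x) + Cv)) =
        (\<lambda>x. ?f x * \<Phi> (density_ratio b S x) - s * gauss_pdf S x + (s + Cv) * ?f x)"
      unfolding 2[symmetric] by (simp add: v_def algebra_simps fun_eq_iff)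
    then show ?thesis using 1 integrable_gauss_pdf(1)[OF Spd] integrable_gauss_pdf(1)[OF R0] by simp
  qed
  let ?Q = "\<lambda>x. ?f x * (1 + (norm x)\<^sup>2) * v (?k x)"
  have iQ: "integrable lborel ?Q"
  proof (rule integrableI_nonneg)
    show "?Q \<in> borel_measurable lborel" by measurable
    show "AE x in lborel. 0 \<le> ?Q x" using fp vk0 by (intro AE_I2 mult_nonneg_nonneg) (auto intro: less_imp_le)
    have lin: "linear ((*v) B)" for B :: "real ^ 'q ^ 'q" by (rule matrix_vector_mul_linear)
    let ?G = "\<lambda>x. ennreal (?f x * (v (density_ratio b S x) + Cv))"
    have G: "?G \<in> borel_measurable borel" by measurable
    have Gfin: "(\<integral>\<^sup>+z. ?G (C *v z) \<partial>lborel) < \<infinity>"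
    proof -
      have "(\<integral>\<^sup>+x. ?G x \<partial>lborel) < \<infinity>"
      proof (subst nn_integral_eq_integral[OF iS])
        show "AE x in lborel. 0 \<le> ?f x * (v (density_ratio b S x) + Cv)"
          by (intro AE_I2 mult_nonneg_nonneg add_nonneg_nonneg vS0 Cv(1) less_imp_le[OF fp])
      qed simp
      moreover have "(\<integral>\<^sup>+x. ?G x \<partial>lborel) = ennreal \<bar>det C\<bar> * (\<integral>\<^sup>+z. ?G (C *v z) \<partial>lborel)"
        using nn_integral_linear_map[OF lin[of C] _ G] C(1) by (simp add: invertible_det_nz)
      moreover have "ennreal \<bar>det C\<bar> \<noteq> 0" using C(1) by (simp add: invertible_det_nz)
      ultimately show ?thesis by (auto simp: ennreal_mult_less_top top_unique less_top)
    qed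
    have "(\<integral>\<^sup>+x. ennreal (?Q x) \<partial>lborel) = ennreal \<bar>det A\<bar> * (\<integral>\<^sup>+z. ennreal (?Q (A *v z)) \<partial>lborel)"
      using nn_integral_linear_map[OF lin[of A], of "\<lambda>x. ennreal (?Q x)"] detA by simp
    also have "\<dots> \<le> ennreal \<bar>det A\<bar> * (\<integral>\<^sup>+z. ennreal (1 + 2 * m\<^sup>2 / \<eta>) * ?G (C *v z) \<partial>lborel)"
    proof (intro mult_left_mono nn_integral_mono)
      fix z
      have "v (?k (A *v z)) \<le> v (density_ratio b S (C *v z)) + Cv"
        unfolding ratio by (rule Cv(2)[OF density_ratio_pos[OF Spd]])
      then have "?Q (A *v z) \<le> ((1 + 2 * m\<^sup>2 / \<eta>) * ?f (C *v z)) * (v (density_ratio b S (C *v z)) + Cv)"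
        using less_imp_le[OF fp[of "C *v z"]] eta(1) by (intro mult_mono[OF weight _ _ vk0] mult_nonneg_nonneg add_nonneg_nonneg) auto
      then have "ennreal (?Q (A *v z)) \<le> ennreal ((1 + 2 * m\<^sup>2 / \<eta>) * (?f (C *v z) * (v (density_ratio b S (C *v z)) + Cv)))"
        by (intro ennreal_leI) (simp only: mult.assoc)
      then show "ennreal (?Q (A *v z)) \<le> ennreal (1 + 2 * m\<^sup>2 / \<eta>) * ?G (C *v z)"
        using eta(1) by (subst (asm) ennreal_mult') auto
    qed simp
    also have "\<dots> = ennreal \<bar>det A\<bar> * (ennreal (1 + 2 * m\<^sup>2 / \<eta>) * (\<integral>\<^sup>+z. ?G (C *v z) \<partial>lborel))"
      by (subst nn_integral_cmult) measurable
    also have "\<dots> < \<infinity>" using Gfin by (simp add: ennreal_mult_less_top)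
    finally show "(\<integral>\<^sup>+x. ennreal (?Q x) \<partial>lborel) < \<infinity>" .
  qed
  have "(\<lambda>x. ?f x * (1 + (norm x)\<^sup>2) * \<Phi> (?k x)) =
      (\<lambda>x. ?Q x + ((s * c) * (gauss_pdf R x * (1 + (norm x)\<^sup>2)) - s * (?f x * (1 + (norm x)\<^sup>2))))"
    unfolding gauss_pdf_ratio[OF R, of b, symmetric] by (simp add: v_def algebra_simps fun_eq_iff)
  then show ?thesis
    using iQ integrable_gauss_pdf_norm[OF R] integrable_gauss_pdf_norm[OF R0] by simp
qed

section \<open>Differentiation under the integral\<close>

lemma mvn_integral_density:
  assumes S: "S \<in> pd_mats" and [measurable]: "g \<in> borel_measurable borel"
  shows "integrable (mvn S) g \<longleftrightarrow> integrable lborel (\<lambda>x. gauss_pdf S x * g x :: real)"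
    "(\<integral>x. g x \<partial>mvn S) = (\<integral>x. gauss_pdf S x * g x \<partial>lborel)"
  unfolding mvn_density using gauss_pdf_pos[OF S]
  by (subst integrable_density integral_density; auto simp: less_imp_le)+

lemma AE_vec_coordinate:
  fixes P :: "real ^ 'q::finite \<Rightarrow> bool"
  assumes [measurable]: "{u. P u} \<in> sets borel"
    and slice: "\<And>x. AE y in lborel. P (\<chi> i. if i = m then y else x i)"
  shows "AE u in lborel. P u"
proof -
  have [measurable]: "Measurable.pred borel P" using assms(1) by (simp add: pred_def)
  let ?f = "\<lambda>u. if P u then 0 else 1 :: ennreal"
  have f: "?f \<in> borel_measurable borel" by measurable
  have "(\<integral>\<^sup>+y. ?f (\<chi> i. if i = m then y else x i) \<partial>lborel) = (\<integral>\<^sup>+y. 0 \<partial>(lborel :: real measure))" for x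
    by (rule nn_integral_cong_AE) (use slice[of x] in \<open>auto elim!: eventually_mono\<close>)
  then have "(\<integral>\<^sup>+u. ?f u \<partial>lborel) = 0"
    unfolding nn_integral_vec_coordinate[OF f, of m] by simp
  then have "AE u in lborel. ?f u = 0" by (subst (asm) nn_integral_0_iff_AE) auto
  then show ?thesis by eventually_elim (auto split: if_splits)
qed

lemma AE_linear_image:
  fixes A :: "real ^ 'q::finite ^ 'q"
  assumes A: "invertible A" and [measurable]: "{u. P u} \<in> sets borel" and P: "AE u in lborel. P u"
  shows "AE x in lborel. P (A *v x)"
proof -
  have [measurable]: "Measurable.pred borel P" using assms(2) by (simp add: pred_def)
  let ?f = "\<lambda>u. if P u then 0 else 1 :: ennreal"
  let ?B = "matrix_inv A"
  have dB: "det ?B \<noteq> 0" using matrix_inv_mult[OF A] by (metis invertible_det_nz invertible_def)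
  have f: "(\<lambda>x. ?f (A *v x)) \<in> borel_measurable borel" by measurable
  have "(\<integral>\<^sup>+x. ?f (A *v x) \<partial>lborel) = ennreal \<bar>det ?B\<bar> * (\<integral>\<^sup>+y. ?f (A *v (?B *v y)) \<partial>lborel)"
    using nn_integral_linear_map[OF matrix_vector_mul_linear[of ?B] _ f] dB by simp
  also have "(\<integral>\<^sup>+y. ?f (A *v (?B *v y)) \<partial>lborel) = (\<integral>\<^sup>+y. ?f y \<partial>lborel)"
    by (simp add: transpose_matrix_inv_mult[OF A])
  also have "\<dots> = (\<integral>\<^sup>+y. 0 \<partial>(lborel :: (real ^ 'q) measure))"
    by (rule nn_integral_cong_AE) (use P in \<open>auto elim!: eventually_mono\<close>)
  finally have "(\<integral>\<^sup>+x. ?f (A *v x) \<partial>lborel) = 0" by simp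
  then have "AE x in lborel. ?f (A *v x) = 0" using f by (subst (asm) nn_integral_0_iff_AE) auto
  then show ?thesis by eventually_elim (auto split: if_splits)
qed

text \<open>
  The set where the product equals \<open>r\<close> meets almost every line parallel to an axis in at most one point.
\<close>

lemma AE_product_coordinates_neq:
  fixes a c :: "'q::finite"
  assumes ac: "a \<noteq> c"
  shows "AE u in lborel. (u :: real ^ 'q) $ a * u $ c \<noteq> r"
proof -
  have 1: "AE u in lborel. (u :: real ^ 'q) $ a \<noteq> 0"
  proof (rule AE_vec_coordinate[where m=a])
    show "{u :: real ^ 'q. u $ a \<noteq> 0} \<in> sets borel" by measurable
    show "AE y in lborel. (\<chi> i. if i = a then y else x i) $ a \<noteq> 0" for x
      using AE_lborel_singleton[of 0] by simp
  qed
  have 2: "AE u in lborel. (u :: real ^ 'q) $ a \<noteq> 0 \<longrightarrow> u $ a * u $ c \<noteq> r"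
  proof (rule AE_vec_coordinate[where m=c])
    show "{u :: real ^ 'q. u $ a \<noteq> 0 \<longrightarrow> u $ a * u $ c \<noteq> r} \<in> sets borel" by measurable
    show "AE y in lborel. (\<chi> i. if i = c then y else x i) $ a \<noteq> 0 \<longrightarrow>
        (\<chi> i. if i = c then y else x i) $ a * (\<chi> i. if i = c then y else x i) $ c \<noteq> r" for x
      using AE_lborel_singleton[of "r / x a"]
    proof eventually_elim
      case (elim y)
      then show ?case using ac by (auto simp: field_simps)
    qed
  qed
  show ?thesis using 1 2 by eventually_elim blast
qed

text \<open>
  The logarithmic derivative of the normal density along a direction.
\<close>

definition log_pdf_deriv :: "real ^ 'q::finite ^ 'q \<Rightarrow> real ^ 'q ^ 'q \<Rightarrow> real ^ 'q \<Rightarrow> real" where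
  "log_pdf_deriv S H x = ((matrix_inv S *v x) \<bullet> (H *v (matrix_inv S *v x)) - trace (matrix_inv S ** H)) / 2"

lemma gauss_pdf_has_derivative:
  assumes "S \<in> pd_mats" "transpose H = H"
  shows "((\<lambda>t. gauss_pdf (S + t *\<^sub>R H) x) has_real_derivative gauss_pdf S x * log_pdf_deriv S H x) (at 0)"
proof -
  obtain \<delta> where "\<And>x. ((\<lambda>t. gauss_pdf (S + t *\<^sub>R H) x) has_real_derivative
      gauss_pdf S x * (((matrix_inv S *v x) \<bullet> (H *v (matrix_inv S *v x))) - trace (matrix_inv S ** H)) / 2) (at 0)"
    by (rule gauss_pdf_line[OF assms], rule that)
  then show ?thesis by (simp add: log_pdf_deriv_def)
qed

lemma pd_line:
  fixes S H :: "real ^ 'q::finite ^ 'q"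
  assumes "S \<in> pd_mats" "transpose H = H"
  obtains \<delta> where "0 < \<delta>" "\<And>t. \<bar>t\<bar> < \<delta> \<Longrightarrow> S + t *\<^sub>R H \<in> pd_mats"
  by (rule gauss_pdf_line[OF assms], rule that)

lemma block_diag_line: "block_diag b (S + t *\<^sub>R H) = block_diag b S + t *\<^sub>R block_diag b H"
  by (simp add: block_diag_add block_diag_scaleR)

lemma density_ratio_line:
  fixes R H :: "real ^ 'q::finite ^ 'q" and b :: "'q \<Rightarrow> 'k::finite"
  assumes R: "R \<in> pd_mats" and H: "transpose H = H"
  shows "((\<lambda>t. density_ratio b (R + t *\<^sub>R H) x) has_real_derivative
    density_ratio b R x * (log_pdf_deriv R H x - log_pdf_deriv (block_diag b R) (block_diag b H) x)) (at 0)"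
proof -
  have R0: "block_diag b R \<in> pd_mats" by (rule block_diag_pd[OF R])
  have H0: "transpose (block_diag b H) = block_diag b H" by (simp add: transpose_block_diag H)
  obtain \<delta> where \<delta>: "0 < \<delta>" "\<And>t. \<bar>t\<bar> < \<delta> \<Longrightarrow> R + t *\<^sub>R H \<in> pd_mats" by (rule pd_line[OF R H], rule that)
  let ?p = "log_pdf_deriv R H x" and ?q = "log_pdf_deriv (block_diag b R) (block_diag b H) x"
  let ?h = "gauss_pdf R x" and ?g = "gauss_pdf (block_diag b R) x"
  have g0: "0 < ?g" by (rule gauss_pdf_pos[OF R0])
  have "((\<lambda>t. gauss_pdf (R + t *\<^sub>R H) x / gauss_pdf (block_diag b R + t *\<^sub>R block_diag b H) x) has_real_derivative
      (?h * ?p * ?g - ?h * (?g * ?q)) / (?g * ?g)) (at 0)"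
    using DERIV_divide[OF gauss_pdf_has_derivative[OF R H, of x] gauss_pdf_has_derivative[OF R0 H0, of x]] g0 by simp
  moreover have "(?h * ?p * ?g - ?h * (?g * ?q)) / (?g * ?g) = density_ratio b R x * (?p - ?q)"
    unfolding density_ratio_eq[OF R] using g0 by (simp add: field_simps)
  ultimately have "((\<lambda>t. gauss_pdf (R + t *\<^sub>R H) x / gauss_pdf (block_diag b R + t *\<^sub>R block_diag b H) x) has_real_derivative
      density_ratio b R x * (?p - ?q)) (at 0)" by simp
  then show ?thesis
  proof (rule has_field_derivative_transform_within[OF _ \<delta>(1)])
    fix t :: real assume "dist t 0 < \<delta>"
    then show "gauss_pdf (R + t *\<^sub>R H) x / gauss_pdf (block_diag b R + t *\<^sub>R block_diag b H) x = density_ratio b (R + t *\<^sub>R H) x"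
      using density_ratio_eq[OF \<delta>(2), of t b x] by (simp add: block_diag_line)
  qed simp
qed

lemma density_ratio_line_continuous:
  fixes R H :: "real ^ 'q::finite ^ 'q"
  assumes "R + t *\<^sub>R H \<in> pd_mats" "transpose H = H"
  shows "isCont (\<lambda>s. density_ratio b (R + s *\<^sub>R H) x) t"
proof -
  have "isCont (\<lambda>s. density_ratio b (R + t *\<^sub>R H + s *\<^sub>R H) x) 0"
    by (rule DERIV_isCont[OF density_ratio_line[OF assms]])
  then show ?thesis
    unfolding isCont_iff by (simp add: scaleR_add_left add.assoc)
qed

lemma dep_integrand_line:
  fixes R H :: "real ^ 'q::finite ^ 'q" and b :: "'q \<Rightarrow> 'k::finite"
  assumes R: "R \<in> pd_mats" and H: "transpose H = H"
    and \<Phi>: "(\<Phi> has_real_derivative D) (at (density_ratio b R x))"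
  shows "((\<lambda>t. dep_integrand b \<Phi> (R + t *\<^sub>R H) x) has_real_derivative
    gauss_pdf (block_diag b R) x * \<Phi> (density_ratio b R x) * log_pdf_deriv (block_diag b R) (block_diag b H) x
    + gauss_pdf R x * D * (log_pdf_deriv R H x - log_pdf_deriv (block_diag b R) (block_diag b H) x)) (at 0)"
proof -
  have R0: "block_diag b R \<in> pd_mats" by (rule block_diag_pd[OF R])
  have H0: "transpose (block_diag b H) = block_diag b H" by (simp add: transpose_block_diag H)
  have c: "((\<lambda>t. \<Phi> (density_ratio b (R + t *\<^sub>R H) x)) has_real_derivative
      D * (density_ratio b R x * (log_pdf_deriv R H x - log_pdf_deriv (block_diag b R) (block_diag b H) x))) (at 0)"
    using DERIV_chain2[OF _ density_ratio_line[OF R H, of b x], of \<Phi> D] \<Phi> by simp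
  have eq: "dep_integrand b \<Phi> (R + t *\<^sub>R H) x = gauss_pdf (block_diag b R + t *\<^sub>R block_diag b H) x * \<Phi> (density_ratio b (R + t *\<^sub>R H) x)" for t
    by (simp add: dep_integrand_eq block_diag_line)
  show ?thesis unfolding eq
  proof (rule DERIV_cong[OF DERIV_mult[OF gauss_pdf_has_derivative[OF R0 H0] c]])
    show "gauss_pdf (block_diag b R) x * log_pdf_deriv (block_diag b R) (block_diag b H) x * \<Phi> (density_ratio b (R + 0 *\<^sub>R H) x) +
      D * (density_ratio b R x * (log_pdf_deriv R H x - log_pdf_deriv (block_diag b R) (block_diag b H) x)) * gauss_pdf (block_diag b R + 0 *\<^sub>R block_diag b H) x =
      gauss_pdf (block_diag b R) x * \<Phi> (density_ratio b R x) * log_pdf_deriv (block_diag b R) (block_diag b H) x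
      + gauss_pdf R x * D * (log_pdf_deriv R H x - log_pdf_deriv (block_diag b R) (block_diag b H) x)"
      unfolding gauss_pdf_ratio[OF R, of b, symmetric] by simp
  qed
qed

text \<open>
  Perturbing one correlation between two different blocks leaves \<open>R\<^sub>0\<close> fixed and moves the density
  ratio with nonzero speed at almost every point, so that a differentiable integrand forces \<open>\<Phi>\<close> to be
  differentiable at the values of the density ratio.
\<close>

lemma AE_differentiable_at_ratio:
  fixes R :: "real ^ 'q::finite ^ 'q" and b :: "'q \<Rightarrow> 'k::finite"
  assumes R: "R \<in> pd_mats" and ac: "b a \<noteq> b c"
    and g: "AE x in lborel. ((\<lambda>S. dep_integrand b \<Phi> S x) has_derivative g x) (at R within cov_mats)"
  shows "AE x in lborel. \<exists>D. (\<Phi> has_real_derivative D) (at (density_ratio b R x))"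
proof -
  let ?iR = "matrix_inv R"
  have R0: "block_diag b R \<in> pd_mats" by (rule block_diag_pd[OF R])
  \<comment> \<open>the direction that changes only the correlation of the coordinates \<open>a\<close> and \<open>c\<close>\<close>
  define H :: "real ^ 'q ^ 'q" where "H = (\<chi> i j. if (i = a \<and> j = c) \<or> (i = c \<and> j = a) then 1 else 0)"
  have H: "transpose H = H" by (auto simp: H_def transpose_def vec_eq_iff)
  have H0: "block_diag b H = 0" using ac by (auto simp: H_def block_diag_def vec_eq_iff)
  have "a \<noteq> c" using ac by auto
  have form: "u \<bullet> (H *v u) = 2 * (u $ a * u $ c)" for u
  proof -
    have "H *v u = (\<chi> i. (if i = a then u $ c else 0) + (if i = c then u $ a else 0))"
    proof (unfold vec_eq_iff, intro allI)
      fix i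
      have "(H *v u) $ i = (\<Sum>j\<in>UNIV. (if j = c then if i = a then u $ j else 0 else 0) + (if j = a then if i = c then u $ j else 0 else 0))"
        unfolding matrix_vector_mult_def H_def using \<open>a \<noteq> c\<close> by (auto intro!: sum.cong)
      then show "(H *v u) $ i = (\<chi> i. (if i = a then u $ c else 0) + (if i = c then u $ a else 0)) $ i"
        by (simp add: sum.distrib)
    qed
    then show ?thesis by (simp add: inner_vec_def distrib_left sum.distrib if_distrib[of "\<lambda>v. _ * v"] mult.commute cong: if_cong)
  qed
  obtain \<delta> where \<delta>: "0 < \<delta>" "\<And>t. \<bar>t\<bar> < \<delta> \<Longrightarrow> R + t *\<^sub>R H \<in> pd_mats" by (rule pd_line[OF R H], rule that)
  have inv: "invertible ?iR" using pd_matrix_inv(3)[OF R] by (rule pd_matrix_inv(2))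
  have "AE u in lborel. (u :: real ^ 'q) $ a * u $ c \<noteq> trace (?iR ** H) / 2"
    by (rule AE_product_coordinates_neq[OF \<open>a \<noteq> c\<close>])
  then have ne: "AE x in lborel. (?iR *v x) $ a * (?iR *v x) $ c \<noteq> trace (?iR ** H) / 2"
    by (intro AE_linear_image[OF inv]) measurable
  show ?thesis using g ne
  proof eventually_elim
    case (elim x)
    let ?\<kappa> = "\<lambda>t. density_ratio b (R + t *\<^sub>R H) x"
    let ?f0 = "gauss_pdf (block_diag b R) x"
    have q0: "log_pdf_deriv (block_diag b R) (block_diag b H) x = 0"
      unfolding H0 log_pdf_deriv_def by (simp add: trace_def matrix_matrix_mult_def)
    define s where "s = density_ratio b R x * log_pdf_deriv R H x"
    have k: "(?\<kappa> has_real_derivative s) (at 0)"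
      using density_ratio_line[OF R H, of b x] by (simp add: q0 s_def)
    have "log_pdf_deriv R H x \<noteq> 0" using elim(2) by (simp add: log_pdf_deriv_def form)
    then have s: "s \<noteq> 0" using density_ratio_pos[OF R, of b x] by (simp add: s_def)
    have f0: "0 < ?f0" by (rule gauss_pdf_pos[OF R0])
    have "((\<lambda>t. dep_integrand b \<Phi> (R + t *\<^sub>R H) x) has_real_derivative g x H) (at 0)"
      by (rule derivative_along_line[OF R H elim(1)])
    then have "((\<lambda>t. ?f0 * \<Phi> (?\<kappa> t)) has_real_derivative g x H) (at 0)"
      by (simp add: dep_integrand_eq block_diag_line H0)
    from DERIV_cdivide[OF this, of ?f0] have p: "((\<lambda>t. \<Phi> (?\<kappa> t)) has_real_derivative g x H / ?f0) (at 0)"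
      using f0 by simp
    have "(\<Phi> has_real_derivative g x H / ?f0 / s) (at (?\<kappa> 0))"
      by (rule DERIV_of_compose[OF k s \<delta>(1) density_ratio_line_continuous[OF \<delta>(2) H] p])
    then show ?case by auto
  qed
qed

lemma weighted_quad_form:
  fixes B W :: "real ^ 'q::finite ^ 'q"
  assumes W: "\<And>a c. has_bochner_integral M (\<lambda>x. w x * (x $ a * x $ c)) (W $ a $ c)"
  shows "has_bochner_integral M (\<lambda>x. w x * (x \<bullet> (B *v x))) (trace (B ** W))"
proof -
  have sym: "W $ c $ a = W $ a $ c" for a c
    using has_bochner_integral_eq[OF W[of a c]] W[of c a] by (simp add: mult.commute)
  have eq: "w x * (x \<bullet> (B *v x)) = (\<Sum>a\<in>UNIV. \<Sum>c\<in>UNIV. B $ a $ c * (w x * (x $ a * x $ c)))" for x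
    by (simp add: inner_vec_def matrix_vector_mult_def sum_distrib_left mult_ac)
  have "trace (B ** W) = (\<Sum>a\<in>UNIV. \<Sum>c\<in>UNIV. B $ a $ c * W $ a $ c)"
    by (simp add: trace_def matrix_matrix_mult_def sym)
  then show ?thesis unfolding eq
    by (simp only:) (intro has_bochner_integral_sum has_bochner_integral_mult_right W)
qed

lemma log_pdf_deriv_quad_form:
  fixes S H :: "real ^ 'q::finite ^ 'q"
  assumes "S \<in> pd_mats"
  shows "log_pdf_deriv S H x = (x \<bullet> ((matrix_inv S ** H ** matrix_inv S) *v x) - trace (matrix_inv S ** H)) / 2"
proof -
  have "(matrix_inv S *v x) \<bullet> y = x \<bullet> (matrix_inv S *v y)" for y
    using inner_transpose[of x "matrix_inv S" y] by (simp add: pd_matrix_inv(4)[OF assms])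
  then show ?thesis by (simp add: log_pdf_deriv_def matrix_vector_mul_assoc matrix_mul_assoc)
qed

lemma weighted_log_pdf_deriv:
  fixes S H W :: "real ^ 'q::finite ^ 'q"
  assumes S: "S \<in> pd_mats" and W: "\<And>a c. has_bochner_integral lborel (\<lambda>x. w x * (x $ a * x $ c)) (W $ a $ c)"
    and w: "has_bochner_integral lborel w e"
  shows "has_bochner_integral lborel (\<lambda>x. w x * log_pdf_deriv S H x)
    ((trace (matrix_inv S ** H ** matrix_inv S ** W) - e * trace (matrix_inv S ** H)) / 2)"
proof -
  have "has_bochner_integral lborel (\<lambda>x. (w x * (x \<bullet> ((matrix_inv S ** H ** matrix_inv S) *v x)) - w x * trace (matrix_inv S ** H)) / 2)
      ((trace (matrix_inv S ** H ** matrix_inv S ** W) - e * trace (matrix_inv S ** H)) / 2)"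
    by (intro has_bochner_integral_divide_zero has_bochner_integral_diff has_bochner_integral_mult_left weighted_quad_form W w)
  then show ?thesis by (simp add: log_pdf_deriv_quad_form[OF S] right_diff_distrib diff_divide_distrib)
qed


lemma trace_lincomb:
  fixes A B H :: "real ^ 'q::finite ^ 'q"
  shows "trace ((A + B) ** H) = trace (A ** H) + trace (B ** H)" "trace ((A - B) ** H) = trace (A ** H) - trace (B ** H)"
    "trace ((r *\<^sub>R A) ** H) = r * trace (A ** H)"
  by (simp_all add: trace_def matrix_matrix_mult_def sum.distrib sum_subtractf distrib_right left_diff_distrib sum_distrib_left mult.assoc)

lemma transpose_lincomb:
  fixes A B :: "real ^ 'q ^ 'q"
  shows "transpose (A + B) = transpose A + transpose B" "transpose (A - B) = transpose A - transpose B"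
    "transpose (r *\<^sub>R A) = r *\<^sub>R transpose A"
  by (simp_all add: transpose_def vec_eq_iff)

lemma transpose_weighted_second_moment: "transpose (weighted_second_moment N f) = weighted_second_moment N f"
  by (simp add: transpose_def weighted_second_moment_def vec_eq_iff mult.commute)

lemma transpose_M_mat:
  assumes R: "R \<in> pd_mats"
  shows "transpose (M_mat b \<Phi> R) = M_mat b \<Phi> R"
proof -
  have R0: "block_diag b R \<in> pd_mats" by (rule block_diag_pd[OF R])
  show ?thesis
    unfolding M_mat_def Let_def
    by (simp add: transpose_lincomb matrix_transpose_mul pd_matrix_inv(4)[OF R] pd_matrix_inv(4)[OF R0]
        transpose_block_diag transpose_weighted_second_moment matrix_mul_assoc)
qed

lemma trace_sandwich:
  fixes R H W :: "real ^ 'q::finite ^ 'q"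
  assumes R: "R \<in> pd_mats"
  shows "trace (matrix_inv R ** H ** matrix_inv R ** W) = trace (matrix_inv R ** W ** matrix_inv R ** H)"
  using trace_mul_sym[of "matrix_inv R ** H" "matrix_inv R ** W"] by (simp add: matrix_mul_assoc)

text \<open>
  Passing from \<open>H\<close> to its diagonal blocks is self-adjoint for the trace pairing and commutes with
  multiplication by the block diagonal matrix \<open>R\<^sub>0\<^sup>-\<^sup>1\<close>.  This moves the block structure from the direction
  of differentiation to the moment matrix, as in the matrices \<open>F\<^sub>1\<close> and \<open>F\<^sub>2\<close>.
\<close>

lemma trace_block_sandwich:
  fixes R H W :: "real ^ 'q::finite ^ 'q" and b :: "'q \<Rightarrow> 'k::finite"
  assumes R: "R \<in> pd_mats"
  shows "trace (matrix_inv (block_diag b R) ** block_diag b H ** matrix_inv (block_diag b R) ** W) =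
      trace (matrix_inv (block_diag b R) ** block_diag b W ** matrix_inv (block_diag b R) ** H)"
    "trace (matrix_inv (block_diag b R) ** block_diag b H) = trace (matrix_inv (block_diag b R) ** H)"
proof -
  let ?I = "matrix_inv (block_diag b R)"
  have R0: "block_diag b R \<in> pd_mats" by (rule block_diag_pd[OF R])
  have I: "block_diag b ?I = ?I" by (rule block_diag_matrix_inv[OF block_diag_idem pd_matrix_inv(2)[OF R0]])
  have F: "block_diag b (?I ** W ** ?I) = ?I ** block_diag b W ** ?I"
    by (simp add: block_diag_mult_right[OF I] block_diag_mult_left[OF I])
  show "trace (?I ** block_diag b H) = trace (?I ** H)" by (rule trace_mult_block_diag[OF I, symmetric])
  have "trace (?I ** block_diag b H ** ?I ** W) = trace (?I ** W ** ?I ** block_diag b H)" by (rule trace_sandwich[OF R0])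
  also have "\<dots> = trace (block_diag b H ** (?I ** W ** ?I))" by (rule trace_mul_sym)
  also have "\<dots> = trace (block_diag b H ** block_diag b (?I ** W ** ?I))" by (rule trace_mult_block_diag[OF block_diag_idem])
  also have "\<dots> = trace ((?I ** block_diag b W ** ?I) ** block_diag b H)" unfolding F by (rule trace_mul_sym)
  also have "\<dots> = trace ((?I ** block_diag b W ** ?I) ** H)"
    by (rule trace_mult_block_diag[symmetric]) (metis F block_diag_idem)
  finally show "trace (?I ** block_diag b H ** ?I ** W) = trace (?I ** block_diag b W ** ?I ** H)" .
qed

text \<open>
  The terms of the differentiated integrand are at most quadratic in \<open>x\<close>, so that the bound with
  quadratic weight, applied to the ratio and to its multiples by \<open>3 / 2\<close> and \<open>1 / 2\<close>, dominates all of them.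
\<close>

lemma integrable_weights:
  fixes R :: "real ^ 'q::finite ^ 'q" and b :: "'q \<Rightarrow> 'k::finite"
  assumes int: "\<And>S. S \<in> pd_mats \<Longrightarrow> integrable lborel (dep_integrand b \<Phi> S)"
    and R: "R \<in> pd_mats" and cvx: "convex_on {0<..} \<Phi>" and cont: "continuous_on {0<..} \<Phi>" and \<Phi>1: "\<Phi> 1 = 0"
    and diff: "AE x in lborel. \<exists>D. (\<Phi> has_real_derivative D) (at (density_ratio b R x))"
  shows "integrable lborel (\<lambda>x. gauss_pdf (block_diag b R) x * \<Phi> (density_ratio b R x))"
    "integrable lborel (\<lambda>x. gauss_pdf (block_diag b R) x * \<Phi> (density_ratio b R x) * (x $ a * x $ c))"
    "integrable lborel (\<lambda>x. gauss_pdf R x * deriv \<Phi> (density_ratio b R x))"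
    "integrable lborel (\<lambda>x. gauss_pdf R x * deriv \<Phi> (density_ratio b R x) * (x $ a * x $ c))"
proof -
  have R0: "block_diag b R \<in> pd_mats" by (rule block_diag_pd[OF R])
  let ?k = "density_ratio b R" and ?g = "gauss_pdf (block_diag b R)"
  have gp: "0 < ?g x" for x by (rule gauss_pdf_pos[OF R0])
  have kp: "0 < ?k x" for x by (rule density_ratio_pos[OF R])
  note k_meas[measurable] = density_ratio_measurable[OF R, of b]
  have m1[measurable]: "(\<lambda>x. \<Phi> (?k x)) \<in> borel_measurable borel"
    by (rule borel_measurable_comp_positive[OF cont k_meas kp])
  have m2[measurable]: "(\<lambda>x. deriv \<Phi> (?k x)) \<in> borel_measurable borel"
    by (rule borel_measurable_deriv_comp[OF cvx cont k_meas kp])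
  have iw: "integrable lborel (\<lambda>x. \<bar>?g x * (1 + (norm x)\<^sup>2) * \<Phi> (c * ?k x)\<bar>)" if "0 < c" for c
    by (intro integrable_abs integrable_quadratic_weight[OF int R cvx cont \<Phi>1 that])
  have xx: "\<bar>x $ a * x $ c\<bar> \<le> 1 + (norm x)\<^sup>2" for x :: "real ^ 'q" and a c
  proof -
    have "\<bar>x $ a * x $ c\<bar> \<le> norm x * norm x"
      unfolding abs_mult by (intro mult_mono component_le_norm_cart) auto
    then show ?thesis by (simp add: power2_eq_square)
  qed
  have ones: "\<bar>1 :: real\<bar> \<le> 1 + (norm x)\<^sup>2" for x :: "real ^ 'q" by simp
  have B0: "integrable lborel (\<lambda>x. ?g x * \<Phi> (?k x) * h x)"
    if [measurable]: "h \<in> borel_measurable borel" and h: "\<And>x. \<bar>h x\<bar> \<le> 1 + (norm x)\<^sup>2" for h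
  proof (rule Bochner_Integration.integrable_bound[OF iw[of 1]])
    show "AE x in lborel. norm (?g x * \<Phi> (?k x) * h x) \<le> norm \<bar>?g x * (1 + (norm x)\<^sup>2) * \<Phi> (1 * ?k x)\<bar>"
    proof (rule AE_I2)
      fix x
      have "\<bar>?g x * \<Phi> (?k x)\<bar> * \<bar>h x\<bar> \<le> \<bar>?g x * \<Phi> (?k x)\<bar> * (1 + (norm x)\<^sup>2)" by (intro mult_left_mono h) simp
      then show "norm (?g x * \<Phi> (?k x) * h x) \<le> norm \<bar>?g x * (1 + (norm x)\<^sup>2) * \<Phi> (1 * ?k x)\<bar>"
        by (simp add: abs_mult mult_ac)
    qed
  qed (use that in \<open>auto intro!: borel_measurable_times\<close>)
  let ?G = "\<lambda>x. 2 * (\<bar>?g x * (1 + (norm x)\<^sup>2) * \<Phi> (3 / 2 * ?k x)\<bar> + \<bar>?g x * (1 + (norm x)\<^sup>2) * \<Phi> (1 / 2 * ?k x)\<bar> + \<bar>?g x * (1 + (norm x)\<^sup>2) * \<Phi> (1 * ?k x)\<bar>)"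
  have iG: "integrable lborel ?G"
    by (intro integrable_mult_right Bochner_Integration.integrable_add iw) auto
  have B1: "integrable lborel (\<lambda>x. gauss_pdf R x * deriv \<Phi> (?k x) * h x)"
    if [measurable]: "h \<in> borel_measurable borel" and h: "\<And>x. \<bar>h x\<bar> \<le> 1 + (norm x)\<^sup>2" for h
  proof (rule Bochner_Integration.integrable_bound[OF iG])
    show "AE x in lborel. norm (gauss_pdf R x * deriv \<Phi> (?k x) * h x) \<le> norm (?G x)"
      using diff
    proof eventually_elim
      case (elim x)
      then obtain D where D: "(\<Phi> has_real_derivative D) (at (?k x))" by blast
      have "\<bar>?k x * deriv \<Phi> (?k x)\<bar> \<le> 2 * (\<bar>\<Phi> (3 / 2 * ?k x)\<bar> + \<bar>\<Phi> (1 / 2 * ?k x)\<bar> + \<bar>\<Phi> (?k x)\<bar>)" (is "_ \<le> ?r")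
        unfolding DERIV_imp_deriv[OF D] by (rule convex_deriv_bound[OF cvx kp D])
      then have le: "?g x * \<bar>?k x * deriv \<Phi> (?k x)\<bar> * \<bar>h x\<bar> \<le> ?g x * ?r * (1 + (norm x)\<^sup>2)"
        using gp[of x] h by (intro mult_mono mult_left_mono) auto
      have e1: "norm (gauss_pdf R x * deriv \<Phi> (?k x) * h x) = ?g x * \<bar>?k x * deriv \<Phi> (?k x)\<bar> * \<bar>h x\<bar>"
        unfolding gauss_pdf_ratio[OF R, of b, symmetric] using gp[of x] by (simp add: abs_mult)
      have e2: "norm (?G x) = ?g x * ?r * (1 + (norm x)\<^sup>2)"
      proof -
        have n: "\<bar>2 * (\<bar>u * w * p\<bar> + \<bar>u * w * q\<bar> + \<bar>u * w * r\<bar>)\<bar> = u * (2 * (\<bar>p\<bar> + \<bar>q\<bar> + \<bar>r\<bar>)) * w" if "0 < u" "0 \<le> w" for u w p q r :: real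
          using that by (simp add: abs_mult algebra_simps)
        show ?thesis unfolding real_norm_def by (subst n) (use gp[of x] in auto)
      qed
      show ?case unfolding e1 e2 by (rule le)
    qed
  qed (use that in \<open>auto intro!: borel_measurable_times\<close>)
  show "integrable lborel (\<lambda>x. ?g x * \<Phi> (?k x))" using B0[of "\<lambda>_. 1"] ones by simp
  show "integrable lborel (\<lambda>x. ?g x * \<Phi> (?k x) * (x $ a * x $ c))" by (rule B0[OF _ xx]) measurable
  show "integrable lborel (\<lambda>x. gauss_pdf R x * deriv \<Phi> (?k x))" using B1[of "\<lambda>_. 1"] ones by simp
  show "integrable lborel (\<lambda>x. gauss_pdf R x * deriv \<Phi> (?k x) * (x $ a * x $ c))" by (rule B1[OF _ xx]) measurable
qed

text \<open>
  With one block the density ratio is constantly \<open>1\<close>, where \<open>\<Phi>\<close> vanishes but may have a kink; the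
  terms with \<open>\<Phi>'\<close> then cancel in \<open>M\<close>.
\<close>

lemma single_block:
  fixes R :: "real ^ 'q::finite ^ 'q" and b :: "'q \<Rightarrow> 'k::finite"
  assumes b: "\<forall>a c. b a = b c" and R: "R \<in> pd_mats" and \<Phi>1: "\<Phi> 1 = 0"
  shows "gauss_dep b \<Phi> R = 0" "M_mat b \<Phi> R = 0"
proof -
  have bd: "block_diag b A = A" for A :: "real ^ 'q ^ 'q"
  proof -
    have "(if b a = b c then t else 0) = t" for a c and t :: real using b by simp
    then show ?thesis by (simp add: block_diag_def vec_eq_iff)
  qed
  have k: "density_ratio b R x = 1" for x
    using gauss_pdf_pos[OF R, of x] by (simp add: density_ratio_eq[OF R] bd)
  show gd: "gauss_dep b \<Phi> R = 0" by (simp add: gauss_dep_def dep_integrand_eq k \<Phi>1)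
  have w: "weighted_second_moment N (\<lambda>x. 0) = 0" for N :: "(real ^ 'q) measure"
    by (simp add: weighted_second_moment_def vec_eq_iff)
  have z: "A ** 0 = 0" "0 ** A = 0" for A :: "real ^ 'q ^ 'q"
    by (simp_all add: matrix_matrix_mult_def vec_eq_iff)
  show "M_mat b \<Phi> R = 0" by (simp add: M_mat_def Let_def bd k \<Phi>1 gd w z)
qed

text \<open>
  Integrating the pointwise derivative term by term produces the matrix \<open>M\<close>.  Symmetric directions
  suffice, since the influence function takes symmetric values.
\<close>

lemma interchange_derivative:
  fixes R :: "real ^ 'q::finite ^ 'q" and b :: "'q \<Rightarrow> 'k::finite"
  assumes int: "\<And>S. S \<in> pd_mats \<Longrightarrow> integrable lborel (dep_integrand b \<Phi> S)"
    and R: "R \<in> pd_mats" and cvx: "convex_on {0<..} \<Phi>" and cont: "continuous_on {0<..} \<Phi>" and \<Phi>1: "\<Phi> 1 = 0"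
    and ic: "diff_integral_interchange b \<Phi> R"
  obtains D' where "(gauss_dep b \<Phi> has_derivative D') (at R within cov_mats)"
    "\<And>H. transpose H = H \<Longrightarrow> D' H = trace (M_mat b \<Phi> R ** H)"
proof -
  obtain D' g where D': "(gauss_dep b \<Phi> has_derivative D') (at R within cov_mats)"
    and g: "AE x in lborel. ((\<lambda>S. dep_integrand b \<Phi> S x) has_derivative g x) (at R within cov_mats)"
    and gi: "\<And>H. transpose H = H \<Longrightarrow> has_bochner_integral lborel (\<lambda>x. g x H) (D' H)"
    using ic unfolding diff_integral_interchange_def by blast
  have "D' H = trace (M_mat b \<Phi> R ** H)" if H: "transpose H = H" for H
  proof (cases "\<forall>a c. b a = b c")
    case True
    obtain \<delta> where \<delta>: "0 < \<delta>" "\<And>t. \<bar>t\<bar> < \<delta> \<Longrightarrow> R + t *\<^sub>R H \<in> pd_mats" by (rule pd_line[OF R H], rule that)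
    have "((\<lambda>t. gauss_dep b \<Phi> (R + t *\<^sub>R H)) has_real_derivative 0) (at 0)"
    proof (rule has_field_derivative_transform_within[OF DERIV_const[of 0] \<delta>(1)])
      fix t :: real assume "dist t 0 < \<delta>"
      then have pd: "R + t *\<^sub>R H \<in> pd_mats" using \<delta>(2)[of t] by simp
      have "gauss_dep b \<Phi> (R + t *\<^sub>R H) = 0" by (rule single_block(1)[where \<Phi>=\<Phi>, OF True pd \<Phi>1])
      then show "0 = gauss_dep b \<Phi> (R + t *\<^sub>R H)" by simp
    qed simp
    then have "D' H = 0" using derivative_along_line[OF R H D'] DERIV_unique by blast
    moreover have "M_mat b \<Phi> R = 0" by (rule single_block(2)[where \<Phi>=\<Phi>, OF True R \<Phi>1])
    ultimately show ?thesis by (simp add: trace_def matrix_matrix_mult_def)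
  next
    case False
    then obtain a c where ac: "b a \<noteq> b c" by blast
    have diff: "AE x in lborel. \<exists>D. (\<Phi> has_real_derivative D) (at (density_ratio b R x))"
      by (rule AE_differentiable_at_ratio[OF R ac g])
    let ?R0 = "block_diag b R" and ?H0 = "block_diag b H"
    have R0: "?R0 \<in> pd_mats" by (rule block_diag_pd[OF R])
    let ?k = "density_ratio b R"
    note iw = integrable_weights[OF int R cvx cont \<Phi>1 diff]
    have kp: "0 < ?k x" for x by (rule density_ratio_pos[OF R])
    note k_meas[measurable] = density_ratio_measurable[OF R, of b]
    have m1[measurable]: "(\<lambda>x. \<Phi> (?k x)) \<in> borel_measurable borel"
      by (rule borel_measurable_comp_positive[OF cont k_meas kp])
    have m2[measurable]: "(\<lambda>x. deriv \<Phi> (?k x)) \<in> borel_measurable borel"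
      by (rule borel_measurable_deriv_comp[OF cvx cont k_meas kp])
    define w0 where "w0 x = gauss_pdf ?R0 x * \<Phi> (?k x)" for x
    define w1 where "w1 x = gauss_pdf R x * deriv \<Phi> (?k x)" for x
    define W0 where "W0 = weighted_second_moment (mvn ?R0) (\<lambda>x. \<Phi> (?k x))"
    define W1 where "W1 = weighted_second_moment (mvn R) (\<lambda>x. deriv \<Phi> (?k x))"
    define e0 where "e0 = gauss_dep b \<Phi> R"
    define e1 where "e1 = (\<integral>x. deriv \<Phi> (?k x) \<partial>mvn R)"
    have h0: "has_bochner_integral lborel w0 e0"
      using iw(1) unfolding e0_def gauss_dep_def dep_integrand_eq w0_def has_bochner_integral_iff by simp
    have h1: "has_bochner_integral lborel w1 e1"
      using iw(3) unfolding e1_def w1_def has_bochner_integral_iff mvn_integral_density(2)[OF R m2] by simp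
    have H0: "has_bochner_integral lborel (\<lambda>x. w0 x * (x $ a * x $ c)) (W0 $ a $ c)" for a c
    proof -
      have "(\<lambda>x. \<Phi> (?k x) * (x $ a * x $ c)) \<in> borel_measurable borel" by measurable
      from mvn_integral_density(2)[OF R0 this] show ?thesis
        using iw(2)[of a c] unfolding w0_def W0_def has_bochner_integral_iff weighted_second_moment_def by (simp add: mult.assoc)
    qed
    have H1: "has_bochner_integral lborel (\<lambda>x. w1 x * (x $ a * x $ c)) (W1 $ a $ c)" for a c
    proof -
      have "(\<lambda>x. deriv \<Phi> (?k x) * (x $ a * x $ c)) \<in> borel_measurable borel" by measurable
      from mvn_integral_density(2)[OF R this] show ?thesis
        using iw(4)[of a c] unfolding w1_def W1_def has_bochner_integral_iff weighted_second_moment_def by (simp add: mult.assoc)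
    qed
    let ?E = "\<lambda>x. w0 x * log_pdf_deriv ?R0 ?H0 x + (w1 x * log_pdf_deriv R H x - w1 x * log_pdf_deriv ?R0 ?H0 x)"
    let ?iR = "matrix_inv R" and ?jR = "matrix_inv ?R0"
    have E: "has_bochner_integral lborel ?E
        ((trace (?jR ** ?H0 ** ?jR ** W0) - e0 * trace (?jR ** ?H0)) / 2 +
         ((trace (?iR ** H ** ?iR ** W1) - e1 * trace (?iR ** H)) / 2 -
          (trace (?jR ** ?H0 ** ?jR ** W1) - e1 * trace (?jR ** ?H0)) / 2))"
      by (rule has_bochner_integral_add[OF weighted_log_pdf_deriv[OF R0 H0 h0]
            has_bochner_integral_diff[OF weighted_log_pdf_deriv[OF R H1 h1] weighted_log_pdf_deriv[OF R0 H1 h1]]])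
    have ae: "AE x in lborel. g x H = ?E x"
      using g diff
    proof eventually_elim
      case (elim x)
      then obtain D where D: "(\<Phi> has_real_derivative D) (at (?k x))" by blast
      have "g x H = gauss_pdf ?R0 x * \<Phi> (?k x) * log_pdf_deriv ?R0 ?H0 x
          + gauss_pdf R x * D * (log_pdf_deriv R H x - log_pdf_deriv ?R0 ?H0 x)"
        by (rule DERIV_unique[OF derivative_along_line[OF R H elim(1)] dep_integrand_line[OF R H D]])
      then show ?case unfolding w0_def w1_def DERIV_imp_deriv[OF D] by (simp add: right_diff_distrib)
    qed
    have "D' H = (\<integral>x. g x H \<partial>lborel)" using gi[OF H] by (simp add: has_bochner_integral_iff)
    also have "\<dots> = (\<integral>x. ?E x \<partial>lborel)"
      using gi[OF H] E ae by (intro integral_cong_AE) (auto simp: has_bochner_integral_iff)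
    also have "\<dots> = (trace (?jR ** ?H0 ** ?jR ** W0) - e0 * trace (?jR ** ?H0)) / 2 +
         ((trace (?iR ** H ** ?iR ** W1) - e1 * trace (?iR ** H)) / 2 -
          (trace (?jR ** ?H0 ** ?jR ** W1) - e1 * trace (?jR ** ?H0)) / 2)"
      using E by (simp add: has_bochner_integral_iff)
    also have "\<dots> = trace (M_mat b \<Phi> R ** H)"
      unfolding M_mat_def Let_def W0_def[symmetric] W1_def[symmetric] e0_def[symmetric] e1_def[symmetric]
        trace_block_sandwich[OF R] trace_sandwich[OF R, of H] trace_lincomb
      by (simp add: field_simps)
    finally show ?thesis .
  qed
  with D' show ?thesis by (rule that)
qed

section \<open>The matrix M for two divergences\<close>

lemma mvn_has_integral_density:
  assumes S: "S \<in> pd_mats" and g: "g \<in> borel_measurable borel"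
  shows "has_bochner_integral (mvn S) g I \<longleftrightarrow> has_bochner_integral lborel (\<lambda>x. gauss_pdf S x * g x :: real) I"
  unfolding has_bochner_integral_iff mvn_integral_density[OF S g] ..

text \<open>
  Moments with a weight that is itself a ratio of normal densities are moments of another normal law.
\<close>

lemma mvn_change_density:
  assumes S: "S \<in> pd_mats" and T: "T \<in> pd_mats" and [measurable]: "w \<in> borel_measurable borel" "g \<in> borel_measurable borel"
    and w: "\<And>x. gauss_pdf S x * w x = h * gauss_pdf T x"
    and g: "has_bochner_integral (mvn T) g I"
  shows "has_bochner_integral (mvn S) (\<lambda>x. w x * g x :: real) (h * I)"
proof -
  have "has_bochner_integral lborel (\<lambda>x. h * (gauss_pdf T x * g x)) (h * I)"
    using g by (intro has_bochner_integral_mult_right) (simp add: mvn_has_integral_density[OF T])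
  moreover have "h * (gauss_pdf T x * g x) = gauss_pdf S x * (w x * g x)" for x
    using w[of x] by (metis mult.assoc)
  ultimately show ?thesis by (simp add: mvn_has_integral_density[OF S])
qed

lemma mvn_total:
  assumes "S \<in> pd_mats" shows "has_bochner_integral (mvn S) (\<lambda>x. 1 :: real) 1"
proof -
  interpret prob_space "mvn S" by (rule prob_space_mvn[OF assms])
  show ?thesis using prob_space by (simp add: has_bochner_integral_iff)
qed

lemma weighted_second_moment_eqI:
  assumes "\<And>a c. has_bochner_integral N (\<lambda>x. f x * (x $ a * x $ c)) (V $ a $ c)"
  shows "weighted_second_moment N f = V"
  using assms by (simp add: weighted_second_moment_def vec_eq_iff has_bochner_integral_iff)

lemma mvn_quad_form_second_moment:
  fixes R B :: "real ^ 'q::finite ^ 'q"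
  assumes R: "R \<in> pd_mats" and B: "transpose B = B"
  shows "has_bochner_integral (mvn R) (\<lambda>x. (x \<bullet> (B *v x)) * (x $ a * x $ c))
    (trace (B ** R) * R $ a $ c + 2 * (R ** B ** R) $ a $ c)"
proof -
  note Rs = pd_sym_nth[OF R]
  have Bs: "B $ d $ e = B $ e $ d" for d e using B by (metis transpose_def vec_lambda_beta)
  have eq: "(x \<bullet> (B *v x)) * (x $ a * x $ c) = (\<Sum>d\<in>UNIV. \<Sum>e\<in>UNIV. B $ d $ e * (x $ a * x $ c * x $ d * x $ e))" for x
    by (simp add: inner_vec_def matrix_vector_mult_def sum_distrib_left sum_distrib_right mult_ac)
  have 0: "has_bochner_integral (mvn R) (\<lambda>x. (x \<bullet> (B *v x)) * (x $ a * x $ c))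
     (\<Sum>d\<in>UNIV. \<Sum>e\<in>UNIV. B $ d $ e * (R $ a $ c * R $ d $ e + R $ a $ d * R $ c $ e + R $ a $ e * R $ c $ d))"
    unfolding eq by (intro has_bochner_integral_sum has_bochner_integral_mult_right mvn_fourth_moment[OF R])
  have 1: "(\<Sum>d\<in>UNIV. \<Sum>e\<in>UNIV. B $ d $ e * (R $ a $ c * R $ d $ e)) = trace (B ** R) * R $ a $ c"
  proof -
    have "trace (B ** R) = (\<Sum>d\<in>UNIV. \<Sum>e\<in>UNIV. B $ d $ e * R $ d $ e)"
      unfolding trace_def matrix_matrix_mult_def by (simp, intro sum.cong refl arg_cong2[of _ _ _ _ "(*)"] Rs)
    then show ?thesis by (simp add: sum_distrib_left sum_distrib_right mult_ac)
  qed
  have 2: "(\<Sum>d\<in>UNIV. \<Sum>e\<in>UNIV. B $ d $ e * (R $ a $ d * R $ c $ e)) = (R ** B ** R) $ a $ c" for a c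
  proof -
    have "(R ** B ** R) $ a $ c = (\<Sum>e\<in>UNIV. \<Sum>d\<in>UNIV. R $ a $ d * B $ d $ e * R $ e $ c)"
      by (simp add: matrix_matrix_mult_def sum_distrib_right)
    also have "\<dots> = (\<Sum>d\<in>UNIV. \<Sum>e\<in>UNIV. R $ a $ d * B $ d $ e * R $ e $ c)" by (rule sum.swap)
    also have "\<dots> = (\<Sum>d\<in>UNIV. \<Sum>e\<in>UNIV. B $ d $ e * (R $ a $ d * R $ c $ e))"
    proof (intro sum.cong refl)
      fix d e
      show "R $ a $ d * B $ d $ e * R $ e $ c = B $ d $ e * (R $ a $ d * R $ c $ e)" unfolding Rs[of e c] by simp
    qed
    finally show ?thesis by simp
  qed
  have 3: "(\<Sum>d\<in>UNIV. \<Sum>e\<in>UNIV. B $ d $ e * (R $ a $ e * R $ c $ d)) = (R ** B ** R) $ a $ c"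
  proof -
    have "(\<Sum>d\<in>UNIV. \<Sum>e\<in>UNIV. B $ d $ e * (R $ a $ e * R $ c $ d)) = (\<Sum>e\<in>UNIV. \<Sum>d\<in>UNIV. B $ d $ e * (R $ a $ e * R $ c $ d))" by (rule sum.swap)
    also have "\<dots> = (\<Sum>e\<in>UNIV. \<Sum>d\<in>UNIV. B $ e $ d * (R $ a $ e * R $ c $ d))"
      by (intro sum.cong refl arg_cong2[of _ _ _ _ "(*)"] Bs)
    finally show ?thesis unfolding 2 .
  qed
  show ?thesis using 0 by (simp only: distrib_left sum.distrib 1 2 3) (simp add: algebra_simps)
qed

lemma density_ratio_exp:
  fixes R :: "real ^ 'q::finite ^ 'q" and b :: "'q \<Rightarrow> 'k::finite"
  assumes R: "R \<in> pd_mats"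
  defines "\<kappa> \<equiv> ln (sqrt (det (block_diag b R)) / sqrt (det R))"
  shows "density_ratio b R x = exp (\<kappa> - (x \<bullet> ((matrix_inv R - matrix_inv (block_diag b R)) *v x)) / 2)"
proof -
  have "0 < det R" "0 < det (block_diag b R)"
    using pd_matrix_inv(1)[OF R] pd_matrix_inv(1)[OF block_diag_pd[OF R]] .
  then have C: "0 < sqrt (det (block_diag b R)) / sqrt (det R)" by simp
  have "exp (ln C - q / 2) = C * exp (- q / 2)" if "0 < C" for C q :: real
    using that by (simp add: exp_diff exp_minus inverse_eq_divide)
  from this[OF C] show ?thesis
    unfolding density_ratio_def prod_sqrt_block_det \<kappa>_def by (rule sym)
qed

text \<open>
  \<open>R\<close> and \<open>R\<^sub>0\<close> have the same diagonal blocks, hence the same trace against \<open>R\<^sub>0\<^sup>-\<^sup>1\<close>.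
\<close>

lemma trace_block_inverse:
  fixes R :: "real ^ 'q::finite ^ 'q" and b :: "'q \<Rightarrow> 'k::finite"
  assumes R: "R \<in> pd_mats"
  shows "trace ((matrix_inv R - matrix_inv (block_diag b R)) ** R) = 0"
proof -
  have R0: "block_diag b R \<in> pd_mats" by (rule block_diag_pd[OF R])
  have "trace (matrix_inv (block_diag b R) ** R) = trace (matrix_inv (block_diag b R) ** block_diag b R)"
    by (rule trace_block_sandwich(2)[OF R, symmetric])
  then show ?thesis
    by (simp add: trace_lincomb matrix_inv_mult[OF pd_matrix_inv(2)[OF R]] matrix_inv_mult[OF pd_matrix_inv(2)[OF R0]])
qed

lemma transpose_inverse_difference:
  fixes R :: "real ^ 'q::finite ^ 'q" and b :: "'q \<Rightarrow> 'k::finite"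
  assumes R: "R \<in> pd_mats"
  shows "transpose (matrix_inv R - matrix_inv (block_diag b R)) = matrix_inv R - matrix_inv (block_diag b R)"
  by (simp add: transpose_lincomb pd_matrix_inv(4)[OF R] pd_matrix_inv(4)[OF block_diag_pd[OF R]])

text \<open>
  Under \<open>N(0, R)\<close> the logarithm of the density ratio is a constant minus a quadratic form of mean \<open>0\<close>.
\<close>

lemma log_ratio_moments:
  fixes R :: "real ^ 'q::finite ^ 'q" and b :: "'q \<Rightarrow> 'k::finite"
  assumes R: "R \<in> pd_mats"
  defines "\<kappa> \<equiv> ln (sqrt (det (block_diag b R)) / sqrt (det R))"
    and "B \<equiv> matrix_inv R - matrix_inv (block_diag b R)"
  shows "has_bochner_integral (mvn R) (\<lambda>x. ln (density_ratio b R x)) \<kappa>"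
    "has_bochner_integral (mvn R) (\<lambda>x. ln (density_ratio b R x) * (x $ a * x $ c)) ((\<kappa> *\<^sub>R R - R ** B ** R) $ a $ c)"
proof -
  have ln: "ln (density_ratio b R x) = \<kappa> - (x \<bullet> (B *v x)) / 2" for x
    unfolding density_ratio_exp[OF R] \<kappa>_def B_def by simp
  have t: "transpose B = B" unfolding B_def by (rule transpose_inverse_difference[OF R])
  have tr: "trace (B ** R) = 0" unfolding B_def by (rule trace_block_inverse[OF R])
  have "has_bochner_integral (mvn R) (\<lambda>x. \<kappa> * 1 - (1 * (x \<bullet> (B *v x))) / 2) (\<kappa> * 1 - trace (B ** R) / 2)"
    using weighted_quad_form[of "mvn R" "\<lambda>_. 1" R B] mvn_second_moment[OF R]
    by (intro has_bochner_integral_diff has_bochner_integral_mult_right has_bochner_integral_divide_zero mvn_total[OF R]) simp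
  then show "has_bochner_integral (mvn R) (\<lambda>x. ln (density_ratio b R x)) \<kappa>" by (simp add: ln tr)
  have "has_bochner_integral (mvn R) (\<lambda>x. \<kappa> * (x $ a * x $ c) - ((x \<bullet> (B *v x)) * (x $ a * x $ c)) / 2)
      (\<kappa> * R $ a $ c - (trace (B ** R) * R $ a $ c + 2 * (R ** B ** R) $ a $ c) / 2)"
    by (intro has_bochner_integral_diff has_bochner_integral_mult_right has_bochner_integral_divide_zero
        mvn_second_moment[OF R] mvn_quad_form_second_moment[OF R t])
  then show "has_bochner_integral (mvn R) (\<lambda>x. ln (density_ratio b R x) * (x $ a * x $ c)) ((\<kappa> *\<^sub>R R - R ** B ** R) $ a $ c)"
    by (simp add: ln tr left_diff_distrib)
qed

lemma gauss_dep_mvn: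
  assumes R: "R \<in> pd_mats" and m: "(\<lambda>x. \<Phi> (density_ratio b R x)) \<in> borel_measurable borel"
  shows "gauss_dep b \<Phi> R = (\<integral>x. \<Phi> (density_ratio b R x) \<partial>mvn (block_diag b R))"
  unfolding gauss_dep_def dep_integrand_eq mvn_integral_density(2)[OF block_diag_pd[OF R] m] ..

lemma gauss_dep_t_ln_t:
  fixes R :: "real ^ 'q::finite ^ 'q" and b :: "'q \<Rightarrow> 'k::finite"
  assumes R: "R \<in> pd_mats"
  shows "gauss_dep b (\<lambda>t. t * ln t) R = ln (sqrt (det (block_diag b R)) / sqrt (det R))"
proof -
  note [measurable] = density_ratio_measurable[OF R, of b]
  have "has_bochner_integral (mvn (block_diag b R)) (\<lambda>x. density_ratio b R x * ln (density_ratio b R x)) (1 * ln (sqrt (det (block_diag b R)) / sqrt (det R)))"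
    by (rule mvn_change_density[OF block_diag_pd[OF R] R]) (auto simp: gauss_pdf_ratio[OF R] intro!: log_ratio_moments(1)[OF R])
  then show ?thesis by (subst gauss_dep_mvn[OF R]) (auto simp: has_bochner_integral_iff)
qed

lemma deriv_t_ln_t: "0 < t \<Longrightarrow> deriv (\<lambda>t :: real. t * ln t) t = 1 + ln t"
  by (rule DERIV_imp_deriv) (auto intro!: derivative_eq_intros)

lemma deriv_hellinger: "0 < t \<Longrightarrow> deriv (\<lambda>t :: real. (sqrt t - 1)\<^sup>2) t = 1 - 1 / sqrt t"
  by (rule DERIV_imp_deriv) (auto intro!: derivative_eq_intros simp: field_simps)

text \<open>
  Every moment in \<open>M\<close> is, after a change of density, a moment of \<open>ln k\<close> under \<open>N(0, R)\<close>.
\<close>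

lemma M_mat_t_ln_t:
  fixes R :: "real ^ 'q::finite ^ 'q" and b :: "'q \<Rightarrow> 'k::finite"
  assumes R: "R \<in> pd_mats"
  shows "M_mat b (\<lambda>t. t * ln t) R = - (1 / 2) *\<^sub>R (matrix_inv R - matrix_inv (block_diag b R))"
proof -
  let ?R0 = "block_diag b R"
  let ?iR = "matrix_inv R" and ?jR = "matrix_inv ?R0"
  let ?k = "density_ratio b R"
  have R0: "?R0 \<in> pd_mats" by (rule block_diag_pd[OF R])
  define \<kappa> where "\<kappa> = ln (sqrt (det ?R0) / sqrt (det R))"
  define B where "B = ?iR - ?jR"
  define V where "V = \<kappa> *\<^sub>R R - R ** B ** R"
  note [measurable] = density_ratio_measurable[OF R, of b]
  note lm = log_ratio_moments[OF R, of b, folded \<kappa>_def B_def, folded V_def]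
  have W0: "weighted_second_moment (mvn ?R0) (\<lambda>x. ?k x * ln (?k x)) = V"
  proof (rule weighted_second_moment_eqI)
    fix a c
    have "has_bochner_integral (mvn ?R0) (\<lambda>x. ?k x * (ln (?k x) * (x $ a * x $ c))) (1 * V $ a $ c)"
      by (rule mvn_change_density[OF R0 R]) (auto simp: gauss_pdf_ratio[OF R] intro!: lm(2))
    then show "has_bochner_integral (mvn ?R0) (\<lambda>x. ?k x * ln (?k x) * (x $ a * x $ c)) (V $ a $ c)" by (simp add: mult.assoc)
  qed
  have d: "deriv (\<lambda>t. t * ln t) (?k x) = 1 + ln (?k x)" for x by (rule deriv_t_ln_t[OF density_ratio_pos[OF R]])
  have W1: "weighted_second_moment (mvn R) (\<lambda>x. 1 + ln (?k x)) = R + V"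
  proof (rule weighted_second_moment_eqI)
    fix a c
    show "has_bochner_integral (mvn R) (\<lambda>x. (1 + ln (?k x)) * (x $ a * x $ c)) ((R + V) $ a $ c)"
      using has_bochner_integral_add[OF mvn_second_moment[OF R, of a c] lm(2)[of a c]] by (simp add: distrib_right)
  qed
  have e1: "(\<integral>x. 1 + ln (?k x) \<partial>mvn R) = 1 + \<kappa>"
    using has_bochner_integral_add[OF mvn_total[OF R] lm(1)] by (simp add: has_bochner_integral_iff)
  have i: "?iR ** R = mat 1" "R ** ?iR = mat 1" "?jR ** ?R0 = mat 1"
    using matrix_inv_mult[OF pd_matrix_inv(2)[OF R]] matrix_inv_mult[OF pd_matrix_inv(2)[OF R0]] by auto
  have RBR: "?iR ** (R ** B ** R) ** ?iR = B"
  proof -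
    have "?iR ** (R ** B ** R) ** ?iR = (?iR ** R) ** B ** (R ** ?iR)" by (simp only: matrix_mul_assoc)
    then show ?thesis by (simp add: i)
  qed
  have "M_mat b (\<lambda>t. t * ln t) R = (1 / 2) *\<^sub>R
      (?jR ** block_diag b V ** ?jR - \<kappa> *\<^sub>R ?jR - (1 + \<kappa>) *\<^sub>R B + ?iR ** (R + V) ** ?iR - ?jR ** block_diag b (R + V) ** ?jR)"
    by (simp only: M_mat_def Let_def d W0 W1 e1 gauss_dep_t_ln_t[OF R] \<kappa>_def[symmetric] B_def)
  also have "\<dots> = (1 / 2) *\<^sub>R (- ?jR - \<kappa> *\<^sub>R ?jR - (1 + \<kappa>) *\<^sub>R B + ?iR + \<kappa> *\<^sub>R ?iR - B)"
  proof -
    have "?iR ** (R + V) ** ?iR = ?iR + (\<kappa> *\<^sub>R ?iR - B)"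
      unfolding V_def matrix_distribs RBR by (simp add: i)
    then show ?thesis by (simp add: block_diag_add matrix_distribs i)
  qed
  also have "\<dots> = - (1 / 2) *\<^sub>R B"
    unfolding B_def by (simp add: vec_eq_iff field_simps)
  finally show ?thesis unfolding B_def .
qed

lemma pd_add: "A \<in> pd_mats \<Longrightarrow> B \<in> pd_mats \<Longrightarrow> A + B \<in> pd_mats"
  unfolding pd_mats_def cov_mats_def
  by (auto simp: transpose_lincomb matrix_vector_mult_add_rdistrib inner_add_right add_pos_pos)

lemma pd_scaleR: "A \<in> pd_mats \<Longrightarrow> 0 < r \<Longrightarrow> r *\<^sub>R A \<in> pd_mats"
  unfolding pd_mats_def cov_mats_def
  by (auto simp: transpose_lincomb scaleR_matrix_vector_assoc[symmetric])

lemma det_scaleR: "det (r *\<^sub>R A) = r ^ CARD('q) * det A" for A :: "real ^ 'q::finite ^ 'q"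
proof -
  have "r *\<^sub>R A = diag_mat (\<lambda>_. r) ** A"
  proof -
    have "diag_mat (\<lambda>_. r) = r *\<^sub>R (mat 1 :: real ^ 'q ^ 'q)" by (simp add: diag_mat_def mat_def vec_eq_iff)
    then show ?thesis by (simp add: matrix_distribs)
  qed
  then show ?thesis by (simp add: det_mul det_diag_mat)
qed

text \<open>
  The geometric mean of the two densities is \<open>h\<close> times a normal density whose precision matrix is the mean
  of \<open>R\<^sup>-\<^sup>1\<close> and \<open>R\<^sub>0\<^sup>-\<^sup>1\<close>.  All moments in \<open>M\<close> are moments of the three laws \<open>N(0, R)\<close>, \<open>N(0, R\<^sub>0)\<close> and \<open>N(0, Q)\<close>.
\<close>

lemma M_mat_hellinger:
  fixes R :: "real ^ 'q::finite ^ 'q" and b :: "'q \<Rightarrow> 'k::finite"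
  assumes R: "R \<in> pd_mats"
  defines "N \<equiv> mat 1 + matrix_inv (block_diag b R) ** R"
  shows "M_mat b (\<lambda>t. (sqrt t - 1)\<^sup>2) R =
       (2 powr (real CARD('q) / 2) * exp (- gauss_dep b (\<lambda>t. t * ln t) R / 2) / sqrt (det N)) *\<^sub>R
       (- (1 / 2) *\<^sub>R (matrix_inv R - matrix_inv (block_diag b R)) + matrix_inv N ** matrix_inv (block_diag b R) - gamma_mat b R)"
proof -
  let ?R0 = "block_diag b R"
  let ?iR = "matrix_inv R" and ?jR = "matrix_inv ?R0" and ?iN = "matrix_inv N"
  let ?k = "density_ratio b R"
  have R0: "?R0 \<in> pd_mats" by (rule block_diag_pd[OF R])
  have i: "?iR ** R = mat 1" "R ** ?iR = mat 1" "?jR ** ?R0 = mat 1"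
    using matrix_inv_mult[OF pd_matrix_inv(2)[OF R]] matrix_inv_mult[OF pd_matrix_inv(2)[OF R0]] by auto
  have dR: "0 < det R" "0 < det ?R0" using pd_matrix_inv(1)[OF R] pd_matrix_inv(1)[OF R0] .
  have NR: "N ** ?iR = ?iR + ?jR"
  proof -
    have "N ** ?iR = ?iR + ?jR ** (R ** ?iR)" by (simp add: N_def matrix_distribs matrix_mul_assoc)
    then show ?thesis by (simp add: i)
  qed
  \<comment> \<open>the precision matrix of the geometric mean of the two densities\<close>
  define P where "P = (1 / 2) *\<^sub>R (?iR + ?jR)"
  have P: "P \<in> pd_mats" unfolding P_def by (intro pd_scaleR pd_add pd_matrix_inv(3)[OF R] pd_matrix_inv(3)[OF R0]) simp
  define Q where "Q = matrix_inv P"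
  have Q: "Q \<in> pd_mats" unfolding Q_def by (rule pd_matrix_inv(3)[OF P])
  have iQ: "matrix_inv Q = P"
    by (rule matrix_inv_eqI) (simp add: Q_def matrix_inv_mult[OF pd_matrix_inv(2)[OF P]])
  have N': "N = 2 *\<^sub>R (P ** R)"
    by (simp add: P_def N_def matrix_distribs i)
  have detN: "det N = 2 ^ CARD('q) * (det P * det R)" unfolding N' det_scaleR det_mul ..
  have dP: "0 < det P" by (rule pd_matrix_inv(1)[OF P])
  have detN0: "0 < det N" unfolding detN using dP dR by simp
  have Ninv: "N ** ?iN = mat 1" "?iN ** N = mat 1"
    using matrix_inv_mult[of N] detN0 by (auto simp: invertible_det_nz)
  have QN: "Q = 2 *\<^sub>R (R ** ?iN)"
    unfolding Q_def
  proof (rule matrix_inv_eqI)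
    have "P ** (2 *\<^sub>R (R ** ?iN)) = (2 *\<^sub>R (P ** R)) ** ?iN" by (simp add: matrix_distribs matrix_mul_assoc)
    then show "P ** (2 *\<^sub>R (R ** ?iN)) = mat 1" unfolding N'[symmetric] Ninv .
  qed
  have detQ: "det Q * det P = 1"
    using det_mul[of Q P] by (simp add: Q_def matrix_inv_mult[OF pd_matrix_inv(2)[OF P]])
  \<comment> \<open>the integral of the geometric mean\<close>
  define h where "h = 2 powr (real CARD('q) / 2) * exp (- gauss_dep b (\<lambda>t. t * ln t) R / 2) / sqrt (det N)"
  define C where "C = sqrt (det ?R0) / sqrt (det R)"
  have C: "0 < C" using dR by (simp add: C_def)
  have h: "h = sqrt C * sqrt (det Q) / sqrt (det ?R0)"
  proof -
    have "exp (- gauss_dep b (\<lambda>t. t * ln t) R / 2) = 1 / sqrt C"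
    proof -
      have "- gauss_dep b (\<lambda>t. t * ln t) R / 2 = - (ln C * (1 / 2))"
        unfolding gauss_dep_t_ln_t[OF R] C_def by simp
      then show ?thesis using C by (simp add: powr_half_sqrt[symmetric] powr_def exp_minus field_simps)
    qed
    moreover have "2 powr (real CARD('q) / 2) = sqrt (2 ^ CARD('q))"
      by (simp add: powr_half_sqrt[symmetric] powr_realpow[symmetric] powr_powr)
    moreover have "sqrt (det N) = sqrt (2 ^ CARD('q)) * (sqrt (det P) * sqrt (det R))"
      unfolding detN by (simp add: real_sqrt_mult)
    moreover have "sqrt (det Q) = 1 / sqrt (det P)"
      using detQ dP by (simp add: real_sqrt_mult[symmetric] real_sqrt_divide[symmetric] field_simps)
    ultimately have "h = 1 / (sqrt C * (sqrt (det P) * sqrt (det R)))" "sqrt (det Q) = 1 / sqrt (det P)"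
      by (simp_all add: h_def)
    moreover have "1 / (sc * (p * r)) = sc * (1 / p) / r0" if "sc * sc = r0 / r" "0 < sc" "0 < p" "0 < r" "0 < r0" for sc p r r0 :: real
    proof -
      have "r0 = sc * sc * r" using that by simp
      then show ?thesis using that by (simp add: field_simps)
    qed
    ultimately show ?thesis using C dR dP by (simp add: C_def)
  qed
  have u: "gauss_pdf ?R0 x * sqrt (?k x) = h * gauss_pdf Q x" for x
  proof -
    let ?c = "(2 * pi) powr (real CARD('q) / 2)"
    let ?a = "x \<bullet> (?iR *v x)" and ?d = "x \<bullet> (?jR *v x)"
    have "?k x = C * exp (- (?a - ?d) / 2)"
      by (simp add: density_ratio_def prod_sqrt_block_det C_def matrix_vector_mult_diff_rdistrib inner_diff_right)
    then have k1: "sqrt (?k x) = sqrt C * exp (- (?a - ?d) / 4)"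
    proof -
      have "exp (- (?a - ?d) / 2) = (exp (- (?a - ?d) / 4))\<^sup>2" by (simp add: power2_eq_square exp_add[symmetric])
      then show ?thesis using \<open>?k x = _\<close> by (simp add: real_sqrt_mult)
    qed
    have k2: "gauss_pdf ?R0 x = exp (- ?d / 2) / (?c * sqrt (det ?R0))" by (simp add: gauss_pdf_def)
    have k3: "gauss_pdf Q x = exp (- (?a + ?d) / 4) / (?c * sqrt (det Q))"
    proof -
      have xP: "x \<bullet> (P *v x) = (?a + ?d) / 2"
        by (simp add: P_def scaleR_matrix_vector_assoc[symmetric] matrix_vector_mult_add_rdistrib inner_add_right)
      have e: "- ((s + t) / 2) / 2 = - (s + t) / 4" for s t :: real by linarith
      show ?thesis unfolding gauss_pdf_def iQ xP e ..
    qed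
    have k4: "exp (- ?d / 2) * exp (- (?a - ?d) / 4) = exp (- (?a + ?d) / 4)"
    proof -
      have "exp (- t / 2) * exp (- (s - t) / 4) = exp (- (s + t) / 4)" for s t :: real
      proof -
        have "- t / 2 + - (s - t) / 4 = - (s + t) / 4" by (simp add: add_divide_distrib diff_divide_distrib)
        then show ?thesis by (simp only: exp_add[symmetric])
      qed
      then show ?thesis .
    qed
    have k5: "0 < sqrt (det Q)" using pd_matrix_inv(1)[OF Q] by simp
    have "E1 / (c * r0) * (sc * E2) = (sc * sq / r0) * (E3 / (c * sq))" if "E1 * E2 = E3" "0 < sq" for E1 E2 E3 c r0 sc sq :: real
      using that by (auto simp: mult_ac)
    from this[OF k4 k5] show ?thesis unfolding h k1 k2 k3 .
  qed
  have u': "gauss_pdf R x * (1 / sqrt (?k x)) = h * gauss_pdf Q x" for x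
  proof -
    have k: "0 < ?k x" by (rule density_ratio_pos[OF R])
    have "gauss_pdf R x * (1 / sqrt (?k x)) = gauss_pdf ?R0 x * (?k x / sqrt (?k x))"
      unfolding gauss_pdf_ratio[OF R, of b, symmetric] by simp
    also have "?k x / sqrt (?k x) = sqrt (?k x)" using k by (intro real_div_sqrt) simp
    finally show ?thesis unfolding u .
  qed
  note [measurable] = density_ratio_measurable[OF R, of b]
  have sq: "(sqrt (?k x) - 1)\<^sup>2 = ?k x - 2 * sqrt (?k x) + 1" for x
    using density_ratio_pos[OF R, of b x] by (simp add: power2_diff)
  have m0: "has_bochner_integral (mvn ?R0) (\<lambda>x. (sqrt (?k x) - 1)\<^sup>2 * g x) (1 * IR - 2 * (h * IQ) + I0)"
    if [measurable]: "g \<in> borel_measurable borel" and "has_bochner_integral (mvn R) g IR" "has_bochner_integral (mvn Q) g IQ" "has_bochner_integral (mvn ?R0) g I0" for g IR IQ I0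
  proof -
    have 1: "has_bochner_integral (mvn ?R0) (\<lambda>x. ?k x * g x) (1 * IR)"
      by (rule mvn_change_density[OF R0 R]) (auto simp: gauss_pdf_ratio[OF R] that)
    have 2: "has_bochner_integral (mvn ?R0) (\<lambda>x. sqrt (?k x) * g x) (h * IQ)"
      by (rule mvn_change_density[OF R0 Q]) (auto simp: u that)
    have "has_bochner_integral (mvn ?R0) (\<lambda>x. ?k x * g x - 2 * (sqrt (?k x) * g x) + g x) (1 * IR - 2 * (h * IQ) + I0)"
      by (intro has_bochner_integral_add has_bochner_integral_diff has_bochner_integral_mult_right 1 2 that)
    then show ?thesis unfolding sq by (simp add: distrib_right left_diff_distrib mult.assoc)
  qed
  have m1: "has_bochner_integral (mvn R) (\<lambda>x. (1 - 1 / sqrt (?k x)) * g x) (IR - h * IQ)"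
    if [measurable]: "g \<in> borel_measurable borel" and "has_bochner_integral (mvn R) g IR" "has_bochner_integral (mvn Q) g IQ" for g IR IQ
  proof -
    have 2: "has_bochner_integral (mvn R) (\<lambda>x. 1 / sqrt (?k x) * g x) (h * IQ)"
      by (rule mvn_change_density[OF R Q]) (use u' that in auto)
    show ?thesis using has_bochner_integral_diff[OF that(2) 2] by (simp add: left_diff_distrib)
  qed
  have W0: "weighted_second_moment (mvn ?R0) (\<lambda>x. (sqrt (?k x) - 1)\<^sup>2) = R - (2 * h) *\<^sub>R Q + ?R0"
  proof (rule weighted_second_moment_eqI)
    fix a c
    show "has_bochner_integral (mvn ?R0) (\<lambda>x. (sqrt (?k x) - 1)\<^sup>2 * (x $ a * x $ c)) ((R - (2 * h) *\<^sub>R Q + ?R0) $ a $ c)"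
      using m0[OF _ mvn_second_moment[OF R, of a c] mvn_second_moment[OF Q, of a c] mvn_second_moment[OF R0, of a c]] by (simp add: mult.assoc)
  qed
  have W1: "weighted_second_moment (mvn R) (\<lambda>x. 1 - 1 / sqrt (?k x)) = R - h *\<^sub>R Q"
  proof (rule weighted_second_moment_eqI)
    fix a c
    show "has_bochner_integral (mvn R) (\<lambda>x. (1 - 1 / sqrt (?k x)) * (x $ a * x $ c)) ((R - h *\<^sub>R Q) $ a $ c)"
      using m1[OF _ mvn_second_moment[OF R, of a c] mvn_second_moment[OF Q, of a c]] by simp
  qed
  have e1: "(\<integral>x. 1 - 1 / sqrt (?k x) \<partial>mvn R) = 1 - h"
    using m1[OF _ mvn_total[OF R] mvn_total[OF Q]] by (simp add: has_bochner_integral_iff)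
  have gd: "gauss_dep b (\<lambda>t. (sqrt t - 1)\<^sup>2) R = 2 - 2 * h"
    using m0[OF _ mvn_total[OF R] mvn_total[OF Q] mvn_total[OF R0]]
    by (subst gauss_dep_mvn[OF R]) (auto simp: has_bochner_integral_iff)
  have d: "deriv (\<lambda>t. (sqrt t - 1)\<^sup>2) (?k x) = 1 - 1 / sqrt (?k x)" for x
    by (rule deriv_hellinger[OF density_ratio_pos[OF R]])
  define G where "G = ?jR ** block_diag b Q ** ?jR"
  have gam: "gamma_mat b R = (1 / 2) *\<^sub>R G"
    by (simp add: gamma_mat_def Let_def G_def QN N_def[symmetric] block_diag_scaleR matrix_distribs)
  have iQi: "?iR ** Q ** ?iR = 2 *\<^sub>R (?iN ** ?iR)"
  proof -
    have "?iR ** Q ** ?iR = 2 *\<^sub>R ((?iR ** R) ** ?iN ** ?iR)" by (simp add: QN matrix_distribs matrix_mul_assoc)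
    then show ?thesis by (simp add: i)
  qed
  have key: "?iR = ?iN ** ?iR + ?iN ** ?jR"
  proof -
    have "?iN ** (N ** ?iR) = ?iR" by (simp add: matrix_mul_assoc Ninv)
    then show ?thesis unfolding NR by (simp add: matrix_distribs)
  qed
  have "M_mat b (\<lambda>t. (sqrt t - 1)\<^sup>2) R = (1 / 2) *\<^sub>R
      (?jR ** block_diag b (R - (2 * h) *\<^sub>R Q + ?R0) ** ?jR - (2 - 2 * h) *\<^sub>R ?jR - (1 - h) *\<^sub>R (?iR - ?jR)
        + ?iR ** (R - h *\<^sub>R Q) ** ?iR - ?jR ** block_diag b (R - h *\<^sub>R Q) ** ?jR)"
    by (simp only: M_mat_def Let_def d W0 W1 e1 gd)
  also have "\<dots> = (1 / 2) *\<^sub>R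
      ((?jR - (2 * h) *\<^sub>R G + ?jR) - (2 - 2 * h) *\<^sub>R ?jR - (1 - h) *\<^sub>R (?iR - ?jR)
        + (?iR - h *\<^sub>R (2 *\<^sub>R (?iN ** ?iR))) - (?jR - h *\<^sub>R G))"
  proof -
    have "?jR ** block_diag b (R - (2 * h) *\<^sub>R Q + ?R0) ** ?jR = ?jR - (2 * h) *\<^sub>R G + ?jR"
        "?jR ** block_diag b (R - h *\<^sub>R Q) ** ?jR = ?jR - h *\<^sub>R G"
      by (simp_all only: block_diag_add block_diag_diff block_diag_scaleR block_diag_idem matrix_distribs i matrix_mul_lid G_def)
    moreover have "?iR ** (R - h *\<^sub>R Q) ** ?iR = ?iR - h *\<^sub>R (2 *\<^sub>R (?iN ** ?iR))"
      unfolding iQi[symmetric] by (simp only: matrix_distribs i matrix_mul_lid)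
    ultimately show ?thesis by (simp only:)
  qed
  also have "\<dots> = h *\<^sub>R (- (1 / 2) *\<^sub>R (?iR - ?jR) + ?iN ** ?jR - (1 / 2) *\<^sub>R G)"
  proof -
    define X where "X = ?iN ** ?iR"
    have X: "?iN ** ?jR = ?iR - X" using key unfolding X_def by (metis add_diff_cancel_left')
    show ?thesis unfolding X X_def[symmetric] by (simp add: vec_eq_iff field_simps)
  qed
  finally show ?thesis unfolding gam h_def .
qed

section \<open>The standard normal quantile function\<close>

abbreviation "Gcdf \<equiv> cdf std_normal_distribution"

interpretation SN: real_distribution std_normal_distribution
  by (rule real_dist_normal_dist)

lemma std_density_le: "0 < std_normal_density x"
  by (simp add: std_normal_density_def)

lemma Gcdf_diff:
  assumes "a \<le> x"
  shows "Gcdf x = Gcdf a + integral {a..x} std_normal_density"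
proof -
  have i: "set_integrable lborel A std_normal_density" if "A \<in> sets borel" for A
    unfolding set_integrable_def using that by (intro integrable_mult_indicator) auto
  have "Gcdf x - Gcdf a = measure std_normal_distribution {a<..x}"
    using assms by (cases "a = x") (auto simp: SN.cdf_diff_eq)
  also have "\<dots> = (LINT y:{a<..x}|lborel. std_normal_density y)"
  proof -
    have "emeasure std_normal_distribution {a<..x} = (\<integral>\<^sup>+y. ennreal (indicator {a<..x} y * std_normal_density y) \<partial>lborel)"
      by (subst emeasure_density) (auto intro!: nn_integral_cong simp: indicator_def)
    also have "\<dots> = ennreal (LINT y|lborel. indicator {a<..x} y * std_normal_density y)"
      using i[of "{a<..x}"] by (intro nn_integral_eq_integral) (auto simp: set_integrable_def indicator_def)
    finally show ?thesis
      by (simp add: measure_def set_lebesgue_integral_def integral_nonneg_AE)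
  qed
  also have "\<dots> = (LINT y:{a..x}|lborel. std_normal_density y)"
    by (rule set_integral_cong_set) (auto simp: set_borel_measurable_def AE_I' intro!: AE_I[of _ _ "{a}"])
  also have "\<dots> = integral {a..x} std_normal_density"
    by (rule set_borel_integral_eq_integral(2)) (rule i, simp)
  finally show ?thesis by simp
qed

lemma Gcdf_DERIV: "(Gcdf has_real_derivative std_normal_density x) (at x)"
proof -
  have "((\<lambda>u. integral {x - 1..u} std_normal_density) has_real_derivative std_normal_density x) (at x within {x - 1..x + 1})"
    by (rule integral_has_real_derivative) (auto simp: std_normal_density_def intro!: continuous_intros)
  then have "((\<lambda>u. Gcdf (x - 1) + integral {x - 1..u} std_normal_density) has_real_derivative std_normal_density x) (at x within {x - 1..x + 1})"
    by (auto intro!: derivative_eq_intros)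
  then have "(Gcdf has_real_derivative std_normal_density x) (at x within {x - 1..x + 1})"
    by (rule has_field_derivative_transform_within[where d=1]) (auto intro!: Gcdf_diff[symmetric])
  moreover have "at x within {x - 1..x + 1} = at x"
    by (rule at_within_interior) auto
  ultimately show ?thesis by simp
qed

lemma Gcdf_strict_mono: "x < y \<Longrightarrow> Gcdf x < Gcdf y"
  by (rule DERIV_pos_imp_increasing) (auto intro!: exI[of _ "std_normal_density _"] Gcdf_DERIV std_density_le)

lemma Gcdf_less_iff [simp]: "Gcdf x < Gcdf y \<longleftrightarrow> x < y" and Gcdf_le_iff [simp]: "Gcdf x \<le> Gcdf y \<longleftrightarrow> x \<le> y"
  using Gcdf_strict_mono[of x y] Gcdf_strict_mono[of y x] by (cases x y rule: linorder_cases; auto)+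

lemma Gcdf_bounds: "0 < Gcdf x" "Gcdf x < 1"
proof -
  have "0 \<le> Gcdf (x - 1)" by (rule SN.cdf_nonneg)
  also have "\<dots> < Gcdf x" by simp
  finally show "0 < Gcdf x" .
  have "Gcdf x < Gcdf (x + 1)" by simp
  also have "\<dots> \<le> 1" by (rule SN.cdf_bounded_prob)
  finally show "Gcdf x < 1" .
qed

lemma Gcdf_isCont: "isCont Gcdf x"
  using Gcdf_DERIV DERIV_isCont by blast

lemma quantile_Gcdf [simp]: "std_normal_quantile (Gcdf x) = x"
proof -
  have "{y. Gcdf x \<le> Gcdf y} = {x..}" by auto
  then show ?thesis by (simp add: std_normal_quantile_def)
qed

lemma Gcdf_surj:
  assumes "0 < u" "u < 1"
  obtains x where "Gcdf x = u"
proof -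
  have "eventually (\<lambda>x. Gcdf x < u) at_bot"
    using SN.cdf_lim_at_bot assms by (auto dest: order_tendstoD(2))
  then obtain a where a: "Gcdf a < u" by (auto simp: eventually_at_bot_linorder)
  have "eventually (\<lambda>x. u < Gcdf x) at_top"
    using SN.cdf_lim_at_top_prob assms by (auto dest: order_tendstoD(1))
  then obtain c where c: "u < Gcdf c" by (auto simp: eventually_at_top_linorder)
  have "a \<le> c" using a c by (metis Gcdf_le_iff less_imp_le less_trans)
  then have "\<exists>x\<ge>a. x \<le> c \<and> Gcdf x = u"
    using a c by (intro IVT) (auto simp: Gcdf_isCont)
  then show ?thesis using that by blast
qed

lemma Gcdf_quantile: "0 < u \<Longrightarrow> u < 1 \<Longrightarrow> Gcdf (std_normal_quantile u) = u"
  by (rule Gcdf_surj[of u]) auto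

lemma quantile_mono: "0 < u \<Longrightarrow> u \<le> v \<Longrightarrow> v < 1 \<Longrightarrow> std_normal_quantile u \<le> std_normal_quantile v"
  using Gcdf_quantile[of u] Gcdf_quantile[of v] by (subst Gcdf_le_iff[symmetric]) auto

lemma std_normal_quantile_measurable [measurable]: "std_normal_quantile \<in> borel_measurable borel"
proof -
  have "mono_on {0<..<1} std_normal_quantile"
    by (auto intro!: mono_onI quantile_mono)
  then have "std_normal_quantile \<in> borel_measurable (restrict_space borel {0<..<1})"
    by (rule borel_measurable_mono_on_fnc)
  then have m: "(\<lambda>u. if u \<in> {0<..<1} then std_normal_quantile u else 0) \<in> borel_measurable borel"
    by (subst (asm) measurable_restrict_space_iff[of _ _ 0]) auto
  have "{x. u \<le> Gcdf x} = UNIV" if "u \<le> 0" for u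
    using Gcdf_bounds(1) that by (auto intro: order.trans less_imp_le)
  then have lo: "std_normal_quantile u = std_normal_quantile 0" if "u \<le> 0" for u
    using that by (simp add: std_normal_quantile_def)
  have "{x. u \<le> Gcdf x} = {}" if "1 \<le> u" for u
    using Gcdf_bounds(2) that by (auto simp: not_le intro: less_le_trans)
  then have hi: "std_normal_quantile u = std_normal_quantile 1" if "1 \<le> u" for u
    using that by (simp add: std_normal_quantile_def)
  have eq: "std_normal_quantile = (\<lambda>u. if u \<le> 0 then std_normal_quantile 0 else if 1 \<le> u then std_normal_quantile 1
      else if u \<in> {0<..<1} then std_normal_quantile u else 0)"
  proof
    fix u :: real
    show "std_normal_quantile u = (if u \<le> 0 then std_normal_quantile 0 else if 1 \<le> u then std_normal_quantile 1
      else if u \<in> {0<..<1} then std_normal_quantile u else 0)"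
      using lo[of u] hi[of u] by simp
  qed
  show ?thesis
    by (subst eq) (intro measurable_If m, auto)
qed

lemma Gcdf_upper_tail: "1 - Gcdf x = measure std_normal_distribution {x<..}"
proof -
  have "measure std_normal_distribution {x<..} = 1 - measure std_normal_distribution {..x}"
    using SN.prob_compl[of "{..x}"] by (simp add: Compl_atMost[symmetric] Compl_eq_Diff_UNIV)
  then show ?thesis by (simp add: cdf_def)
qed

text \<open>
  Since \<open>(x + t)\<^sup>2 \<ge> x\<^sup>2 + t\<^sup>2\<close> for \<open>t > 0\<close>, the tail has at most \<open>exp (- x\<^sup>2 / 2)\<close> times the total mass.
\<close>

lemma upper_tail_le:
  assumes "0 \<le> x"
  shows "1 - Gcdf x \<le> sqrt (2 * pi) * std_normal_density x"
proof -
  have "emeasure std_normal_distribution {x<..} = (\<integral>\<^sup>+y. ennreal (std_normal_density y) * indicator {x<..} y \<partial>lborel)"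
    by (subst emeasure_density) auto
  also have "\<dots> = (\<integral>\<^sup>+t. ennreal (std_normal_density (x + 1 * t)) * indicator {x<..} (x + 1 * t) \<partial>lborel)"
    by (subst nn_integral_real_affine[of _ 1 x]) auto
  also have "\<dots> \<le> (\<integral>\<^sup>+t. ennreal (sqrt (2 * pi) * std_normal_density x) * ennreal (std_normal_density t) \<partial>lborel)"
  proof (rule nn_integral_mono)
    fix t :: real
    have "std_normal_density (x + t) \<le> sqrt (2 * pi) * std_normal_density x * std_normal_density t" if "0 < t"
    proof -
      have "- (x + t)\<^sup>2 / 2 \<le> - x\<^sup>2 / 2 + - t\<^sup>2 / 2"
      proof -
        have "0 \<le> x * t" using that assms by simp
        then have "x\<^sup>2 + t\<^sup>2 \<le> (x + t)\<^sup>2" by (simp add: power2_sum algebra_simps)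
        then show ?thesis by linarith
      qed
      then have "exp (- (x + t)\<^sup>2 / 2) \<le> exp (- x\<^sup>2 / 2) * exp (- t\<^sup>2 / 2)"
        by (simp flip: exp_add)
      then show ?thesis by (simp add: std_normal_density_def divide_right_mono)
    qed
    then show "ennreal (std_normal_density (x + 1 * t)) * indicator {x<..} (x + 1 * t) \<le>
      ennreal (sqrt (2 * pi) * std_normal_density x) * ennreal (std_normal_density t)"
      by (auto simp: indicator_def ennreal_mult''[symmetric] intro!: ennreal_leI)
  qed
  also have "\<dots> = ennreal (sqrt (2 * pi) * std_normal_density x) * emeasure std_normal_distribution UNIV"
    by (subst nn_integral_cmult) (auto simp: emeasure_density)
  also have "emeasure std_normal_distribution UNIV = 1"
    using SN.emeasure_space_1 by simp
  finally have "emeasure std_normal_distribution {x<..} \<le> ennreal (sqrt (2 * pi) * std_normal_density x)" by simp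
  then show ?thesis
    unfolding Gcdf_upper_tail by (simp add: SN.emeasure_eq_measure)
qed

lemma std_normal_density_uminus: "std_normal_density (- x) = std_normal_density x"
  by (simp add: std_normal_density_def)

lemma Gcdf_uminus: "Gcdf (- x) = 1 - Gcdf x"
proof -
  have "((\<lambda>x. Gcdf (- x) + Gcdf x) has_real_derivative 0) (at x)" for x
  proof -
    have "((\<lambda>x. Gcdf (- x)) has_real_derivative std_normal_density (- x) * (- 1)) (at x)"
      by (rule DERIV_chain'[of uminus "- 1" x UNIV, OF _ Gcdf_DERIV]) (auto intro!: derivative_eq_intros)
    from DERIV_add[OF this Gcdf_DERIV] show ?thesis by (simp add: std_normal_density_uminus)
  qed
  then have c: "Gcdf (- x) + Gcdf x = Gcdf (- y) + Gcdf y" for x y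
    using DERIV_isconst_all[of "\<lambda>x. Gcdf (- x) + Gcdf x" x y] by blast
  have "((\<lambda>y. Gcdf (- y) + Gcdf y) \<longlongrightarrow> 0 + 1) at_top"
    by (intro tendsto_add SN.cdf_lim_at_top_prob filterlim_compose[OF SN.cdf_lim_at_bot filterlim_uminus_at_bot_at_top])
  moreover have "((\<lambda>y. Gcdf (- y) + Gcdf y) \<longlongrightarrow> Gcdf (- x) + Gcdf x) at_top"
  proof -
    have "(\<lambda>y. Gcdf (- y) + Gcdf y) = (\<lambda>y. Gcdf (- x) + Gcdf x)" by (rule ext) (rule c)
    then show ?thesis by simp
  qed
  ultimately have "Gcdf (- x) + Gcdf x = 0 + 1"
    using tendsto_unique trivial_limit_at_top_linorder by blast
  then show ?thesis by simp
qed

text \<open>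
  Both tails of the standard normal law are dominated by its density.
\<close>

lemma Gcdf_product_le: "Gcdf x * (1 - Gcdf x) \<le> sqrt (2 * pi) * std_normal_density x"
proof (cases "0 \<le> x")
  case True
  have "Gcdf x * (1 - Gcdf x) \<le> 1 * (1 - Gcdf x)"
    using Gcdf_bounds[of x] by (intro mult_right_mono) auto
  then show ?thesis using upper_tail_le[OF True] by simp
next
  case False
  have "Gcdf x * (1 - Gcdf x) \<le> Gcdf x * 1"
    using Gcdf_bounds[of x] by (intro mult_left_mono) auto
  also have "Gcdf x * 1 = 1 - Gcdf (- x)" by (simp add: Gcdf_uminus)
  also have "\<dots> \<le> sqrt (2 * pi) * std_normal_density x"
    using upper_tail_le[of "- x"] False by (simp add: std_normal_density_uminus)
  finally show ?thesis .
qed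

text \<open>
  The logit of the distribution function has derivative \<open>density / (G (1 - G))\<close>, which the tail bound keeps
  away from \<open>0\<close>.
\<close>

lemma logit_Gcdf_expanding:
  assumes "x < y"
  shows "y - x \<le> sqrt (2 * pi) * ((ln (Gcdf y) - ln (1 - Gcdf y)) - (ln (Gcdf x) - ln (1 - Gcdf x)))"
proof -
  let ?g = "\<lambda>x. ln (Gcdf x) - ln (1 - Gcdf x)"
  have d: "(?g has_real_derivative std_normal_density z / (Gcdf z * (1 - Gcdf z))) (at z)" for z
    using Gcdf_bounds[of z]
    by (auto intro!: derivative_eq_intros DERIV_ln_divide Gcdf_DERIV simp: field_simps)
  obtain z where z: "x < z" "z < y" "?g y - ?g x = (y - x) * (std_normal_density z / (Gcdf z * (1 - Gcdf z)))"
    using MVT2[OF assms d] by blast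
  have "0 < Gcdf z * (1 - Gcdf z)" using Gcdf_bounds[of z] by simp
  then have "1 \<le> sqrt (2 * pi) * (std_normal_density z / (Gcdf z * (1 - Gcdf z)))"
    using Gcdf_product_le[of z] by (simp add: field_simps)
  then have "(y - x) * 1 \<le> (y - x) * (sqrt (2 * pi) * (std_normal_density z / (Gcdf z * (1 - Gcdf z))))"
    using assms by (intro mult_left_mono) auto
  then show ?thesis unfolding z(3) by (simp add: mult_ac)
qed

text \<open>
  The quantile function is Lipschitz in the logit of its argument.  This tames its poles at \<open>0\<close> and \<open>1\<close>: it
  remains to control ratios of probabilities.
\<close>

lemma quantile_logit_lipschitz:
  assumes "0 < p" "p < 1" "0 < u" "u < 1"
  shows "\<bar>std_normal_quantile p - std_normal_quantile u\<bar> \<le> sqrt (2 * pi) * (\<bar>ln p - ln u\<bar> + \<bar>ln (1 - p) - ln (1 - u)\<bar>)"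
proof -
  have *: "\<bar>x - y\<bar> \<le> sqrt (2 * pi) * (\<bar>ln (Gcdf x) - ln (Gcdf y)\<bar> + \<bar>ln (1 - Gcdf x) - ln (1 - Gcdf y)\<bar>)" if "x \<le> y" for x y
  proof (cases "x = y")
    case False
    then have "\<bar>x - y\<bar> \<le> sqrt (2 * pi) * ((ln (Gcdf y) - ln (1 - Gcdf y)) - (ln (Gcdf x) - ln (1 - Gcdf x)))"
      using logit_Gcdf_expanding[of x y] that by simp
    also have "\<dots> \<le> sqrt (2 * pi) * (\<bar>ln (Gcdf x) - ln (Gcdf y)\<bar> + \<bar>ln (1 - Gcdf x) - ln (1 - Gcdf y)\<bar>)"
      by (intro mult_left_mono) auto
    finally show ?thesis .
  qed auto
  have "\<bar>x - y\<bar> \<le> sqrt (2 * pi) * (\<bar>ln (Gcdf x) - ln (Gcdf y)\<bar> + \<bar>ln (1 - Gcdf x) - ln (1 - Gcdf y)\<bar>)" for x y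
    using *[of x y] *[of y x] by (cases "x \<le> y") (auto simp: abs_minus_commute)
  from this[of "std_normal_quantile p" "std_normal_quantile u"] show ?thesis
    using assms by (simp add: Gcdf_quantile)
qed

text \<open>
  Convenient because the right-hand side has a computable mean at ratios of empirical probabilities
  and vanishes to second order at \<open>x = 1\<close>.
\<close>

lemma ln_sq_le:
  assumes "0 < (x :: real)"
  shows "(ln x)\<^sup>2 \<le> 4 * (sqrt x + 1 / sqrt x - 2)"
proof -
  have *: "2 * ln z \<le> z - 1 / z" if "1 \<le> z" for z :: real
  proof -
    have "(1 - 1 / 1 - 2 * ln 1) \<le> z - 1 / z - 2 * ln z"
    proof (rule DERIV_nonneg_imp_nondecreasing[OF that])
      fix t :: real assume "1 \<le> t" "t \<le> z"
      then have "((\<lambda>z. z - 1 / z - 2 * ln z) has_real_derivative (1 - 1 / t)\<^sup>2) (at t)"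
        by (auto intro!: derivative_eq_intros simp: power2_eq_square field_simps)
      then show "\<exists>y. ((\<lambda>z. z - 1 / z - 2 * ln z) has_real_derivative y) (at t) \<and> 0 \<le> y"
        by (intro exI conjI) auto
    qed
    then show ?thesis by simp
  qed
  have **: "(ln y)\<^sup>2 \<le> y + 1 / y - 2" if "1 \<le> y" for y :: real
  proof -
    have y: "0 < sqrt y" "1 \<le> sqrt y" using that by auto
    have "ln y = 2 * ln (sqrt y)" using that by (simp add: ln_sqrt)
    also have "\<dots> \<le> sqrt y - 1 / sqrt y" using *[of "sqrt y"] that by simp
    finally have "(ln y)\<^sup>2 \<le> (sqrt y - 1 / sqrt y)\<^sup>2"
      using that by (intro power_mono) auto
    also have "\<dots> = y + 1 / y - 2" using y that by (simp add: power2_diff power_divide)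
    finally show ?thesis .
  qed
  have ***: "(ln y)\<^sup>2 \<le> y + 1 / y - 2" if "0 < y" for y :: real
  proof (cases "1 \<le> y")
    case False
    then have "(ln (1 / y))\<^sup>2 \<le> 1 / y + 1 / (1 / y) - 2" using that by (intro **) auto
    then show ?thesis using that by (simp add: ln_div)
  qed (rule **)
  have "ln x = 2 * ln (sqrt x)" using assms by (simp add: ln_sqrt)
  then have "(ln x)\<^sup>2 = 4 * (ln (sqrt x))\<^sup>2" by (simp add: power_mult_distrib)
  then show ?thesis using ***[of "sqrt x"] assms by simp
qed

lemma quantile_diff_sq_le:
  assumes "0 < p" "p < 1" "0 < u" "u < 1"
  shows "(std_normal_quantile u - std_normal_quantile p)\<^sup>2 \<le>
    16 * pi * ((sqrt (u / p) + sqrt (p / u) - 2) + (sqrt ((1 - u) / (1 - p)) + sqrt ((1 - p) / (1 - u)) - 2))"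
proof -
  have l: "(ln u - ln p)\<^sup>2 \<le> 4 * (sqrt (u / p) + sqrt (p / u) - 2)" if "0 < u" "0 < p" for u p :: real
    using ln_sq_le[of "u / p"] that by (simp add: ln_div real_sqrt_divide)
  have "(std_normal_quantile u - std_normal_quantile p)\<^sup>2 = \<bar>std_normal_quantile u - std_normal_quantile p\<bar>\<^sup>2" by simp
  also have "\<dots> \<le> (sqrt (2 * pi) * (\<bar>ln u - ln p\<bar> + \<bar>ln (1 - u) - ln (1 - p)\<bar>))\<^sup>2"
    using quantile_logit_lipschitz[OF assms(3,4,1,2)] by (intro power_mono) auto
  also have "\<dots> = 2 * pi * (\<bar>ln u - ln p\<bar> + \<bar>ln (1 - u) - ln (1 - p)\<bar>)\<^sup>2" by (simp add: power_mult_distrib)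
  also have "\<dots> \<le> 2 * pi * (2 * (ln u - ln p)\<^sup>2 + 2 * (ln (1 - u) - ln (1 - p))\<^sup>2)"
  proof (rule mult_left_mono)
    have "(a + b)\<^sup>2 \<le> 2 * a\<^sup>2 + 2 * b\<^sup>2" for a b :: real
      using zero_le_power2[of "a - b"] by (simp add: power2_eq_square algebra_simps)
    from this[of "\<bar>ln u - ln p\<bar>" "\<bar>ln (1 - u) - ln (1 - p)\<bar>"]
    show "(\<bar>ln u - ln p\<bar> + \<bar>ln (1 - u) - ln (1 - p)\<bar>)\<^sup>2 \<le> 2 * (ln u - ln p)\<^sup>2 + 2 * (ln (1 - u) - ln (1 - p))\<^sup>2" by simp
  qed auto
  also have "\<dots> \<le> 2 * pi * (2 * (4 * (sqrt (u / p) + sqrt (p / u) - 2)) + 2 * (4 * (sqrt ((1 - u) / (1 - p)) + sqrt ((1 - p) / (1 - u)) - 2)))"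
    using l[of u p] l[of "1 - u" "1 - p"] assms by (intro mult_left_mono add_mono) auto
  also have "\<dots> = 16 * pi * ((sqrt (u / p) + sqrt (p / u) - 2) + (sqrt ((1 - u) / (1 - p)) + sqrt ((1 - p) / (1 - u)) - 2))"
    by (simp add: algebra_simps)
  finally show ?thesis .
qed

section \<open>Means of functions of a binomial count\<close>

lemma nn_integral_power_01: "(\<integral>\<^sup>+t. ennreal (t ^ k) * indicator {0..1} t \<partial>lborel) = ennreal (1 / real (k + 1))"
proof -
  have "(\<integral>\<^sup>+t. ennreal (t ^ k) * indicator {0..1} t \<partial>lborel) = ennreal (1 ^ (k + 1) / (k + 1) - 0 ^ (k + 1) / (k + 1))"
  proof (rule nn_integral_FTC_Icc)
    fix t :: real
    show "((\<lambda>t. t ^ (k + 1) / real (k + 1)) has_real_derivative t ^ k) (at t)"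
      by (rule DERIV_cong[OF DERIV_cdivide[OF DERIV_pow]]) simp
  qed auto
  then show ?thesis by simp
qed

lemma nn_integral_affine_power_01:
  assumes "0 < p" "p \<le> (1 :: real)"
  shows "(\<integral>\<^sup>+t. ennreal ((1 - p + p * t) ^ m) * indicator {0..1} t \<partial>lborel) \<le> ennreal (1 / (real (m + 1) * p))"
proof -
  have "(\<integral>\<^sup>+t. ennreal ((1 - p + p * t) ^ m) * indicator {0..1} t \<partial>lborel) =
     ennreal ((1 - p + p * 1) ^ (m + 1) / ((m + 1) * p) - (1 - p + p * 0) ^ (m + 1) / ((m + 1) * p))"
  proof (rule nn_integral_FTC_Icc[where F="\<lambda>t. (1 - p + p * t) ^ (m + 1) / (real (m + 1) * p)"])
    fix t :: real
    have "((\<lambda>t. 1 - p + p * t) has_real_derivative p) (at t)"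
      by (auto intro!: derivative_eq_intros)
    from DERIV_cdivide[OF DERIV_power[OF this, of "m + 1"], of "real (m + 1) * p"]
    show "((\<lambda>t. (1 - p + p * t) ^ (m + 1) / (real (m + 1) * p)) has_real_derivative (1 - p + p * t) ^ m) (at t)"
      by (rule DERIV_cong) (use assms in simp)
    show "0 \<le> (1 - p + p * t) ^ m" if "t \<in> {0..1}" using assms that by simp
  qed auto
  also have "\<dots> \<le> ennreal (1 / (real (m + 1) * p))"
    using assms by (intro ennreal_leI) (simp add: divide_nonneg_pos)
  finally show ?thesis .
qed

text \<open>The number of hits of \<open>A\<close> among independent observations with law \<open>N\<close> is binomial.\<close>

context
  fixes N :: "real measure" and J :: "nat set" and A :: "real set" and p :: real
  assumes N: "prob_space N" and setsN: "sets N = sets borel" and J: "finite J"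
    and A: "A \<in> sets borel" and p: "measure N A = p" "0 < p" "p \<le> 1"
begin

interpretation N: prob_space N by (rule N)
interpretation P: prob_space "PiM J (\<lambda>_. N)" by (rule prob_space_PiM) (rule N)
interpretation PN: product_sigma_finite "\<lambda>_::nat. N" by (simp add: product_sigma_finite_def N.sigma_finite_measure_axioms)

abbreviation "hits x \<equiv> \<Sum>j\<in>J. indicator A (x j) :: real"

lemma hits_measurable: "(\<lambda>x. hits x) \<in> borel_measurable (PiM J (\<lambda>_. N))"
proof -
  have [measurable]: "A \<in> sets N" using A setsN by simp
  show ?thesis by measurable
qed

lemma hits_bounds: "0 \<le> hits x" "hits x \<le> card J"
  by (auto intro!: sum_nonneg order.trans[OF sum_bounded_above[of J "\<lambda>j. indicator A (x j)" 1]])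

lemma hits_mean: "integrable (PiM J (\<lambda>_. N)) hits" "(\<integral>x. hits x \<partial>PiM J (\<lambda>_. N)) = card J * p"
proof -
  have [measurable]: "A \<in> sets N" using A setsN by simp
  have i: "integrable (PiM J (\<lambda>_. N)) (\<lambda>x. indicator A (x j) :: real)" if "j \<in> J" for j
    using that by (intro P.integrable_const_bound[of _ 1]) auto
  then show "integrable (PiM J (\<lambda>_. N)) hits" by auto
  have "(\<integral>x. indicat_real A (x j) \<partial>PiM J (\<lambda>_. N)) = p" if "j \<in> J" for j
  proof -
    have "(\<integral>x. indicat_real A (x j) \<partial>PiM J (\<lambda>_. N)) = (\<integral>y. indicat_real A y \<partial>distr (PiM J (\<lambda>_. N)) N (\<lambda>x. x j))"
      using integral_distr[OF measurable_component_singleton[OF that, of "\<lambda>_. N"], of "indicator A :: real \<Rightarrow> real"]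
      by simp
    also have "distr (PiM J (\<lambda>_. N)) N (\<lambda>x. x j) = N"
      using that J N by (intro distr_PiM_component) auto
    finally show ?thesis using p by simp
  qed
  then show "(\<integral>x. hits x \<partial>PiM J (\<lambda>_. N)) = card J * p"
    using i by (subst Bochner_Integration.integral_sum) auto
qed

text \<open>
  The probability generating function of the binomial law.
\<close>

lemma hits_generating:
  assumes "0 \<le> t" "t \<le> 1"
  shows "(\<integral>\<^sup>+x. ennreal (\<Prod>j\<in>J. (if x j \<in> A then t else 1)) \<partial>PiM J (\<lambda>_. N)) = ennreal ((1 - p + p * t) ^ card J)"
proof -
  have [measurable]: "A \<in> sets N" using A setsN by simp
  have "(\<integral>\<^sup>+x. ennreal (\<Prod>j\<in>J. (if x j \<in> A then t else 1)) \<partial>PiM J (\<lambda>_. N)) =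
      (\<integral>\<^sup>+x. (\<Prod>j\<in>J. ennreal (if x j \<in> A then t else 1)) \<partial>PiM J (\<lambda>_. N))"
    using assms by (intro nn_integral_cong prod_ennreal[symmetric]) auto
  also have "\<dots> = (\<Prod>j\<in>J. \<integral>\<^sup>+y. ennreal (if y \<in> A then t else 1) \<partial>N)"
    using J by (rule PN.product_nn_integral_prod) measurable
  also have "(\<integral>\<^sup>+y. ennreal (if y \<in> A then t else 1) \<partial>N) = ennreal (1 - p + p * t)"
  proof -
    have "(\<integral>\<^sup>+y. ennreal (if y \<in> A then t else 1) \<partial>N) = ennreal (\<integral>y. (if y \<in> A then t else 1) \<partial>N)"
      using assms by (intro nn_integral_eq_integral N.integrable_const_bound[of _ 1]) auto
    also have "(\<integral>y. (if y \<in> A then t else 1) \<partial>N) = (\<integral>y. 1 + (t - 1) * indicator A y \<partial>N)"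
      by (intro Bochner_Integration.integral_cong) auto
    also have "\<dots> = 1 + (t - 1) * p"
    proof -
      have "integrable N (indicator A :: real \<Rightarrow> real)" by (rule N.integrable_const_bound[of _ 1]) auto
      then show ?thesis using p by (subst Bochner_Integration.integral_add) (auto simp: N.prob_space)
    qed
    finally show ?thesis by (simp add: algebra_simps)
  qed
  also have "(\<Prod>j\<in>J. ennreal (1 - p + p * t)) = ennreal ((1 - p + p * t) ^ card J)"
  proof -
    have "0 \<le> 1 - p + p * t" using p assms by simp
    then show ?thesis by (simp only: prod_constant ennreal_power)
  qed
  finally show ?thesis .
qed

text \<open>
  The bound \<open>E[1 / (K + 1)] \<le> 1 / ((m + 1) p)\<close> for a binomial \<open>K\<close>, from \<open>1 / (K + 1) = \<integral>\<^sub>0\<^sup>1 t\<^sup>K dt\<close>.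
\<close>

lemma hits_inverse_mean: "(\<integral>\<^sup>+x. ennreal (1 / (hits x + 1)) \<partial>PiM J (\<lambda>_. N)) \<le> ennreal (1 / ((real (card J) + 1) * p))"
proof -
  have [measurable]: "A \<in> sets N" using A setsN by simp
  have pw: "ennreal (1 / (hits x + 1)) = (\<integral>\<^sup>+t. ennreal (\<Prod>j\<in>J. (if x j \<in> A then t else 1)) * indicator {0..1} t \<partial>lborel)" for x :: "nat \<Rightarrow> real"
  proof -
    let ?k = "card {j\<in>J. x j \<in> A}"
    have "hits x = real ?k" using J by (simp add: indicator_def sum.If_cases Int_def)
    moreover have "(\<Prod>j\<in>J. (if x j \<in> A then t else 1)) = t ^ ?k" for t :: real
      using J by (simp add: prod.If_cases Int_def)
    ultimately show ?thesis using nn_integral_power_01[of ?k] by (simp add: add.commute)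
  qed
  interpret Q: pair_sigma_finite "PiM J (\<lambda>_. N)" "lborel :: real measure" ..
  have "(\<integral>\<^sup>+x. ennreal (1 / (hits x + 1)) \<partial>PiM J (\<lambda>_. N)) =
     (\<integral>\<^sup>+x. \<integral>\<^sup>+t. ennreal (\<Prod>j\<in>J. (if x j \<in> A then t else 1)) * indicator {0..1} t \<partial>lborel \<partial>PiM J (\<lambda>_. N))"
    unfolding pw ..
  also have "\<dots> = (\<integral>\<^sup>+t. \<integral>\<^sup>+x. ennreal (\<Prod>j\<in>J. (if x j \<in> A then t else 1)) * indicator {0..1} t \<partial>PiM J (\<lambda>_. N) \<partial>lborel)"
    by (rule Q.Fubini'[symmetric]) measurable
  also have "\<dots> = (\<integral>\<^sup>+t. ennreal ((1 - p + p * t) ^ card J) * indicator {0..1} t \<partial>lborel)"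
  proof (rule nn_integral_cong)
    fix t :: real
    show "(\<integral>\<^sup>+x. ennreal (\<Prod>j\<in>J. (if x j \<in> A then t else 1)) * indicator {0..1} t \<partial>PiM J (\<lambda>_. N)) =
      ennreal ((1 - p + p * t) ^ card J) * indicator {0..1} t"
      using hits_generating[of t] by (cases "t \<in> {0..1}") auto
  qed
  also have "\<dots> \<le> ennreal (1 / (real (card J + 1) * p))"
    using p by (intro nn_integral_affine_power_01) auto
  finally show ?thesis by (simp add: add.commute)
qed

text \<open>
  With \<open>(K + 1) / (m + 2)\<close> as estimator of \<open>p\<close>: the arithmetic-geometric mean inequality reduces the means
  of both square roots to the means of \<open>K\<close> and \<open>1 / (K + 1)\<close>.  The power \<open>3 / 4\<close> is a deliberate loss: it
  keeps the bound integrable when \<open>p\<close> is uniform and still yields a rate better than \<open>m\<^sup>-\<^sup>1\<^sup>/\<^sup>2\<close>.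
\<close>

lemma sqrt_ratio_mean:
  "(\<integral>x. sqrt (((hits x + 1) / (real (card J) + 2)) / p) + sqrt (p / ((hits x + 1) / (real (card J) + 2))) - 2 \<partial>PiM J (\<lambda>_. N))
    \<le> (1 / ((real (card J) + 2) * p)) powr (3 / 4) + 1 / (2 * (real (card J) + 1))" (is "?L \<le> _")
  "integrable (PiM J (\<lambda>_. N)) (\<lambda>x. sqrt (((hits x + 1) / (real (card J) + 2)) / p) + sqrt (p / ((hits x + 1) / (real (card J) + 2))) - 2)"
proof -
  let ?m = "real (card J)"
  note hits_measurable[measurable]
  define \<tau> where "\<tau> = 1 / ((?m + 2) * p)"
  \<comment> \<open>\<open>s\<^sup>2\<close> bounds the mean of the ratio, which makes \<open>s\<close> the weight for the arithmetic-geometric mean inequality\<close>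
  define s where "s = sqrt (1 + \<tau>)"
  have t0: "0 < \<tau>" using p by (simp add: \<tau>_def)
  have s1: "1 \<le> s" "s\<^sup>2 = 1 + \<tau>" using t0 by (auto simp: s_def)
  let ?a = "\<lambda>x. (hits x + 1) / (?m + 2)"
  have a: "0 < ?a x" "?a x \<le> 1" for x
    using hits_bounds[of x] by (auto simp: field_simps)
  have am: "sqrt (u * v) \<le> (u + v) / 2" if "0 \<le> u" "0 \<le> v" for u v :: real
    using arith_geo_mean_sqrt[OF that] by simp
  have b1: "sqrt (?a x / p) \<le> (?a x / p / s + s) / 2" for x
  proof -
    have "0 \<le> ?a x / p / s" using s1(1) divide_nonneg_pos[OF less_imp_le[OF divide_pos_pos[OF a(1)[of x] p(2)]], of s] by linarith
    from am[OF this, of s] show ?thesis using s1(1) by simp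
  qed
  have b2: "sqrt (p / ?a x) \<le> (p / ?a x + 1) / 2" for x
    using am[OF less_imp_le[OF divide_pos_pos[OF p(2) a(1)[of x]]], of 1] by simp
  have inv_i: "integrable (PiM J (\<lambda>_. N)) (\<lambda>x. 1 / (hits x + 1))"
  proof (rule P.integrable_const_bound[of _ 1])
    have "norm (1 / (h + 1)) \<le> 1" if "0 \<le> h" for h :: real using that by simp
    then show "AE x in PiM J (\<lambda>_. N). norm (1 / (hits x + 1)) \<le> 1" using hits_bounds(1) by (intro AE_I2) blast
  qed measurable
  have inv_m: "(\<integral>x. 1 / (hits x + 1) \<partial>PiM J (\<lambda>_. N)) \<le> 1 / ((?m + 1) * p)"
  proof -
    have "ennreal (\<integral>x. 1 / (hits x + 1) \<partial>PiM J (\<lambda>_. N)) = (\<integral>\<^sup>+x. ennreal (1 / (hits x + 1)) \<partial>PiM J (\<lambda>_. N))"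
      using inv_i hits_bounds by (intro nn_integral_eq_integral[symmetric]) (auto intro!: AE_I2 divide_nonneg_nonneg add_nonneg_nonneg)
    also have "\<dots> \<le> ennreal (1 / ((?m + 1) * p))" by (rule hits_inverse_mean)
    finally show ?thesis using p by (subst (asm) ennreal_le_iff) auto
  qed
  let ?B = "\<lambda>x. (?a x / p / s + s) / 2 + (p / ?a x + 1) / 2 - 2"
  have Beq: "?B x = (1 / (2 * (?m + 2) * p * s)) * hits x + ((p * (?m + 2) / 2) * (1 / (hits x + 1)) + (1 / (2 * (?m + 2) * p * s) + s / 2 + 1 / 2 - 2))" for x
  proof -
    define m2 c i where "m2 = ?m + 2" and "c = 1 / (2 * (?m + 2) * p * s)" and "i = 1 / (hits x + 1)"
    have "c = 1 / (2 * ((?m + 2) * p * s))" by (simp add: c_def mult.assoc)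
    then have "2 * c = 1 / ((?m + 2) * p * s)" by simp
    then have 1: "?a x / p / s = 2 * c * (hits x + 1)" by simp
    have 2: "p / ?a x = p * m2 * i" by (simp add: i_def m2_def)
    show ?thesis
      unfolding 1 2 c_def[symmetric] i_def[symmetric] unfolding m2_def[symmetric] by (simp add: algebra_simps add_divide_distrib)
  qed
  have Bi: "integrable (PiM J (\<lambda>_. N)) ?B"
    unfolding Beq using hits_mean(1) inv_i
    by (intro Bochner_Integration.integrable_add integrable_mult_right) auto
  have "(\<integral>x. ?B x \<partial>PiM J (\<lambda>_. N)) = (1 / (2 * (?m + 2) * p * s)) * (?m * p) +
      ((p * (?m + 2) / 2) * (\<integral>x. 1 / (hits x + 1) \<partial>PiM J (\<lambda>_. N)) + (1 / (2 * (?m + 2) * p * s) + s / 2 + 1 / 2 - 2))"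
  proof -
    have "(\<integral>x. A' * hits x + (B' * (1 / (hits x + 1)) + C') \<partial>PiM J (\<lambda>_. N)) = A' * (?m * p) + (B' * (\<integral>x. 1 / (hits x + 1) \<partial>PiM J (\<lambda>_. N)) + C')" for A' B' C'
    proof -
      have 1: "integrable (PiM J (\<lambda>_. N)) (\<lambda>x. A' * hits x)"
        by (rule integrable_mult_right[OF hits_mean(1)])
      have 2: "integrable (PiM J (\<lambda>_. N)) (\<lambda>x. B' * (1 / (hits x + 1)))"
        by (rule integrable_mult_right[OF inv_i])
      have 3: "integrable (PiM J (\<lambda>_. N)) (\<lambda>x. B' * (1 / (hits x + 1)) + C')"
        by (rule Bochner_Integration.integrable_add[OF 2]) simp
      have "(\<integral>x. B' * (1 / (hits x + 1)) + C' \<partial>PiM J (\<lambda>_. N)) = (\<integral>x. B' * (1 / (hits x + 1)) \<partial>PiM J (\<lambda>_. N)) + C'"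
        by (subst Bochner_Integration.integral_add[OF 2]) (simp_all add: P.prob_space)
      then show ?thesis
        by (simp only: Bochner_Integration.integral_add[OF 1 3] integral_mult_right_zero hits_mean(2))
    qed
    then show ?thesis unfolding Beq .
  qed
  also have "\<dots> \<le> (1 / (2 * (?m + 2) * p * s)) * (?m * p) +
      ((p * (?m + 2) / 2) * (1 / ((?m + 1) * p)) + (1 / (2 * (?m + 2) * p * s) + s / 2 + 1 / 2 - 2))"
    using inv_m p by (intro add_mono mult_left_mono order_refl) auto
  also have "\<dots> = ((?m * p + 1) / ((?m + 2) * p)) / s / 2 + s / 2 - 1 + 1 / (2 * (?m + 1))"
  proof -
    have e1: "(p * m2 / 2) * (1 / (m1 * p)) = 1 / 2 + 1 / (2 * m1)" if "m2 = m1 + 1" "0 < m1" for m1 m2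
      using p that by (simp add: field_simps)
    have e2: "b / (m2 * p) / s / 2 = 1 / (2 * m2 * p * s) * b" if "0 < m2" for b m2
      using p s1(1) that by (simp add: field_simps)
    have "0 < ?m + 1" "0 < ?m + 2" by simp_all
    then show ?thesis
      unfolding e2[OF \<open>0 < ?m + 2\<close>] using e1[of "?m + 2" "?m + 1"] by (simp add: distrib_left)
  qed
  also have "\<dots> \<le> s - 1 + 1 / (2 * (?m + 1))"
  proof -
    have "(?m * p + 1) / ((?m + 2) * p) \<le> s\<^sup>2"
    proof -
      have Y: "0 < (?m + 2) * p" using p by simp
      have "(?m * p + 1) / ((?m + 2) * p) \<le> ((?m + 2) * p + 1) / ((?m + 2) * p)"
        using p Y by (intro divide_right_mono) (auto simp: distrib_right)
      also have "\<dots> = 1 + 1 / ((?m + 2) * p)" using p Y by (simp add: add_divide_distrib)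
      finally show ?thesis unfolding s1(2) \<tau>_def .
    qed
    then have "((?m * p + 1) / ((?m + 2) * p)) / s \<le> s\<^sup>2 / s"
      using s1(1) by (intro divide_right_mono) auto
    also have "s\<^sup>2 / s = s" using s1(1) by (simp add: power2_eq_square)
    finally have le: "((?m * p + 1) / ((?m + 2) * p)) / s \<le> s" .
    have gen: "Y / 2 + s / 2 - 1 + c \<le> s - 1 + c" if "Y \<le> s" for Y c :: real using that by linarith
    show ?thesis by (rule gen[OF le])
  qed
  also have "s - 1 \<le> \<tau> powr (3 / 4)"
  proof (cases "1 \<le> \<tau>")
    case True
    have "s \<le> 1 + sqrt \<tau>" unfolding s_def using t0 sqrt_add_le_add_sqrt[of 1 \<tau>] by simp
    also have "sqrt \<tau> = \<tau> powr (1 / 2)" using t0 by (simp add: powr_half_sqrt)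
    also have "\<dots> \<le> \<tau> powr (3 / 4)" using True by (intro powr_mono) auto
    finally show ?thesis by simp
  next
    case False
    have "s \<le> 1 + \<tau> / 2" unfolding s_def using t0 by (intro real_le_lsqrt) (auto simp: power2_eq_square field_simps)
    also have "\<tau> / 2 \<le> \<tau>" using t0 by simp
    also have "\<tau> = \<tau> powr 1" using t0 by simp
    also have "\<dots> \<le> \<tau> powr (3 / 4)" using False t0 by (intro powr_mono') auto
    finally show ?thesis by simp
  qed
  finally have BB: "(\<integral>x. ?B x \<partial>PiM J (\<lambda>_. N)) \<le> \<tau> powr (3 / 4) + 1 / (2 * (?m + 1))" by simp
  show i: "integrable (PiM J (\<lambda>_. N)) (\<lambda>x. sqrt (?a x / p) + sqrt (p / ?a x) - 2)"
  proof (rule Bochner_Integration.integrable_bound[of _ "\<lambda>x. ?B x + 4"])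
    show "AE x in PiM J (\<lambda>_. N). norm (sqrt (?a x / p) + sqrt (p / ?a x) - 2) \<le> norm (?B x + 4)"
    proof (rule AE_I2)
      fix x
      have nn: "0 \<le> sqrt (y / z)" if "0 < y" "0 < z" for y z :: real using that by simp
      have "0 \<le> sqrt (?a x / p)" "0 \<le> sqrt (p / ?a x)" using nn[OF a(1)[of x] p(2)] nn[OF p(2) a(1)[of x]] .
      then show "norm (sqrt (?a x / p) + sqrt (p / ?a x) - 2) \<le> norm (?B x + 4)"
        using b1[of x] b2[of x] unfolding real_norm_def by linarith
    qed
  next
    show "integrable (PiM J (\<lambda>_. N)) (\<lambda>x. ?B x + 4)"
      by (rule Bochner_Integration.integrable_add[OF Bi]) simp
  next
    show "(\<lambda>x. sqrt (?a x / p) + sqrt (p / ?a x) - 2) \<in> borel_measurable (PiM J (\<lambda>_. N))" by measurable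
  qed
  have "?L \<le> (\<integral>x. ?B x \<partial>PiM J (\<lambda>_. N))"
  proof (rule integral_mono[OF i Bi])
    fix x
    show "sqrt (?a x / p) + sqrt (p / ?a x) - 2 \<le> ?B x" using b1[of x] b2[of x] by linarith
  qed
  from order.trans[OF this BB] show "?L \<le> (1 / ((?m + 2) * p)) powr (3 / 4) + 1 / (2 * (?m + 1))"
    unfolding \<tau>_def .
qed

end

section \<open>The normal score of one observation\<close>

text \<open>
  The probability transform is uniform, and \<open>u\<^sup>-\<^sup>3\<^sup>/\<^sup>4\<close> has integral \<open>4\<close> over the unit interval.
\<close>

lemma Gcdf_powr_mean: "(\<integral>\<^sup>+y. ennreal (Gcdf y powr (-(3/4))) \<partial>std_normal_distribution) \<le> 4"
proof -
  let ?f = "\<lambda>y. Gcdf y powr (-(3/4)) * std_normal_density y"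
  have meas[measurable]: "Gcdf \<in> borel_measurable borel"
    by (intro borel_measurable_continuous_onI) (simp add: continuous_on_eq_continuous_at Gcdf_isCont)
  have d: "((\<lambda>y. 4 * Gcdf y powr (1/4)) has_real_derivative ?f y) (at y)" for y
    using DERIV_cmult[OF DERIV_fun_powr[OF Gcdf_DERIV Gcdf_bounds(1), of "1/4" y], of 4] by simp
  have lim: "((\<lambda>y. 4 * Gcdf y powr (1/4)) \<longlongrightarrow> 4) at_top"
  proof -
    have "((\<lambda>y. 4 * Gcdf y powr (1/4)) \<longlongrightarrow> 4 * 1 powr (1/4)) at_top"
      by (intro tendsto_intros SN.cdf_lim_at_top_prob) auto
    then show ?thesis by simp
  qed
  have part: "(\<integral>\<^sup>+y. ennreal (?f y) * indicator {- real k..} y \<partial>lborel) \<le> 4" for k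
  proof -
    have "(\<integral>\<^sup>+y. ennreal (?f y) * indicator {- real k..} y \<partial>lborel) = ennreal (4 - 4 * Gcdf (- real k) powr (1/4))"
      by (rule nn_integral_FTC_atLeast[OF _ d _ lim]) (auto intro!: mult_nonneg_nonneg less_imp_le[OF std_density_le])
    also have "\<dots> \<le> ennreal 4" by (intro ennreal_leI) auto
    finally show ?thesis by simp
  qed
  have "(\<integral>\<^sup>+y. ennreal (Gcdf y powr (-(3/4))) \<partial>std_normal_distribution) = (\<integral>\<^sup>+y. ennreal (?f y) \<partial>lborel)"
    by (subst nn_integral_density) (auto simp: ennreal_mult' mult.commute less_imp_le[OF std_density_le])
  also have "\<dots> = (\<integral>\<^sup>+y. (SUP k. ennreal (?f y) * indicator {- real k..} y) \<partial>lborel)"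
  proof (rule nn_integral_cong)
    fix y :: real
    obtain k :: nat where k: "- y \<le> real k" using real_arch_simple by blast
    have "(SUP k. ennreal (?f y) * indicator {- real k..} y) = ennreal (?f y)"
    proof (rule antisym)
      show "(SUP k. ennreal (?f y) * indicator {- real k..} y) \<le> ennreal (?f y)"
        by (rule SUP_least) (auto simp: indicator_def)
      show "ennreal (?f y) \<le> (SUP k. ennreal (?f y) * indicator {- real k..} y)"
        by (rule SUP_upper2[of k]) (use k in auto)
    qed
    then show "ennreal (?f y) = (SUP k. ennreal (?f y) * indicator {- real k..} y)" by simp
  qed
  also have "\<dots> = (SUP k. \<integral>\<^sup>+y. ennreal (?f y) * indicator {- real k..} y \<partial>lborel)"
    by (rule nn_integral_monotone_convergence_SUP) (auto simp: incseq_def le_fun_def indicator_def)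
  also have "\<dots> \<le> 4" by (rule SUP_least) (rule part)
  finally show ?thesis .
qed

lemma Gcdf_compl_powr_mean: "(\<integral>\<^sup>+y. ennreal ((1 - Gcdf y) powr (-(3/4))) \<partial>std_normal_distribution) \<le> 4"
proof -
  have meas[measurable]: "Gcdf \<in> borel_measurable borel"
    by (intro borel_measurable_continuous_onI) (simp add: continuous_on_eq_continuous_at Gcdf_isCont)
  have "(\<integral>\<^sup>+y. ennreal ((1 - Gcdf y) powr (-(3/4))) \<partial>std_normal_distribution) =
      (\<integral>\<^sup>+y. ennreal (std_normal_density y) * ennreal (Gcdf (- y) powr (-(3/4))) \<partial>lborel)"
    by (subst nn_integral_density) (auto simp: Gcdf_uminus)
  also have "\<dots> = (\<integral>\<^sup>+y. ennreal (std_normal_density y) * ennreal (Gcdf y powr (-(3/4))) \<partial>lborel)"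
    by (subst nn_integral_real_affine[of _ "-1" 0]) (auto simp: std_normal_density_uminus)
  also have "\<dots> = (\<integral>\<^sup>+y. ennreal (Gcdf y powr (-(3/4))) \<partial>std_normal_distribution)"
    by (subst nn_integral_density) auto
  finally show ?thesis using Gcdf_powr_mean by simp
qed

text \<open>
  The normal score of the rank of a standard normal observation approximates the observation in mean
  square, with an error \<open>o(n\<^sup>-\<^sup>1\<^sup>/\<^sup>2)\<close>.  Given the observation \<open>y\<close>, its rank is one plus a binomial count with
  success probability \<open>p = G y\<close>, and the transform \<open>p\<close> is uniform.
\<close>

lemma normal_score_mean_square:
  fixes I :: "nat set"
  assumes I: "finite I" "l \<in> I"
  shows "(\<integral>\<^sup>+x. ennreal ((std_normal_quantile ((\<Sum>i\<in>I. if x i \<le> x l then 1 else 0) / (real (card I) + 1)) - x l)\<^sup>2)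
      \<partial>PiM I (\<lambda>_. std_normal_distribution))
    \<le> ennreal (16 * pi * (8 * (real (card I) + 1) powr (-(3/4)) + 1 / real (card I)))"
proof -
  define J where "J = I - {l}"
  have IJ: "I = insert l J" "l \<notin> J" "finite J" using I by (auto simp: J_def)
  define m where "m = real (card J)"
  have card: "real (card I) = m + 1" using IJ by (simp add: m_def)
  have m0: "0 \<le> m" by (simp add: m_def)
  have PS: "prob_space std_normal_distribution" by (rule SN.prob_space_axioms)
  interpret PN: product_sigma_finite "\<lambda>_::nat. std_normal_distribution"
    by (simp add: product_sigma_finite_def SN.sigma_finite_measure_axioms)
  have [measurable]: "Gcdf \<in> borel_measurable borel"
    by (intro borel_measurable_continuous_onI) (simp add: continuous_on_eq_continuous_at Gcdf_isCont)
  let ?Q = "PiM J (\<lambda>_. std_normal_distribution)"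
  let ?F = "\<lambda>x. ennreal ((std_normal_quantile ((\<Sum>i\<in>I. if x i \<le> x l then 1 else 0) / (real (card I) + 1)) - x l)\<^sup>2)"
  let ?b = "\<lambda>y. 16 * pi * (((1 / ((m + 2) * Gcdf y)) powr (3 / 4) + 1 / (2 * (m + 1))) +
     ((1 / ((m + 2) * (1 - Gcdf y))) powr (3 / 4) + 1 / (2 * (m + 1))))"
  have Fm[measurable]: "?F \<in> borel_measurable (PiM (insert l J) (\<lambda>_. std_normal_distribution))"
    unfolding IJ(1)[symmetric] using I by measurable
  have inner: "(\<integral>\<^sup>+x. ?F (x(l := y)) \<partial>?Q) \<le> ennreal (?b y)" for y
  proof -
    let ?A = "{..y}" and ?A' = "{y<..}"
    let ?h = "\<lambda>x. \<Sum>j\<in>J. indicat_real ?A (x j)" and ?h' = "\<lambda>x. \<Sum>j\<in>J. indicat_real ?A' (x j)"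
    let ?T = "\<lambda>p u. sqrt (u / p) + sqrt (p / u) - 2"
    have pA: "measure std_normal_distribution ?A = Gcdf y" by (simp add: cdf_def)
    have pA': "measure std_normal_distribution ?A' = 1 - Gcdf y" by (simp add: Gcdf_upper_tail)
    note g = Gcdf_bounds[of y]
    have 1: "(\<integral>x. ?T (Gcdf y) ((?h x + 1) / (m + 2)) \<partial>?Q) \<le> (1 / ((m + 2) * Gcdf y)) powr (3 / 4) + 1 / (2 * (m + 1))"
      "integrable ?Q (\<lambda>x. ?T (Gcdf y) ((?h x + 1) / (m + 2)))"
      unfolding m_def using sqrt_ratio_mean[OF PS _ IJ(3) _ pA] g by auto
    have 2: "(\<integral>x. ?T (1 - Gcdf y) ((?h' x + 1) / (m + 2)) \<partial>?Q) \<le> (1 / ((m + 2) * (1 - Gcdf y))) powr (3 / 4) + 1 / (2 * (m + 1))"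
      "integrable ?Q (\<lambda>x. ?T (1 - Gcdf y) ((?h' x + 1) / (m + 2)))"
      unfolding m_def using sqrt_ratio_mean[OF PS _ IJ(3) _ pA'] g by auto
    let ?G = "\<lambda>x. 16 * pi * (?T (Gcdf y) ((?h x + 1) / (m + 2)) + ?T (1 - Gcdf y) ((?h' x + 1) / (m + 2)))"
    have hs: "?h x + ?h' x = m" for x
    proof -
      have "?h x + ?h' x = (\<Sum>j\<in>J. 1)"
        unfolding sum.distrib[symmetric] by (intro sum.cong) (auto simp: indicator_def)
      then show ?thesis by (simp add: m_def)
    qed
    have h0: "0 \<le> ?h x" "0 \<le> ?h' x" for x by (auto intro!: sum_nonneg)
    have rk: "(\<Sum>i\<in>I. if (x(l := y)) i \<le> (x(l := y)) l then 1 else 0) = ?h x + 1" for x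
    proof -
      have "(\<Sum>i\<in>J. if (x(l := y)) i \<le> y then 1 else 0) = ?h x"
        using IJ(2) by (intro sum.cong) (auto simp: indicator_def)
      then show ?thesis using IJ by simp
    qed
    have pw: "(std_normal_quantile ((?h x + 1) / (m + 2)) - y)\<^sup>2 \<le> ?G x" for x
    proof -
      have u: "0 < (?h x + 1) / (m + 2)" "(?h x + 1) / (m + 2) < 1"
        using h0[of x] hs[of x] m0 by (auto simp: field_simps)
      have "1 - (?h x + 1) / (m + 2) = (?h' x + 1) / (m + 2)"
        using hs[of x] m0 by (simp add: field_simps)
      then show ?thesis using quantile_diff_sq_le[OF g u] by simp
    qed
    have "(\<integral>\<^sup>+x. ?F (x(l := y)) \<partial>?Q) = (\<integral>\<^sup>+x. ennreal ((std_normal_quantile ((?h x + 1) / (m + 2)) - y)\<^sup>2) \<partial>?Q)"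
      unfolding rk card by (simp add: add.commute)
    also have "\<dots> \<le> (\<integral>\<^sup>+x. ennreal (?G x) \<partial>?Q)"
      using pw by (intro nn_integral_mono ennreal_leI)
    also have "\<dots> = ennreal (\<integral>x. ?G x \<partial>?Q)"
    proof (rule nn_integral_eq_integral)
      show "integrable ?Q ?G"
        by (intro integrable_mult_right Bochner_Integration.integrable_add 1(2) 2(2))
      show "AE x in ?Q. 0 \<le> ?G x"
        by (rule AE_I2) (rule order.trans[OF zero_le_power2 pw])
    qed
    also have "(\<integral>x. ?G x \<partial>?Q) = 16 * pi * ((\<integral>x. ?T (Gcdf y) ((?h x + 1) / (m + 2)) \<partial>?Q) + (\<integral>x. ?T (1 - Gcdf y) ((?h' x + 1) / (m + 2)) \<partial>?Q))"
      unfolding integral_mult_right_zero Bochner_Integration.integral_add[OF 1(2) 2(2)] ..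
    also have "ennreal \<dots> \<le> ennreal (?b y)"
      using 1(1) 2(1) by (intro ennreal_leI mult_left_mono add_mono) auto
    finally show ?thesis .
  qed
  have beq: "?b y = 16 * pi * (m + 2) powr (-(3/4)) * Gcdf y powr (-(3/4)) +
      (16 * pi * (m + 2) powr (-(3/4)) * (1 - Gcdf y) powr (-(3/4)) + 16 * pi / (m + 1))" for y
  proof -
    have e: "(1 / ((m + 2) * v)) powr (3 / 4) = (m + 2) powr (-(3/4)) * v powr (-(3/4))" if "0 < v" for v
      using m0 that by (simp add: powr_divide powr_mult powr_minus_divide)
    define c where "c = 1 / (2 * (m + 1))"
    have "2 * c = 1 / (m + 1)" using m0 by (simp add: c_def field_simps)
    then have c: "16 * pi / (m + 1) = 16 * pi * (2 * c)" by simp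
    have "0 < Gcdf y" "0 < 1 - Gcdf y" using Gcdf_bounds[of y] by auto
    then show ?thesis unfolding e[OF \<open>0 < Gcdf y\<close>] e[OF \<open>0 < 1 - Gcdf y\<close>] c_def[symmetric] c
      by (simp add: algebra_simps)
  qed
  have "(\<integral>\<^sup>+x. ?F x \<partial>PiM I (\<lambda>_. std_normal_distribution)) = (\<integral>\<^sup>+y. \<integral>\<^sup>+x. ?F (x(l := y)) \<partial>?Q \<partial>std_normal_distribution)"
    using PN.product_nn_integral_insert_rev[OF IJ(3,2) Fm] by (simp add: IJ(1)[symmetric])
  also have "\<dots> \<le> (\<integral>\<^sup>+y. ennreal (?b y) \<partial>std_normal_distribution)"
    by (intro nn_integral_mono inner)
  also have "\<dots> = ennreal (16 * pi * (m + 2) powr (-(3/4))) * (\<integral>\<^sup>+y. ennreal (Gcdf y powr (-(3/4))) \<partial>std_normal_distribution) +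
      (ennreal (16 * pi * (m + 2) powr (-(3/4))) * (\<integral>\<^sup>+y. ennreal ((1 - Gcdf y) powr (-(3/4))) \<partial>std_normal_distribution) + ennreal (16 * pi / (m + 1)))"
    unfolding beq using m0
    by (simp add: ennreal_mult nn_integral_add nn_integral_cmult SN.emeasure_space_1[simplified])
  also have "\<dots> \<le> ennreal (16 * pi * (m + 2) powr (-(3/4))) * 4 + (ennreal (16 * pi * (m + 2) powr (-(3/4))) * 4 + ennreal (16 * pi / (m + 1)))"
    by (intro add_mono mult_left_mono Gcdf_powr_mean Gcdf_compl_powr_mean order_refl) auto
  also have "\<dots> = ennreal (16 * pi * (m + 2) powr (-(3/4)) * 4 + (16 * pi * (m + 2) powr (-(3/4)) * 4 + 16 * pi / (m + 1)))"
  proof -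
    have "ennreal u * 4 + (ennreal u * 4 + ennreal v) = ennreal (u * 4 + (u * 4 + v))" if "0 \<le> u" "0 \<le> v" for u v
    proof -
      have "ennreal u * 4 = ennreal (u * 4)" using that by (simp add: ennreal_mult)
      then show ?thesis using that by (simp add: ennreal_plus[symmetric] del: ennreal_plus)
    qed
    then show ?thesis using m0 by simp
  qed
  also have "16 * pi * (m + 2) powr (-(3/4)) * 4 + (16 * pi * (m + 2) powr (-(3/4)) * 4 + 16 * pi / (m + 1)) =
     16 * pi * (8 * (real (card I) + 1) powr (-(3/4)) + 1 / real (card I))"
    by (simp add: card algebra_simps)
  finally show ?thesis .
qed

section \<open>Products of normal scores\<close>

definition score_err :: "nat set \<Rightarrow> (nat \<Rightarrow> real) \<Rightarrow> nat \<Rightarrow> real" where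
  "score_err I U l = std_normal_quantile ((\<Sum>i\<in>I. if U i \<le> U l then 1 else 0) / (real (card I) + 1)) - U l"

text \<open>
  The mean square error of a single normal score is at most this rate, which is \<open>o(n\<^sup>-\<^sup>1\<^sup>/\<^sup>2)\<close>.
\<close>

definition score_rate :: "nat \<Rightarrow> real" where
  "score_rate n = 16 * pi * (8 * (real n + 1) powr (-(3/4)) + 1 / real n)"

lemma score_rate_pos: "0 < score_rate n"
  by (auto simp: score_rate_def intro!: mult_pos_pos add_pos_nonneg)

lemma score_rate_limits: "score_rate \<longlonglongrightarrow> 0" "(\<lambda>n. sqrt (real n) * score_rate n) \<longlonglongrightarrow> 0"
  unfolding score_rate_def by real_asymp+

lemma score_err_measurable [measurable]:
  assumes "finite I" "l \<in> I" "\<And>i. i \<in> I \<Longrightarrow> (\<lambda>x. U x i) \<in> borel_measurable M"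
  shows "(\<lambda>x. score_err I (U x) l) \<in> borel_measurable M"
proof -
  have [measurable]: "(\<lambda>x. U x l) \<in> borel_measurable M" using assms by blast
  have [measurable]: "(\<lambda>x. (\<Sum>i\<in>I. if U x i \<le> U x l then 1 else 0 :: real)) \<in> borel_measurable M"
  proof (rule borel_measurable_sum)
    fix i assume "i \<in> I"
    then have [measurable]: "(\<lambda>x. U x i) \<in> borel_measurable M" using assms by blast
    show "(\<lambda>x. if U x i \<le> U x l then 1 else 0 :: real) \<in> borel_measurable M" by measurable
  qed
  show ?thesis unfolding score_err_def by measurable
qed

text \<open>The observations are vectors with law \<open>N(0, R)\<close>; every coordinate is ranked separately.\<close>

context
  fixes R :: "real ^ 'q::finite ^ 'q" and I :: "nat set"
  assumes R: "R \<in> pd_mats" and R1: "\<And>a. R $ a $ a = 1" and I: "finite I"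
begin

interpretation mu: prob_space "mvn R" by (rule prob_space_mvn[OF R])
interpretation Q: prob_space "PiM I (\<lambda>_. mvn R)" by (rule prob_space_PiM) (rule mu.prob_space_axioms)
interpretation PQ: product_sigma_finite "\<lambda>_::nat. mvn R"
  by (simp add: product_sigma_finite_def mu.sigma_finite_measure_axioms)
interpretation PN: product_sigma_finite "\<lambda>_::nat. std_normal_distribution"
  by (simp add: product_sigma_finite_def SN.sigma_finite_measure_axioms)

abbreviation "Q \<equiv> PiM I (\<lambda>_. mvn R)"

lemma coordinate_measurable: "i \<in> I \<Longrightarrow> (\<lambda>x. x i $ a) \<in> borel_measurable Q"
  by measurable

lemma marginal_sample: "distr Q (PiM I (\<lambda>_. borel)) (\<lambda>x. \<lambda>i\<in>I. x i $ a) = PiM I (\<lambda>_. std_normal_distribution)"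
proof (rule PN.PiM_eqI)
  show "sets (distr Q (PiM I (\<lambda>_. borel)) (\<lambda>x. \<lambda>i\<in>I. x i $ a)) = sets (PiM I (\<lambda>_. std_normal_distribution))"
  proof -
    have "sets (PiM I (\<lambda>_. borel)) = sets (PiM I (\<lambda>_. std_normal_distribution))" by (rule sets_PiM_cong) auto
    then show ?thesis by simp
  qed
  fix A :: "nat \<Rightarrow> real set" assume "\<And>i. i \<in> I \<Longrightarrow> A i \<in> sets std_normal_distribution"
  then have A: "\<And>i. i \<in> I \<Longrightarrow> A i \<in> sets borel" by simp
  have m: "(\<lambda>x. \<lambda>i\<in>I. x i $ a) \<in> measurable Q (PiM I (\<lambda>_. borel))" by measurable
  have v: "(\<lambda>z. z $ a) -` A i \<in> sets borel" if "i \<in> I" for i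
    using measurable_sets[OF borel_measurable_vec_nth[OF measurable_ident] A[OF that], of a] by simp
  have "emeasure (distr Q (PiM I (\<lambda>_. borel)) (\<lambda>x. \<lambda>i\<in>I. x i $ a)) (Pi\<^sub>E I A) =
      emeasure Q ((\<lambda>x. \<lambda>i\<in>I. x i $ a) -` (Pi\<^sub>E I A) \<inter> space Q)"
    using A I by (intro emeasure_distr m sets_PiM_I_finite) auto
  also have "(\<lambda>x. \<lambda>i\<in>I. x i $ a) -` (Pi\<^sub>E I A) \<inter> space Q = Pi\<^sub>E I (\<lambda>i. (\<lambda>z. z $ a) -` A i)"
    by (auto simp: space_PiM PiE_def Pi_iff extensional_def)
  also have "emeasure Q \<dots> = (\<Prod>i\<in>I. emeasure (mvn R) ((\<lambda>z. z $ a) -` A i))"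
    using v I by (intro PQ.emeasure_PiM) auto
  also have "\<dots> = (\<Prod>i\<in>I. emeasure std_normal_distribution (A i))"
  proof (rule prod.cong[OF refl])
    fix i assume i: "i \<in> I"
    show "emeasure (mvn R) ((\<lambda>z. z $ a) -` A i) = emeasure std_normal_distribution (A i)"
      unfolding mvn_marginal[OF R R1, symmetric, of a] using A[OF i] by (subst emeasure_distr) auto
  qed
  finally show "emeasure (distr Q (PiM I (\<lambda>_. borel)) (\<lambda>x. \<lambda>i\<in>I. x i $ a)) (Pi\<^sub>E I A) = (\<Prod>i\<in>I. emeasure std_normal_distribution (A i))" .
qed (rule I)

lemma score_err_cong: "(\<And>i. i \<in> I \<Longrightarrow> U i = V i) \<Longrightarrow> l \<in> I \<Longrightarrow> score_err I U l = score_err I V l"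
  unfolding score_err_def by (auto cong: sum.cong)

lemma score_err_mean_square:
  assumes l: "l \<in> I"
  shows "(\<integral>\<^sup>+x. ennreal ((score_err I (\<lambda>i. x i $ a) l)\<^sup>2) \<partial>Q) \<le> ennreal (score_rate (card I))"
proof -
  have m: "(\<lambda>x. \<lambda>i\<in>I. x i $ a) \<in> measurable Q (PiM I (\<lambda>_. borel))" by measurable
  have s[measurable]: "(\<lambda>x. score_err I x l) \<in> borel_measurable (PiM I (\<lambda>_. borel))"
    using I l by (intro score_err_measurable measurable_component_singleton)
  have "(\<integral>\<^sup>+x. ennreal ((score_err I (\<lambda>i. x i $ a) l)\<^sup>2) \<partial>Q) = (\<integral>\<^sup>+x. ennreal ((score_err I (\<lambda>i\<in>I. x i $ a) l)\<^sup>2) \<partial>Q)"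
    using l by (intro nn_integral_cong) (subst score_err_cong[of _ "\<lambda>i. _ i $ a"], auto)
  also have "\<dots> = (\<integral>\<^sup>+x. ennreal ((score_err I x l)\<^sup>2) \<partial>PiM I (\<lambda>_. std_normal_distribution))"
    unfolding marginal_sample[of a, symmetric] using m by (subst nn_integral_distr) auto
  also have "\<dots> \<le> ennreal (score_rate (card I))"
    using normal_score_mean_square[OF I l] unfolding score_err_def score_rate_def by simp
  finally show ?thesis .
qed

abbreviation "resid a c x l \<equiv> x l $ c - R $ a $ c * x l $ a"
abbreviation "serr a x l \<equiv> score_err I (\<lambda>i. x i $ a) l"

lemma serr_measurable [measurable]: "l \<in> I \<Longrightarrow> (\<lambda>x. serr a x l) \<in> borel_measurable Q"
  using I by (intro score_err_measurable coordinate_measurable)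

lemma serr_upd: "serr a (x(l := z)) m = score_err I ((\<lambda>i. x i $ a)(l := z $ a)) m"
proof -
  have "(\<lambda>i. (x(l := z)) i $ a) = (\<lambda>i. x i $ a)(l := z $ a)" by auto
  then show ?thesis by simp
qed

lemma score_err_upd_measurable: "m \<in> I \<Longrightarrow> (\<lambda>t. score_err I (u(l := t)) m) \<in> borel_measurable borel"
proof (intro score_err_measurable I)
  fix i show "(\<lambda>t. (u(l := t)) i) \<in> borel_measurable borel" by (cases "i = l") auto
qed

lemma resid_serr_square:
  assumes l: "l \<in> I" and ac: "a \<noteq> c"
  shows "(\<integral>\<^sup>+x. ennreal ((resid a c x l * serr a x l)\<^sup>2) \<partial>Q) \<le> ennreal (score_rate (card I))"
proof -
  define J where "J = I - {l}"
  have IJ: "insert l J = I" "l \<notin> J" "finite J" using l I by (auto simp: J_def)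
  have r: "ennreal (1 - (R $ a $ c)\<^sup>2) \<le> 1" by (simp add: ennreal_le_1)
  have l1: "(\<lambda>x. ennreal ((resid a c x l * serr a x l)\<^sup>2)) \<in> borel_measurable (PiM (insert l J) (\<lambda>_. mvn R))"
    and l2: "(\<lambda>x. ennreal ((serr a x l)\<^sup>2)) \<in> borel_measurable (PiM (insert l J) (\<lambda>_. mvn R))"
    unfolding IJ(1) using l by measurable
  have "(\<integral>\<^sup>+x. ennreal ((resid a c x l * serr a x l)\<^sup>2) \<partial>Q) =
     (\<integral>\<^sup>+x. \<integral>\<^sup>+z. ennreal ((z $ c - R $ a $ c * z $ a)\<^sup>2) * ennreal ((score_err I ((\<lambda>i. x i $ a)(l := z $ a)) l)\<^sup>2) \<partial>mvn R \<partial>PiM J (\<lambda>_. mvn R))"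
  proof -
    have e: "ennreal ((resid a c (x(l := z)) l * serr a (x(l := z)) l)\<^sup>2) =
      ennreal ((z $ c - R $ a $ c * z $ a)\<^sup>2) * ennreal ((score_err I ((\<lambda>i. x i $ a)(l := z $ a)) l)\<^sup>2)" for x z
      unfolding serr_upd by (simp add: power_mult_distrib ennreal_mult)
    show ?thesis using PQ.product_nn_integral_insert[OF IJ(3,2) l1] unfolding IJ(1) e .
  qed
  also have "\<dots> = (\<integral>\<^sup>+x. ennreal (1 - (R $ a $ c)\<^sup>2) * (\<integral>\<^sup>+z. ennreal ((score_err I ((\<lambda>i. x i $ a)(l := z $ a)) l)\<^sup>2) \<partial>mvn R) \<partial>PiM J (\<lambda>_. mvn R))"
  proof (rule nn_integral_cong)
    fix x :: "nat \<Rightarrow> real ^ 'q"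
    note score_err_upd_measurable[OF l, measurable]
    show "(\<integral>\<^sup>+z. ennreal ((z $ c - R $ a $ c * z $ a)\<^sup>2) * ennreal ((score_err I ((\<lambda>i. x i $ a)(l := z $ a)) l)\<^sup>2) \<partial>mvn R) =
      ennreal (1 - (R $ a $ c)\<^sup>2) * (\<integral>\<^sup>+z. ennreal ((score_err I ((\<lambda>i. x i $ a)(l := z $ a)) l)\<^sup>2) \<partial>mvn R)"
      by (rule mvn_residual_sq[OF R R1 R1 ac, of "\<lambda>t. ennreal ((score_err I ((\<lambda>i. x i $ a)(l := t)) l)\<^sup>2)"]) measurable
  qed
  also have "\<dots> \<le> (\<integral>\<^sup>+x. 1 * (\<integral>\<^sup>+z. ennreal ((score_err I ((\<lambda>i. x i $ a)(l := z $ a)) l)\<^sup>2) \<partial>mvn R) \<partial>PiM J (\<lambda>_. mvn R))"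
    by (intro nn_integral_mono mult_right_mono r) auto
  also have "\<dots> = (\<integral>\<^sup>+x. ennreal ((serr a x l)\<^sup>2) \<partial>Q)"
    using PQ.product_nn_integral_insert[OF IJ(3,2) l2] unfolding IJ(1) serr_upd by (simp only: mult_1)
  also have "\<dots> \<le> ennreal (score_rate (card I))" by (rule score_err_mean_square[OF l])
  finally show ?thesis .
qed

lemma resid_serr_square_integrable:
  assumes "l \<in> I" "a \<noteq> c"
  shows "integrable Q (\<lambda>x. (resid a c x l * serr a x l)\<^sup>2)" "(\<integral>x. (resid a c x l * serr a x l)\<^sup>2 \<partial>Q) \<le> score_rate (card I)"
proof -
  have m: "(\<lambda>x. (resid a c x l * serr a x l)\<^sup>2) \<in> borel_measurable Q" using assms by measurable
  show i: "integrable Q (\<lambda>x. (resid a c x l * serr a x l)\<^sup>2)"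
    using m order.strict_trans1[OF resid_serr_square[OF assms] ennreal_less_top] by (intro integrableI_nonneg) auto
  have "ennreal (\<integral>x. (resid a c x l * serr a x l)\<^sup>2 \<partial>Q) \<le> ennreal (score_rate (card I))"
    using resid_serr_square[OF assms] i by (subst nn_integral_eq_integral[symmetric]) auto
  then show "(\<integral>x. (resid a c x l * serr a x l)\<^sup>2 \<partial>Q) \<le> score_rate (card I)"
    using score_rate_pos[of "card I"] by (subst (asm) ennreal_le_iff) auto
qed

text \<open>
  Given everything but the coordinate \<open>c\<close> of the observation \<open>l\<close>, the residual of that observation has mean
  \<open>0\<close>, whereas the other factors are fixed: score errors in the coordinate \<open>a\<close> depend on the ranks in that
  coordinate only.
\<close>

lemma resid_serr_orthogonal:
  assumes l: "l \<in> I" and m: "m \<in> I" and lm: "l \<noteq> m" and ac: "a \<noteq> c"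
  shows "integrable Q (\<lambda>x. (resid a c x l * serr a x l) * (resid a c x m * serr a x m))"
    "(\<integral>x. (resid a c x l * serr a x l) * (resid a c x m * serr a x m) \<partial>Q) = 0"
proof -
  let ?f = "\<lambda>x. (resid a c x l * serr a x l) * (resid a c x m * serr a x m)"
  define J where "J = I - {l}"
  have IJ: "insert l J = I" "l \<notin> J" "finite J" using l I by (auto simp: J_def)
  show i: "integrable Q ?f"
  proof (rule Bochner_Integration.integrable_bound)
    show "integrable Q (\<lambda>x. (resid a c x l * serr a x l)\<^sup>2 + (resid a c x m * serr a x m)\<^sup>2)"
      using resid_serr_square_integrable(1)[OF l ac] resid_serr_square_integrable(1)[OF m ac] by simp
    have "\<bar>u * v\<bar> \<le> u\<^sup>2 + v\<^sup>2" for u v :: real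
    proof -
      have "2 * \<bar>u * v\<bar> \<le> u\<^sup>2 + v\<^sup>2"
        using sum_squares_bound[of "\<bar>u\<bar>" "\<bar>v\<bar>"] by (simp add: abs_mult)
      then show ?thesis using zero_le_power2[of u] zero_le_power2[of v] by linarith
    qed
    then show "AE x in Q. norm (?f x) \<le> norm ((resid a c x l * serr a x l)\<^sup>2 + (resid a c x m * serr a x m)\<^sup>2)"
      by (intro AE_I2) (simp only: real_norm_def abs_of_nonneg[OF sum_power2_ge_zero])
  qed (use l m in measurable)
  have "(\<integral>x. ?f x \<partial>Q) = (\<integral>x. (\<integral>z. ?f (x(l := z)) \<partial>mvn R) \<partial>PiM J (\<lambda>_. mvn R))"
    using PQ.product_integral_insert[OF IJ(3,2), of ?f] i unfolding IJ(1) by simp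
  also have "\<dots> = (\<integral>x. 0 \<partial>PiM J (\<lambda>_. mvn R))"
  proof (rule Bochner_Integration.integral_cong[OF refl])
    fix x :: "nat \<Rightarrow> real ^ 'q"
    note score_err_upd_measurable[OF l, measurable] score_err_upd_measurable[OF m, measurable]
    define F where "F t = score_err I ((\<lambda>i. x i $ a)(l := t)) l * (resid a c x m * score_err I ((\<lambda>i. x i $ a)(l := t)) m)" for t
    have Fm: "F \<in> borel_measurable borel" unfolding F_def by measurable
    have eq: "?f (x(l := z)) = (z $ c - R $ a $ c * z $ a) * F (z $ a)" for z
      using lm unfolding serr_upd F_def by (simp add: mult_ac)
    show "(\<integral>z. ?f (x(l := z)) \<partial>mvn R) = 0"
      unfolding eq using mvn_residual_zero[OF R R1 R1 ac Fm] not_integrable_integral_eq by blast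
  qed
  finally show "(\<integral>x. ?f x \<partial>Q) = 0" by simp
qed

text \<open>
  The first order term of the expansion is a sum of uncorrelated terms, so its second moment grows only
  linearly in the number of observations.
\<close>

lemma resid_serr_sum_square:
  assumes ac: "a \<noteq> c"
  shows "(\<integral>\<^sup>+x. ennreal ((\<Sum>l\<in>I. resid a c x l * serr a x l)\<^sup>2) \<partial>Q) \<le> ennreal (card I * score_rate (card I))"
proof -
  let ?g = "\<lambda>l x. resid a c x l * serr a x l"
  have i: "integrable Q (\<lambda>x. ?g l x * ?g m x)" if "l \<in> I" "m \<in> I" for l m
    using that resid_serr_orthogonal(1)[OF that _ ac] resid_serr_square_integrable(1)[OF that(1) ac]
    by (cases "l = m") (auto simp: power2_eq_square)
  have sq: "(\<Sum>l\<in>I. ?g l x)\<^sup>2 = (\<Sum>l\<in>I. \<Sum>m\<in>I. ?g l x * ?g m x)" for x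
    by (simp only: power2_eq_square sum_product)
  have I2: "integrable Q (\<lambda>x. (\<Sum>l\<in>I. ?g l x)\<^sup>2)"
    unfolding sq by (intro Bochner_Integration.integrable_sum i)
  have "(\<integral>x. (\<Sum>l\<in>I. ?g l x)\<^sup>2 \<partial>Q) = (\<Sum>l\<in>I. \<Sum>m\<in>I. \<integral>x. ?g l x * ?g m x \<partial>Q)"
  proof -
    have "(\<integral>x. (\<Sum>l\<in>I. ?g l x)\<^sup>2 \<partial>Q) = (\<Sum>l\<in>I. \<integral>x. (\<Sum>m\<in>I. ?g l x * ?g m x) \<partial>Q)"
      unfolding sq by (intro Bochner_Integration.integral_sum Bochner_Integration.integrable_sum i)
    also have "\<dots> = (\<Sum>l\<in>I. \<Sum>m\<in>I. \<integral>x. ?g l x * ?g m x \<partial>Q)"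
      by (intro sum.cong refl Bochner_Integration.integral_sum i)
    finally show ?thesis .
  qed
  also have "\<dots> = (\<Sum>l\<in>I. \<Sum>m\<in>I. if l = m then \<integral>x. (?g l x)\<^sup>2 \<partial>Q else 0)"
    using resid_serr_orthogonal(2)[OF _ _ _ ac] by (intro sum.cong refl) (auto simp: power2_eq_square)
  also have "\<dots> = (\<Sum>l\<in>I. \<integral>x. (?g l x)\<^sup>2 \<partial>Q)" using I by simp
  also have "\<dots> \<le> (\<Sum>l\<in>I. score_rate (card I))"
    by (intro sum_mono resid_serr_square_integrable(2)[OF _ ac])
  finally have "(\<integral>x. (\<Sum>l\<in>I. ?g l x)\<^sup>2 \<partial>Q) \<le> card I * score_rate (card I)" by simp
  then show ?thesis using I2 by (subst nn_integral_eq_integral) (auto intro!: ennreal_leI)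
qed

lemma nn_integral_abs_le_of_square:
  assumes m: "f \<in> borel_measurable Q" and b: "(\<integral>\<^sup>+x. ennreal ((f x)\<^sup>2) \<partial>Q) \<le> ennreal e" and e: "0 < e"
  shows "(\<integral>\<^sup>+x. ennreal \<bar>f x\<bar> \<partial>Q) \<le> ennreal (sqrt e)"
proof -
  have "(\<integral>\<^sup>+x. ennreal \<bar>f x\<bar> \<partial>Q) \<le> (\<integral>\<^sup>+x. ennreal (1 / (2 * sqrt e)) * ennreal ((f x)\<^sup>2) + ennreal (sqrt e / 2) \<partial>Q)"
  proof (rule nn_integral_mono)
    fix x
    have "2 * \<bar>f x\<bar> * sqrt e \<le> (f x)\<^sup>2 + e"
      using sum_squares_bound[of "\<bar>f x\<bar>" "sqrt e"] e by simp
    then have "\<bar>f x\<bar> \<le> 1 / (2 * sqrt e) * (f x)\<^sup>2 + sqrt e / 2"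
      using e by (simp add: field_simps)
    then show "ennreal \<bar>f x\<bar> \<le> ennreal (1 / (2 * sqrt e)) * ennreal ((f x)\<^sup>2) + ennreal (sqrt e / 2)"
      using e by (simp add: ennreal_mult[symmetric] ennreal_plus[symmetric] ennreal_leI del: ennreal_plus)
  qed
  also have "\<dots> = ennreal (1 / (2 * sqrt e)) * (\<integral>\<^sup>+x. ennreal ((f x)\<^sup>2) \<partial>Q) + ennreal (sqrt e / 2)"
    using m by (subst nn_integral_add) (auto simp: nn_integral_cmult Q.emeasure_space_1)
  also have "\<dots> \<le> ennreal (1 / (2 * sqrt e)) * ennreal e + ennreal (sqrt e / 2)"
    by (intro add_mono mult_left_mono b) auto
  also have "\<dots> = ennreal (1 / (2 * sqrt e) * e + sqrt e / 2)"
    using e by (simp add: ennreal_mult[symmetric] ennreal_plus[symmetric] del: ennreal_plus)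
  also have "1 / (2 * sqrt e) * e + sqrt e / 2 = sqrt e"
  proof -
    have "e / sqrt e = sqrt e" using e by (simp add: real_div_sqrt)
    moreover have "1 / (2 * sqrt e) * e = 1 / 2 * (e / sqrt e)" by simp
    ultimately show ?thesis by linarith
  qed
  finally show ?thesis .
qed

lemma nn_integral_component_square:
  assumes l: "l \<in> I"
  shows "(\<integral>\<^sup>+x. ennreal ((x l $ a)\<^sup>2) \<partial>Q) = 1"
proof -
  have d: "distr Q (mvn R) (\<lambda>x. x l) = mvn R"
    using I l by (intro distr_PiM_component mu.prob_space_axioms)
  have "(\<integral>\<^sup>+x. ennreal ((x l $ a)\<^sup>2) \<partial>Q) = (\<integral>\<^sup>+z. ennreal ((z $ a)\<^sup>2) \<partial>distr Q (mvn R) (\<lambda>x. x l))"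
    using l by (subst nn_integral_distr) auto
  also have "\<dots> = (\<integral>\<^sup>+z. ennreal ((z $ a)\<^sup>2) \<partial>mvn R)" unfolding d ..
  also have "\<dots> = ennreal (R $ a $ a)"
    using mvn_second_moment[OF R, of a a]
    by (subst nn_integral_eq_integral) (auto simp: has_bochner_integral_iff power2_eq_square)
  finally show ?thesis by (simp add: R1)
qed

lemma score_square_error:
  "(\<integral>\<^sup>+x. ennreal \<bar>\<Sum>l\<in>I. (x l $ a + serr a x l)\<^sup>2 - (x l $ a)\<^sup>2\<bar> \<partial>Q) \<le>
    ennreal (card I * (score_rate (card I) + 2 * sqrt (score_rate (card I))))"
proof -
  define e where "e = score_rate (card I)"
  have e: "0 < e" by (simp add: e_def score_rate_pos)
  let ?b = "\<lambda>l x. ennreal (1 + 1 / sqrt e) * ennreal ((serr a x l)\<^sup>2) + ennreal (sqrt e) * ennreal ((x l $ a)\<^sup>2)"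
  have "(\<integral>\<^sup>+x. ennreal \<bar>\<Sum>l\<in>I. (x l $ a + serr a x l)\<^sup>2 - (x l $ a)\<^sup>2\<bar> \<partial>Q) \<le> (\<integral>\<^sup>+x. (\<Sum>l\<in>I. ?b l x) \<partial>Q)"
  proof (rule nn_integral_mono)
    fix x :: "nat \<Rightarrow> real ^ 'q"
    have pt: "\<bar>(u + d)\<^sup>2 - u\<^sup>2\<bar> \<le> (1 + 1 / sqrt e) * d\<^sup>2 + sqrt e * u\<^sup>2" for u d :: real
    proof -
      define k where "k = sqrt (sqrt e)"
      have k: "0 < k" "k\<^sup>2 = sqrt e" using e by (auto simp: k_def)
      have "2 * \<bar>k * u\<bar> * \<bar>d / k\<bar> \<le> (k * u)\<^sup>2 + (d / k)\<^sup>2"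
        using sum_squares_bound[of "\<bar>k * u\<bar>" "\<bar>d / k\<bar>"] by (simp only: power2_abs)
      then have "2 * \<bar>u * d\<bar> \<le> sqrt e * u\<^sup>2 + 1 / sqrt e * d\<^sup>2"
        using k by (simp add: abs_mult power_mult_distrib power_divide)
      moreover have "(u + d)\<^sup>2 - u\<^sup>2 = 2 * (u * d) + d\<^sup>2" by (simp add: power2_sum)
      moreover have "\<bar>2 * (u * d) + d\<^sup>2\<bar> \<le> 2 * \<bar>u * d\<bar> + d\<^sup>2"
        using abs_triangle_ineq[of "2 * (u * d)" "d\<^sup>2"] by (simp add: abs_mult)
      ultimately have "\<bar>(u + d)\<^sup>2 - u\<^sup>2\<bar> \<le> sqrt e * u\<^sup>2 + 1 / sqrt e * d\<^sup>2 + d\<^sup>2" by linarith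
      then show ?thesis by (simp add: distrib_right)
    qed
    have "\<bar>\<Sum>l\<in>I. (x l $ a + serr a x l)\<^sup>2 - (x l $ a)\<^sup>2\<bar> \<le> (\<Sum>l\<in>I. (1 + 1 / sqrt e) * (serr a x l)\<^sup>2 + sqrt e * (x l $ a)\<^sup>2)"
      by (rule order.trans[OF sum_abs]) (intro sum_mono pt)
    then have "ennreal \<bar>\<Sum>l\<in>I. (x l $ a + serr a x l)\<^sup>2 - (x l $ a)\<^sup>2\<bar> \<le> ennreal (\<Sum>l\<in>I. (1 + 1 / sqrt e) * (serr a x l)\<^sup>2 + sqrt e * (x l $ a)\<^sup>2)"
      by (rule ennreal_leI)
    also have "\<dots> = (\<Sum>l\<in>I. ennreal ((1 + 1 / sqrt e) * (serr a x l)\<^sup>2 + sqrt e * (x l $ a)\<^sup>2))"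
      using e by (intro sum_ennreal[symmetric]) auto
    also have "\<dots> = (\<Sum>l\<in>I. ?b l x)"
      using e by (intro sum.cong refl) (simp add: ennreal_mult[symmetric] ennreal_plus[symmetric] del: ennreal_plus)
    finally show "ennreal \<bar>\<Sum>l\<in>I. (x l $ a + serr a x l)\<^sup>2 - (x l $ a)\<^sup>2\<bar> \<le> (\<Sum>l\<in>I. ?b l x)" .
  qed
  also have "\<dots> = (\<Sum>l\<in>I. \<integral>\<^sup>+x. ?b l x \<partial>Q)"
    by (intro nn_integral_sum) measurable
  also have "\<dots> \<le> (\<Sum>l\<in>I. ennreal (e + 2 * sqrt e))"
  proof (rule sum_mono)
    fix l assume l: "l \<in> I"
    have "(\<integral>\<^sup>+x. ?b l x \<partial>Q) = ennreal (1 + 1 / sqrt e) * (\<integral>\<^sup>+x. ennreal ((serr a x l)\<^sup>2) \<partial>Q) + ennreal (sqrt e) * (\<integral>\<^sup>+x. ennreal ((x l $ a)\<^sup>2) \<partial>Q)"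
      using l by (subst nn_integral_add) (auto simp: nn_integral_cmult)
    also have "\<dots> \<le> ennreal (1 + 1 / sqrt e) * ennreal e + ennreal (sqrt e) * 1"
      using score_err_mean_square[OF l, of a] nn_integral_component_square[OF l, of a]
      by (intro add_mono mult_left_mono) (auto simp: e_def)
    also have "\<dots> = ennreal ((1 + 1 / sqrt e) * e + sqrt e)"
      using e by (simp add: ennreal_mult[symmetric] ennreal_plus[symmetric] del: ennreal_plus)
    also have "(1 + 1 / sqrt e) * e + sqrt e = e + 2 * sqrt e"
      using e by (simp add: distrib_right real_div_sqrt)
    finally show "(\<integral>\<^sup>+x. ?b l x \<partial>Q) \<le> ennreal (e + 2 * sqrt e)" .
  qed
  also have "\<dots> = ennreal (card I * (e + 2 * sqrt e))"
    using e by (simp add: ennreal_mult' ennreal_of_nat_eq_real_of_nat)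
  finally show ?thesis by (simp add: e_def)
qed

text \<open>
  Replacing observations by their normal scores changes the sum of \<open>u v - \<rho> (u\<^sup>2 + v\<^sup>2) / 2\<close> by
  \<open>o(n\<^sup>1\<^sup>/\<^sup>2)\<close>.  The partial derivatives of this function are the regression residuals, so the first order
  terms are centered and uncorrelated; the second order terms are controlled by the mean square errors.
\<close>

lemma score_product_error:
  assumes ac: "a \<noteq> c"
  defines "g \<equiv> \<lambda>u v. u * v - R $ a $ c / 2 * (u\<^sup>2 + v\<^sup>2)"
  shows "(\<integral>\<^sup>+x. ennreal \<bar>\<Sum>l\<in>I. g (x l $ a + serr a x l) (x l $ c + serr c x l) - g (x l $ a) (x l $ c)\<bar> \<partial>Q) \<le>
    ennreal (2 * sqrt (card I * score_rate (card I)) + 2 * (card I * score_rate (card I)))"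
proof (cases "I = {}")
  case False
  define e where "e = score_rate (card I)"
  have e: "0 < e" by (simp add: e_def score_rate_pos)
  have n: "0 < real (card I)" using False I by (simp add: card_gt_0_iff)
  have r: "R $ c $ a = R $ a $ c" by (rule pd_sym_nth[OF R])
  have r1: "\<bar>R $ a $ c\<bar> \<le> 1"
    using corr_sq_less_1[OF R R1 R1 ac] abs_square_le_1[of "R $ a $ c"] by simp
  let ?S = "\<lambda>a c x. \<Sum>l\<in>I. resid a c x l * serr a x l"
  have Sm: "(\<lambda>x. ?S a c x) \<in> borel_measurable Q" for a c by measurable
  let ?q = "\<lambda>l x. ennreal ((serr a x l)\<^sup>2) + ennreal ((serr c x l)\<^sup>2)"
  have "(\<integral>\<^sup>+x. ennreal \<bar>\<Sum>l\<in>I. g (x l $ a + serr a x l) (x l $ c + serr c x l) - g (x l $ a) (x l $ c)\<bar> \<partial>Q) \<le>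
    (\<integral>\<^sup>+x. (ennreal \<bar>?S a c x\<bar> + ennreal \<bar>?S c a x\<bar>) + (\<Sum>l\<in>I. ?q l x) \<partial>Q)"
  proof (rule nn_integral_mono)
    fix x :: "nat \<Rightarrow> real ^ 'q"
    have ex: "g (u + d) (v + w) - g u v = (v - R $ a $ c * u) * d + (u - R $ a $ c * v) * w + (d * w - R $ a $ c / 2 * (d\<^sup>2 + w\<^sup>2))" for u v d w
      unfolding g_def by (simp add: power2_eq_square algebra_simps add_divide_distrib)
    have rem: "\<bar>d * w - R $ a $ c / 2 * (d\<^sup>2 + w\<^sup>2)\<bar> \<le> d\<^sup>2 + w\<^sup>2" for d w
    proof -
      have "2 * \<bar>d * w\<bar> \<le> d\<^sup>2 + w\<^sup>2" using sum_squares_bound[of "\<bar>d\<bar>" "\<bar>w\<bar>"] by (simp add: abs_mult)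
      moreover have "\<bar>R $ a $ c * (d\<^sup>2 + w\<^sup>2)\<bar> \<le> 1 * (d\<^sup>2 + w\<^sup>2)"
        unfolding abs_mult using r1 by (intro mult_mono) auto
      ultimately show ?thesis by (simp add: abs_le_iff) linarith
    qed
    have "(\<Sum>l\<in>I. g (x l $ a + serr a x l) (x l $ c + serr c x l) - g (x l $ a) (x l $ c)) =
      ?S a c x + ?S c a x + (\<Sum>l\<in>I. serr a x l * serr c x l - R $ a $ c / 2 * ((serr a x l)\<^sup>2 + (serr c x l)\<^sup>2))"
      unfolding ex r by (simp only: sum.distrib)
    moreover have "\<bar>\<Sum>l\<in>I. serr a x l * serr c x l - R $ a $ c / 2 * ((serr a x l)\<^sup>2 + (serr c x l)\<^sup>2)\<bar> \<le> (\<Sum>l\<in>I. (serr a x l)\<^sup>2 + (serr c x l)\<^sup>2)"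
      by (rule order.trans[OF sum_abs]) (intro sum_mono rem)
    ultimately have "\<bar>\<Sum>l\<in>I. g (x l $ a + serr a x l) (x l $ c + serr c x l) - g (x l $ a) (x l $ c)\<bar> \<le>
      (\<bar>?S a c x\<bar> + \<bar>?S c a x\<bar>) + (\<Sum>l\<in>I. (serr a x l)\<^sup>2 + (serr c x l)\<^sup>2)" by linarith
    then have "ennreal \<bar>\<Sum>l\<in>I. g (x l $ a + serr a x l) (x l $ c + serr c x l) - g (x l $ a) (x l $ c)\<bar> \<le>
      ennreal ((\<bar>?S a c x\<bar> + \<bar>?S c a x\<bar>) + (\<Sum>l\<in>I. (serr a x l)\<^sup>2 + (serr c x l)\<^sup>2))" by (rule ennreal_leI)
    also have "\<dots> = (ennreal \<bar>?S a c x\<bar> + ennreal \<bar>?S c a x\<bar>) + ennreal (\<Sum>l\<in>I. (serr a x l)\<^sup>2 + (serr c x l)\<^sup>2)"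
      by (subst ennreal_plus) (auto intro!: sum_nonneg)
    also have "ennreal (\<Sum>l\<in>I. (serr a x l)\<^sup>2 + (serr c x l)\<^sup>2) = (\<Sum>l\<in>I. ?q l x)"
      by (subst sum_ennreal[symmetric]) auto
    finally show "ennreal \<bar>\<Sum>l\<in>I. g (x l $ a + serr a x l) (x l $ c + serr c x l) - g (x l $ a) (x l $ c)\<bar> \<le>
      (ennreal \<bar>?S a c x\<bar> + ennreal \<bar>?S c a x\<bar>) + (\<Sum>l\<in>I. ?q l x)" .
  qed
  also have "\<dots> = ((\<integral>\<^sup>+x. ennreal \<bar>?S a c x\<bar> \<partial>Q) + (\<integral>\<^sup>+x. ennreal \<bar>?S c a x\<bar> \<partial>Q)) +
      (\<Sum>l\<in>I. (\<integral>\<^sup>+x. ennreal ((serr a x l)\<^sup>2) \<partial>Q) + (\<integral>\<^sup>+x. ennreal ((serr c x l)\<^sup>2) \<partial>Q))"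
  proof -
    have "(\<integral>\<^sup>+x. (\<Sum>l\<in>I. ?q l x) \<partial>Q) = (\<Sum>l\<in>I. \<integral>\<^sup>+x. ?q l x \<partial>Q)" by (intro nn_integral_sum) measurable
    also have "\<dots> = (\<Sum>l\<in>I. (\<integral>\<^sup>+x. ennreal ((serr a x l)\<^sup>2) \<partial>Q) + (\<integral>\<^sup>+x. ennreal ((serr c x l)\<^sup>2) \<partial>Q))"
      by (intro sum.cong refl nn_integral_add) measurable
    finally show ?thesis using Sm by (subst nn_integral_add, measurable, subst nn_integral_add) auto
  qed
  also have "\<dots> \<le> (ennreal (sqrt (card I * e)) + ennreal (sqrt (card I * e))) + (\<Sum>l\<in>I. ennreal e + ennreal e)"
    using ac e n
    by (intro add_mono sum_mono nn_integral_abs_le_of_square Sm resid_serr_sum_square[folded e_def] score_err_mean_square[folded e_def]) auto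
  also have "\<dots> = ennreal (2 * sqrt (card I * e) + 2 * (card I * e))"
  proof -
    have "(\<Sum>l\<in>I. ennreal e + ennreal e) = (\<Sum>l\<in>I. ennreal (2 * e))"
      using e by (intro sum.cong refl) (simp add: ennreal_plus[symmetric] del: ennreal_plus)
    also have "\<dots> = ennreal (\<Sum>l\<in>I. 2 * e)" using e by (intro sum_ennreal) auto
    finally have "(\<Sum>l\<in>I. ennreal e + ennreal e) = ennreal (2 * (card I * e))" by (simp add: mult_ac)
    moreover have "ennreal (sqrt (card I * e)) + ennreal (sqrt (card I * e)) = ennreal (2 * sqrt (card I * e))"
      using e n by (simp add: ennreal_plus[symmetric] del: ennreal_plus)
    ultimately show ?thesis using e n by (simp add: ennreal_plus[symmetric] del: ennreal_plus)
  qed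
  finally show ?thesis by (simp add: e_def)
qed simp

end

section \<open>Convergence to centered normal laws\<close>

lemma norm_iexp_diff_le: "cmod (iexp a - iexp b) \<le> \<bar>a - b\<bar>"
proof -
  have "iexp a - iexp b = iexp b * (iexp (a - b) - 1)"
    by (simp add: algebra_simps exp_add[symmetric])
  then have "cmod (iexp a - iexp b) = cmod (iexp (a - b) - 1)" by (simp add: norm_mult)
  also have "\<dots> \<le> \<bar>a - b\<bar>" using iexp_approx1[of "a - b" 0] by simp
  finally show ?thesis .
qed

lemma real_distribution_normal_law: "0 \<le> v \<Longrightarrow> real_distribution (normal_law v)"
proof -
  assume v: "0 \<le> v"
  show ?thesis
  proof (cases "v = 0")
    case True
    then show ?thesis
      by (auto simp: normal_law_def real_distribution_def real_distribution_axioms_def prob_space_return)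
  next
    case False
    then have "prob_space (density lborel (\<lambda>x. ennreal (normal_density 0 (sqrt v) x)))"
      using v by (intro prob_space_normal_density) auto
    then show ?thesis using False
      by (auto simp: normal_law_def real_distribution_def real_distribution_axioms_def)
  qed
qed

lemma char_normal_law:
  assumes "0 < v"
  shows "char (normal_law v) t = char std_normal_distribution (sqrt v * t)"
proof -
  have "distributed std_normal_distribution lborel (\<lambda>x. x) (\<lambda>x. ennreal (std_normal_density x))"
    by (auto simp: distributed_def intro!: distr_id2[THEN trans])
  from SN.normal_density_affine[OF this, of "sqrt v" 0]
  have "distributed std_normal_distribution lborel (\<lambda>x. sqrt v * x) (\<lambda>x. ennreal (normal_density 0 (sqrt v) x))"
    using assms by simp
  then have "distr std_normal_distribution lborel (\<lambda>x. sqrt v * x) = normal_law v"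
    using assms by (simp add: distributed_def normal_law_def)
  moreover have "distr std_normal_distribution lborel (\<lambda>x. sqrt v * x) = distr std_normal_distribution borel (\<lambda>x. sqrt v * x)"
    by (rule distr_cong) auto
  ultimately have "normal_law v = distr std_normal_distribution borel (\<lambda>x. sqrt v * x)" by simp
  then show ?thesis
    by (simp add: char_def integral_distr mult.assoc mult.left_commute)
qed

lemma char_normal_law_zero: "char (normal_law 0) t = 1"
  by (simp add: char_def normal_law_def integral_return)

context prob_space
begin

text \<open>
  The degenerate case \<open>v = 0\<close> is included: the summands then vanish almost surely.
\<close>

lemma char_clt:
  fixes Y :: "nat \<Rightarrow> 'a \<Rightarrow> real"
  assumes indep: "indep_vars (\<lambda>_. borel) Y {1..}"
    and law: "\<And>l. 1 \<le> l \<Longrightarrow> distr M borel (Y l) = \<mu>"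
    and mean: "\<And>l. 1 \<le> l \<Longrightarrow> expectation (Y l) = 0"
    and sq: "\<And>l. 1 \<le> l \<Longrightarrow> integrable M (\<lambda>x. (Y l x)\<^sup>2)"
    and var: "\<And>l. 1 \<le> l \<Longrightarrow> expectation (\<lambda>x. (Y l x)\<^sup>2) = v"
  shows "(\<lambda>n. char (distr M borel (\<lambda>x. (\<Sum>l=1..n. Y l x) / sqrt (real n))) t) \<longlonglongrightarrow> char (normal_law v) t"
proof -
  have rv[measurable]: "Y l \<in> borel_measurable M" if "1 \<le> l" for l
    using indep that by (auto simp: indep_vars_def)
  have rv'[measurable]: "Y (Suc i) \<in> borel_measurable M" for i by (rule rv) simp
  have sumeq: "(\<Sum>l=1..n. Y l x) = (\<Sum>i<n. Y (Suc i) x)" for n x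
    using sum.atLeast1_atMost_eq[of "\<lambda>l. Y l x" n] by simp
  have v0: "0 \<le> v" using var[of 1] by (metis integral_nonneg_AE AE_I2 le_refl zero_le_power2)
  show ?thesis
  proof (cases "v = 0")
    case True
    have "AE x in M. (Y l x)\<^sup>2 = 0" if "1 \<le> l" for l
      using integral_nonneg_eq_0_iff_AE[OF sq[OF that]] var[OF that] True by auto
    then have "AE x in M. \<forall>i. Y (Suc i) x = 0" by (subst AE_all_countable) simp
    then have ae: "AE x in M. (\<Sum>l=1..n. Y l x) / sqrt (real n) = 0" for n
      unfolding sumeq by eventually_elim simp
    have "char (distr M borel (\<lambda>x. (\<Sum>l=1..n. Y l x) / sqrt (real n))) t = 1" for n
    proof -
      have "char (distr M borel (\<lambda>x. (\<Sum>l=1..n. Y l x) / sqrt (real n))) t = (CLINT x|M. iexp (t * ((\<Sum>l=1..n. Y l x) / sqrt (real n))))"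
        unfolding char_def sumeq by (subst integral_distr) auto
      also have "\<dots> = (CLINT x|M. 1)"
      proof (rule integral_cong_AE)
        show "AE x in M. iexp (t * ((\<Sum>l=1..n. Y l x) / sqrt (real n))) = 1"
          using ae[of n]
        proof eventually_elim
          case (elim x)
          then show ?case by (simp only: elim mult_zero_right of_real_0 exp_zero)
        qed
      qed (unfold sumeq, measurable)
      finally show ?thesis by (simp add: prob_space)
    qed
    then show ?thesis by (simp add: True char_normal_law_zero)
  next
    case False
    define s where "s = sqrt v"
    have s: "0 < s" "s\<^sup>2 = v" using False v0 by (auto simp: s_def)
    have "weak_conv_m (\<lambda>n. distr M borel (\<lambda>x. (\<Sum>i<n. Y (Suc i) x) / sqrt (real n * s\<^sup>2))) std_normal_distribution"
    proof (rule central_limit_theorem_zero_mean[where \<mu>=\<mu>])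
      have "indep_vars (\<lambda>i. PiM {Suc i} (\<lambda>_. borel)) (\<lambda>i x. restrict (\<lambda>j. Y j x) {Suc i}) UNIV"
        by (rule indep_vars_restrict[OF indep]) (auto simp: disjoint_family_on_def)
      from indep_vars_compose2[OF this, of "\<lambda>i f. f (Suc i)" "\<lambda>_. borel"]
      show "indep_vars (\<lambda>_. borel) (\<lambda>i. Y (Suc i)) UNIV" by simp
      show "variance (Y (Suc n)) = s\<^sup>2" for n using mean[of "Suc n"] var[of "Suc n"] s by simp
    qed (use law mean sq s in auto)
    then have conv: "(\<lambda>n. char (distr M borel (\<lambda>x. (\<Sum>i<n. Y (Suc i) x) / sqrt (real n * s\<^sup>2))) (s * t)) \<longlonglongrightarrow> char std_normal_distribution (s * t)"
      by (intro levy_continuity1 real_distribution_distr real_dist_normal_dist) auto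
    have "char (distr M borel (\<lambda>x. (\<Sum>i<n. Y (Suc i) x) / sqrt (real n * s\<^sup>2))) (s * t) = char (distr M borel (\<lambda>x. (\<Sum>l=1..n. Y l x) / sqrt (real n))) t" for n
    proof -
      have chr: "char (distr M borel U) r = (CLINT x|M. iexp (r * U x))" if "U \<in> borel_measurable M" for U r
        using that by (simp add: char_def integral_distr)
      have eq: "s * t * (x / sqrt (real n * s\<^sup>2)) = t * (x / sqrt (real n))" for x
        using s(1) by (simp add: real_sqrt_mult)
      show ?thesis unfolding sumeq by (subst (1 2) chr) (simp_all only: eq, measurable)
    qed
    then show ?thesis using conv char_normal_law[of v t] False v0 by (simp add: s_def)
  qed
qed

text \<open>
  Asymptotically equivalent sequences have the same limit law, by comparison of characteristic
  functions.
\<close>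

lemma weak_conv_of_close:
  fixes T S :: "nat \<Rightarrow> 'a \<Rightarrow> real"
  assumes T[measurable]: "\<And>n. T n \<in> borel_measurable M" and S[measurable]: "\<And>n. S n \<in> borel_measurable M"
    and v: "0 \<le> v"
    and char: "\<And>t. (\<lambda>n. char (distr M borel (S n)) t) \<longlonglongrightarrow> char (normal_law v) t"
    and close: "(\<lambda>n. expectation (\<lambda>x. min 1 \<bar>T n x - S n x\<bar>)) \<longlonglongrightarrow> 0"
  shows "weak_conv_m (\<lambda>n. distr M borel (T n)) (normal_law v)"
proof (rule levy_continuity)
  show "real_distribution (distr M borel (T n))" for n by (intro real_distribution_distr) simp
  show "real_distribution (normal_law v)" by (rule real_distribution_normal_law[OF v])
  fix t
  have ii: "integrable M (\<lambda>x. iexp (t * U x))" if [measurable]: "U \<in> borel_measurable M" for U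
    by (rule integrable_const_bound[of _ 1]) auto
  have b: "cmod (char (distr M borel (T n)) t - char (distr M borel (S n)) t) \<le> (2 + \<bar>t\<bar>) * expectation (\<lambda>x. min 1 \<bar>T n x - S n x\<bar>)" for n
  proof -
    have "char (distr M borel (T n)) t - char (distr M borel (S n)) t = (CLINT x|M. iexp (t * T n x) - iexp (t * S n x))"
    proof -
      have "char (distr M borel U) t = (CLINT x|M. iexp (t * U x))" if "U \<in> borel_measurable M" for U
        using that by (simp add: char_def integral_distr)
      then show ?thesis by (simp only: T S Bochner_Integration.integral_diff ii)
    qed
    also have "cmod \<dots> \<le> (\<integral>x. cmod (iexp (t * T n x) - iexp (t * S n x)) \<partial>M)"
      by (rule integral_norm_bound)
    also have "\<dots> \<le> (\<integral>x. (2 + \<bar>t\<bar>) * min 1 \<bar>T n x - S n x\<bar> \<partial>M)"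
    proof (rule integral_mono)
      show "integrable M (\<lambda>x. cmod (iexp (t * T n x) - iexp (t * S n x)))"
        by (intro integrable_norm Bochner_Integration.integrable_diff ii T S)
      show "integrable M (\<lambda>x. (2 + \<bar>t\<bar>) * min 1 \<bar>T n x - S n x\<bar>)"
        by (intro integrable_mult_right integrable_const_bound[of _ 1]) auto
      fix x
      have 1: "cmod (iexp (t * T n x) - iexp (t * S n x)) \<le> \<bar>t\<bar> * \<bar>T n x - S n x\<bar>"
        using norm_iexp_diff_le[of "t * T n x" "t * S n x"] by (simp add: abs_mult[symmetric] right_diff_distrib)
      have 2: "cmod (iexp (t * T n x) - iexp (t * S n x)) \<le> 2"
        using norm_triangle_ineq4[of "iexp (t * T n x)" "iexp (t * S n x)"] by simp
      show "cmod (iexp (t * T n x) - iexp (t * S n x)) \<le> (2 + \<bar>t\<bar>) * min 1 \<bar>T n x - S n x\<bar>"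
      proof (cases "\<bar>T n x - S n x\<bar> \<le> 1")
        case True
        have "\<bar>t\<bar> * \<bar>T n x - S n x\<bar> \<le> (2 + \<bar>t\<bar>) * \<bar>T n x - S n x\<bar>" by (intro mult_right_mono) auto
        then show ?thesis using 1 True by simp
      qed (use 2 in simp)
    qed
    also have "\<dots> = (2 + \<bar>t\<bar>) * expectation (\<lambda>x. min 1 \<bar>T n x - S n x\<bar>)" by simp
    finally show ?thesis .
  qed
  have c: "(\<lambda>n. (2 + \<bar>t\<bar>) * expectation (\<lambda>x. min 1 \<bar>T n x - S n x\<bar>)) \<longlonglongrightarrow> 0"
    using tendsto_mult_right_zero[OF close] by simp
  have "\<forall>\<^sub>F n in sequentially. cmod (char (distr M borel (T n)) t - char (distr M borel (S n)) t) \<le> (2 + \<bar>t\<bar>) * expectation (\<lambda>x. min 1 \<bar>T n x - S n x\<bar>)"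
    by (intro always_eventually allI b)
  then have "(\<lambda>n. char (distr M borel (T n)) t - char (distr M borel (S n)) t) \<longlonglongrightarrow> 0"
    by (rule Lim_null_comparison[OF _ c])
  from tendsto_add[OF this char[of t]] show "(\<lambda>n. char (distr M borel (T n)) t) \<longlonglongrightarrow> char (normal_law v) t" by simp
qed

lemma indep_vars_pair:
  assumes indep: "indep_vars (\<lambda>_. borel) Y I" and "l \<in> I" "m \<in> I" "l \<noteq> m"
  shows "indep_var borel (Y l) borel (Y m)"
proof -
  have "indep_var (PiM {l} (\<lambda>_. borel)) (\<lambda>x. restrict (\<lambda>i. Y i x) {l}) (PiM {m} (\<lambda>_. borel)) (\<lambda>x. restrict (\<lambda>i. Y i x) {m})"
    using assms by (intro indep_var_restrict[OF indep]) auto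
  from indep_var_compose[OF this, of "\<lambda>f. f l" borel "\<lambda>f. f m" borel]
  show ?thesis by (simp add: comp_def)
qed

lemma second_moment_iid_sum:
  fixes Y :: "nat \<Rightarrow> 'a \<Rightarrow> real" and v :: real
  assumes indep: "indep_vars (\<lambda>_. borel) Y I" and I: "finite I"
    and mean: "\<And>l. l \<in> I \<Longrightarrow> expectation (Y l) = 0"
    and sq: "\<And>l. l \<in> I \<Longrightarrow> integrable M (\<lambda>x. (Y l x)\<^sup>2)"
    and var: "\<And>l. l \<in> I \<Longrightarrow> expectation (\<lambda>x. (Y l x)\<^sup>2) = (v :: real)"
  shows "integrable M (\<lambda>x. (\<Sum>l\<in>I. Y l x)\<^sup>2)" "expectation (\<lambda>x. (\<Sum>l\<in>I. Y l x)\<^sup>2) = card I * v"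
proof -
  have rv: "Y l \<in> borel_measurable M" if "l \<in> I" for l using indep that by (auto simp: indep_vars_def)
  have i1: "integrable M (Y l)" if "l \<in> I" for l
    using square_integrable_imp_integrable[OF rv[OF that] sq[OF that]] .
  have pr: "integrable M (\<lambda>x. Y l x * Y m x) \<and> expectation (\<lambda>x. Y l x * Y m x) = (if l = m then v else 0)" if lm: "l \<in> I" "m \<in> I" for l m
  proof (cases "l = m")
    case True
    then show ?thesis using sq[OF lm(1)] var[OF lm(1)] by (simp add: power2_eq_square)
  next
    case False
    have "indep_var borel (Y l) borel (Y m)"
      by (rule indep_vars_pair[OF indep lm False])
    then show ?thesis
      using indep_var_lebesgue_integral[of "Y l" "Y m"] indep_var_integrable[of "Y l" "Y m"] i1 lm mean False by simp
  qed
  have s: "(\<Sum>l\<in>I. Y l x)\<^sup>2 = (\<Sum>l\<in>I. \<Sum>m\<in>I. Y l x * Y m x)" for x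
    by (simp only: power2_eq_square sum_product)
  show "integrable M (\<lambda>x. (\<Sum>l\<in>I. Y l x)\<^sup>2)"
    unfolding s using pr by (intro Bochner_Integration.integrable_sum) auto
  have "expectation (\<lambda>x. (\<Sum>l\<in>I. Y l x)\<^sup>2) = (\<Sum>l\<in>I. expectation (\<lambda>x. \<Sum>m\<in>I. Y l x * Y m x))"
    unfolding s using pr by (intro Bochner_Integration.integral_sum Bochner_Integration.integrable_sum) auto
  also have "\<dots> = (\<Sum>l\<in>I. \<Sum>m\<in>I. expectation (\<lambda>x. Y l x * Y m x))"
    using pr by (intro sum.cong refl Bochner_Integration.integral_sum) auto
  also have "\<dots> = (\<Sum>l\<in>I. \<Sum>m\<in>I. if l = m then v else 0)"
    using pr by (intro sum.cong refl) auto
  finally show "expectation (\<lambda>x. (\<Sum>l\<in>I. Y l x)\<^sup>2) = card I * v" using I by simp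
qed

end

section \<open>Normal scores of a copula sample\<close>

text \<open>
  Without ties the ranks run through \<open>1, \<dots>, n\<close> in some order.
\<close>

lemma sum_ranks:
  fixes U :: "nat \<Rightarrow> real"
  assumes inj: "inj_on U {1..n}"
  shows "(\<Sum>l=1..n. f (\<Sum>i=1..n. if U i \<le> U l then 1 else 0 :: real)) = (\<Sum>l=1..n. f (real l))"
proof -
  define rk where "rk l = card {i\<in>{1..n}. U i \<le> U l}" for l
  have rk: "(\<Sum>i=1..n. if U i \<le> U l then 1 else 0 :: real) = real (rk l)" for l
    by (simp add: rk_def sum.If_cases Int_def)
  have less: "rk l < rk m" if "l \<in> {1..n}" "m \<in> {1..n}" "U l < U m" for l m
    unfolding rk_def
  proof (intro psubset_card_mono psubsetI)
    show "{i \<in> {1..n}. U i \<le> U l} \<subseteq> {i \<in> {1..n}. U i \<le> U m}" using that by auto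
    have "m \<in> {i \<in> {1..n}. U i \<le> U m}" "m \<notin> {i \<in> {1..n}. U i \<le> U l}" using that by auto
    then show "{i \<in> {1..n}. U i \<le> U l} \<noteq> {i \<in> {1..n}. U i \<le> U m}" by blast
  qed simp
  have "inj_on rk {1..n}"
  proof (rule inj_onI)
    fix l m assume lm: "l \<in> {1..n}" "m \<in> {1..n}" "rk l = rk m"
    then have "U l = U m" using less[OF lm(1,2)] less[OF lm(2,1)] lm(3) by (cases "U l" "U m" rule: linorder_cases) auto
    then show "l = m" using inj lm by (auto dest: inj_onD)
  qed
  moreover have "rk ` {1..n} \<subseteq> {1..n}"
  proof
    fix r assume "r \<in> rk ` {1..n}"
    then obtain l where l: "l \<in> {1..n}" "r = rk l" by auto
    have "{l} \<subseteq> {i\<in>{1..n}. U i \<le> U l}" using l by auto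
    then have "card {l} \<le> rk l" unfolding rk_def by (intro card_mono) auto
    moreover have "rk l \<le> card {1..n}" unfolding rk_def by (intro card_mono) auto
    ultimately show "r \<in> {1..n}" using l by simp
  qed
  ultimately have "bij_betw rk {1..n} {1..n}"
    by (simp add: bij_betw_def endo_inj_surj)
  then show ?thesis unfolding rk by (rule sum.reindex_bij_betw)
qed

lemma norm_matrix_le_sum: "norm (A :: real ^ 'q::finite ^ 'p::finite) \<le> (\<Sum>a\<in>UNIV. \<Sum>c\<in>UNIV. \<bar>A $ a $ c\<bar>)"
proof -
  have "norm A \<le> (\<Sum>a\<in>UNIV. norm (A $ a))" by (simp add: norm_vec_def L2_set_le_sum)
  also have "\<dots> \<le> (\<Sum>a\<in>UNIV. \<Sum>c\<in>UNIV. \<bar>A $ a $ c\<bar>)" by (intro sum_mono norm_le_l1_cart)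
  finally show ?thesis .
qed

locale copula_sample = prob_space M for M :: "'s measure" +
  fixes X :: "'s \<Rightarrow> real ^ 'q::finite" and Xs :: "nat \<Rightarrow> 's \<Rightarrow> real ^ 'q" and R :: "real ^ 'q ^ 'q"
  assumes X_meas: "X \<in> borel_measurable M"
    and X_cont: "\<forall>a. continuous_on UNIV (cdf (distr M borel (\<lambda>\<omega>. X \<omega> $ a)))"
    and R: "R \<in> pd_mats" and R1: "\<forall>a. R $ a $ a = 1"
    and copula: "gaussian_copula M X R"
    and Xs_indep: "indep_vars (\<lambda>_. borel) Xs {1..}"
    and Xs_law: "\<forall>l\<ge>1. distr M borel (Xs l) = distr M borel X"
begin

lemma R_diag: "R $ a $ a = 1" using R1 by blast

definition mcdf :: "'q \<Rightarrow> real \<Rightarrow> real" where "mcdf a = cdf (distr M borel (\<lambda>\<omega>. X \<omega> $ a))"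

definition score :: "real ^ 'q \<Rightarrow> real ^ 'q" where
  "score x = (\<chi> a. std_normal_quantile (mcdf a (x $ a)))"

definition Z :: "nat \<Rightarrow> 's \<Rightarrow> real ^ 'q" where "Z l \<omega> = score (Xs l \<omega>)"

interpretation mu: prob_space "mvn R" by (rule prob_space_mvn[OF R])

lemma Xs_meas [measurable]: "1 \<le> l \<Longrightarrow> Xs l \<in> borel_measurable M"
  using Xs_indep by (auto simp: indep_vars_def)

lemma mcdf_measurable [measurable]: "mcdf a \<in> borel_measurable borel"
  unfolding mcdf_def using X_cont by (intro borel_measurable_continuous_onI) blast

lemma score_measurable [measurable]: "score \<in> borel_measurable borel"
  unfolding score_def by measurable

lemma Z_meas [measurable]: "1 \<le> l \<Longrightarrow> Z l \<in> borel_measurable M"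
  unfolding Z_def by (rule measurable_compose[OF Xs_meas score_measurable])

lemma Z_law:
  assumes "1 \<le> l"
  shows "distr M borel (Z l) = mvn R"
proof -
  have "distr M borel (Z l) = distr (distr M borel (Xs l)) borel score"
    unfolding Z_def using assms by (subst distr_distr) (auto simp: comp_def)
  also have "\<dots> = distr (distr M borel X) borel score" using Xs_law assms by simp
  also have "\<dots> = distr M borel (\<lambda>\<omega>. score (X \<omega>))"
    using X_meas by (subst distr_distr) (auto simp: comp_def)
  also have "\<dots> = mvn R" using copula by (simp add: gaussian_copula_def score_def mcdf_def)
  finally show ?thesis .
qed

lemma Z_indep: "indep_vars (\<lambda>_. borel) Z {1..}"
  using indep_vars_compose2[OF Xs_indep, of "\<lambda>_. score" "\<lambda>_. borel"] by (simp add: Z_def[abs_def])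

lemma Z_sample:
  assumes "1 \<le> n"
  shows "distr M (PiM {1..n} (\<lambda>_. borel)) (\<lambda>\<omega>. \<lambda>i\<in>{1..n}. Z i \<omega>) = PiM {1..n} (\<lambda>_. mvn R)"
proof -
  have "indep_vars (\<lambda>_. borel) Z {1..n}" by (rule indep_vars_subset[OF Z_indep]) auto
  then have "distr M (PiM {1..n} (\<lambda>_. borel)) (\<lambda>\<omega>. \<lambda>i\<in>{1..n}. Z i \<omega>) = PiM {1..n} (\<lambda>i. distr M borel (Z i))"
    using assms by (subst (asm) indep_vars_iff_distr_eq_PiM') auto
  also have "\<dots> = PiM {1..n} (\<lambda>_. mvn R)" by (rule PiM_cong) (auto simp: Z_law)
  finally show ?thesis .
qed

lemma nn_integral_sample:
  assumes n: "1 \<le> n" and G: "G \<in> borel_measurable (PiM {1..n} (\<lambda>_. mvn R))"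
  shows "(\<integral>\<^sup>+\<omega>. G (\<lambda>i\<in>{1..n}. Z i \<omega>) \<partial>M) = (\<integral>\<^sup>+x. G x \<partial>PiM {1..n} (\<lambda>_. mvn R))"
proof -
  have s: "sets (PiM {1..n} (\<lambda>_. mvn R)) = sets (PiM {1..n} (\<lambda>_. borel))" by (rule sets_PiM_cong) auto
  have Gm: "G \<in> borel_measurable (PiM {1..n} (\<lambda>_. borel))"
    using G by (simp only: measurable_cong_sets[OF s refl])
  have m: "(\<lambda>\<omega>. \<lambda>i\<in>{1..n}. Z i \<omega>) \<in> measurable M (PiM {1..n} (\<lambda>_. borel))"
    by (rule measurable_restrict) (rule Z_meas, simp)
  show ?thesis unfolding Z_sample[OF n, symmetric] by (rule nn_integral_distr[OF m, symmetric]) (simp only: measurable_distr_eq1 Gm)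
qed

lemma Z_coord_law:
  assumes "1 \<le> l"
  shows "distr M borel (\<lambda>\<omega>. Z l \<omega> $ a) = std_normal_distribution"
proof -
  have "distr M borel (\<lambda>\<omega>. Z l \<omega> $ a) = distr (distr M borel (Z l)) borel (\<lambda>z. z $ a)"
    using assms by (subst distr_distr) (auto simp: comp_def)
  then show ?thesis by (simp add: Z_law[OF assms] mvn_marginal[OF R R_diag])
qed

lemma Z_coord_distributed: "1 \<le> l \<Longrightarrow> distributed M lborel (\<lambda>\<omega>. Z l \<omega> $ a) (normal_density 0 1)"
  using Z_coord_law[of l a] by (auto simp: distributed_def cong: distr_cong)

lemma Z_no_atom:
  assumes l: "1 \<le> l"
  shows "AE \<omega> in M. Z l \<omega> $ a \<noteq> t"
  using distributed_AE2[OF Z_coord_distributed[OF l, of a], of "\<lambda>x. x \<noteq> t"] AE_lborel_singleton[of t] by auto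

lemma Z_no_tie:
  assumes lm: "1 \<le> l" "1 \<le> m" "l \<noteq> m"
  shows "AE \<omega> in M. Z l \<omega> $ a \<noteq> Z m \<omega> $ a"
proof -
  have "indep_vars (\<lambda>_. borel) (\<lambda>l \<omega>. Z l \<omega> $ a) {1..}"
    by (rule indep_vars_compose2[OF Z_indep, of "\<lambda>_ z. z $ a"]) measurable
  then have "indep_var borel (\<lambda>\<omega>. Z l \<omega> $ a) borel (\<lambda>\<omega>. Z m \<omega> $ a)"
    using lm by (intro indep_vars_pair) auto
  then have "distributed M lborel (\<lambda>\<omega>. Z l \<omega> $ a - Z m \<omega> $ a) (normal_density (0 - 0) (sqrt (1\<^sup>2 + 1\<^sup>2)))"
    using lm by (intro diff_indep_normal Z_coord_distributed) auto
  from distributed_AE2[OF this, of "\<lambda>x. x \<noteq> 0"] have "AE \<omega> in M. Z l \<omega> $ a - Z m \<omega> $ a \<noteq> 0"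
    using AE_lborel_singleton[of 0] by auto
  then show ?thesis by simp
qed

lemma mcdf_bounds: "0 \<le> mcdf a x" "mcdf a x \<le> 1"
proof -
  interpret D: real_distribution "distr M borel (\<lambda>\<omega>. X \<omega> $ a)"
    using X_meas by (intro real_distribution_distr) auto
  show "0 \<le> mcdf a x" "mcdf a x \<le> 1" unfolding mcdf_def by (auto intro: D.cdf_nonneg D.cdf_bounded_prob)
qed

lemma mcdf_mono: "x \<le> y \<Longrightarrow> mcdf a x \<le> mcdf a y"
proof -
  interpret D: real_distribution "distr M borel (\<lambda>\<omega>. X \<omega> $ a)"
    using X_meas by (intro real_distribution_distr) auto
  show "x \<le> y \<Longrightarrow> mcdf a x \<le> mcdf a y" unfolding mcdf_def by (rule D.cdf_nondecreasing)
qed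

text \<open>
  The scores \<open>Z\<close> order the observations as the data do, without ties.
\<close>

definition regular :: "'s \<Rightarrow> bool" where
  "regular \<omega> \<longleftrightarrow> (\<forall>l\<ge>1. \<forall>m\<ge>1. \<forall>a. (Xs l \<omega> $ a \<le> Xs m \<omega> $ a \<longleftrightarrow> Z l \<omega> $ a \<le> Z m \<omega> $ a) \<and>
     (l \<noteq> m \<longrightarrow> Z l \<omega> $ a \<noteq> Z m \<omega> $ a))"

text \<open>
  The scores are nondecreasing in the observations, strictly so outside a null set, because they have
  no ties.
\<close>

lemma AE_regular: "AE \<omega> in M. regular \<omega>"
proof -
  have "AE \<omega> in M. \<forall>l. \<forall>m. \<forall>a\<in>(UNIV :: 'q set). 1 \<le> l \<and> 1 \<le> m \<longrightarrow>
      Z l \<omega> $ a \<noteq> std_normal_quantile 0 \<and> Z l \<omega> $ a \<noteq> std_normal_quantile 1 \<and> (l \<noteq> m \<longrightarrow> Z l \<omega> $ a \<noteq> Z m \<omega> $ a)"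
    unfolding AE_all_countable
  proof (intro allI)
    fix l m :: nat
    show "AE \<omega> in M. \<forall>a\<in>(UNIV :: 'q set). 1 \<le> l \<and> 1 \<le> m \<longrightarrow>
      Z l \<omega> $ a \<noteq> std_normal_quantile 0 \<and> Z l \<omega> $ a \<noteq> std_normal_quantile 1 \<and> (l \<noteq> m \<longrightarrow> Z l \<omega> $ a \<noteq> Z m \<omega> $ a)"
    proof (rule AE_finite_allI)
      fix a :: 'q
      show "AE \<omega> in M. 1 \<le> l \<and> 1 \<le> m \<longrightarrow>
        Z l \<omega> $ a \<noteq> std_normal_quantile 0 \<and> Z l \<omega> $ a \<noteq> std_normal_quantile 1 \<and> (l \<noteq> m \<longrightarrow> Z l \<omega> $ a \<noteq> Z m \<omega> $ a)"
      proof (cases "1 \<le> l \<and> 1 \<le> m")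
        case True
        then have 1: "AE \<omega> in M. Z l \<omega> $ a \<noteq> std_normal_quantile 0" "AE \<omega> in M. Z l \<omega> $ a \<noteq> std_normal_quantile 1"
          by (auto intro: Z_no_atom)
        have 2: "AE \<omega> in M. l \<noteq> m \<longrightarrow> Z l \<omega> $ a \<noteq> Z m \<omega> $ a"
          using Z_no_tie[of l m a] True by (cases "l = m") auto
        show ?thesis using 1 2 by eventually_elim simp
      qed auto
    qed simp
  qed
  then show ?thesis
  proof eventually_elim
    case (elim \<omega>)
    have F: "0 < mcdf a (Xs l \<omega> $ a)" "mcdf a (Xs l \<omega> $ a) < 1" if "1 \<le> l" for l a
    proof -
      have "Z l \<omega> $ a \<noteq> std_normal_quantile 0" "Z l \<omega> $ a \<noteq> std_normal_quantile 1" using elim that by blast+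
      then have "mcdf a (Xs l \<omega> $ a) \<noteq> 0" "mcdf a (Xs l \<omega> $ a) \<noteq> 1" by (auto simp: Z_def score_def)
      then show "0 < mcdf a (Xs l \<omega> $ a)" "mcdf a (Xs l \<omega> $ a) < 1"
        using mcdf_bounds[of a "Xs l \<omega> $ a"] by auto
    qed
    have mono: "Z l \<omega> $ a \<le> Z m \<omega> $ a" if "1 \<le> l" "1 \<le> m" "Xs l \<omega> $ a \<le> Xs m \<omega> $ a" for l m a
      using quantile_mono[OF F(1)[OF that(1), of a] mcdf_mono[OF that(3), of a] F(2)[OF that(2), of a]]
      by (simp add: Z_def score_def)
    have "Xs l \<omega> $ a \<le> Xs m \<omega> $ a" if lm: "1 \<le> l" "1 \<le> m" "Z l \<omega> $ a \<le> Z m \<omega> $ a" for l m a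
    proof (rule ccontr)
      assume n: "\<not> Xs l \<omega> $ a \<le> Xs m \<omega> $ a"
      then have "Z m \<omega> $ a \<le> Z l \<omega> $ a" using mono[of m l a] lm by simp
      then have "Z l \<omega> $ a = Z m \<omega> $ a" using lm by simp
      then have "l = m" using elim lm by blast
      then show False using n by simp
    qed
    then show ?case using mono elim unfolding regular_def by blast
  qed
qed

abbreviation "serrZ n \<omega> a l \<equiv> score_err {1..n} (\<lambda>i. Z i \<omega> $ a) l"

lemma normal_score_regular:
  assumes "regular \<omega>" "l \<in> {1..n}"
  shows "normal_score Xs n \<omega> l a = std_normal_quantile ((\<Sum>i=1..n. if Z i \<omega> $ a \<le> Z l \<omega> $ a then 1 else 0) / (real n + 1))"
    "normal_score Xs n \<omega> l a = Z l \<omega> $ a + serrZ n \<omega> a l"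
proof -
  have "(\<Sum>i=1..n. if Xs i \<omega> $ a \<le> Xs l \<omega> $ a then 1 else 0 :: real) = (\<Sum>i=1..n. if Z i \<omega> $ a \<le> Z l \<omega> $ a then 1 else 0)"
    using assms by (intro sum.cong) (auto simp: regular_def)
  moreover have gen: "real n / (real n + 1) * (S / real n) = S / (real n + 1)" for S using assms(2) by simp
  ultimately show "normal_score Xs n \<omega> l a = std_normal_quantile ((\<Sum>i=1..n. if Z i \<omega> $ a \<le> Z l \<omega> $ a then 1 else 0) / (real n + 1))"
    using gen by (simp only: normal_score_def emp_cdf_def)
  then show "normal_score Xs n \<omega> l a = Z l \<omega> $ a + serrZ n \<omega> a l" by (simp add: score_err_def)
qed

definition score_var :: "nat \<Rightarrow> real" where
  "score_var n = (\<Sum>l=1..n. (std_normal_quantile (real l / (real n + 1)))\<^sup>2) / real n"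

lemma sum_score_squares:
  assumes "regular \<omega>" "1 \<le> n"
  shows "(\<Sum>l=1..n. (normal_score Xs n \<omega> l a)\<^sup>2) = real n * score_var n"
proof -
  have "(\<Sum>l=1..n. (normal_score Xs n \<omega> l a)\<^sup>2) =
      (\<Sum>l=1..n. (\<lambda>r. (std_normal_quantile (r / (real n + 1)))\<^sup>2) (\<Sum>i=1..n. if Z i \<omega> $ a \<le> Z l \<omega> $ a then 1 else 0))"
    by (intro sum.cong refl) (simp add: normal_score_regular(1)[OF assms(1)])
  also have "\<dots> = (\<Sum>l=1..n. (std_normal_quantile (real l / (real n + 1)))\<^sup>2)"
  proof (rule sum_ranks)
    show "inj_on (\<lambda>l. Z l \<omega> $ a) {1..n}"
    proof (rule inj_onI, rule ccontr)
      fix l m assume "l \<in> {1..n}" "m \<in> {1..n}" "Z l \<omega> $ a = Z m \<omega> $ a" "l \<noteq> m"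
      then show False using assms(1) unfolding regular_def by (metis atLeastAtMost_iff)
    qed
  qed
  finally show ?thesis using assms by (simp add: score_var_def)
qed

lemma rank_corr_eq: "rank_corr Xs n \<omega> $ a $ c = ((\<Sum>l=1..n. normal_score Xs n \<omega> l a * normal_score Xs n \<omega> l c) / real n) / score_var n"
  by (simp add: rank_corr_def score_var_def)

definition lin :: "'q \<Rightarrow> 'q \<Rightarrow> real \<Rightarrow> real \<Rightarrow> real" where
  "lin a c u v = u * v - R $ a $ c / 2 * (u\<^sup>2 + v\<^sup>2)"

text \<open>
  The influence function of the normal scores correlation: the product of two scores, corrected for the
  common normalisation by their mean squares.
\<close>

definition influence :: "real ^ 'q \<Rightarrow> real ^ 'q ^ 'q" where
  "influence z = (\<chi> a c. lin a c (z $ a) (z $ c))"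

text \<open>
  Without ties the common denominator is the mean square of the scores of either coordinate.
\<close>

lemma rank_corr_deviation:
  assumes reg: "regular \<omega>" and n: "1 \<le> n" and s: "score_var n \<noteq> 0"
  shows "score_var n * (rank_corr Xs n \<omega> $ a $ c - R $ a $ c) =
    (\<Sum>l=1..n. lin a c (normal_score Xs n \<omega> l a) (normal_score Xs n \<omega> l c)) / real n"
proof -
  have "(\<Sum>l=1..n. lin a c (normal_score Xs n \<omega> l a) (normal_score Xs n \<omega> l c)) =
      (\<Sum>l=1..n. normal_score Xs n \<omega> l a * normal_score Xs n \<omega> l c) - R $ a $ c / 2 * (real n * score_var n + real n * score_var n)"
    unfolding lin_def by (simp only: sum_subtractf sum_distrib_left[symmetric] sum.distrib sum_score_squares[OF reg n])
  moreover have "\<sigma> * (A / N / \<sigma> - r) = (A - r / 2 * (N * \<sigma> + N * \<sigma>)) / N" if "N \<noteq> 0" "\<sigma> \<noteq> 0" for \<sigma> A N r :: real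
    using that by (simp add: field_simps)
  ultimately show ?thesis using n s by (simp add: rank_corr_eq)
qed

lemma rank_corr_diag: "regular \<omega> \<Longrightarrow> 1 \<le> n \<Longrightarrow> score_var n \<noteq> 0 \<Longrightarrow> rank_corr Xs n \<omega> $ a $ a = 1"
  using rank_corr_deviation[of \<omega> n a a] by (simp add: lin_def R_diag power2_eq_square)

lemma score_var_nonneg: "0 \<le> score_var n"
  by (simp add: score_var_def sum_nonneg)

lemma rank_corr_cov: "rank_corr Xs n \<omega> \<in> cov_mats"
proof -
  let ?s = "\<lambda>l. (\<chi> a. normal_score Xs n \<omega> l a) :: real ^ 'q"
  have "x \<bullet> (rank_corr Xs n \<omega> *v x) = (\<Sum>l=1..n. (x \<bullet> ?s l)\<^sup>2) / real n / score_var n" for x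
  proof -
    have "x \<bullet> (rank_corr Xs n \<omega> *v x) = (\<Sum>a\<in>UNIV. \<Sum>c\<in>UNIV. \<Sum>l=1..n. (x $ a * ?s l $ a) * (x $ c * ?s l $ c)) / real n / score_var n"
      by (simp add: inner_vec_def matrix_vector_mult_def rank_corr_eq sum_distrib_left sum_distrib_right sum_divide_distrib mult_ac)
    also have "(\<Sum>a\<in>UNIV. \<Sum>c\<in>UNIV. \<Sum>l=1..n. (x $ a * ?s l $ a) * (x $ c * ?s l $ c)) = (\<Sum>l=1..n. \<Sum>a\<in>UNIV. \<Sum>c\<in>UNIV. (x $ a * ?s l $ a) * (x $ c * ?s l $ c))"
    proof -
      have "(\<Sum>a\<in>UNIV. \<Sum>c\<in>UNIV. \<Sum>l=1..n. (x $ a * ?s l $ a) * (x $ c * ?s l $ c)) = (\<Sum>a\<in>UNIV. \<Sum>l=1..n. \<Sum>c\<in>UNIV. (x $ a * ?s l $ a) * (x $ c * ?s l $ c))"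
        by (intro sum.cong refl sum.swap)
      also have "\<dots> = (\<Sum>l=1..n. \<Sum>a\<in>UNIV. \<Sum>c\<in>UNIV. (x $ a * ?s l $ a) * (x $ c * ?s l $ c))" by (rule sum.swap)
      finally show ?thesis .
    qed
    also have "\<dots> = (\<Sum>l=1..n. (x \<bullet> ?s l)\<^sup>2)"
      by (simp add: inner_vec_def power2_eq_square sum_product)
    finally show ?thesis .
  qed
  then have "0 \<le> x \<bullet> (rank_corr Xs n \<omega> *v x)" for x
    by (simp add: sum_nonneg score_var_nonneg)
  moreover have "transpose (rank_corr Xs n \<omega>) = rank_corr Xs n \<omega>"
    by (simp add: transpose_def vec_eq_iff rank_corr_eq mult.commute)
  ultimately show ?thesis by (simp add: cov_mats_def)
qed

text \<open>
  \<open>rank_corr\<close> depends on the sample only through finitely many comparisons, so that any function of it is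
  measurable.
\<close>

lemma rank_corr_functional_measurable: "(\<lambda>\<omega>. f (rank_corr Xs n \<omega>)) \<in> measurable M (borel :: 'b::topological_space measure)"
proof -
  define S where "S = {1..n} \<times> {1..n} \<times> (UNIV :: 'q set)"
  define K where "K \<omega> = {t \<in> S. Xs (fst t) \<omega> $ snd (snd t) \<le> Xs (fst (snd t)) \<omega> $ snd (snd t)}" for \<omega>
  define ec where "ec P a l = (\<Sum>i=1..n. if (i, l, a) \<in> P then 1 else 0 :: real) / real n" for P and a :: 'q and l :: nat
  define ns where "ns P l a = std_normal_quantile (real n / (real n + 1) * ec P a l)" for P and a :: 'q and l :: nat
  define H where "H P = (\<chi> a c. ((\<Sum>l=1..n. ns P l a * ns P l c) / real n) / score_var n)" for P
  have "finite S" by (simp add: S_def)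
  have ns: "normal_score Xs n \<omega> l a = ns (K \<omega>) l a" if "l \<in> {1..n}" for \<omega> l a
    using that unfolding normal_score_def ns_def emp_cdf_def ec_def
    by (intro arg_cong[of _ _ std_normal_quantile] arg_cong2[of _ _ _ _ "(*)"] arg_cong2[of _ _ _ _ "(/)"] refl sum.cong) (auto simp: K_def S_def)
  have H: "rank_corr Xs n \<omega> = H (K \<omega>)" for \<omega>
    by (auto simp: vec_eq_iff rank_corr_eq H_def ns intro!: arg_cong2[of _ _ _ _ "(/)"] sum.cong)
  have "K \<in> measurable M (count_space (Pow S))"
  proof (subst measurable_count_space_eq2)
    show "finite (Pow S)" using \<open>finite S\<close> by simp
    show "K \<in> space M \<rightarrow> Pow S \<and> (\<forall>a\<in>Pow S. K -` {a} \<inter> space M \<in> sets M)"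
    proof (intro conjI ballI)
      fix P assume P: "P \<in> Pow S"
      have "K \<omega> = P \<longleftrightarrow> (\<forall>t\<in>S. (Xs (fst t) \<omega> $ snd (snd t) \<le> Xs (fst (snd t)) \<omega> $ snd (snd t)) = (t \<in> P))" for \<omega>
        using P unfolding K_def by blast
      then have "K -` {P} \<inter> space M = {\<omega>\<in>space M. \<forall>t\<in>S. (Xs (fst t) \<omega> $ snd (snd t) \<le> Xs (fst (snd t)) \<omega> $ snd (snd t)) = (t \<in> P)}"
        by auto
      also have "\<dots> \<in> sets M"
      proof (rule sets.sets_Collect_finite_All[OF _ \<open>finite S\<close>])
        fix t assume "t \<in> S"
        then have t: "1 \<le> fst t" "1 \<le> fst (snd t)" by (auto simp: S_def)
        note [measurable] = Xs_meas[OF t(1)] Xs_meas[OF t(2)]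
        show "{\<omega>\<in>space M. (Xs (fst t) \<omega> $ snd (snd t) \<le> Xs (fst (snd t)) \<omega> $ snd (snd t)) = (t \<in> P)} \<in> sets M"
          by measurable
      qed
      finally show "K -` {P} \<inter> space M \<in> sets M" .
    qed (auto simp: K_def)
  qed
  from measurable_compose[OF this, of "\<lambda>P. f (H P)"] show ?thesis unfolding H by simp
qed

end

section \<open>The delta method\<close>

lemma trace_mult: "trace (A ** B) = (\<Sum>a\<in>UNIV. \<Sum>c\<in>UNIV. A $ a $ c * B $ c $ a)" for A B :: "real ^ 'q::finite ^ 'q"
  by (simp add: trace_def matrix_matrix_mult_def)

lemma quad_form_sum: "z \<bullet> (A *v z) = (\<Sum>a\<in>UNIV. \<Sum>c\<in>UNIV. A $ a $ c * (z $ a * z $ c))" for A :: "real ^ 'q::finite ^ 'q"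
  by (simp add: inner_vec_def matrix_vector_mult_def sum_distrib_left mult_ac)

lemma mvn_quad_form:
  fixes R A :: "real ^ 'q::finite ^ 'q"
  assumes R: "R \<in> pd_mats"
  shows "has_bochner_integral (mvn R) (\<lambda>z. z \<bullet> (A *v z)) (trace (A ** R))"
proof -
  have "trace (A ** R) = (\<Sum>a\<in>UNIV. \<Sum>c\<in>UNIV. A $ a $ c * R $ a $ c)"
    unfolding trace_mult by (intro sum.cong refl arg_cong2[of _ _ _ _ "(*)"] pd_sym_nth[OF R])
  then show ?thesis unfolding quad_form_sum
    by (simp only:) (intro has_bochner_integral_sum has_bochner_integral_mult_right mvn_second_moment[OF R])
qed

lemma mvn_quad_form_square:
  fixes R A :: "real ^ 'q::finite ^ 'q"
  assumes R: "R \<in> pd_mats" and A: "transpose A = A"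
  shows "has_bochner_integral (mvn R) (\<lambda>z. (z \<bullet> (A *v z))\<^sup>2)
    ((trace (A ** R))\<^sup>2 + 2 * trace ((A ** R) ** (A ** R)))"
proof -
  have As: "A $ a $ c = A $ c $ a" for a c using A by (metis transpose_def vec_lambda_beta)
  note Rs = pd_sym_nth[OF R]
  have sq: "(z \<bullet> (A *v z))\<^sup>2 = (\<Sum>a\<in>UNIV. \<Sum>c\<in>UNIV. \<Sum>d\<in>UNIV. \<Sum>e\<in>UNIV. (A $ a $ c * A $ d $ e) * (z $ a * z $ c * z $ d * z $ e))" for z
    unfolding quad_form_sum power2_eq_square sum_distrib_left sum_distrib_right
    by (intro sum.cong refl) (simp add: mult_ac)
  have h: "has_bochner_integral (mvn R) (\<lambda>z. (z \<bullet> (A *v z))\<^sup>2)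
    (\<Sum>a\<in>UNIV. \<Sum>c\<in>UNIV. \<Sum>d\<in>UNIV. \<Sum>e\<in>UNIV. (A $ a $ c * A $ d $ e) * (R $ a $ c * R $ d $ e + R $ a $ d * R $ c $ e + R $ a $ e * R $ c $ d))"
    unfolding sq by (intro has_bochner_integral_sum has_bochner_integral_mult_right mvn_fourth_moment[OF R])
  have 1: "(\<Sum>a\<in>UNIV. \<Sum>c\<in>UNIV. \<Sum>d\<in>UNIV. \<Sum>e\<in>UNIV. (A $ a $ c * A $ d $ e) * (R $ a $ c * R $ d $ e)) = (trace (A ** R))\<^sup>2"
  proof -
    have t: "trace (A ** R) = (\<Sum>a\<in>UNIV. \<Sum>c\<in>UNIV. A $ a $ c * R $ a $ c)"
      unfolding trace_mult by (intro sum.cong refl arg_cong2[of _ _ _ _ "(*)"] Rs)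
    show ?thesis unfolding t power2_eq_square sum_distrib_left sum_distrib_right
      by (intro sum.cong refl) (simp add: mult_ac)
  qed
  have t4: "trace ((A ** R) ** (A ** R)) = (\<Sum>a\<in>UNIV. \<Sum>c\<in>UNIV. \<Sum>d\<in>UNIV. \<Sum>e\<in>UNIV. (A $ a $ c * A $ d $ e) * (R $ a $ e * R $ c $ d))"
  proof -
    have "trace ((A ** R) ** (A ** R)) = (\<Sum>a\<in>UNIV. \<Sum>d\<in>UNIV. (\<Sum>c\<in>UNIV. A $ a $ c * R $ c $ d) * (\<Sum>e\<in>UNIV. A $ d $ e * R $ e $ a))"
      by (simp only: trace_mult[of "A ** R"]) (simp add: matrix_matrix_mult_def)
    also have "\<dots> = (\<Sum>a\<in>UNIV. \<Sum>d\<in>UNIV. \<Sum>c\<in>UNIV. \<Sum>e\<in>UNIV. (A $ a $ c * R $ c $ d) * (A $ d $ e * R $ e $ a))"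
      by (simp only: sum_product)
    also have "\<dots> = (\<Sum>a\<in>UNIV. \<Sum>c\<in>UNIV. \<Sum>d\<in>UNIV. \<Sum>e\<in>UNIV. (A $ a $ c * R $ c $ d) * (A $ d $ e * R $ e $ a))"
      by (intro sum.cong refl sum.swap)
    also have "\<dots> = (\<Sum>a\<in>UNIV. \<Sum>c\<in>UNIV. \<Sum>d\<in>UNIV. \<Sum>e\<in>UNIV. (A $ a $ c * A $ d $ e) * (R $ a $ e * R $ c $ d))"
    proof (intro sum.cong refl)
      fix a c d e
      show "(A $ a $ c * R $ c $ d) * (A $ d $ e * R $ e $ a) = (A $ a $ c * A $ d $ e) * (R $ a $ e * R $ c $ d)"
        unfolding Rs[of e a] by (simp add: mult_ac)
    qed
    finally show ?thesis .
  qed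
  have 2: "(\<Sum>a\<in>UNIV. \<Sum>c\<in>UNIV. \<Sum>d\<in>UNIV. \<Sum>e\<in>UNIV. (A $ a $ c * A $ d $ e) * (R $ a $ d * R $ c $ e)) = trace ((A ** R) ** (A ** R))"
  proof -
    have "(\<Sum>a\<in>UNIV. \<Sum>c\<in>UNIV. \<Sum>d\<in>UNIV. \<Sum>e\<in>UNIV. (A $ a $ c * A $ d $ e) * (R $ a $ d * R $ c $ e)) =
      (\<Sum>a\<in>UNIV. \<Sum>c\<in>UNIV. \<Sum>e\<in>UNIV. \<Sum>d\<in>UNIV. (A $ a $ c * A $ d $ e) * (R $ a $ d * R $ c $ e))"
      by (intro sum.cong refl sum.swap)
    also have "\<dots> = (\<Sum>a\<in>UNIV. \<Sum>c\<in>UNIV. \<Sum>e\<in>UNIV. \<Sum>d\<in>UNIV. (A $ a $ c * A $ e $ d) * (R $ a $ d * R $ c $ e))"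
      by (intro sum.cong refl arg_cong2[of _ _ _ _ "(*)"] As)
    finally show ?thesis unfolding t4 .
  qed
  show ?thesis using h
    by (simp only: distrib_left sum.distrib 1 2 t4[symmetric]) (simp add: algebra_simps)
qed

text \<open>
  \<open>W\<close> is the symmetrised matrix of the coefficients of \<open>L\<close>.
\<close>

lemma linear_functional_symmetric:
  fixes L :: "real ^ 'q::finite ^ 'q \<Rightarrow> real"
  assumes "linear L"
  obtains W :: "real ^ 'q ^ 'q" where "transpose W = W" "\<And>H. transpose H = H \<Longrightarrow> L H = trace (W ** H)"
proof -
  interpret L: linear L by fact
  define U :: "real ^ 'q ^ 'q" where "U = (\<chi> a c. L (axis a (axis c 1)))"
  define W where "W = (1 / 2) *\<^sub>R (U + transpose U)"
  have LU: "L H = (\<Sum>a\<in>UNIV. \<Sum>c\<in>UNIV. H $ a $ c * U $ a $ c)" for H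
  proof -
    have "H = (\<Sum>a\<in>UNIV. \<Sum>c\<in>UNIV. H $ a $ c *\<^sub>R axis a (axis c 1))"
    proof (unfold vec_eq_iff, intro allI)
      fix i j
      have "(\<Sum>a\<in>UNIV. \<Sum>c\<in>UNIV. H $ a $ c *\<^sub>R axis a (axis c 1)) $ i $ j =
          (\<Sum>a\<in>UNIV. if i = a then (\<Sum>c\<in>UNIV. if j = c then H $ a $ c else 0) else 0)"
        unfolding sum_component
      proof (rule sum.cong[OF refl])
        fix a
        show "(\<Sum>c\<in>UNIV. (H $ a $ c *\<^sub>R axis a (axis c 1)) $ i $ j) = (if i = a then (\<Sum>c\<in>UNIV. if j = c then H $ a $ c else 0) else 0)"
          by (cases "i = a") (simp_all add: axis_def if_distrib[of "\<lambda>v. _ * v"] cong: if_cong)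
      qed
      then show "H $ i $ j = (\<Sum>a\<in>UNIV. \<Sum>c\<in>UNIV. H $ a $ c *\<^sub>R axis a (axis c 1)) $ i $ j" by simp
    qed
    then have "L H = L (\<Sum>a\<in>UNIV. \<Sum>c\<in>UNIV. H $ a $ c *\<^sub>R axis a (axis c 1))" by simp
    then show ?thesis by (simp add: L.sum L.scale U_def)
  qed
  have "L H = trace (W ** H)" if H: "transpose H = H" for H
  proof -
    have Hs: "H $ c $ a = H $ a $ c" for a c using H by (metis transpose_def vec_lambda_beta)
    have "trace (W ** H) = (\<Sum>a\<in>UNIV. \<Sum>c\<in>UNIV. H $ a $ c * U $ a $ c) / 2 + (\<Sum>a\<in>UNIV. \<Sum>c\<in>UNIV. H $ c $ a * U $ c $ a) / 2"
      by (simp add: trace_mult W_def transpose_def sum_divide_distrib sum.distrib[symmetric] Hs algebra_simps add_divide_distrib)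
    also have "(\<Sum>a\<in>UNIV. \<Sum>c\<in>UNIV. H $ c $ a * U $ c $ a) = (\<Sum>a\<in>UNIV. \<Sum>c\<in>UNIV. H $ a $ c * U $ a $ c)" by (rule sum.swap)
    finally show ?thesis unfolding LU by simp
  qed
  moreover have "transpose W = W" by (simp add: W_def transpose_def vec_eq_iff add.commute)
  ultimately show ?thesis by (rule that[rotated])
qed

context copula_sample
begin

lemma R_sym: "R $ c $ a = R $ a $ c" by (rule pd_sym_nth[OF R])

lemma transpose_influence: "transpose (influence z) = influence z"
  by (simp add: influence_def lin_def transpose_def vec_eq_iff R_sym mult.commute add.commute)

lemma influence_measurable [measurable]: "(\<lambda>z. influence z $ a $ c) \<in> borel_measurable borel"
  unfolding influence_def lin_def by simp

text \<open>
  The correction by the squares removes exactly the diagonal of \<open>W R\<close> from the weights.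
\<close>

lemma trace_influence:
  assumes W: "transpose W = W"
  shows "trace (W ** influence z) = z \<bullet> ((W - diag_part (W ** R)) *v z)"
proof -
  have Ws: "W $ c $ a = W $ a $ c" for a c using W by (metis transpose_def vec_lambda_beta)
  have d: "z \<bullet> (diag_part (W ** R) *v z) = (\<Sum>a\<in>UNIV. \<Sum>c\<in>UNIV. W $ a $ c * R $ a $ c * (z $ a)\<^sup>2)"
  proof -
    have "diag_part (W ** R) *v z = (\<chi> a. (W ** R) $ a $ a * z $ a)"
      by (simp add: vec_eq_iff matrix_vector_mult_def diag_part_def if_distrib[of "\<lambda>v. v * _"] cong: if_cong)
    then show ?thesis
      by (simp add: inner_vec_def matrix_matrix_mult_def sum_distrib_left sum_distrib_right power2_eq_square mult_ac R_sym)
  qed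
  have "trace (W ** influence z) = (\<Sum>a\<in>UNIV. \<Sum>c\<in>UNIV. W $ a $ c * (z $ a * z $ c)
      - (W $ a $ c * R $ a $ c * (z $ a)\<^sup>2) / 2 - (W $ c $ a * R $ c $ a * (z $ c)\<^sup>2) / 2)"
    unfolding trace_mult influence_def lin_def
  proof (intro sum.cong refl)
    fix a c
    show "W $ a $ c * (\<chi> a c. z $ a * z $ c - R $ a $ c / 2 * ((z $ a)\<^sup>2 + (z $ c)\<^sup>2)) $ c $ a = W $ a $ c * (z $ a * z $ c)
      - (W $ a $ c * R $ a $ c * (z $ a)\<^sup>2) / 2 - (W $ c $ a * R $ c $ a * (z $ c)\<^sup>2) / 2"
      by (simp add: R_sym[of c a] Ws[of c a] algebra_simps)
  qed
  also have "\<dots> = z \<bullet> (W *v z) - z \<bullet> (diag_part (W ** R) *v z) / 2 - (\<Sum>a\<in>UNIV. \<Sum>c\<in>UNIV. W $ c $ a * R $ c $ a * (z $ c)\<^sup>2) / 2"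
    by (simp add: quad_form_sum[of z W] d sum_subtractf sum_divide_distrib)
  also have "(\<Sum>a\<in>UNIV. \<Sum>c\<in>UNIV. W $ c $ a * R $ c $ a * (z $ c)\<^sup>2) = z \<bullet> (diag_part (W ** R) *v z)"
    unfolding d by (rule sum.swap)
  finally show ?thesis by (simp add: matrix_vector_mult_diff_rdistrib inner_diff_right)
qed

lemma trace_influence_weight: "trace ((W - diag_part (W ** R)) ** R) = 0"
proof -
  have d: "(diag_part D ** R) $ a $ a = D $ a $ a" for a D
    by (simp add: matrix_matrix_mult_def diag_part_def if_distrib[of "\<lambda>v. v * _"] R_diag cong: if_cong)
  have "trace (diag_part (W ** R) ** R) = trace (W ** R)" by (simp add: trace_def d)
  moreover have "trace ((W - diag_part (W ** R)) ** R) = trace (W ** R) - trace (diag_part (W ** R) ** R)"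
    by (simp add: trace_mult left_diff_distrib sum_subtractf)
  ultimately show ?thesis by simp
qed

lemma transpose_diag_part: "transpose (diag_part A) = diag_part A"
  by (auto simp: transpose_def diag_part_def vec_eq_iff)

text \<open>
  A linear functional of the influence function is a quadratic form \<open>z\<^sup>T A z\<close> with \<open>Tr(A R) = 0\<close>, which gives
  mean \<open>0\<close> and variance \<open>2 Tr((A R)\<^sup>2)\<close>.
\<close>

lemma influence_moments:
  fixes L :: "real ^ 'q ^ 'q \<Rightarrow> real"
  assumes L: "linear L"
  shows "has_bochner_integral (mvn R) (\<lambda>z. L (influence z)) 0"
    "integrable (mvn R) (\<lambda>z. (L (influence z))\<^sup>2)"
    "transpose W = W \<Longrightarrow> (\<And>H. transpose H = H \<Longrightarrow> L H = trace (W ** H)) \<Longrightarrow> A = W - diag_part (W ** R) \<Longrightarrow>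
      (\<integral>z. (L (influence z))\<^sup>2 \<partial>mvn R) = 2 * trace ((A ** R) ** (A ** R))"
proof -
  have key: "has_bochner_integral (mvn R) (\<lambda>z. L (influence z)) 0"
      "has_bochner_integral (mvn R) (\<lambda>z. (L (influence z))\<^sup>2) (2 * trace ((A ** R) ** (A ** R)))"
    if W: "transpose W = W" and LW: "\<And>H. transpose H = H \<Longrightarrow> L H = trace (W ** H)" and A: "A = W - diag_part (W ** R)" for W A
  proof -
    have eq: "L (influence z) = z \<bullet> (A *v z)" for z
      unfolding LW[OF transpose_influence] A by (rule trace_influence[OF W])
    have tA: "transpose A = A" unfolding A
      using W transpose_diag_part[of "W ** R"] by (simp add: transpose_def vec_eq_iff)
    have t0: "trace (A ** R) = 0" unfolding A by (rule trace_influence_weight)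
    show "has_bochner_integral (mvn R) (\<lambda>z. L (influence z)) 0"
      using mvn_quad_form[OF R, of A] unfolding eq t0 .
    show "has_bochner_integral (mvn R) (\<lambda>z. (L (influence z))\<^sup>2) (2 * trace ((A ** R) ** (A ** R)))"
      using mvn_quad_form_square[OF R tA] unfolding eq t0 by simp
  qed
  obtain W0 :: "real ^ 'q ^ 'q" where W0: "transpose W0 = W0" "\<And>H. transpose H = H \<Longrightarrow> L H = trace (W0 ** H)"
    by (rule linear_functional_symmetric[OF L], rule that)
  show "has_bochner_integral (mvn R) (\<lambda>z. L (influence z)) 0" by (rule key(1)[OF W0 refl])
  show "integrable (mvn R) (\<lambda>z. (L (influence z))\<^sup>2)" using key(2)[OF W0 refl] by (simp add: has_bochner_integral_iff)
  show "(\<integral>z. (L (influence z))\<^sup>2 \<partial>mvn R) = 2 * trace ((A ** R) ** (A ** R))"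
    if "transpose W = W" "\<And>H. transpose H = H \<Longrightarrow> L H = trace (W ** H)" "A = W - diag_part (W ** R)"
    using key(2)[OF that] by (simp add: has_bochner_integral_iff)
qed

lemma linear_influence_measurable:
  fixes L :: "real ^ 'q ^ 'q \<Rightarrow> real"
  assumes "linear L" shows "(\<lambda>z. L (influence z)) \<in> borel_measurable borel"
proof -
  have "(\<lambda>z. L (influence z)) \<in> borel_measurable (mvn R)"
    using influence_moments(1)[OF assms] by (auto simp: has_bochner_integral_iff)
  then show ?thesis by (simp cong: measurable_cong_sets)
qed

lemma influence_iid:
  fixes L :: "real ^ 'q ^ 'q \<Rightarrow> real"
  assumes L: "linear L"
  defines "Y \<equiv> \<lambda>l \<omega>. L (influence (Z l \<omega>))"
  shows "indep_vars (\<lambda>_. borel) Y {1..}"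
    "\<And>l. 1 \<le> l \<Longrightarrow> distr M borel (Y l) = distr (mvn R) borel (\<lambda>z. L (influence z))"
    "\<And>l. 1 \<le> l \<Longrightarrow> expectation (Y l) = 0"
    "\<And>l. 1 \<le> l \<Longrightarrow> integrable M (\<lambda>x. (Y l x)\<^sup>2)"
    "\<And>l. 1 \<le> l \<Longrightarrow> expectation (\<lambda>x. (Y l x)\<^sup>2) = (\<integral>z. (L (influence z))\<^sup>2 \<partial>mvn R)"
proof -
  note [measurable] = linear_influence_measurable[OF L]
  show "indep_vars (\<lambda>_. borel) Y {1..}"
    unfolding Y_def by (rule indep_vars_compose2[OF Z_indep, of "\<lambda>_ z. L (influence z)"]) measurable
  fix l :: nat assume l: "1 \<le> l"
  note Zl = Z_meas[OF l]
  show "distr M borel (Y l) = distr (mvn R) borel (\<lambda>z. L (influence z))"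
    unfolding Z_law[OF l, symmetric] Y_def using Zl by (subst distr_distr) (auto simp: comp_def)
  show "expectation (Y l) = 0"
    using integral_distr[OF Zl, of "\<lambda>z. L (influence z)"] influence_moments(1)[OF L]
    by (simp add: Z_law[OF l] Y_def has_bochner_integral_iff)
  show "integrable M (\<lambda>x. (Y l x)\<^sup>2)"
    using integrable_distr_eq[OF Zl, of "\<lambda>z. (L (influence z))\<^sup>2"] influence_moments(2)[OF L]
    by (simp add: Z_law[OF l] Y_def)
  show "expectation (\<lambda>x. (Y l x)\<^sup>2) = (\<integral>z. (L (influence z))\<^sup>2 \<partial>mvn R)"
    using integral_distr[OF Zl, of "\<lambda>z. (L (influence z))\<^sup>2"] by (simp add: Z_law[OF l] Y_def)
qed

text \<open>
  The effect on the sum of influences of replacing the \<open>Z l\<close> by their normal scores.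
\<close>

definition score_dev :: "nat \<Rightarrow> 's \<Rightarrow> 'q \<Rightarrow> 'q \<Rightarrow> real" where
  "score_dev n \<omega> a c = (\<Sum>l=1..n. lin a c (Z l \<omega> $ a + serrZ n \<omega> a l) (Z l \<omega> $ c + serrZ n \<omega> c l) - lin a c (Z l \<omega> $ a) (Z l \<omega> $ c))"

lemma serrZ_measurable [measurable]:
  assumes "l \<in> {1..n}" shows "(\<lambda>\<omega>. serrZ n \<omega> a l) \<in> borel_measurable M"
  using assms by (intro score_err_measurable) (auto intro!: borel_measurable_vec_nth Z_meas simp del: One_nat_def)

lemma score_dev_measurable [measurable]: "(\<lambda>\<omega>. score_dev n \<omega> a c) \<in> borel_measurable M"
  unfolding score_dev_def lin_def
proof (rule borel_measurable_sum)
  fix l assume l: "l \<in> {1..n}"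
  note [measurable] = serrZ_measurable[OF l] Z_meas[of l]
  have "1 \<le> l" using l by simp
  note [measurable] = Z_meas[OF this]
  show "(\<lambda>\<omega>. (Z l \<omega> $ a + serrZ n \<omega> a l) * (Z l \<omega> $ c + serrZ n \<omega> c l) -
      R $ a $ c / 2 * ((Z l \<omega> $ a + serrZ n \<omega> a l)\<^sup>2 + (Z l \<omega> $ c + serrZ n \<omega> c l)\<^sup>2) -
      (Z l \<omega> $ a * Z l \<omega> $ c - R $ a $ c / 2 * ((Z l \<omega> $ a)\<^sup>2 + (Z l \<omega> $ c)\<^sup>2))) \<in> borel_measurable M"
    by measurable
qed

definition dev_rate :: "nat \<Rightarrow> real" where
  "dev_rate n = 2 * sqrt (real n * score_rate n) + 2 * (real n * score_rate n)"

lemma score_dev_mean: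
  assumes n: "1 \<le> n"
  shows "(\<integral>\<^sup>+\<omega>. ennreal \<bar>score_dev n \<omega> a c\<bar> \<partial>M) \<le> ennreal (dev_rate n)"
proof (cases "a = c")
  case True
  then have "score_dev n \<omega> a c = 0" for \<omega>
    by (simp add: score_dev_def lin_def R_diag power2_eq_square)
  then show ?thesis by simp
next
  case False
  let ?I = "{1..n}"
  let ?G = "\<lambda>x. ennreal \<bar>\<Sum>l\<in>?I. lin a c (x l $ a + score_err ?I (\<lambda>i. x i $ a) l) (x l $ c + score_err ?I (\<lambda>i. x i $ c) l) - lin a c (x l $ a) (x l $ c)\<bar>"
  have "(\<integral>\<^sup>+x. ?G x \<partial>PiM ?I (\<lambda>_. mvn R)) \<le> ennreal (dev_rate n)"
    using score_product_error[OF R R_diag finite_atLeastAtMost[of 1 n] False] unfolding lin_def dev_rate_def by simp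
  moreover have "(\<integral>\<^sup>+\<omega>. ennreal \<bar>score_dev n \<omega> a c\<bar> \<partial>M) = (\<integral>\<^sup>+x. ?G x \<partial>PiM ?I (\<lambda>_. mvn R))"
  proof -
    have G: "?G \<in> borel_measurable (PiM ?I (\<lambda>_. mvn R))"
    proof (intro measurable_compose[OF _ measurable_ennreal] borel_measurable_abs borel_measurable_sum)
      fix l assume l: "l \<in> ?I"
      have "(\<lambda>x. score_err ?I (\<lambda>i. x i $ d) l) \<in> borel_measurable (PiM ?I (\<lambda>_. mvn R))" for d
        using l by (intro score_err_measurable) (simp_all, measurable)
      note [measurable] = this
      have "(\<lambda>x. x l $ d) \<in> borel_measurable (PiM ?I (\<lambda>_. mvn R))" for d
        using l by measurable
      note [measurable] = this
      show "(\<lambda>x. lin a c (x l $ a + score_err ?I (\<lambda>i. x i $ a) l) (x l $ c + score_err ?I (\<lambda>i. x i $ c) l) - lin a c (x l $ a) (x l $ c)) \<in> borel_measurable (PiM ?I (\<lambda>_. mvn R))"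
        unfolding lin_def by measurable
    qed
    have "?G (\<lambda>i\<in>?I. Z i \<omega>) = ennreal \<bar>score_dev n \<omega> a c\<bar>" for \<omega>
    proof -
      have "score_err ?I (\<lambda>i. (\<lambda>i\<in>?I. Z i \<omega>) i $ d) l = serrZ n \<omega> d l" if "l \<in> ?I" for d l
        using that by (intro score_err_cong[OF R R_diag finite_atLeastAtMost]) auto
      then show ?thesis unfolding score_dev_def by (intro arg_cong[of _ _ ennreal] arg_cong[of _ _ abs] sum.cong) auto
    qed
    then show ?thesis using nn_integral_sample[OF n G] by simp
  qed
  ultimately show ?thesis by simp
qed

lemma dev_rate_limit: "(\<lambda>n. dev_rate n / sqrt (real n)) \<longlonglongrightarrow> 0"
proof -
  have "dev_rate n / sqrt (real n) = 2 * sqrt (score_rate n) + 2 * (sqrt (real n) * score_rate n)" if "0 < n" for n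
  proof -
    have n: "0 < real n" using that by simp
    have "real n / sqrt (real n) = sqrt (real n)" by (rule real_div_sqrt) simp
    then have "real n * score_rate n / sqrt (real n) = sqrt (real n) * score_rate n"
      by (metis times_divide_eq_left)
    moreover have "sqrt (real n * score_rate n) / sqrt (real n) = sqrt (score_rate n)"
      using n by (simp only: real_sqrt_mult) simp
    ultimately show ?thesis unfolding dev_rate_def by (simp add: add_divide_distrib)
  qed
  then have "eventually (\<lambda>n. 2 * sqrt (score_rate n) + 2 * (sqrt (real n) * score_rate n) = dev_rate n / sqrt (real n)) sequentially"
    by (intro eventually_sequentiallyI[of 1]) simp
  moreover have "(\<lambda>n. 2 * sqrt (score_rate n) + 2 * (sqrt (real n) * score_rate n)) \<longlonglongrightarrow> 2 * sqrt 0 + 2 * 0"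
    by (intro tendsto_intros score_rate_limits)
  ultimately show ?thesis using Lim_transform_eventually by force
qed

text \<open>
  \<open>score_var n\<close> is deterministic but equals, without ties, the mean square of the normal scores; so it can
  be compared with the mean square of the \<open>Z l\<close>, whose expectation is \<open>1\<close>.
\<close>

lemma score_var_dev:
  assumes n: "1 \<le> n"
  shows "\<bar>score_var n - 1\<bar> \<le> score_rate n + 2 * sqrt (score_rate n)"
proof -
  fix a :: 'q
  let ?I = "{1..n}"
  let ?T = "\<lambda>\<omega>. \<Sum>l=1..n. (Z l \<omega> $ a)\<^sup>2"
  let ?e = "score_rate n + 2 * sqrt (score_rate n)"
  let ?G = "\<lambda>x. ennreal \<bar>\<Sum>l\<in>?I. (x l $ a + score_err ?I (\<lambda>i. x i $ a) l)\<^sup>2 - (x l $ a)\<^sup>2\<bar>"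
  have e: "0 \<le> ?e" using score_rate_pos[of n] by simp
  have G: "?G \<in> borel_measurable (PiM ?I (\<lambda>_. mvn R))"
  proof (intro measurable_compose[OF _ measurable_ennreal] borel_measurable_abs borel_measurable_sum)
    fix l assume l: "l \<in> ?I"
    have [measurable]: "(\<lambda>x. score_err ?I (\<lambda>i. x i $ a) l) \<in> borel_measurable (PiM ?I (\<lambda>_. mvn R))"
      using l by (intro score_err_measurable) (simp_all, measurable)
    have [measurable]: "(\<lambda>x. x l $ a) \<in> borel_measurable (PiM ?I (\<lambda>_. mvn R))"
      using l by measurable
    show "(\<lambda>x. (x l $ a + score_err ?I (\<lambda>i. x i $ a) l)\<^sup>2 - (x l $ a)\<^sup>2) \<in> borel_measurable (PiM ?I (\<lambda>_. mvn R))"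
      by measurable
  qed
  have GZ: "?G (\<lambda>i\<in>?I. Z i \<omega>) = ennreal \<bar>\<Sum>l\<in>?I. (Z l \<omega> $ a + serrZ n \<omega> a l)\<^sup>2 - (Z l \<omega> $ a)\<^sup>2\<bar>" for \<omega>
  proof -
    have "score_err ?I (\<lambda>i. (\<lambda>i\<in>?I. Z i \<omega>) i $ a) l = serrZ n \<omega> a l" if "l \<in> ?I" for l
      using that by (intro score_err_cong[OF R R_diag finite_atLeastAtMost]) auto
    then show ?thesis by (intro arg_cong[of _ _ ennreal] arg_cong[of _ _ abs] sum.cong) auto
  qed
  have Zi: "integrable M (\<lambda>\<omega>. (Z l \<omega> $ a)\<^sup>2)" "expectation (\<lambda>\<omega>. (Z l \<omega> $ a)\<^sup>2) = 1" if "1 \<le> l" for l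
  proof -
    note Zl = Z_meas[OF that]
    have h: "has_bochner_integral (mvn R) (\<lambda>z. (z $ a)\<^sup>2) 1"
      using mvn_second_moment[OF R, of a a] by (simp add: R_diag power2_eq_square)
    show "integrable M (\<lambda>\<omega>. (Z l \<omega> $ a)\<^sup>2)"
      using integrable_distr_eq[OF Zl, of "\<lambda>z. (z $ a)\<^sup>2"] h by (simp add: Z_law[OF that] has_bochner_integral_iff)
    show "expectation (\<lambda>\<omega>. (Z l \<omega> $ a)\<^sup>2) = 1"
      using integral_distr[OF Zl, of "\<lambda>z. (z $ a)\<^sup>2"] h by (simp add: Z_law[OF that] has_bochner_integral_iff)
  qed
  have Ti: "integrable M ?T" "expectation ?T = real n"
    using Zi by (auto simp: Bochner_Integration.integral_sum simp del: One_nat_def)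
  have Di: "integrable M (\<lambda>\<omega>. real n * score_var n - ?T \<omega>)" using Ti(1) by simp
  have "\<bar>real n * score_var n - real n * 1\<bar> = real n * \<bar>score_var n - 1\<bar>"
    by (simp only: right_diff_distrib[symmetric] abs_mult abs_of_nat)
  then have "real n * \<bar>score_var n - 1\<bar> = \<bar>expectation (\<lambda>\<omega>. real n * score_var n - ?T \<omega>)\<bar>"
    using Ti by (simp add: prob_space)
  also have "\<dots> \<le> expectation (\<lambda>\<omega>. \<bar>real n * score_var n - ?T \<omega>\<bar>)" by (rule integral_abs_bound)
  finally have "ennreal (real n * \<bar>score_var n - 1\<bar>) \<le> ennreal (expectation (\<lambda>\<omega>. \<bar>real n * score_var n - ?T \<omega>\<bar>))"
    by (rule ennreal_leI)
  also have "\<dots> = (\<integral>\<^sup>+\<omega>. ennreal \<bar>real n * score_var n - ?T \<omega>\<bar> \<partial>M)"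
    using Di by (intro nn_integral_eq_integral[symmetric]) auto
  also have "\<dots> = (\<integral>\<^sup>+\<omega>. ?G (\<lambda>i\<in>?I. Z i \<omega>) \<partial>M)"
  proof (rule nn_integral_cong_AE)
    show "AE \<omega> in M. ennreal \<bar>real n * score_var n - ?T \<omega>\<bar> = ?G (\<lambda>i\<in>?I. Z i \<omega>)"
      using AE_regular
    proof eventually_elim
      case (elim \<omega>)
      have "real n * score_var n = (\<Sum>l=1..n. (Z l \<omega> $ a + serrZ n \<omega> a l)\<^sup>2)"
        unfolding sum_score_squares[OF elim n, of a, symmetric]
        by (intro sum.cong refl) (simp only: normal_score_regular(2)[OF elim])
      then show ?case unfolding GZ by (simp add: sum_subtractf)
    qed
  qed
  also have "\<dots> = (\<integral>\<^sup>+x. ?G x \<partial>PiM ?I (\<lambda>_. mvn R))" by (rule nn_integral_sample[OF n G])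
  also have "\<dots> \<le> ennreal (real n * ?e)"
    using score_square_error[OF R R_diag finite_atLeastAtMost[of 1 n], of a] by simp
  finally have "real n * \<bar>score_var n - 1\<bar> \<le> real n * ?e" using e by (subst (asm) ennreal_le_iff) auto
  then show ?thesis using n by simp
qed

lemma score_var_limit: "score_var \<longlonglongrightarrow> 1"
proof -
  have "(\<lambda>n. score_rate n + 2 * sqrt (score_rate n)) \<longlonglongrightarrow> 0 + 2 * sqrt 0"
    by (intro tendsto_intros score_rate_limits)
  then have l: "(\<lambda>n. score_rate n + 2 * sqrt (score_rate n)) \<longlonglongrightarrow> 0" by simp
  have "(\<lambda>n. score_var n - 1) \<longlonglongrightarrow> 0"
    by (rule Lim_null_comparison[OF _ l]) (use score_var_dev in \<open>auto intro!: eventually_sequentiallyI[of 1]\<close>)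
  then show ?thesis by (simp add: LIM_zero_iff)
qed

lemma influence_sum_mean:
  obtains C where "0 \<le> C" "\<And>n. 1 \<le> n \<Longrightarrow>
    (\<integral>\<^sup>+\<omega>. ennreal (\<Sum>a\<in>UNIV. \<Sum>c\<in>UNIV. \<bar>(\<Sum>l=1..n. influence (Z l \<omega>) $ a $ c) / sqrt (real n)\<bar>) \<partial>M) \<le> ennreal C"
proof -
  define v where "v a c = (\<integral>z. (influence z $ a $ c)\<^sup>2 \<partial>mvn R)" for a c
  have v0: "0 \<le> v a c" for a c by (simp add: v_def)
  have one: "(\<integral>\<^sup>+\<omega>. ennreal \<bar>(\<Sum>l=1..n. influence (Z l \<omega>) $ a $ c) / sqrt (real n)\<bar> \<partial>M) \<le> ennreal (1 + v a c)"
    if n: "1 \<le> n" for n a c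
  proof -
    have lin: "linear (\<lambda>H :: real ^ 'q ^ 'q. H $ a $ c)" by (simp add: linear_iff)
    have ind: "indep_vars (\<lambda>_. borel) (\<lambda>l \<omega>. influence (Z l \<omega>) $ a $ c) {1..n}"
      by (rule indep_vars_subset[OF influence_iid(1)[OF lin]]) auto
    note sm = second_moment_iid_sum[OF ind finite_atLeastAtMost, of "v a c"]
    have sq: "integrable M (\<lambda>\<omega>. (\<Sum>l=1..n. influence (Z l \<omega>) $ a $ c)\<^sup>2)"
        "expectation (\<lambda>\<omega>. (\<Sum>l=1..n. influence (Z l \<omega>) $ a $ c)\<^sup>2) = n * v a c"
      using sm influence_iid(3-5)[OF lin] by (simp_all add: v_def)
    let ?f = "\<lambda>\<omega>. 1 + (\<Sum>l=1..n. influence (Z l \<omega>) $ a $ c)\<^sup>2 / real n"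
    have "(\<integral>\<^sup>+\<omega>. ennreal \<bar>(\<Sum>l=1..n. influence (Z l \<omega>) $ a $ c) / sqrt (real n)\<bar> \<partial>M) \<le> (\<integral>\<^sup>+\<omega>. ennreal (?f \<omega>) \<partial>M)"
    proof (intro nn_integral_mono ennreal_leI)
      fix \<omega>
      have b: "\<bar>t\<bar> \<le> 1 + t\<^sup>2" for t :: real
        using zero_le_power2[of "\<bar>t\<bar> - 1"] zero_le_power2[of t] by (simp add: power2_eq_square algebra_simps) 
      show "\<bar>(\<Sum>l=1..n. influence (Z l \<omega>) $ a $ c) / sqrt (real n)\<bar> \<le> ?f \<omega>"
        using b[of "(\<Sum>l=1..n. influence (Z l \<omega>) $ a $ c) / sqrt (real n)"] by (simp add: power_divide)
    qed
    also have "\<dots> = ennreal (expectation ?f)" using sq(1) by (intro nn_integral_eq_integral) auto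
    also have "expectation ?f = 1 + v a c" using sq n by (simp add: prob_space)
    finally show ?thesis .
  qed
  show ?thesis
  proof (rule that[of "\<Sum>a\<in>UNIV. \<Sum>c\<in>UNIV. 1 + v a c"])
    show "0 \<le> (\<Sum>a\<in>UNIV. \<Sum>c\<in>UNIV. 1 + v a c)" using v0 by (intro sum_nonneg) (simp add: add_nonneg_nonneg)
    fix n :: nat assume n: "1 \<le> n"
    have m[measurable]: "(\<lambda>\<omega>. influence (Z l \<omega>) $ a $ c) \<in> borel_measurable M" if "l \<in> {1..n}" for l a c
      using that by (intro measurable_compose[OF Z_meas influence_measurable]) auto
    have "(\<integral>\<^sup>+\<omega>. ennreal (\<Sum>a\<in>UNIV. \<Sum>c\<in>UNIV. \<bar>(\<Sum>l=1..n. influence (Z l \<omega>) $ a $ c) / sqrt (real n)\<bar>) \<partial>M)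
       = (\<Sum>a\<in>UNIV. \<Sum>c\<in>UNIV. \<integral>\<^sup>+\<omega>. ennreal \<bar>(\<Sum>l=1..n. influence (Z l \<omega>) $ a $ c) / sqrt (real n)\<bar> \<partial>M)"
    proof -
      have e: "ennreal (\<Sum>a\<in>UNIV. \<Sum>c\<in>UNIV. \<bar>(\<Sum>l=1..n. influence (Z l \<omega>) $ a $ c) / sqrt (real n)\<bar>)
        = (\<Sum>a\<in>UNIV. \<Sum>c\<in>UNIV. ennreal \<bar>(\<Sum>l=1..n. influence (Z l \<omega>) $ a $ c) / sqrt (real n)\<bar>)" for \<omega>
        by (simp add: sum_ennreal sum_nonneg)
      have t: "(\<lambda>\<omega>. ennreal \<bar>(\<Sum>l=1..n. influence (Z l \<omega>) $ a $ c) / sqrt (real n)\<bar>) \<in> borel_measurable M" for a c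
        by (intro measurable_compose[OF _ measurable_ennreal] borel_measurable_abs borel_measurable_divide borel_measurable_sum m) auto
      show ?thesis unfolding e by (simp only: nn_integral_sum[OF borel_measurable_sum[OF t]] nn_integral_sum[OF t])
    qed
    also have "\<dots> \<le> (\<Sum>a\<in>UNIV. \<Sum>c\<in>UNIV. ennreal (1 + v a c))"
      by (intro sum_mono one[OF n])
    also have "\<dots> = ennreal (\<Sum>a\<in>UNIV. \<Sum>c\<in>UNIV. 1 + v a c)"
      using v0 by (simp add: sum_ennreal sum_nonneg add_nonneg_nonneg del: ennreal_plus)
    finally show "(\<integral>\<^sup>+\<omega>. ennreal (\<Sum>a\<in>UNIV. \<Sum>c\<in>UNIV. \<bar>(\<Sum>l=1..n. influence (Z l \<omega>) $ a $ c) / sqrt (real n)\<bar>) \<partial>M)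
       \<le> ennreal (\<Sum>a\<in>UNIV. \<Sum>c\<in>UNIV. 1 + v a c)" .
  qed
qed


text \<open>
  The standardised estimation error is the normalised sum of influences up to a term that vanishes in
  probability, and the derivative \<open>L\<close> carries this over to \<open>F\<close>.  For large \<open>n\<close> the estimator almost surely is a
  covariance matrix with unit diagonal, so that \<open>F\<close> may be replaced by any \<open>G\<close> that agrees with it there.
\<close>

lemma delta_method:
  fixes F G L :: "real ^ 'q ^ 'q \<Rightarrow> real"
  assumes F: "(F has_derivative L) (at R within cov_mats)"
    and G: "\<And>A. A \<in> cov_mats \<Longrightarrow> (\<forall>a. A $ a $ a = 1) \<Longrightarrow> G A = F A"
  shows "weak_conv_m (\<lambda>n. distr M borel (\<lambda>\<omega>. sqrt (real n) * (G (rank_corr Xs n \<omega>) - G R)))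
    (normal_law (\<integral>z. (L (influence z))\<^sup>2 \<partial>mvn R))"
proof -
  interpret L: bounded_linear L using F by (rule has_derivative_bounded_linear)
  have lin: "linear L" by (rule L.linear)
  obtain K where K: "0 \<le> K" "\<And>H. \<bar>L H\<bar> \<le> norm H * K" using L.nonneg_bounded by auto
  obtain C where C: "0 \<le> C" "\<And>n. 1 \<le> n \<Longrightarrow>
    (\<integral>\<^sup>+\<omega>. ennreal (\<Sum>a\<in>UNIV. \<Sum>c\<in>UNIV. \<bar>(\<Sum>l=1..n. influence (Z l \<omega>) $ a $ c) / sqrt (real n)\<bar>) \<partial>M) \<le> ennreal C"
    by (rule influence_sum_mean, rule that)
  define T where "T n \<omega> = sqrt (real n) * (G (rank_corr Xs n \<omega>) - G R)" for n \<omega>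
  define S where "S n \<omega> = (\<Sum>l=1..n. L (influence (Z l \<omega>))) / sqrt (real n)" for n \<omega>
  define NA where "NA n \<omega> = (\<Sum>a\<in>UNIV. \<Sum>c\<in>UNIV. \<bar>(\<Sum>l=1..n. influence (Z l \<omega>) $ a $ c) / sqrt (real n)\<bar>)" for n \<omega>
  define NE where "NE n \<omega> = (\<Sum>a\<in>UNIV. \<Sum>c\<in>UNIV. \<bar>score_dev n \<omega> a c\<bar> / sqrt (real n))" for n \<omega>
  define N where "N = real (CARD('q)) * real (CARD('q))"
  have RC: "R \<in> cov_mats" using R by (simp add: pd_mats_def)
  have GR: "G R = F R" by (rule G[OF RC R1])
  have T_meas: "T n \<in> borel_measurable M" for n
    unfolding T_def using rank_corr_functional_measurable[of "\<lambda>A. sqrt (real n) * (G A - G R)"] .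
  have S_meas: "S n \<in> borel_measurable M" for n
    unfolding S_def
    by (intro borel_measurable_divide borel_measurable_sum measurable_compose[OF Z_meas linear_influence_measurable[OF lin]]) auto
  have NA_meas: "(\<lambda>\<omega>. NA n \<omega>) \<in> borel_measurable M" for n
    unfolding NA_def
    by (intro borel_measurable_sum borel_measurable_abs borel_measurable_divide measurable_compose[OF Z_meas influence_measurable]) auto
  have NE_meas: "(\<lambda>\<omega>. NE n \<omega>) \<in> borel_measurable M" for n
    unfolding NE_def by measurable
  have nn: "0 \<le> NA n \<omega>" "0 \<le> NE n \<omega>" for n \<omega>
    by (auto simp: NA_def NE_def intro!: sum_nonneg)
  have NE_mean: "(\<integral>\<^sup>+\<omega>. ennreal (NE n \<omega>) \<partial>M) \<le> ennreal (N * (dev_rate n / sqrt (real n)))" if n: "1 \<le> n" for n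
  proof -
    have d0: "0 \<le> dev_rate n" using score_rate_pos[of n] by (simp add: dev_rate_def)
    have sn: "0 < sqrt (real n)" using n by simp
    have "ennreal (NE n \<omega>) = (\<Sum>a\<in>UNIV. \<Sum>c\<in>UNIV. ennreal (\<bar>score_dev n \<omega> a c\<bar> / sqrt (real n)))" for \<omega>
      by (simp add: NE_def sum_ennreal sum_nonneg)
    also have "\<dots> \<omega> = (\<Sum>a\<in>UNIV. \<Sum>c\<in>UNIV. ennreal (1 / sqrt (real n)) * ennreal \<bar>score_dev n \<omega> a c\<bar>)" for \<omega>
      by (simp add: ennreal_mult[symmetric])
    finally have e: "ennreal (NE n \<omega>) = (\<Sum>a\<in>UNIV. \<Sum>c\<in>UNIV. ennreal (1 / sqrt (real n)) * ennreal \<bar>score_dev n \<omega> a c\<bar>)" for \<omega> .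
    have t: "(\<lambda>\<omega>. ennreal \<bar>score_dev n \<omega> a c\<bar>) \<in> borel_measurable M" for a c by measurable
    have t': "(\<lambda>\<omega>. ennreal (1 / sqrt (real n)) * ennreal \<bar>score_dev n \<omega> a c\<bar>) \<in> borel_measurable M" for a c by measurable
    have "(\<integral>\<^sup>+\<omega>. ennreal (NE n \<omega>) \<partial>M) = (\<Sum>a\<in>UNIV. \<Sum>c\<in>UNIV. ennreal (1 / sqrt (real n)) * (\<integral>\<^sup>+\<omega>. ennreal \<bar>score_dev n \<omega> a c\<bar> \<partial>M))"
      unfolding e by (simp only: nn_integral_sum[OF borel_measurable_sum[OF t']] nn_integral_sum[OF t'] nn_integral_cmult[OF t])
    also have "\<dots> \<le> (\<Sum>a\<in>(UNIV :: 'q set). \<Sum>c\<in>(UNIV :: 'q set). ennreal (1 / sqrt (real n)) * ennreal (dev_rate n))"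
      by (intro sum_mono mult_left_mono score_dev_mean[OF n]) simp
    also have "\<dots> = (\<Sum>a\<in>(UNIV :: 'q set). \<Sum>c\<in>(UNIV :: 'q set). ennreal (dev_rate n / sqrt (real n)))"
      using d0 by (simp add: ennreal_mult[symmetric] del: sum_constant)
    also have "\<dots> = ennreal (\<Sum>a\<in>(UNIV :: 'q set). \<Sum>c\<in>(UNIV :: 'q set). dev_rate n / sqrt (real n))"
      using d0 by (simp add: sum_ennreal sum_nonneg del: sum_constant)
    finally show ?thesis by (simp add: N_def mult.assoc)
  qed
  have pointwise: "min 1 \<bar>T n \<omega> - S n \<omega>\<bar> \<le>
      (2 * (\<epsilon> + 1 / (\<delta> * sqrt (real n))) + 2 * K * \<bar>1 - score_var n\<bar>) * NA n \<omega> +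
      (2 * (\<epsilon> + 1 / (\<delta> * sqrt (real n))) + 2 * K) * NE n \<omega>"
    if reg: "regular \<omega>" and n: "1 \<le> n" and s: "1 / 2 \<le> score_var n" and eps: "0 < \<epsilon>" and del: "0 < \<delta>"
      and FR: "\<And>B. B \<in> cov_mats \<Longrightarrow> norm (B - R) < \<delta> \<Longrightarrow> norm (F B - F R - L (B - R)) \<le> \<epsilon> * norm (B - R)" for n \<omega> \<epsilon> \<delta>
  proof -
    let ?r = "sqrt (real n)"
    let ?\<sigma> = "score_var n"
    define D where "D = rank_corr Xs n \<omega> - R"
    define A where "A = (1 / ?r) *\<^sub>R (\<Sum>l=1..n. influence (Z l \<omega>))"
    define E :: "real ^ 'q ^ 'q" where "E = (\<chi> a c. score_dev n \<omega> a c / ?r)"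
    define W where "W = ?r *\<^sub>R D"
    have r: "0 < ?r" using n by simp
    have sp: "0 < ?\<sigma>" using s by linarith
    have sW: "?\<sigma> *\<^sub>R W = A + E"
    proof (unfold vec_eq_iff, intro allI)
      fix a c
      have "?\<sigma> * (rank_corr Xs n \<omega> $ a $ c - R $ a $ c) = (\<Sum>l=1..n. lin a c (normal_score Xs n \<omega> l a) (normal_score Xs n \<omega> l c)) / real n"
        using rank_corr_deviation[OF reg n] sp by simp
      also have "(\<Sum>l=1..n. lin a c (normal_score Xs n \<omega> l a) (normal_score Xs n \<omega> l c)) = (\<Sum>l=1..n. lin a c (Z l \<omega> $ a + serrZ n \<omega> a l) (Z l \<omega> $ c + serrZ n \<omega> c l))"
        by (intro sum.cong refl) (simp only: normal_score_regular(2)[OF reg])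
      also have "\<dots> = (\<Sum>l=1..n. influence (Z l \<omega>) $ a $ c) + score_dev n \<omega> a c"
        by (simp add: score_dev_def influence_def sum_subtractf)
      finally have 1: "?\<sigma> * D $ a $ c = ((\<Sum>l=1..n. influence (Z l \<omega>) $ a $ c) + score_dev n \<omega> a c) / real n"
        by (simp add: D_def)
      have "?r * (x / real n) = x / ?r" for x
        using r real_sqrt_mult_self[of "real n"] by (simp add: field_simps)
      then have "?r * (?\<sigma> * D $ a $ c) = ((\<Sum>l=1..n. influence (Z l \<omega>) $ a $ c) + score_dev n \<omega> a c) / ?r" unfolding 1 .
      then show "(?\<sigma> *\<^sub>R W) $ a $ c = (A + E) $ a $ c"
        by (simp add: W_def A_def E_def add_divide_distrib mult.left_commute)
    qed
    have nA: "norm A \<le> NA n \<omega>"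
    proof -
      have "norm A \<le> (\<Sum>a\<in>UNIV. \<Sum>c\<in>UNIV. \<bar>A $ a $ c\<bar>)" by (rule norm_matrix_le_sum)
      also have "\<dots> = NA n \<omega>" unfolding NA_def by (intro sum.cong refl) (simp add: A_def)
      finally show ?thesis .
    qed
    have nE: "norm E \<le> NE n \<omega>"
    proof -
      have "norm E \<le> (\<Sum>a\<in>UNIV. \<Sum>c\<in>UNIV. \<bar>E $ a $ c\<bar>)" by (rule norm_matrix_le_sum)
      also have "\<dots> = NE n \<omega>" unfolding NE_def by (intro sum.cong refl) (simp add: E_def)
      finally show ?thesis .
    qed
    have WA: "W = (1 / ?\<sigma>) *\<^sub>R (A + E)" unfolding sW[symmetric] using sp by simp
    have s2: "1 / ?\<sigma> \<le> 2" using s sp by (simp add: field_simps)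
    have nW: "norm W \<le> 2 * (NA n \<omega> + NE n \<omega>)"
    proof -
      have "norm W = 1 / ?\<sigma> * norm (A + E)" unfolding WA using sp by simp
      also have "\<dots> \<le> 2 * (NA n \<omega> + NE n \<omega>)"
        using norm_triangle_ineq[of A E] nA nE s2 by (intro mult_mono) auto
      finally show ?thesis .
    qed
    have nWA: "norm (W - A) \<le> 2 * (NE n \<omega> + \<bar>1 - ?\<sigma>\<bar> * NA n \<omega>)"
    proof -
      have "A = (1 / ?\<sigma>) *\<^sub>R (?\<sigma> *\<^sub>R A)" using sp by simp
      then have "W - A = (1 / ?\<sigma>) *\<^sub>R (A + E - ?\<sigma> *\<^sub>R A)" unfolding WA by (metis scaleR_diff_right)
      also have "A + E - ?\<sigma> *\<^sub>R A = E + (1 - ?\<sigma>) *\<^sub>R A" by (simp add: scaleR_diff_left)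
      finally have "norm (W - A) = 1 / ?\<sigma> * norm (E + (1 - ?\<sigma>) *\<^sub>R A)" using sp by simp
      also have "\<dots> \<le> 2 * (NE n \<omega> + \<bar>1 - ?\<sigma>\<bar> * NA n \<omega>)"
      proof (intro mult_mono s2)
        have "norm (E + (1 - ?\<sigma>) *\<^sub>R A) \<le> norm E + \<bar>1 - ?\<sigma>\<bar> * norm A"
          using norm_triangle_ineq[of E "(1 - ?\<sigma>) *\<^sub>R A"] by simp
        also have "\<dots> \<le> NE n \<omega> + \<bar>1 - ?\<sigma>\<bar> * NA n \<omega>" by (intro add_mono mult_left_mono nA nE) simp
        finally show "norm (E + (1 - ?\<sigma>) *\<^sub>R A) \<le> NE n \<omega> + \<bar>1 - ?\<sigma>\<bar> * NA n \<omega>" .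
      qed auto
      finally show ?thesis .
    qed
    have SA: "S n \<omega> = L A" by (simp add: S_def A_def L.scaleR L.sum)
    have TF: "T n \<omega> = ?r * (F (rank_corr Xs n \<omega>) - F R)"
      using G[OF rank_corr_cov] rank_corr_diag[OF reg n] sp by (simp add: T_def GR)
    have rD: "?r * norm D = norm W" using r by (simp add: W_def)
    have "min 1 \<bar>T n \<omega> - S n \<omega>\<bar> \<le> (\<epsilon> + 1 / (\<delta> * ?r)) * norm W + K * norm (W - A)"
    \<comment> \<open>outside the ball of radius \<open>\<delta>\<close> the truncation at \<open>1\<close> is paid for by Markov's inequality\<close>
    proof (cases "norm D < \<delta>")
      case True
      have "T n \<omega> - S n \<omega> = ?r * (F (rank_corr Xs n \<omega>) - F R - L D) + L (W - A)"
        by (simp add: TF SA L.diff W_def L.scaleR right_diff_distrib)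
      then have "\<bar>T n \<omega> - S n \<omega>\<bar> \<le> ?r * \<bar>F (rank_corr Xs n \<omega>) - F R - L D\<bar> + \<bar>L (W - A)\<bar>"
        using r by (metis abs_mult abs_of_pos abs_triangle_ineq)
      also have "\<dots> \<le> ?r * (\<epsilon> * norm D) + norm (W - A) * K"
        using FR[OF rank_corr_cov] True r by (intro add_mono mult_left_mono K(2)) (auto simp: D_def)
      also have "\<dots> = \<epsilon> * norm W + K * norm (W - A)" unfolding rD[symmetric] by simp
      also have "\<dots> \<le> (\<epsilon> + 1 / (\<delta> * ?r)) * norm W + K * norm (W - A)"
        using del r by (intro add_right_mono mult_right_mono) auto
      finally show ?thesis by linarith
    next
      case False
      have "1 \<le> norm D / \<delta>" using False del by simp
      also have "norm D / \<delta> = 1 / (\<delta> * ?r) * norm W" unfolding rD[symmetric] using r del by simp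
      also have "\<dots> \<le> (\<epsilon> + 1 / (\<delta> * ?r)) * norm W" using eps by (intro mult_right_mono) auto
      finally have "1 \<le> (\<epsilon> + 1 / (\<delta> * ?r)) * norm W" .
      moreover have "0 \<le> K * norm (W - A)" using K by simp
      ultimately show ?thesis by linarith
    qed
    also have "\<dots> \<le> (\<epsilon> + 1 / (\<delta> * ?r)) * (2 * (NA n \<omega> + NE n \<omega>)) + K * (2 * (NE n \<omega> + \<bar>1 - ?\<sigma>\<bar> * NA n \<omega>))"
      using eps del r K by (intro add_mono mult_left_mono nW nWA add_nonneg_nonneg) auto
    also have "\<dots> = (2 * (\<epsilon> + 1 / (\<delta> * ?r)) + 2 * K * \<bar>1 - ?\<sigma>\<bar>) * NA n \<omega> + (2 * (\<epsilon> + 1 / (\<delta> * ?r)) + 2 * K) * NE n \<omega>"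
      by (simp only: distrib_left distrib_right mult_ac add_ac)
    finally show ?thesis .
  qed
  have close: "(\<lambda>n. expectation (\<lambda>\<omega>. min 1 \<bar>T n \<omega> - S n \<omega>\<bar>)) \<longlonglongrightarrow> 0"
  proof (rule tendstoI)
    fix r :: real assume r: "0 < r"
    \<comment> \<open>the limit of the bound below is \<open>2 * \<epsilon> * C\<close>\<close>
    define \<epsilon> where "\<epsilon> = r / (4 * (C + 1))"
    have eps: "0 < \<epsilon>" "2 * \<epsilon> * C < r" using r C(1) by (auto simp: \<epsilon>_def field_simps add_pos_nonneg)
    obtain \<delta> where del: "0 < \<delta>"
        "\<And>B. B \<in> cov_mats \<Longrightarrow> norm (B - R) < \<delta> \<Longrightarrow> norm (F B - F R - L (B - R)) \<le> \<epsilon> * norm (B - R)"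
      using F eps(1) unfolding has_derivative_within_alt by blast
    let ?c1 = "\<lambda>n. 2 * (\<epsilon> + 1 / (\<delta> * sqrt (real n))) + 2 * K * \<bar>1 - score_var n\<bar>"
    let ?c2 = "\<lambda>n. 2 * (\<epsilon> + 1 / (\<delta> * sqrt (real n))) + 2 * K"
    let ?B = "\<lambda>n. ?c1 n * C + ?c2 n * (N * (dev_rate n / sqrt (real n)))"
    have inv: "(\<lambda>n. 1 / (\<delta> * sqrt (real n))) \<longlonglongrightarrow> 0"
    proof -
      have "(\<lambda>n. 1 / sqrt (real n)) \<longlonglongrightarrow> 0" by real_asymp
      from tendsto_mult[OF tendsto_const[of "1 / \<delta>"] this] show ?thesis by simp
    qed
    have "?B \<longlonglongrightarrow> (2 * (\<epsilon> + 0) + 2 * K * \<bar>1 - 1\<bar>) * C + (2 * (\<epsilon> + 0) + 2 * K) * (N * 0)"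
      by (intro tendsto_intros inv dev_rate_limit score_var_limit)
    then have "eventually (\<lambda>n. ?B n < r) sequentially"
      using eps by (intro order_tendstoD(2)) auto
    moreover have "eventually (\<lambda>n. 1 / 2 < score_var n) sequentially"
      by (rule order_tendstoD(1)[OF score_var_limit]) simp
    moreover have "eventually (\<lambda>n. 1 \<le> n) sequentially" by (rule eventually_ge_at_top)
    ultimately show "eventually (\<lambda>n. dist (expectation (\<lambda>\<omega>. min 1 \<bar>T n \<omega> - S n \<omega>\<bar>)) 0 < r) sequentially"
    proof eventually_elim
      case (elim n)
      have c: "0 \<le> ?c1 n" "0 \<le> ?c2 n" using eps del K by auto
      have d0: "0 \<le> N * (dev_rate n / sqrt (real n))" using score_rate_pos[of n] by (simp add: dev_rate_def N_def)
      have ae: "AE \<omega> in M. min 1 \<bar>T n \<omega> - S n \<omega>\<bar> \<le> ?c1 n * NA n \<omega> + ?c2 n * NE n \<omega>"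
        using AE_regular
      proof eventually_elim
        case (elim \<omega>)
        show ?case
          by (rule pointwise[OF elim \<open>1 \<le> n\<close> less_imp_le[OF \<open>1 / 2 < score_var n\<close>] eps(1) del])
      qed
      have mm: "(\<lambda>\<omega>. min 1 \<bar>T n \<omega> - S n \<omega>\<bar>) \<in> borel_measurable M"
        using T_meas[of n] S_meas[of n] by measurable
      have int: "integrable M (\<lambda>\<omega>. min 1 \<bar>T n \<omega> - S n \<omega>\<bar>)"
        using mm by (intro integrable_const_bound[of _ 1]) auto
      have "ennreal (expectation (\<lambda>\<omega>. min 1 \<bar>T n \<omega> - S n \<omega>\<bar>)) = (\<integral>\<^sup>+\<omega>. ennreal (min 1 \<bar>T n \<omega> - S n \<omega>\<bar>) \<partial>M)"
        by (rule nn_integral_eq_integral[symmetric, OF int]) auto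
      also have "\<dots> \<le> (\<integral>\<^sup>+\<omega>. ennreal (?c1 n) * ennreal (NA n \<omega>) + ennreal (?c2 n) * ennreal (NE n \<omega>) \<partial>M)"
      proof (rule nn_integral_mono_AE)
        show "AE \<omega> in M. ennreal (min 1 \<bar>T n \<omega> - S n \<omega>\<bar>) \<le> ennreal (?c1 n) * ennreal (NA n \<omega>) + ennreal (?c2 n) * ennreal (NE n \<omega>)"
          using ae
        proof eventually_elim
          case (elim \<omega>)
          have "ennreal (?c1 n) * ennreal (NA n \<omega>) + ennreal (?c2 n) * ennreal (NE n \<omega>) = ennreal (?c1 n * NA n \<omega> + ?c2 n * NE n \<omega>)"
            by (simp only: ennreal_mult[OF c(1) nn(1)] ennreal_mult[OF c(2) nn(2)] ennreal_plus[OF mult_nonneg_nonneg[OF c(1) nn(1)] mult_nonneg_nonneg[OF c(2) nn(2)]])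
          then show ?case using ennreal_leI[OF elim] by simp
        qed
      qed
      also have "\<dots> = ennreal (?c1 n) * (\<integral>\<^sup>+\<omega>. ennreal (NA n \<omega>) \<partial>M) + ennreal (?c2 n) * (\<integral>\<^sup>+\<omega>. ennreal (NE n \<omega>) \<partial>M)"
      proof -
        have m1: "(\<lambda>\<omega>. ennreal (NA n \<omega>)) \<in> borel_measurable M" and m2: "(\<lambda>\<omega>. ennreal (NE n \<omega>)) \<in> borel_measurable M"
          using NA_meas[of n] NE_meas[of n] by measurable
        show ?thesis
          by (subst nn_integral_add) (use m1 m2 in \<open>simp_all add: nn_integral_cmult\<close>)
      qed
      also have "\<dots> \<le> ennreal (?c1 n) * ennreal C + ennreal (?c2 n) * ennreal (N * (dev_rate n / sqrt (real n)))"
        using C(2)[OF \<open>1 \<le> n\<close>] NE_mean[OF \<open>1 \<le> n\<close>] by (intro add_mono mult_left_mono) (auto simp: NA_def)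
      also have "\<dots> = ennreal (?B n)"
        by (simp only: ennreal_mult[OF c(1) C(1)] ennreal_mult[OF c(2) d0] ennreal_plus[OF mult_nonneg_nonneg[OF c(1) C(1)] mult_nonneg_nonneg[OF c(2) d0]])
      finally have "expectation (\<lambda>\<omega>. min 1 \<bar>T n \<omega> - S n \<omega>\<bar>) \<le> ?B n"
        by (subst (asm) ennreal_le_iff) (intro add_nonneg_nonneg mult_nonneg_nonneg c C(1) d0)
      moreover have "0 \<le> expectation (\<lambda>\<omega>. min 1 \<bar>T n \<omega> - S n \<omega>\<bar>)" by (rule Bochner_Integration.integral_nonneg) simp
      ultimately show ?case using \<open>?B n < r\<close> by (simp add: dist_real_def)
    qed
  qed
  have ch: "(\<lambda>n. char (distr M borel (S n)) t) \<longlonglongrightarrow> char (normal_law (\<integral>z. (L (influence z))\<^sup>2 \<partial>mvn R)) t" for t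
    unfolding S_def by (rule char_clt[OF influence_iid[OF lin]])
  have "weak_conv_m (\<lambda>n. distr M borel (T n)) (normal_law (\<integral>z. (L (influence z))\<^sup>2 \<partial>mvn R))"
    by (rule weak_conv_of_close[OF T_meas S_meas _ ch close]) simp
  then show ?thesis unfolding T_def .
qed

end

section \<open>Asymptotic normality of the estimator\<close>

text \<open>
  The normalisation \<open>\<phi>\<close> does nothing to matrices with unit diagonal, in particular to \<open>R\<close> and, almost
  surely, to its estimator; differentiability of \<open>D \<circ> \<phi>\<close> thus suffices for the delta method.
\<close>

lemma cov_to_corr_unit_diag:
  assumes "\<forall>a. A $ a $ a = 1"
  shows "cov_to_corr A = A"
proof -
  have "inv_sqrt_diag A = mat 1" using assms by (simp add: inv_sqrt_diag_def mat_def vec_eq_iff)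
  then show ?thesis by (simp add: cov_to_corr_def)
qed

lemma zeta_sq_eq:
  fixes R :: "real ^ 'q::finite ^ 'q" and b :: "'q \<Rightarrow> 'k::finite" and \<Phi> :: "real \<Rightarrow> real"
  defines "A \<equiv> M_mat b \<Phi> R - diag_part (M_mat b \<Phi> R ** R)"
  shows "zeta_sq b \<Phi> R = 2 * trace ((A ** R) ** (A ** R))"
proof -
  have "trace ((R ** A) ** (R ** A)) = trace (R ** (A ** R ** A))" by (simp add: matrix_mul_assoc)
  also have "\<dots> = trace ((A ** R ** A) ** R)" by (rule trace_mul_sym)
  finally show ?thesis by (simp add: zeta_sq_def Let_def A_def matrix_mul_assoc)
qed

context copula_sample
begin

lemma asymptotic_normality:
  assumes "dep_frechet_differentiable b \<Phi>"
  shows "\<exists>v\<ge>0. weak_conv_m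
    (\<lambda>n. distr M borel (\<lambda>\<omega>. sqrt (real n) * (gauss_dep b \<Phi> (rank_corr Xs n \<omega>) - gauss_dep b \<Phi> R))) (normal_law v)"
proof -
  have "(gauss_dep b \<Phi> \<circ> cov_to_corr) differentiable (at R within cov_mats)"
    using assms R by (simp add: dep_frechet_differentiable_def)
  then obtain L where L: "((gauss_dep b \<Phi> \<circ> cov_to_corr) has_derivative L) (at R within cov_mats)"
    by (auto simp: differentiable_def)
  have "weak_conv_m (\<lambda>n. distr M borel (\<lambda>\<omega>. sqrt (real n) * (gauss_dep b \<Phi> (rank_corr Xs n \<omega>) - gauss_dep b \<Phi> R)))
    (normal_law (\<integral>z. (L (influence z))\<^sup>2 \<partial>mvn R))"
    by (rule delta_method[OF L]) (simp add: cov_to_corr_unit_diag)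
  moreover have "0 \<le> (\<integral>z. (L (influence z))\<^sup>2 \<partial>mvn R)" by simp
  ultimately show ?thesis by blast
qed

lemma asymptotic_variance:
  assumes fd: "dep_frechet_differentiable b \<Phi>" and ic: "diff_integral_interchange b \<Phi> R"
    and \<Phi>: "continuous_on {0<..} \<Phi>" "convex_on {0<..} \<Phi>" "\<Phi> 1 = 0"
  shows "0 \<le> zeta_sq b \<Phi> R \<and> weak_conv_m
    (\<lambda>n. distr M borel (\<lambda>\<omega>. sqrt (real n) * (gauss_dep b \<Phi> (rank_corr Xs n \<omega>) - gauss_dep b \<Phi> R)))
    (normal_law (zeta_sq b \<Phi> R))"
proof -
  have int: "integrable lborel (dep_integrand b \<Phi> S)" if "S \<in> pd_mats" for S
    using fd that by (simp add: dep_frechet_differentiable_def)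
  obtain D' where D': "(gauss_dep b \<Phi> has_derivative D') (at R within cov_mats)"
      "\<And>H. transpose H = H \<Longrightarrow> D' H = trace (M_mat b \<Phi> R ** H)"
    by (rule interchange_derivative[OF int R \<Phi>(2,1,3) ic], assumption, rule that)
  have lin: "linear D'" using D'(1) by (intro bounded_linear.linear has_derivative_bounded_linear)
  have v: "(\<integral>z. (D' (influence z))\<^sup>2 \<partial>mvn R) = zeta_sq b \<Phi> R"
    unfolding zeta_sq_eq by (rule influence_moments(3)[OF lin transpose_M_mat[OF R] D'(2) refl])
  have "0 \<le> zeta_sq b \<Phi> R" unfolding v[symmetric] by simp
  moreover have "weak_conv_m (\<lambda>n. distr M borel (\<lambda>\<omega>. sqrt (real n) * (gauss_dep b \<Phi> (rank_corr Xs n \<omega>) - gauss_dep b \<Phi> R)))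
    (normal_law (\<integral>z. (D' (influence z))\<^sup>2 \<partial>mvn R))"
    by (rule delta_method[OF D'(1)]) simp
  ultimately show ?thesis unfolding v by blast
qed

end

theorem theorem1:
  fixes M :: "'s measure"
    and b :: "'q::finite \<Rightarrow> 'k::finite"
    and X :: "'s \<Rightarrow> real ^ 'q"
    and Xs :: "nat \<Rightarrow> 's \<Rightarrow> real ^ 'q"
    and R :: "real ^ 'q ^ 'q"
    and \<Phi> :: "real \<Rightarrow> real"
  assumes "prob_space M"
    and "surj b"
    and "X \<in> borel_measurable M"
    and "\<forall>a. continuous_on UNIV (cdf (distr M borel (\<lambda>\<omega>. X \<omega> $ a)))"
    and "R \<in> pd_mats"
    and "\<forall>a. R $ a $ a = 1"
    and "gaussian_copula M X R"
    and "prob_space.indep_vars M (\<lambda>_. borel) Xs {1..}"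
    and "\<forall>l\<ge>1. distr M borel (Xs l) = distr M borel X"
    and "continuous_on {0<..} \<Phi>"
    and "convex_on {0<..} \<Phi>"
    and "\<Phi> 1 = 0"
  shows "(dep_frechet_differentiable b \<Phi> \<longrightarrow>
       (\<exists>v\<ge>0. weak_conv_m
          (\<lambda>n. distr M borel (\<lambda>\<omega>. sqrt (real n) * (gauss_dep b \<Phi> (rank_corr Xs n \<omega>) - gauss_dep b \<Phi> R)))
          (normal_law v)))
    \<and> (dep_frechet_differentiable b \<Phi> \<and> diff_integral_interchange b \<Phi> R \<longrightarrow>
       0 \<le> zeta_sq b \<Phi> R \<and>
       weak_conv_m
          (\<lambda>n. distr M borel (\<lambda>\<omega>. sqrt (real n) * (gauss_dep b \<Phi> (rank_corr Xs n \<omega>) - gauss_dep b \<Phi> R)))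
          (normal_law (zeta_sq b \<Phi> R)))
    \<and> M_mat b (\<lambda>t. t * ln t) R = - (1 / 2) *\<^sub>R (matrix_inv R - matrix_inv (block_diag b R))
    \<and> M_mat b (\<lambda>t. (sqrt t - 1)\<^sup>2) R =
       (2 powr (real CARD('q) / 2) * exp (- gauss_dep b (\<lambda>t. t * ln t) R / 2)
          / sqrt (det (mat 1 + matrix_inv (block_diag b R) ** R))) *\<^sub>R
       (- (1 / 2) *\<^sub>R (matrix_inv R - matrix_inv (block_diag b R))
        + matrix_inv (mat 1 + matrix_inv (block_diag b R) ** R) ** matrix_inv (block_diag b R)
        - gamma_mat b R)"
proof -
  interpret prob_space M by fact
  interpret copula_sample M X Xs R by unfold_locales (fact assms)+
  show ?thesis
    using asymptotic_normality asymptotic_variance[OF _ _ assms(10-12)]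
      M_mat_t_ln_t[OF assms(5)] M_mat_hellinger[OF assms(5)]
    by (intro conjI impI) auto
qed

end
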